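(* Let $0<\varepsilon\le R$, $\lambda\ge1$, $\sigma\in\mathbb{R}$, and let $m_\lambda=\dfrac{1}{\lambda\sqrt{\ln\lambda+1}}$. If $\omega_\varepsilon<\min\left(\frac12,m_\lambda\right)$, then $$\left\Vert u_\varepsilon^s(|x|=R)\right\Vert_{H^\sigma}\le(\lambda-1)\,\omega_\varepsilon\left(3\sqrt{\frac\varepsilon R}\left\Vert u^i(|x|=\varepsilon)\right\Vert_{H_*^{\sigma-1/3}}+23\,\omega_\varepsilon\lambda\,|u^i(0)|\left|H_0^{(1)}(\sqrt{q_0}\,\omega R)\right|\right).$$ Furthermore, if for some integer $p>0$ one has $a_n=0$ for all $|n|<p$, then for all $\omega_\varepsilon<\lambda^{-1}p$, $$\left\Vert u_\varepsilon^s(|x|=R)\right\Vert_{H^\sigma}\le3(\lambda-1)\,\omega_\varepsilon\sqrt{\frac\varepsilon R}\left\Vert u^i(|x|=\varepsilon)\right\Vert_{H_*^{\sigma-1/3}}.$$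
   Context: Setting: $\varepsilon,\omega,q,q_0>0$; $q_\varepsilon=q$ for $|x|<\varepsilon$ and $q_\varepsilon=q_0$ for $|x|>\varepsilon$ in $\mathbb{R}^2$; $\omega_\varepsilon=\sqrt{q_0}\,\omega\varepsilon$ and $\lambda=\sqrt{q/q_0}$. $(r,\theta)$ are polar coordinates; $J_n,Y_n$ are Bessel functions and $H_n^{(1)}=J_n+iY_n$. The incident field, a non-singular solution of $\Delta u^i+\omega^2q_0u^i=0$ in $\mathbb{R}^2$, is $u^i=\sum_{n\in\mathbb{Z}}a_nJ_n(\sqrt{q_0}\,\omega r)e^{in\theta}$ (so $u^i(0)=a_0$). $u_\varepsilon\in H^1_{loc}(\mathbb{R}^2)$ solves $\Delta u_\varepsilon+\omega^2q_\varepsilon u_\varepsilon=0$, with $u_\varepsilon=u^i+u^s_\varepsilon$ for $|x|>\varepsilon$, where $u_\varepsilon^s$ satisfies the outgoing radiation condition $\partial_ru^s_\varepsilon-i\omega\sqrt{q_0}u^s_\varepsilon=o(r^{-1/2})$. Equivalently, for $r\ge\varepsilon$, $u^s_\varepsilon=\sum_{n}a_nR_n(\omega_\varepsilon,\lambda)H^{(1)}_n(\sqrt{q_0}\,\omega r)e^{in\theta}$, with $$R_n(x,\lambda)=-\frac{\Re D_n}{D_n},\quad D_n=H_n^{(1)\prime}(x)J_n(\lambda x)-\lambda J_n'(\lambda x)H^{(1)}_n(x).$$ Norms: for $f$ on the circle $|x|=R$ with Fourier coefficients $c_n=\frac1{2\pi}\int_0^{2\pi}f(R,\theta)e^{-in\theta}d\theta$,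 $\Vert f(|x|=R)\Vert_{H^\sigma}=\sqrt{2\pi}\big(\sum_{n}|c_n|^2(1+|n|)^{2\sigma}\big)^{1/2}$, and $\Vert f(|x|=R)\Vert_{H^\sigma_*}$ is the same with the sum over $n\ne0$ (values $+\infty$ allowed). *)

theory Defs
  imports "HOL-Analysis.Analysis"
begin

text \<open>
  The plane \<open>\<real>\<^sup>2\<close> is identified with the type \<^typ>\<open>complex\<close>, regarded as a real Euclidean space;
  the point with polar coordinates \<open>(r, \<theta>)\<close> is \<open>rcis r \<theta>\<close>.
\<close>


section \<open>Bessel functions of integer order and real argument\<close>

text \<open>\<open>J\<^sub>n\<close> is given by its power series for \<open>n \<ge> 0\<close>, and \<open>J\<^sub>-\<^sub>n = (-1)\<^sup>n J\<^sub>n\<close>.\<close>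

definition besselJ :: "int \<Rightarrow> real \<Rightarrow> real" where
  "besselJ n x =
     (if n < 0 then (-1) ^ nat \<bar>n\<bar> else 1) *
     (\<Sum>m. (-1) ^ m / (fact m * fact (m + nat \<bar>n\<bar>)) * (x / 2) ^ (2 * m + nat \<bar>n\<bar>))"

text \<open>
  Neumann's expansion of the second solution, meant for \<open>x > 0\<close> and order \<open>n \<ge> 0\<close>
  (Abramowitz and Stegun 9.1.11, DLMF 10.8.1).
\<close>

definition besselY :: "nat \<Rightarrow> real \<Rightarrow> real" where
  "besselY n x =
     - (\<Sum>k<n. fact (n - k - 1) / fact k * (x\<^sup>2 / 4) ^ k) / (pi * (x / 2) ^ n)
     + 2 / pi * ln (x / 2) * besselJ (int n) x
     - (x / 2) ^ n / pi *
       (\<Sum>k. (Digamma (real k + 1) + Digamma (real (n + k) + 1)) *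
             (- (x\<^sup>2 / 4)) ^ k / (fact k * fact (n + k)))"

definition hankel1 :: "nat \<Rightarrow> real \<Rightarrow> complex" where
  "hankel1 n x = Complex (besselJ (int n) x) (besselY n x)"


section \<open>Weak solutions of the Helmholtz equation\<close>

definition dir_deriv :: "complex \<Rightarrow> (complex \<Rightarrow> complex) \<Rightarrow> complex \<Rightarrow> complex" where
  "dir_deriv h f x = frechet_derivative f (at x) h"

text \<open>
  Differentiability is over the reals, so \<open>C_k k f\<close> says that \<open>f\<close> is \<open>k\<close> times continuously
  differentiable as a function on \<open>\<real>\<^sup>2\<close>, and not that \<open>f\<close> is holomorphic.
\<close>

primrec C_k :: "nat \<Rightarrow> (complex \<Rightarrow> complex) \<Rightarrow> bool" where
  "C_k 0 f \<longleftrightarrow> continuous_on UNIV f"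
| "C_k (Suc k) f \<longleftrightarrow>
     f differentiable_on UNIV \<and> C_k k (dir_deriv 1 f) \<and> C_k k (dir_deriv \<i> f)"

definition test_function :: "(complex \<Rightarrow> complex) \<Rightarrow> bool" where
  "test_function \<phi> \<longleftrightarrow> (\<forall>k. C_k k \<phi>) \<and> (\<exists>K. compact K \<and> (\<forall>x. x \<notin> K \<longrightarrow> \<phi> x = 0))"

definition L2_loc :: "(complex \<Rightarrow> complex) \<Rightarrow> bool" where
  "L2_loc f \<longleftrightarrow> f \<in> borel_measurable lebesgue \<and>
     (\<forall>K. compact K \<longrightarrow> set_integrable lebesgue K (\<lambda>x. (cmod (f x))\<^sup>2))"

definition weak_deriv ::
    "complex \<Rightarrow> (complex \<Rightarrow> complex) \<Rightarrow> (complex \<Rightarrow> complex) \<Rightarrow> bool" where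
  "weak_deriv h u g \<longleftrightarrow>
     (\<forall>\<phi>. test_function \<phi> \<longrightarrow>
        (LINT x|lebesgue. u x * dir_deriv h \<phi> x) = - (LINT x|lebesgue. g x * \<phi> x))"

text \<open>\<open>u \<in> H\<^sup>1\<^sub>l\<^sub>o\<^sub>c(\<real>\<^sup>2)\<close> and \<open>\<Delta>u + V u = 0\<close> in \<open>\<real>\<^sup>2\<close>, in the weak sense.\<close>

definition weak_helmholtz :: "(complex \<Rightarrow> real) \<Rightarrow> (complex \<Rightarrow> complex) \<Rightarrow> bool" where
  "weak_helmholtz V u \<longleftrightarrow>
     L2_loc u \<and>
     (\<exists>g1 g2. L2_loc g1 \<and> L2_loc g2 \<and> weak_deriv 1 u g1 \<and> weak_deriv \<i> u g2 \<and>
        (\<forall>\<phi>. test_function \<phi> \<longrightarrow>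
           (LINT x|lebesgue. g1 x * dir_deriv 1 \<phi> x + g2 x * dir_deriv \<i> \<phi> x) =
           (LINT x|lebesgue. of_real (V x) * u x * \<phi> x)))"

text \<open>
  Outgoing radiation condition \<open>\<partial>\<^sub>r v - i k v = o(r\<^sup>-\<^sup>1\<^sup>/\<^sup>2)\<close> as \<open>r \<rightarrow> \<infinity>\<close>, uniformly in the direction,
  with \<open>v'\<close> standing for the radial derivative, which has to exist far away from the origin.
\<close>

definition outgoing :: "real \<Rightarrow> (complex \<Rightarrow> complex) \<Rightarrow> bool" where
  "outgoing k v \<longleftrightarrow>
     (\<exists>v' :: real \<Rightarrow> real \<Rightarrow> complex.
        (\<forall>\<^sub>F r in at_top. \<forall>\<theta>. ((\<lambda>s. v (rcis s \<theta>)) has_vector_derivative v' r \<theta>) (at r)) \<and>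
        (\<forall>e>0. \<forall>\<^sub>F r in at_top. \<forall>\<theta>.
           cmod (v' r \<theta> - \<i> * of_real k * v (rcis r \<theta>)) \<le> e / sqrt r))"


section \<open>Sobolev norms on circles\<close>

definition fourier_coeff :: "real \<Rightarrow> (complex \<Rightarrow> complex) \<Rightarrow> int \<Rightarrow> complex" where
  "fourier_coeff R f n =
     1 / (2 * pi) * integral {0..2 * pi} (\<lambda>\<theta>. f (rcis R \<theta>) * cis (- (of_int n * \<theta>)))"

definition circle_norm :: "int set \<Rightarrow> real \<Rightarrow> real \<Rightarrow> (complex \<Rightarrow> complex) \<Rightarrow> ennreal" where
  "circle_norm N \<sigma> R f =
     (let c = (\<lambda>n. (cmod (fourier_coeff R f n))\<^sup>2 * (1 + real_of_int \<bar>n\<bar>) powr (2 * \<sigma>))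
      in if c summable_on N then ennreal (sqrt (2 * pi) * sqrt (\<Sum>\<^sub>\<infinity>n\<in>N. c n)) else \<infinity>)"

definition H_norm :: "real \<Rightarrow> real \<Rightarrow> (complex \<Rightarrow> complex) \<Rightarrow> ennreal" where
  "H_norm \<sigma> R f = circle_norm UNIV \<sigma> R f"

definition H_star_norm :: "real \<Rightarrow> real \<Rightarrow> (complex \<Rightarrow> complex) \<Rightarrow> ennreal" where
  "H_star_norm \<sigma> R f = circle_norm (UNIV - {0}) \<sigma> R f"

end

theory Submission
  imports Defs "HOL-Real_Asymp.Real_Asymp"
begin

text \<open>
  Write \<open>k = \<omega> \<surd>q\<^sub>0\<close>, \<open>x = k \<epsilon>\<close> and \<open>t = \<lambda> x\<close>. Testing the weak equation with \<open>r\<^sup>n e\<^sup>-\<^sup>i\<^sup>n\<^sup>\<theta> \<rho>(r\<^sup>2)\<close> shows that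
  every Fourier coefficient of the total field satisfies the radial equation \<open>r (r f')' = (n\<^sup>2 - v r\<^sup>2) f\<close>
  across the interface, so it is a multiple of \<open>J\<^sub>n\<close> inside, and a combination of \<open>J\<^sub>n\<close> and \<open>H\<^sub>n\<close> outside, where
  the radiation condition excludes the incoming solution. Matching at \<open>r = \<epsilon>\<close> gives the reflection
  coefficient \<open>R\<^sub>n = - \<Re> D\<^sub>n / D\<^sub>n\<close>.

  For \<open>n \<ge> 1\<close> and \<open>t \<le> n\<close> the functions live below the turning point. The logarithmic derivative
  \<open>\<psi>(t) = t J\<^sub>n'(t) / J\<^sub>n(t)\<close> is controlled by a Riccati equation, which bounds the numerator, while
  \<open>r |H\<^sub>n(r)|\<^sup>2\<close> is decreasing; this bounds the denominator from below and transports the estimate from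
  \<open>\<epsilon>\<close> to \<open>R\<close> at the cost of \<open>\<surd>(\<epsilon> / R)\<close>. The exponent \<open>-1/3\<close> comes from the size of \<open>\<psi>\<close> at the turning
  point \<open>t = n\<close>. The mode \<open>n = 0\<close> is estimated directly from the power series.
\<close>


subsection \<open>Power series for the Bessel functions\<close>

text \<open>The series for Y_n says nothing about large arguments, yet the radiation condition and
  the monotonicity of r |H_n|^2 both concern infinity. The bridge is Laplace's integral for H_0: it
  decays explicitly, and it is identified with the series by comparing logarithm and constant at the
  origin, so the Euler-Mascheroni constant has to come out exactly. Recurrences carry the decay to
  all orders. The conditions P' = P'' = 0 that start the energy argument for P = r |H_n|^2 are
  reached only in the limit at infinity, so the argument runs on nearby solutions that satisfy them
  at a finite T, and T tends to infinity.

  The bound by m_\<lambda> means t^2 (ln \<lambda> + 1) < 1. It forces t < 1, so every n \<noteq> 0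
  is below its turning point, and it keeps the logarithm in D_0 from cancelling J_0(t). The factor 3
  is fixed at t = n, where \<psi> is at least of order n^(2/3); 23 is a generous upper bound of 5
  sqrt(2 pi), with 5 the constant of mode 0. In the second claim the modes below p vanish because
  D_n has no positive zeros, and the others again satisfy t \<le> |n|.\<close>

definition bes :: "nat \<Rightarrow> real \<Rightarrow> real" where
  "bes n s = (\<Sum>k. (-1) ^ k / (fact k * fact (k + n)) * s ^ k)"

text \<open>With s = (x/2)^2 this is (1/n! - \<open>bes n s\<close>) / s. It is the surplus that
  differentiation leaves behind in the digamma series, cancelled later by the derivative of the
  logarithm that multiplies J_n.\<close>

definition bes_tail :: "nat \<Rightarrow> real \<Rightarrow> real" where
  "bes_tail n s = (\<Sum>k. (-1) ^ k / (fact (k + 1) * fact (n + 1 + k)) * s ^ k)"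

definition neu_coeff :: "nat \<Rightarrow> nat \<Rightarrow> real" where
  "neu_coeff n k = (Digamma (real k + 1) + Digamma (real (n + k) + 1)) * (-1) ^ k / (fact k * fact (n + k))"

definition neu :: "nat \<Rightarrow> real \<Rightarrow> real" where
  "neu n s = (\<Sum>k. neu_coeff n k * s ^ k)"

definition neu_poly :: "nat \<Rightarrow> real \<Rightarrow> real" where
  "neu_poly n s = (\<Sum>k<n. fact (n - k - 1) / fact k * s ^ k)"

lemma summable_div_fact:
  fixes c :: "nat \<Rightarrow> real"
  assumes "\<And>k. \<bar>c k\<bar> \<le> C / fact k"
  shows "summable (\<lambda>k. c k * s ^ k)"
proof (rule summable_comparison_test')
  show "summable (\<lambda>k. C * (inverse (fact k) * \<bar>s\<bar> ^ k))"
    by (intro summable_mult summable_exp)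
  show "norm (c k * s ^ k) \<le> C * (inverse (fact k) * \<bar>s\<bar> ^ k)" if "k \<ge> 0" for k
    using mult_right_mono[OF assms[of k], of "\<bar>s\<bar> ^ k"]
    by (simp add: abs_mult power_abs field_simps)
qed

lemma summable_bes: "summable (\<lambda>k. (-1) ^ k / (fact k * fact (k + n)) * s ^ k :: real)"
proof (rule summable_div_fact[where C = 1])
  fix k
  have "1 \<le> (fact (k + n) :: real)" by (rule fact_ge_1)
  then show "\<bar>(-1) ^ k / (fact k * fact (k + n))\<bar> \<le> (1::real) / fact k"
    by (simp add: abs_mult power_abs field_simps)
qed

lemma summable_bes_tail: "summable (\<lambda>k. (-1) ^ k / (fact (k + 1) * fact (n + 1 + k)) * s ^ k :: real)"
proof (rule summable_div_fact[where C = 1])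
  fix k
  have "(fact k :: real) * 1 \<le> fact (k + 1) * fact (n + 1 + k)"
    by (intro mult_mono fact_mono fact_ge_1) auto
  then show "\<bar>(-1) ^ k / (fact (k + 1) * fact (n + 1 + k))\<bar> \<le> (1::real) / fact k"
    by (simp add: abs_mult power_abs frac_le del: fact_Suc)
qed

text \<open>Digamma at k + 1 is the harmonic number H_k minus the Euler-Mascheroni constant, with 0
  \<le> H_k \<le> k. Linear growth suffices, since the factorials in \<open>neu_coeff\<close> absorb
  it.\<close>

lemma Digamma_Suc_bound: "\<bar>Digamma (real k + 1)\<bar> \<le> real k + 1"
proof -
  have eq: "Digamma (real k + 1) = harm k - euler_mascheroni"
    using Digamma_of_nat[of k, where 'a = real] by (simp add: add.commute)
  have h: "0 \<le> (harm k :: real)" "(harm k :: real) \<le> k"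
  proof -
    show "0 \<le> (harm k :: real)" by (rule harm_nonneg)
    show "(harm k :: real) \<le> k"
    proof (induction k)
      case (Suc k)
      have "inverse (real (Suc k)) \<le> 1" by (simp add: inverse_le_1_iff)
      with Suc show ?case by (simp add: harm_Suc)
    qed (simp add: harm_def)
  qed
  have "0 < (euler_mascheroni :: real)" "(euler_mascheroni :: real) < 1"
    using euler_mascheroni_gt_19_over_33 euler_mascheroni_less_13_over_22 by auto
  with h eq show ?thesis by auto
qed

lemma summable_neu: "summable (\<lambda>k. neu_coeff n k * s ^ k)"
proof (rule summable_div_fact[where C = 4])
  fix k
  have 1: "\<bar>Digamma (real k + 1) + Digamma (real (n + k) + 1)\<bar> \<le> 2 * (real (n + k) + 1)"
    using Digamma_Suc_bound[of k] Digamma_Suc_bound[of "n + k"] by simp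
  have 2: "real (n + k) + 1 \<le> 2 * fact (n + k)"
  proof -
    have "real (n + k) \<le> fact (n + k)" "(1::real) \<le> fact (n + k)"
      using fact_ge_self[of "n + k"] by (metis of_nat_fact of_nat_le_iff, simp)
    then show ?thesis by linarith
  qed
  have "\<bar>neu_coeff n k\<bar> = \<bar>Digamma (real k + 1) + Digamma (real (n + k) + 1)\<bar> / (fact k * fact (n + k))"
    by (simp add: neu_coeff_def abs_mult power_abs)
  also have "\<dots> \<le> (4 * fact (n + k)) / (fact k * fact (n + k))"
    using 1 2 by (intro divide_right_mono) auto
  finally show "\<bar>neu_coeff n k\<bar> \<le> 4 / fact k" by simp
qed

lemma bes_split: "bes n s = 1 / fact n - s * bes_tail n s"
proof -
  have "bes n s = 1 / fact n + (\<Sum>k. (-1) ^ Suc k / (fact (Suc k) * fact (Suc k + n)) * s ^ Suc k)"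
    unfolding bes_def using suminf_split_head[OF summable_bes[of n s]] by simp
  also have "(\<lambda>k. (-1) ^ Suc k / (fact (Suc k) * fact (Suc k + n)) * s ^ Suc k)
      = (\<lambda>k. (- s) * ((-1) ^ k / (fact (k + 1) * fact (n + 1 + k)) * s ^ k))"
    by (simp add: add_ac mult.left_commute del: fact_Suc)
  also have "suminf \<dots> = (- s) * bes_tail n s"
    unfolding bes_tail_def by (rule suminf_mult[OF summable_bes_tail])
  finally show ?thesis by simp
qed

lemma bes_0 [simp]: "bes n 0 = 1 / fact n"
  by (simp add: bes_split)

lemma neu_0: "neu n 0 = (- euler_mascheroni + Digamma (real n + 1)) / fact n"
  unfolding neu_def using powser_zero[of "neu_coeff n"] by (simp add: neu_coeff_def)

text \<open>In the variable s = (x/2)^2 this is the rule (x^(-n) J_n)' = - x^(-n) J_(n+1).\<close>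

lemma bes_deriv: "(bes n has_real_derivative - bes (n + 1) s) (at s)"
proof -
  have "((\<lambda>s. \<Sum>k. (-1) ^ k / (fact k * fact (k + n)) * s ^ k) has_real_derivative
      (\<Sum>k. diffs (\<lambda>k. (-1) ^ k / (fact k * fact (k + n))) k * s ^ k)) (at s)"
    by (rule termdiffs_strong_converges_everywhere[OF summable_bes])
  also have "(\<lambda>k. diffs (\<lambda>k. (-1) ^ k / (fact k * fact (k + n))) k * s ^ k)
      = (\<lambda>k. - ((-1) ^ k / (fact k * fact (k + (n + 1))) * s ^ k))"
    by (rule ext) (simp add: diffs_def divide_simps)
  also have "suminf \<dots> = - bes (n + 1) s"
    unfolding bes_def by (rule suminf_minus[OF summable_bes])
  finally show ?thesis by (simp add: bes_def[abs_def])
qed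

lemma Digamma_Suc_shift: "Digamma (real k + 2) = Digamma (real k + 1) + 1 / (real k + 1)"
  using Digamma_plus1[of "real k + 1"] by (simp add: algebra_simps)

text \<open>Shifting the summation index replaces Digamma (k + 1) by Digamma (k + 2), which is
  larger by 1/(k + 1). The main part is the series of order n + 1, and the fractions 1/(k + 1) add
  up to \<open>bes_tail\<close>.\<close>

lemma neu_deriv: "(neu n has_real_derivative - neu (n + 1) s - bes_tail n s) (at s)"
proof -
  have "((\<lambda>s. \<Sum>k. neu_coeff n k * s ^ k) has_real_derivative
      (\<Sum>k. diffs (neu_coeff n) k * s ^ k)) (at s)"
    by (rule termdiffs_strong_converges_everywhere[OF summable_neu])
  also have "(\<lambda>k. diffs (neu_coeff n) k * s ^ k) = (\<lambda>k. - (neu_coeff (n + 1) k * s ^ k) -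
      ((-1) ^ k / (fact (k + 1) * fact (n + 1 + k)) * s ^ k))"
  proof
    fix k
    define A where "A = Digamma (real k + 1)"
    define B where "B = Digamma (real n + real k + 2)"
    have c: "real k + 1 \<noteq> 0" by linarith
    have "diffs (neu_coeff n) k = - (((A + 1 / (real k + 1) + B)) * (-1) ^ k / (fact k * fact (n + 1 + k)))"
    proof -
      have "Digamma (real (Suc k) + 1) = A + 1 / (real k + 1)"
        using Digamma_Suc_shift[of k] by (simp add: A_def add_ac)
      moreover have "Digamma (real (n + Suc k) + 1) = B" by (simp add: B_def add_ac)
      moreover have "fact (n + Suc k) = (fact (n + 1 + k) :: real)" by (simp add: add_ac)
      moreover have "fact (Suc k) = (real k + 1) * (fact k :: real)" by simp
      moreover have "real (Suc k) = real k + 1" by simp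
      ultimately show ?thesis
        using c unfolding diffs_def neu_coeff_def by (simp only:) (simp add: divide_simps)
    qed
    moreover have "neu_coeff (n + 1) k = (A + B) * (-1) ^ k / (fact k * fact (n + 1 + k))"
      unfolding neu_coeff_def A_def B_def by (simp add: add_ac)
    moreover have "(-1) ^ k / (fact (k + 1) * fact (n + 1 + k)) =
        1 / (real k + 1) * ((-1) ^ k / (fact k * fact (n + 1 + k)))"
      by (simp add: field_simps)
    ultimately have "diffs (neu_coeff n) k = - neu_coeff (n + 1) k - (-1) ^ k / (fact (k + 1) * fact (n + 1 + k))"
    proof (simp only:)
      define G where "G = (-1) ^ k / (fact k * fact (n + 1 + k) :: real)"
      show "- ((A + 1 / (real k + 1) + B) * (-1) ^ k / (fact k * fact (n + 1 + k))) =
          - ((A + B) * (-1) ^ k / (fact k * fact (n + 1 + k))) -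
          1 / (real k + 1) * ((-1) ^ k / (fact k * fact (n + 1 + k)))"
        unfolding times_divide_eq_right[symmetric] G_def[symmetric] by (simp add: algebra_simps)
    qed
    then show "diffs (neu_coeff n) k * s ^ k = - (neu_coeff (n + 1) k * s ^ k) -
      ((-1) ^ k / (fact (k + 1) * fact (n + 1 + k)) * s ^ k)"
      by (simp only:) (simp add: left_diff_distrib)
  qed
  also have "suminf \<dots> = - neu (n + 1) s - bes_tail n s"
    unfolding neu_def bes_tail_def
    by (subst suminf_diff[OF summable_minus[OF summable_neu] summable_bes_tail, symmetric])
      (simp only: suminf_minus[OF summable_neu])
  finally show ?thesis by (simp add: neu_def[abs_def])
qed

text \<open>The three-term recurrence of J_n in the variable s = (x/2)^2. The constant coefficients
  of (n + 1) \<open>bes (n + 1)\<close> and \<open>bes n\<close> agree, so their difference is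
  divisible by s, and the quotient is compared coefficientwise.\<close>

lemma bes_recurrence: "s * bes (n + 2) s + bes n s = (real n + 1) * bes (n + 1) s"
proof -
  define c where "c n k = ((-1) ^ k / (fact k * fact (k + n)) :: real)" for n k
  have sm: "summable (\<lambda>k. c n k * s ^ k)" for n unfolding c_def by (rule summable_bes)
  have b: "bes n s = (\<Sum>k. c n k * s ^ k)" for n by (simp add: bes_def c_def)
  have "(real n + 1) * bes (n + 1) s - bes n s = (\<Sum>k. ((real n + 1) * c (n + 1) k - c n k) * s ^ k)"
    unfolding b
    by (subst suminf_mult[OF sm, symmetric], subst suminf_diff[OF summable_mult[OF sm] sm])
      (simp add: algebra_simps)
  also have "\<dots> = (\<Sum>k. ((real n + 1) * c (n + 1) (Suc k) - c n (Suc k)) * s ^ Suc k)"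
  proof (subst suminf_split_head)
    show "summable (\<lambda>k. ((real n + 1) * c (n + 1) k - c n k) * s ^ k)"
      using summable_diff[OF summable_mult[OF sm[of "n+1"], of "real n + 1"] sm[of n]]
      by (simp add: algebra_simps)
    have "(fact n :: real) \<noteq> 0" "real n + 1 \<noteq> 0" "fact (n + 1) = (real n + 1) * (fact n :: real)"
      by (simp, linarith, simp)
    then have "(real n + 1) * c (n + 1) 0 - c n 0 = 0"
      unfolding c_def by (simp del: fact_Suc)
    then show "suminf (\<lambda>k. ((real n + 1) * c (n + 1) k - c n k) * s ^ k) =
      suminf (\<lambda>k. ((real n + 1) * c (n + 1) k - c n k) * s ^ k) -
        ((real n + 1) * c (n + 1) 0 - c n 0) * s ^ 0"
      by simp
  qed
  also have "(\<lambda>k. ((real n + 1) * c (n + 1) (Suc k) - c n (Suc k)) * s ^ Suc k) = (\<lambda>k. s * (c (n + 2) k * s ^ k))"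
  proof
    fix k
    have nz: "real k + 1 \<noteq> 0" "real k + real n + 2 \<noteq> 0" by linarith+
    define F where "F = (fact k :: real)"
    define G where "G = (fact (Suc k + n) :: real)"
    have 1: "fact (Suc k) = (real k + 1) * F" by (simp add: F_def)
    have 2: "fact (Suc k + (n + 1)) = (real k + real n + 2) * G" by (simp add: G_def add_ac)
    have 3: "fact (k + (n + 2)) = (real k + real n + 2) * G" by (simp add: G_def add_ac)
    have 4: "F \<noteq> 0" "G \<noteq> 0" by (simp_all add: F_def G_def del: fact_Suc)
    have "(real n + 1) * c (n + 1) (Suc k) - c n (Suc k) = c (n + 2) k"
      unfolding c_def 1 2 3 G_def[symmetric] F_def[symmetric] power_Suc using nz 4
      by (simp add: divide_simps) (simp add: algebra_simps)
    then show "((real n + 1) * c (n + 1) (Suc k) - c n (Suc k)) * s ^ Suc k = s * (c (n + 2) k * s ^ k)"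
      by simp
  qed
  also have "suminf \<dots> = s * bes (n + 2) s"
    unfolding b by (rule suminf_mult[OF sm])
  finally show ?thesis by simp
qed

text \<open>Unlike for \<open>bes\<close>, the constant coefficients do not agree: Digamma (n + 2) -
  Digamma (n + 1) = 1/(n + 1) leaves the defect 1/(n + 1)!. The finite part \<open>neu_poly\<close>
  has a matching defect.\<close>

lemma neu_recurrence: "s * neu (n + 2) s + neu n s = (real n + 1) * neu (n + 1) s - 1 / fact (n + 1)"
proof -
  have sm: "summable (\<lambda>k. neu_coeff n k * s ^ k)" for n by (rule summable_neu)
  have "(real n + 1) * neu (n + 1) s - neu n s = (\<Sum>k. ((real n + 1) * neu_coeff (n + 1) k - neu_coeff n k) * s ^ k)"
    unfolding neu_def
    by (subst suminf_mult[OF sm, symmetric], subst suminf_diff[OF summable_mult[OF sm] sm])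
      (simp add: algebra_simps)
  also have "\<dots> = (\<Sum>k. ((real n + 1) * neu_coeff (n + 1) (Suc k) - neu_coeff n (Suc k)) * s ^ Suc k)
      + ((real n + 1) * neu_coeff (n + 1) 0 - neu_coeff n 0)"
  proof (subst suminf_split_head)
    show "summable (\<lambda>k. ((real n + 1) * neu_coeff (n + 1) k - neu_coeff n k) * s ^ k)"
      using summable_diff[OF summable_mult[OF sm[of "n+1"], of "real n + 1"] sm[of n]]
      by (simp add: algebra_simps)
  qed simp
  also have "(real n + 1) * neu_coeff (n + 1) 0 - neu_coeff n 0 = 1 / fact (n + 1)"
  proof -
    have nz: "real n + 1 \<noteq> 0" by linarith
    define B where "B = Digamma (real n + 1)"
    define F where "F = (fact n :: real)"
    have "fact (n + 1) = (real n + 1) * F" "fact n = F" by (simp_all add: F_def)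
    moreover have "Digamma (real (n + 1 + 0) + 1) = B + 1 / (real n + 1)"
      using Digamma_Suc_shift[of n] by (simp add: add_ac B_def)
    moreover have "Digamma (real (n + 0) + 1) = B" by (simp add: B_def)
    moreover have "F \<noteq> 0" by (simp add: F_def)
    ultimately show ?thesis using nz unfolding neu_coeff_def
      by (simp only: add_0_right) (simp add: divide_simps, simp add: algebra_simps)
  qed
  also have "(\<lambda>k. ((real n + 1) * neu_coeff (n + 1) (Suc k) - neu_coeff n (Suc k)) * s ^ Suc k) = (\<lambda>k. s * (neu_coeff (n + 2) k * s ^ k))"
  proof
    fix k
    define A where "A = Digamma (real k + 1)"
    define B where "B = Digamma (real (n + k) + 2)"
    define F where "F = (fact (Suc k + n) :: real)"
    have nz: "real k + 1 \<noteq> 0" "real k + real n + 2 \<noteq> 0" by linarith+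
    have 1: "fact (Suc k) = (real k + 1) * fact k" by simp
    have 2: "fact (n + 1 + Suc k) = (real k + real n + 2) * F" 
      unfolding F_def by (simp add: add_ac)
    have 3: "fact (n + 2 + k) = (real k + real n + 2) * F" unfolding F_def by (simp add: add_ac)
    have 4: "fact (n + Suc k) = F" unfolding F_def by (simp add: add_ac)
    have 5: "F \<noteq> 0" "(fact k::real) \<noteq> 0" unfolding F_def by simp_all
    have 6: "Digamma (real (Suc k) + 1) = A + 1 / (real k + 1)"
      using Digamma_Suc_shift[of k] by (simp add: A_def add_ac)
    have 7: "Digamma (real (n + Suc k) + 1) = B" by (simp add: B_def add_ac)
    have 8: "Digamma (real (n + 1 + Suc k) + 1) = B + 1 / (real k + real n + 2)"
      using Digamma_Suc_shift[of "n + k + 1"] by (simp add: B_def add_ac)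
    have 9: "Digamma (real (n + 2 + k) + 1) = B + 1 / (real k + real n + 2)"
      using 8 by (simp add: add_ac)
    have "(real n + 1) * neu_coeff (n + 1) (Suc k) - neu_coeff n (Suc k) = neu_coeff (n + 2) k"
      unfolding neu_coeff_def 1 2 3 4 6 7 8 9 A_def[symmetric] power_Suc using nz 5
      by (simp add: divide_simps) (simp add: algebra_simps)
    then show "((real n + 1) * neu_coeff (n + 1) (Suc k) - neu_coeff n (Suc k)) * s ^ Suc k = s * (neu_coeff (n + 2) k * s ^ k)"
      by simp
  qed
  also have "suminf \<dots> = s * neu (n + 2) s"
    unfolding neu_def by (rule suminf_mult[OF sm])
  finally show ?thesis by simp
qed

text \<open>Only the Euler combination n p - s p' of the finite singular part p enters Y_n', so the
  derivative itself stays anonymous. In that combination (n - k) (n - k - 1)! = (n - k)! raises the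
  order by one, and only the top term s^n / n! is missing.\<close>

lemma neu_poly_deriv:
  obtains d where "(neu_poly n has_real_derivative d) (at s)"
    and "real n * neu_poly n s - s * d = neu_poly (n + 1) s - s ^ n / fact n"
proof
  let ?d = "\<Sum>k<n. fact (n - k - 1) / fact k * (real k * s ^ (k - 1))"
  show "(neu_poly n has_real_derivative ?d) (at s)"
    unfolding neu_poly_def[abs_def]
    by (auto intro!: derivative_eq_intros sum.cong simp: field_simps)
  have "s * ?d = (\<Sum>k<n. fact (n - k - 1) / fact k * (real k * s ^ k))"
    unfolding sum_distrib_left by (intro sum.cong refl) (auto simp: power_eq_if)
  then have "real n * neu_poly n s - s * ?d = (\<Sum>k<n. real (n - k) * fact (n - k - 1) / fact k * s ^ k)"
    unfolding neu_poly_def sum_distrib_left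
    by (simp only: sum_subtractf[symmetric]) (intro sum.cong refl, simp add: of_nat_diff field_simps)
  also have "\<dots> = (\<Sum>k<n. fact (n - k) / fact k * s ^ k)"
    by (intro sum.cong refl) (auto simp: fact_reduce)
  also have "\<dots> = neu_poly (n + 1) s - s ^ n / fact n"
    unfolding neu_poly_def by simp
  finally show "real n * neu_poly n s - s * ?d = neu_poly (n + 1) s - s ^ n / fact n" .
qed

lemma neu_poly_recurrence:
  "s * neu_poly n s + neu_poly (n + 2) s = (real n + 1) * neu_poly (n + 1) s + s ^ (n + 1) / fact (n + 1)"
proof -
  have "s * neu_poly n s = (\<Sum>k<n. fact (n - k - 1) / fact k * s ^ Suc k)"
    unfolding neu_poly_def sum_distrib_left by (intro sum.cong refl) simp
  also have "\<dots> = (\<Sum>k<Suc n. real k * fact (n - k) / fact k * s ^ k)"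
    by (subst sum.lessThan_Suc_shift) (auto intro!: sum.cong simp: divide_simps)
  finally have 1: "s * neu_poly n s = (\<Sum>k<Suc n. real k * fact (n - k) / fact k * s ^ k)" .
  have "neu_poly (n + 2) s = (\<Sum>k<Suc n. fact (n + 1 - k) / fact k * s ^ k) + s ^ (n + 1) / fact (n + 1)"
    unfolding neu_poly_def by (simp add: numeral_2_eq_2 del: fact_Suc)
  also have "(\<Sum>k<Suc n. fact (n + 1 - k) / fact k * s ^ k) =
      (\<Sum>k<Suc n. (real n + 1 - real k) * fact (n - k) / fact k * s ^ k)"
    by (intro sum.cong refl) (auto simp: Suc_diff_le of_nat_diff algebra_simps)
  finally have 2: "neu_poly (n + 2) s = (\<Sum>k<Suc n. (real n + 1 - real k) * fact (n - k) / fact k * s ^ k) + s ^ (n + 1) / fact (n + 1)" .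
  have 3: "(real n + 1) * neu_poly (n + 1) s = (\<Sum>k<Suc n. (real n + 1) * fact (n - k) / fact k * s ^ k)"
    unfolding neu_poly_def sum_distrib_left by (intro sum.cong) simp_all
  show ?thesis unfolding 1 2 3 add.assoc[symmetric] sum.distrib[symmetric]
    by (intro arg_cong2[where f = "(+)"] sum.cong refl) (simp add: field_simps)
qed

subsection \<open>Recurrences and Wronskian\<close>

definition J :: "nat \<Rightarrow> real \<Rightarrow> real" where "J n = besselJ (int n)"

abbreviation Y :: "nat \<Rightarrow> real \<Rightarrow> real" where "Y \<equiv> besselY"

lemma besselJ_bes: "J n x = (x / 2) ^ n * bes n ((x / 2)\<^sup>2)"
proof -
  have "(-1) ^ m / (fact m * fact (m + n)) * (x / 2) ^ (2 * m + n) =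
      (x / 2) ^ n * ((-1) ^ m / (fact m * fact (m + n)) * ((x / 2)\<^sup>2) ^ m)" for m
    by (simp only: power_add power_mult) (simp only: mult_ac)
  then have "(\<Sum>m. (-1) ^ m / (fact m * fact (m + n)) * (x / 2) ^ (2 * m + n)) =
      (\<Sum>m. (x / 2) ^ n * ((-1) ^ m / (fact m * fact (m + n)) * ((x / 2)\<^sup>2) ^ m))"
    by (simp only:)
  then have "J n x = (\<Sum>m. (x / 2) ^ n * ((-1) ^ m / (fact m * fact (m + n)) * ((x / 2)\<^sup>2) ^ m))"
    unfolding J_def besselJ_def by (simp only: nat_int abs_of_nat) simp
  also have "\<dots> = (x / 2) ^ n * bes n ((x / 2)\<^sup>2)"
    unfolding bes_def by (rule suminf_mult[OF summable_bes])
  finally show ?thesis .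
qed

lemma besselJ_nat_abs: "besselJ n x = (if n < 0 then (-1) ^ nat \<bar>n\<bar> else 1) * J (nat \<bar>n\<bar>) x"
  unfolding J_def besselJ_def by simp

lemma besselJ_at_0: "besselJ n 0 = (if n = 0 then 1 else 0)"
  by (simp add: besselJ_nat_abs[of n] besselJ_bes)

lemma besselY_neu:
  "Y n x = - neu_poly n ((x / 2)\<^sup>2) / (pi * (x / 2) ^ n) + 2 / pi * ln (x / 2) * J n x
     - (x / 2) ^ n / pi * neu n ((x / 2)\<^sup>2)"
proof -
  have "(Digamma (real k + 1) + Digamma (real (n + k) + 1)) * (- (x\<^sup>2 / 4)) ^ k / (fact k * fact (n + k))
      = neu_coeff n k * ((x / 2)\<^sup>2) ^ k" for k
  proof -
    have "(- (x\<^sup>2 / 4)) ^ k = (-1) ^ k * ((x / 2)\<^sup>2) ^ k"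
      by (simp only: power_mult_distrib[symmetric]) (simp add: power_divide)
    then show ?thesis by (simp add: neu_coeff_def)
  qed
  then show ?thesis
    unfolding besselY_def neu_def neu_poly_def J_def by (simp add: power_divide)
qed

lemma besselJ_recurrence:
  assumes "x \<noteq> 0"
  shows "J n x + J (n + 2) x = 2 * (real n + 1) / x * J (n + 1) x"
proof -
  define y where "y = x / 2"
  have x: "x = 2 * y" and y: "y \<noteq> 0" using assms by (simp_all add: y_def)
  have "J n x + J (n + 2) x = y ^ n * (y\<^sup>2 * bes (n + 2) (y\<^sup>2) + bes n (y\<^sup>2))"
    unfolding besselJ_bes y_def[symmetric] by (simp add: power_add algebra_simps power2_eq_square)
  also have "\<dots> = 2 * (real n + 1) / x * J (n + 1) x"
    unfolding bes_recurrence besselJ_bes y_def[symmetric] using y by (simp add: x field_simps)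
  finally show ?thesis .
qed

lemma besselJ_deriv:
  assumes "x \<noteq> 0"
  shows "(J n has_real_derivative real n / x * J n x - J (n + 1) x) (at x)"
proof -
  define y where "y = x / 2"
  have x: "x = 2 * y" and y: "y \<noteq> 0" using assms by (simp_all add: y_def)
  have "((\<lambda>x. (x / 2) ^ n * bes n ((x / 2)\<^sup>2)) has_real_derivative
      real n * (x / 2) ^ (n - 1) * (1 / 2) * bes n ((x / 2)\<^sup>2)
      + (x / 2) ^ n * (- bes (n + 1) ((x / 2)\<^sup>2) * (x / 2))) (at x)"
    by (auto intro!: derivative_eq_intros DERIV_chain2[OF bes_deriv] simp: power2_eq_square)
  moreover have "real n * (x / 2) ^ (n - 1) * (1 / 2) * bes n ((x / 2)\<^sup>2)
      + (x / 2) ^ n * (- bes (n + 1) ((x / 2)\<^sup>2) * (x / 2)) = real n / x * J n x - J (n + 1) x"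
    unfolding besselJ_bes y_def[symmetric] using y by (cases n) (simp_all add: x field_simps)
  ultimately show ?thesis by (simp add: besselJ_bes[abs_def])
qed

text \<open>The logarithmic part inherits the recurrence from J_n. In the rest, the defect 1/(n +
  1)! of the digamma series and the defect s^(n+1) / (n + 1)! of the finite part cancel, because
  s^(n+1) = y^(n+2) y^n for s = y^2.\<close>

lemma besselY_recurrence:
  assumes "x > 0"
  shows "Y n x + Y (n + 2) x = 2 * (real n + 1) / x * Y (n + 1) x"
proof -
  define y where "y = x / 2"
  define s where "s = y\<^sup>2"
  have x: "x = 2 * y" and y: "y > 0" using assms by (simp_all add: y_def)
  define N where "N n = - neu_poly n s / (pi * y ^ n) - y ^ n / pi * neu n s" for n
  have Y: "Y n x = N n + 2 / pi * ln y * J n x" for n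
    unfolding besselY_neu N_def s_def y_def by simp
  have "N n + N (n + 2) = - (s * neu_poly n s + neu_poly (n + 2) s) / (pi * y ^ (n + 2))
       - y ^ n / pi * (s * neu (n + 2) s + neu n s)"
    unfolding N_def using y by (simp add: s_def power_add field_simps power2_eq_square)
  also have "\<dots> = (real n + 1) / y * N (n + 1)"
    unfolding neu_poly_recurrence neu_recurrence N_def
  proof -
    have p: "s ^ (n + 1) = y ^ (n + 2) * y ^ n"
      unfolding s_def by (simp only: power_add[symmetric] power_mult[symmetric]) (simp add: mult_2)
    define F where "F = (fact (n + 1) :: real)"
    have F: "F \<noteq> 0" by (simp add: F_def)
    show "- ((real n + 1) * neu_poly (n + 1) s + s ^ (n + 1) / fact (n + 1)) / (pi * y ^ (n + 2)) -
        y ^ n / pi * ((real n + 1) * neu (n + 1) s - 1 / fact (n + 1)) =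
        (real n + 1) / y * (- neu_poly (n + 1) s / (pi * y ^ (n + 1)) - y ^ (n + 1) / pi * neu (n + 1) s)"
      unfolding p F_def[symmetric] using y F by (simp add: divide_simps power_add) (simp add: algebra_simps power2_eq_square)
  qed
  finally have 1: "N n + N (n + 2) = (real n + 1) / y * N (n + 1)" .
  have "Y n x + Y (n + 2) x = N n + N (n + 2) + 2 / pi * ln y * (J n x + J (n + 2) x)"
    unfolding Y by (simp add: algebra_simps)
  also have "\<dots> = (real n + 1) / y * N (n + 1) + 2 / pi * ln y * ((real n + 1) / y * J (n + 1) x)"
    using besselJ_recurrence[of x n] y unfolding 1 by (simp add: x)
  also have "\<dots> = (real n + 1) / y * Y (n + 1) x"
    unfolding Y using y by (simp add: field_simps)
  moreover have "2 * (real n + 1) / x = (real n + 1) / y" unfolding x by (rule mult_divide_mult_cancel_left) simp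
  ultimately show ?thesis by (simp only:)
qed

text \<open>The derivative of the logarithm contributes a multiple of J_n / x, which
  \<open>bes_split\<close> separates into a 1/n! term and a \<open>bes_tail\<close> term. The first
  accounts for the top term missing in \<open>neu_poly_deriv\<close>, the second cancels the surplus
  of \<open>neu_deriv\<close>.\<close>

lemma besselY_deriv:
  assumes "x > 0"
  shows "(Y n has_real_derivative real n / x * Y n x - Y (n + 1) x) (at x)"
proof -
  define y where "y = x / 2"
  define s where "s = y\<^sup>2"
  have x: "x = 2 * y" and y: "y > 0" using assms by (simp_all add: y_def)
  obtain d where d: "(neu_poly n has_real_derivative d) (at s)"
    and d': "real n * neu_poly n s - s * d = neu_poly (n + 1) s - s ^ n / fact n"
    using neu_poly_deriv by blast
  have pw: "((\<lambda>x. (x / 2) ^ n) has_real_derivative real n * y ^ n / (2 * y)) (at x)"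
  proof -
    have "((\<lambda>x. (x / 2) ^ n) has_real_derivative real n * (x / 2) ^ (n - 1) * (1 / 2)) (at x)"
      by (auto intro!: derivative_eq_intros)
    moreover have "real n * (x / 2) ^ (n - 1) * (1 / 2) = real n * y ^ n / (2 * y)"
      unfolding y_def[symmetric] using y by (cases n) auto
    ultimately show ?thesis by (simp only:)
  qed
  have inv: "((\<lambda>x. inverse ((x / 2) ^ n)) has_real_derivative - real n / (2 * y ^ (n + 1))) (at x)"
  proof -
    have "((\<lambda>x. inverse ((x / 2) ^ n)) has_real_derivative
        - (inverse (y ^ n) * (real n * y ^ n / (2 * y)) * inverse (y ^ n))) (at x)"
      using DERIV_inverse'[OF pw] y by (simp add: y_def)
    moreover have "inverse (y ^ n) * (real n * y ^ n / (2 * y)) * inverse (y ^ n) = real n / (2 * y ^ (n + 1))"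
      using y by (simp add: divide_simps)
    ultimately show ?thesis by simp
  qed
  have sq: "((\<lambda>x. (x / 2)\<^sup>2) has_real_derivative y) (at x)"
    by (auto intro!: derivative_eq_intros simp: x)
  have np: "((\<lambda>x. neu_poly n ((x / 2)\<^sup>2)) has_real_derivative d * y) (at x)"
    using DERIV_chain2[OF _ sq, of "neu_poly n" d] d by (simp add: s_def y_def)
  have nu: "((\<lambda>x. neu n ((x / 2)\<^sup>2)) has_real_derivative (- neu (n + 1) s - bes_tail n s) * y) (at x)"
    using DERIV_chain2[OF neu_deriv sq, of n] by (simp add: s_def y_def)
  have ln: "((\<lambda>x. ln (x / 2)) has_real_derivative 1 / (2 * y)) (at x)"
    using y by (auto intro!: derivative_eq_intros simp: x)
  have "((\<lambda>x. - (1 / pi) * (neu_poly n ((x / 2)\<^sup>2) * inverse ((x / 2) ^ n)) + 2 / pi * (ln (x / 2) * J n x)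
     - 1 / pi * ((x / 2) ^ n * neu n ((x / 2)\<^sup>2))) has_real_derivative
     - (1 / pi) * ((d * y) * inverse (y ^ n) + neu_poly n s * (- real n / (2 * y ^ (n + 1))))
     + 2 / pi * (1 / (2 * y) * J n x + ln y * (real n / x * J n x - J (n + 1) x))
     - 1 / pi * (real n * y ^ n / (2 * y) * neu n s + y ^ n * ((- neu (n + 1) s - bes_tail n s) * y))) (at x)"
  proof -
    have "((\<lambda>x. a * (A x * B x) + b * (C x * D x) - c * (E x * F x)) has_real_derivative
        a * (A' * B x + A x * B') + b * (C' * D x + C x * D') - c * (E' * F x + E x * F')) (at x)"
      if "(A has_real_derivative A') (at x)" "(B has_real_derivative B') (at x)"
        "(C has_real_derivative C') (at x)" "(D has_real_derivative D') (at x)"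
        "(E has_real_derivative E') (at x)" "(F has_real_derivative F') (at x)"
      for A B C D E F :: "real \<Rightarrow> real" and a b c A' B' C' D' E' F'
      by (rule derivative_eq_intros that refl)+ (simp add: algebra_simps)
    from this[OF np inv ln _ pw nu, where a = "- (1 / pi)" and b = "2 / pi" and c = "1 / pi"]
      besselJ_deriv[of x n] assms
    show ?thesis by (simp only: y_def s_def)
  qed
  also have "(\<lambda>x. - (1 / pi) * (neu_poly n ((x / 2)\<^sup>2) * inverse ((x / 2) ^ n)) + 2 / pi * (ln (x / 2) * J n x)
     - 1 / pi * ((x / 2) ^ n * neu n ((x / 2)\<^sup>2))) = Y n"
    unfolding besselY_neu by (rule ext) (simp add: field_simps)
  also have "- (1 / pi) * ((d * y) * inverse (y ^ n) + neu_poly n s * (- real n / (2 * y ^ (n + 1))))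
     + 2 / pi * (1 / (2 * y) * J n x + ln y * (real n / x * J n x - J (n + 1) x))
     - 1 / pi * (real n * y ^ n / (2 * y) * neu n s + y ^ n * ((- neu (n + 1) s - bes_tail n s) * y))
     = real n / x * Y n x - Y (n + 1) x" (is "?L = ?R")
  proof -
    define z where "z = y ^ n"
    define E where "E = 1 / (fact n :: real)"
    have z: "z \<noteq> 0" "y \<noteq> 0" using y by (auto simp: z_def)
    have s2: "s = y * y" by (simp add: s_def power2_eq_square)
    have Jn: "J n x = z * (E - y * y * bes_tail n s)"
      unfolding besselJ_bes bes_split E_def z_def y_def by (simp add: s_def y_def power2_eq_square)
    have p: "s ^ n / fact n = z * z * E"
      unfolding s_def E_def z_def by (simp add: power_mult[symmetric] mult_2 power_add)
    have T: "neu_poly (n + 1) s = real n * neu_poly n s - y * y * d + z * z * E"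
      using d'[unfolded p, unfolded s2] by (simp add: s2)
    have Yn: "Y n x = - neu_poly n s / (pi * z) + 2 / pi * ln y * J n x - z / pi * neu n s"
      unfolding besselY_neu s_def y_def z_def by simp
    have Ym: "Y (n + 1) x = - (real n * neu_poly n s - y * y * d + z * z * E) / (pi * (z * y))
        + 2 / pi * ln y * J (n + 1) x - z * y / pi * neu (n + 1) s"
      unfolding T[symmetric] unfolding besselY_neu s_def y_def z_def by (simp add: mult_ac)
    \<comment> \<open>All special functions are replaced by free variables, so that only an identity
      of rational functions is left.\<close>
    have alg: "- (1 / p) * ((d * y) * inverse z + T0 * (- m / (2 * (z * y))))
        + 2 / p * (1 / (2 * y) * (z * (E - y * y * B)) + L * (m / (2 * y) * j - j1))
        - 1 / p * (m * z / (2 * y) * N0 + z * ((- N1 - B) * y))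
      = m / (2 * y) * (- T0 / (p * z) + 2 / p * L * j - z / p * N0)
        - (- (m * T0 - y * y * d + z * z * E) / (p * (z * y)) + 2 / p * L * j1 - z * y / p * N1)"
      if "p \<noteq> 0" for p T0 m B L j j1 N0 N1 :: real
      using z that by (simp add: divide_simps) (simp add: algebra_simps)
    have "?L = - (1 / pi) * ((d * y) * inverse z + neu_poly n s * (- real n / (2 * (z * y))))
        + 2 / pi * (1 / (2 * y) * (z * (E - y * y * bes_tail n s)) + ln y * (real n / (2 * y) * J n x - J (n + 1) x))
        - 1 / pi * (real n * z / (2 * y) * neu n s + z * ((- neu (n + 1) s - bes_tail n s) * y))"
      unfolding Jn[symmetric] by (simp add: z_def x)
    also have "\<dots> = ?R" unfolding alg[OF pi_neq_zero] Yn Ym by (simp add: x)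
    finally show ?thesis .
  qed
  finally show ?thesis .
qed

lemma besselJ_Suc_deriv:
  assumes "x \<noteq> 0"
  shows "(J (n + 1) has_real_derivative J n x - (real n + 1) / x * J (n + 1) x) (at x)"
proof -
  have "real (n + 1) / x * J (n + 1) x - J (n + 1 + 1) x = J n x - (real n + 1) / x * J (n + 1) x"
    using besselJ_recurrence[OF assms, of n] assms by (simp add: field_simps)
  with besselJ_deriv[OF assms, of "n + 1"] show ?thesis by simp
qed

lemma besselY_Suc_deriv:
  assumes "x > 0"
  shows "(Y (n + 1) has_real_derivative Y n x - (real n + 1) / x * Y (n + 1) x) (at x)"
proof -
  have "real (n + 1) / x * Y (n + 1) x - Y (n + 1 + 1) x = Y n x - (real n + 1) / x * Y (n + 1) x"
    using besselY_recurrence[OF assms, of n] assms by (simp add: field_simps)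
  with besselY_deriv[OF assms, of "n + 1"] show ?thesis by simp
qed


section \<open>Limits at the origin and the Wronskian\<close>

lemma isCont_bes: "isCont (bes n) s"
  using bes_deriv DERIV_isCont by blast

lemma isCont_neu: "isCont (neu n) s"
  using neu_deriv DERIV_isCont by blast

lemma isCont_bes_tail: "isCont (bes_tail n) s"
  unfolding bes_tail_def using summable_bes_tail
  by (intro isCont_powser_converges_everywhere) 

lemma tendsto_square_at_right_0: "((\<lambda>x::real. (x / 2)\<^sup>2) \<longlongrightarrow> 0) (at_right 0)"
  by real_asymp

lemma tendsto_bes_at_0: "((\<lambda>x. bes n ((x / 2)\<^sup>2)) \<longlongrightarrow> 1 / fact n) (at_right 0)"
  using isCont_tendsto_compose[OF isCont_bes[of 0] tendsto_square_at_right_0, of n] by simp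

lemma tendsto_bes_tail_at_0: "((\<lambda>x. bes_tail n ((x / 2)\<^sup>2)) \<longlongrightarrow> bes_tail n 0) (at_right 0)"
  using isCont_tendsto_compose[OF isCont_bes_tail[of 0] tendsto_square_at_right_0, of n] by simp

lemma tendsto_neu_at_0: "((\<lambda>x. neu n ((x / 2)\<^sup>2)) \<longlongrightarrow> neu n 0) (at_right 0)"
  using isCont_tendsto_compose[OF isCont_neu[of 0] tendsto_square_at_right_0, of n] by simp

lemma tendsto_J_at_0: "(J n \<longlongrightarrow> (if n = 0 then 1 else 0)) (at_right 0)"
proof -
  have "((\<lambda>x::real. (x / 2) ^ n * bes n ((x / 2)\<^sup>2)) \<longlongrightarrow> (0 / 2) ^ n * (1 / fact n)) (at_right 0)"
    by (intro tendsto_intros tendsto_bes_at_0) auto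
  then show ?thesis by (simp add: besselJ_bes[abs_def] power_0_left split: if_splits)
qed

text \<open>Since \<open>bes 0 s\<close> is 1 - s \<open>bes_tail 0 s\<close>, the logarithm is
  multiplied by 1 up to a term that s ln s kills, and the digamma series starts with -2
  \<open>euler_mascheroni\<close>. This exact constant later identifies the Laplace
  integral.\<close>

lemma tendsto_Y0_at_0:
  "((\<lambda>x. Y 0 x - 2 / pi * (ln (x / 2) + euler_mascheroni)) \<longlongrightarrow> 0) (at_right 0)"
proof -
  have "((\<lambda>x. - (2 / pi) * ((ln (x / 2) * (x / 2)\<^sup>2) * bes_tail 0 ((x / 2)\<^sup>2))
      - 1 / pi * (neu 0 ((x / 2)\<^sup>2) + 2 * euler_mascheroni)) \<longlongrightarrow>
      - (2 / pi) * (0 * bes_tail 0 0) - 1 / pi * (neu 0 0 + 2 * euler_mascheroni)) (at_right 0)"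
    by (intro tendsto_intros tendsto_bes_tail_at_0 tendsto_neu_at_0) real_asymp
  moreover have "Y 0 x - 2 / pi * (ln (x / 2) + euler_mascheroni) =
      - (2 / pi) * ((ln (x / 2) * (x / 2)\<^sup>2) * bes_tail 0 ((x / 2)\<^sup>2))
      - 1 / pi * (neu 0 ((x / 2)\<^sup>2) + 2 * euler_mascheroni)" for x
    unfolding besselY_neu besselJ_bes bes_split by (simp add: neu_poly_def field_simps)
  ultimately show ?thesis by (simp add: neu_0)
qed

lemma tendsto_x_Y1_at_0: "((\<lambda>x. x * Y 1 x) \<longlongrightarrow> - 2 / pi) (at_right 0)"
proof -
  have "((\<lambda>x::real. - 2 / pi + 2 / pi * ((x * ln (x / 2) * (x / 2)) * bes 1 ((x / 2)\<^sup>2))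
      - (x * (x / 2)) / pi * neu 1 ((x / 2)\<^sup>2)) \<longlongrightarrow>
      - 2 / pi + 2 / pi * (0 * (1 / fact 1)) - (0 * (0 / 2)) / pi * neu 1 0) (at_right 0)"
    by (intro tendsto_intros tendsto_bes_at_0 tendsto_neu_at_0; (real_asymp | simp))
  moreover have "\<forall>\<^sub>F x in at_right 0. - 2 / pi + 2 / pi * ((x * ln (x / 2) * (x / 2)) * bes 1 ((x / 2)\<^sup>2))
      - (x * (x / 2)) / pi * neu 1 ((x / 2)\<^sup>2) = x * Y 1 x"
    using eventually_at_right_less[of 0]
  proof eventually_elim
    case (elim x)
    then show ?case unfolding besselY_neu besselJ_bes by (simp add: neu_poly_def field_simps)
  qed
  ultimately show ?thesis by (auto elim: Lim_transform_eventually)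
qed

lemma tendsto_x_J1_Y0_at_0: "((\<lambda>x. x * (J 1 x * Y 0 x)) \<longlongrightarrow> 0) (at_right 0)"
proof -
  have "((\<lambda>x. J 1 x * (x * (Y 0 x - 2 / pi * (ln (x / 2) + euler_mascheroni))
      + 2 / pi * (x * (ln (x / 2) + euler_mascheroni)))) \<longlongrightarrow> 0 * (0 * 0 + 2 / pi * 0)) (at_right 0)"
    using tendsto_J_at_0[of 1]
    by (intro tendsto_intros tendsto_Y0_at_0; (real_asymp | simp))
  then show ?thesis by (simp add: algebra_simps)
qed

text \<open>The common three-term recurrence carries the cross product unchanged from n to n + 1, so
  only order 0 has to be evaluated.\<close>

lemma wronskian_const:
  assumes "x > 0"
  shows "J (n + 1) x * Y n x - J n x * Y (n + 1) x = J 1 x * Y 0 x - J 0 x * Y 1 x"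
proof (induction n)
  case (Suc n)
  have "J (n + 2) x = 2 * (real n + 1) / x * J (n + 1) x - J n x"
    "Y (n + 2) x = 2 * (real n + 1) / x * Y (n + 1) x - Y n x"
    using besselJ_recurrence[of x n] besselY_recurrence[of x n] assms by simp_all
  then have "J (n + 2) x * Y (n + 1) x - J (n + 1) x * Y (n + 2) x = J (n + 1) x * Y n x - J n x * Y (n + 1) x"
    by (simp only:) (simp add: algebra_simps)
  with Suc show ?case by simp
qed simp

text \<open>x times the cross product of order 0 has derivative zero, and its constant value is read
  off at the origin, where x Y_1(x) tends to -2/pi and the other product disappears.\<close>

theorem wronskian:
  assumes "x > 0"
  shows "J (n + 1) x * Y n x - J n x * Y (n + 1) x = 2 / (pi * x)"
proof -
  define W where "W x = x * (J 1 x * Y 0 x - J 0 x * Y 1 x)" for x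
  have "(W has_real_derivative 0) (at x)" if "x > 0" for x
    unfolding W_def using that besselJ_deriv[of x 0] besselY_deriv[of x 0] besselJ_Suc_deriv[of x 0] besselY_Suc_deriv[of x 0]
    by (auto intro!: derivative_eq_intros) (simp add: field_simps)
  then have const: "\<exists>c. \<forall>x\<in>{0<..}. W x = c"
    by (intro has_field_derivative_zero_constant) (auto simp: at_within_open[of _ "{0<..}"])
  then obtain c where c: "\<And>x. x > 0 \<Longrightarrow> W x = c" by auto
  have "((\<lambda>x. x * (J 1 x * Y 0 x) - J 0 x * (x * Y 1 x)) \<longlongrightarrow> 0 - 1 * (- 2 / pi)) (at_right 0)"
    using tendsto_J_at_0[of 0] by (intro tendsto_intros tendsto_x_J1_Y0_at_0 tendsto_x_Y1_at_0) simp_all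
  then have "(W \<longlongrightarrow> 2 / pi) (at_right 0)" unfolding W_def by (simp add: algebra_simps)
  moreover have "(W \<longlongrightarrow> c) (at_right 0)"
    using eventually_at_right_less[of 0]
    by (intro tendsto_eventually) (auto elim!: eventually_mono simp: c)
  ultimately have "c = 2 / pi" by (intro tendsto_unique[of "at_right (0::real)"]) auto
  with c[OF assms] have "J 1 x * Y 0 x - J 0 x * Y 1 x = 2 / (pi * x)"
    unfolding W_def using assms by (simp add: field_simps)
  with wronskian_const[OF assms] show ?thesis by simp
qed


subsection \<open>The Euler derivative and solutions of Bessel's equation\<close>

text \<open>x J_n'(x), written without a derivative by the rule x J_n' = n J_n - x J_(n+1);
  \<open>EY\<close> is x Y_n'(x). With this Euler derivative Bessel's equation is a first-order
  system with the single coefficient n^2/x - x, and the Wronskian is the constant 2/pi.\<close>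

definition EJ :: "nat \<Rightarrow> real \<Rightarrow> real" where "EJ n x = real n * J n x - x * J (n + 1) x"
definition EY :: "nat \<Rightarrow> real \<Rightarrow> real" where "EY n x = real n * Y n x - x * Y (n + 1) x"

lemma J_has_deriv: "x > 0 \<Longrightarrow> (J n has_real_derivative EJ n x / x) (at x)"
  using besselJ_deriv[of x n] by (simp add: EJ_def diff_divide_distrib)

lemma Y_has_deriv: "x > 0 \<Longrightarrow> (Y n has_real_derivative EY n x / x) (at x)"
  using besselY_deriv[of x n] by (simp add: EY_def diff_divide_distrib)

lemma EJ_has_deriv:
  assumes "x > 0"
  shows "(EJ n has_real_derivative ((real n)\<^sup>2 / x - x) * J n x) (at x)"
proof -
  have "((\<lambda>x. real n * J n x - x * J (n + 1) x) has_real_derivative real n * (real n / x * J n x - J (n + 1) x)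
      - (1 * J (n + 1) x + (J n x - (real n + 1) / x * J (n + 1) x) * x)) (at x)"
    using assms
    by (intro DERIV_diff DERIV_cmult DERIV_mult DERIV_ident besselJ_deriv besselJ_Suc_deriv) auto
  moreover have "real n * (real n / x * J n x - J (n + 1) x)
      - (1 * J (n + 1) x + (J n x - (real n + 1) / x * J (n + 1) x) * x) = ((real n)\<^sup>2 / x - x) * J n x"
    using assms by (simp add: field_simps power2_eq_square)
  ultimately show ?thesis unfolding EJ_def[abs_def] by (simp only:)
qed

lemma EY_has_deriv:
  assumes "x > 0"
  shows "(EY n has_real_derivative ((real n)\<^sup>2 / x - x) * Y n x) (at x)"
proof -
  have "((\<lambda>x. real n * Y n x - x * Y (n + 1) x) has_real_derivative real n * (real n / x * Y n x - Y (n + 1) x)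
      - (1 * Y (n + 1) x + (Y n x - (real n + 1) / x * Y (n + 1) x) * x)) (at x)"
    using assms
    by (intro DERIV_diff DERIV_cmult DERIV_mult DERIV_ident besselY_deriv besselY_Suc_deriv) auto
  moreover have "real n * (real n / x * Y n x - Y (n + 1) x)
      - (1 * Y (n + 1) x + (Y n x - (real n + 1) / x * Y (n + 1) x) * x) = ((real n)\<^sup>2 / x - x) * Y n x"
    using assms by (simp add: field_simps power2_eq_square)
  ultimately show ?thesis unfolding EY_def[abs_def] by (simp only:)
qed

lemma wronskian_Euler: "x > 0 \<Longrightarrow> J n x * EY n x - EJ n x * Y n x = 2 / pi"
  using wronskian[of x n] by (simp add: EJ_def EY_def field_simps)

lemma vector_derivative_zero_imp_const:
  fixes f :: "real \<Rightarrow> 'b::real_normed_vector"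
  assumes "convex S" "\<And>x. x \<in> S \<Longrightarrow> (f has_vector_derivative 0) (at x)"
  shows "\<exists>c. \<forall>x\<in>S. f x = c"
  using has_derivative_zero_constant[of S f] assms
  by (auto simp: has_vector_derivative_def intro: has_derivative_at_withinI)

text \<open>The cross products of (f, \<phi>) with (J_n, x J_n') and with (Y_n, x Y_n') have
  derivative zero, because all three pairs solve the same system. These two constants determine f
  and \<phi>, as the Wronskian does not vanish.\<close>

lemma bessel_solution:
  fixes f \<phi> :: "real \<Rightarrow> complex"
  assumes S: "convex S" "open S" "S \<subseteq> {0<..}" and k: "k > 0"
    and f: "\<And>r. r \<in> S \<Longrightarrow> (f has_vector_derivative \<phi> r / of_real r) (at r)"
    and \<phi>: "\<And>r. r \<in> S \<Longrightarrow> (\<phi> has_vector_derivative of_real ((real n)\<^sup>2 / r - k\<^sup>2 * r) * f r) (at r)"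
  obtains \<alpha> \<beta> :: complex where "\<And>r. r \<in> S \<Longrightarrow> f r = \<alpha> * J n (k * r) + \<beta> * Y n (k * r)"
    and "\<And>r. r \<in> S \<Longrightarrow> \<phi> r = \<alpha> * EJ n (k * r) + \<beta> * EY n (k * r)"
proof -
  have dv: "((\<lambda>r. complex_of_real (F (k * r))) has_vector_derivative of_real (F' * k)) (at r)"
    if "(F has_real_derivative F') (at (k * r))" for F F' r
  proof -
    have "((\<lambda>r. F (k * r)) has_real_derivative F' * k) (at r)"
      by (rule DERIV_chain2[where f = F and g = "\<lambda>r. k * r", OF that]) (auto intro!: derivative_eq_intros)
    then show ?thesis
      by (intro has_vector_derivative_of_real) (simp add: has_real_derivative_iff_has_vector_derivative)
  qed
  have const: "\<exists>c. \<forall>r\<in>S. f r * of_real (E (k * r)) - \<phi> r * of_real (C (k * r)) = c"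
    if C: "\<And>x. x > 0 \<Longrightarrow> (C has_real_derivative E x / x) (at x)"
      and E: "\<And>x. x > 0 \<Longrightarrow> (E has_real_derivative ((real n)\<^sup>2 / x - x) * C x) (at x)" for C E
  proof (rule vector_derivative_zero_imp_const[OF S(1)])
    fix r assume r: "r \<in> S"
    have r0: "r > 0" "k * r > 0" using S k r by auto
    have "((\<lambda>r. f r * of_real (E (k * r)) - \<phi> r * of_real (C (k * r))) has_vector_derivative
        (f r * of_real (((real n)\<^sup>2 / (k * r) - k * r) * C (k * r) * k) + \<phi> r / of_real r * of_real (E (k * r)))
        - (\<phi> r * of_real (E (k * r) / (k * r) * k) + of_real ((real n)\<^sup>2 / r - k\<^sup>2 * r) * f r * of_real (C (k * r)))) (at r)"
      by (intro has_vector_derivative_diff has_vector_derivative_mult f \<phi> dv C E r r0)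
    moreover have "E (k * r) / (k * r) * k = E (k * r) / r"
        "((real n)\<^sup>2 / (k * r) - k * r) * C (k * r) * k = ((real n)\<^sup>2 / r - k\<^sup>2 * r) * C (k * r)"
      using r0 k by (simp_all add: field_simps power2_eq_square)
    ultimately show "((\<lambda>r. f r * of_real (E (k * r)) - \<phi> r * of_real (C (k * r))) has_vector_derivative 0) (at r)"
      by (simp only:) (simp add: algebra_simps)
  qed
  obtain A where A: "\<And>r. r \<in> S \<Longrightarrow> f r * of_real (EY n (k * r)) - \<phi> r * of_real (Y n (k * r)) = A"
  proof -
    have "\<exists>c. \<forall>r\<in>S. f r * of_real (EY n (k * r)) - \<phi> r * of_real (Y n (k * r)) = c"
      by (rule const[where C = "Y n" and E = "EY n"]) (fact Y_has_deriv, fact EY_has_deriv)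
    then obtain c where c: "\<forall>r\<in>S. f r * of_real (EY n (k * r)) - \<phi> r * of_real (Y n (k * r)) = c" ..
    show ?thesis by (rule that[of c]) (rule bspec[OF c])
  qed
  obtain B where B: "\<And>r. r \<in> S \<Longrightarrow> f r * of_real (EJ n (k * r)) - \<phi> r * of_real (J n (k * r)) = B"
  proof -
    have "\<exists>c. \<forall>r\<in>S. f r * of_real (EJ n (k * r)) - \<phi> r * of_real (J n (k * r)) = c"
      by (rule const[where C = "J n" and E = "EJ n"]) (fact J_has_deriv, fact EJ_has_deriv)
    then obtain c where c: "\<forall>r\<in>S. f r * of_real (EJ n (k * r)) - \<phi> r * of_real (J n (k * r)) = c" ..
    show ?thesis by (rule that[of c]) (rule bspec[OF c])
  qed
  have w: "complex_of_real (J n (k * r)) * EY n (k * r) - EJ n (k * r) * Y n (k * r) = 2 / of_real pi" if "r \<in> S" for r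
  proof -
    have "k * r > 0" using that S k by auto
    from arg_cong[OF wronskian_Euler[OF this, of n], of complex_of_real] show ?thesis by simp
  qed
  \<comment> \<open>Division by the Wronskian 2/pi, as in Cramer's rule.\<close>
  have scale: "z = of_real pi / 2 * (z * (2 / of_real pi))" for z :: complex
    by simp
  have 1: "f r = (of_real pi / 2 * A) * J n (k * r) + (- (of_real pi / 2) * B) * Y n (k * r)" if r: "r \<in> S" for r
  proof -
    have "f r * (2 / of_real pi) = A * J n (k * r) - B * Y n (k * r)"
      unfolding A[OF r, symmetric] B[OF r, symmetric] w[OF r, symmetric] by (simp add: algebra_simps)
    from scale[of "f r", unfolded this] show ?thesis by (rule trans) (simp add: algebra_simps)
  qed
  have 2: "\<phi> r = (of_real pi / 2 * A) * EJ n (k * r) + (- (of_real pi / 2) * B) * EY n (k * r)" if r: "r \<in> S" for r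
  proof -
    have "\<phi> r * (2 / of_real pi) = A * EJ n (k * r) - B * EY n (k * r)"
      unfolding A[OF r, symmetric] B[OF r, symmetric] w[OF r, symmetric] by (simp add: algebra_simps)
    from scale[of "\<phi> r", unfolded this] show ?thesis by (rule trans) (simp add: algebra_simps)
  qed
  show ?thesis by (rule that[OF 1 2])
qed


subsection \<open>Laplace integrals\<close>

lemma exp_powr_set_integrable:
  fixes x a :: real
  assumes "x > 0" "a > -1"
  shows "set_integrable lborel {0<..} (\<lambda>s. exp (-(x * s)) * s powr a)"
proof -
  let ?f = "\<lambda>t. complex_of_real t powr (of_real (a + 1) - 1) / of_real (exp (x * t))"
  have "?f absolutely_integrable_on {0<..}"
    by (rule absolutely_integrable_Gamma_integral) (use assms in simp_all)
  then have "set_integrable lebesgue {0<..} (\<lambda>t. norm (?f t))"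
    by (rule set_integrable_norm)
  moreover have "norm (?f t) = exp (-(x * t)) * t powr a" if "t \<in> {0<..}" for t
    using that by (simp add: norm_divide norm_powr_real_powr exp_minus field_simps)
  ultimately have "set_integrable lebesgue {0<..} (\<lambda>s. exp (-(x * s)) * s powr a)"
    by (subst (asm) set_integrable_cong[OF refl refl]) auto
  then show ?thesis
    unfolding set_integrable_def by (subst (asm) integrable_completion) auto
qed

lemma exp_powr_set_integral:
  fixes x a :: real
  assumes "x > 0" "a > -1"
  shows "(LBINT s:{0<..}. exp (-(x * s)) * s powr a) = Gamma (a + 1) * x powr (-(a + 1))"
proof -
  have "((\<lambda>t. t powr (a + 1 - 1) / exp t) has_integral Gamma (a + 1)) {0..}"
    by (rule Gamma_integral_real) (use assms in simp)
  moreover have "((\<lambda>t. t powr (a + 1 - 1) / exp t) has_integral Gamma (a + 1)) {0<..} \<longleftrightarrow>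
      ((\<lambda>t. t powr (a + 1 - 1) / exp t) has_integral Gamma (a + 1)) {0..}"
    by (rule has_integral_spike_set_eq; rule negligible_subset[OF negligible_sing[of 0]]) auto
  ultimately have "((\<lambda>t. t powr (a + 1 - 1) / exp t) has_integral Gamma (a + 1)) {0<..}" by simp
  then have hk: "((\<lambda>s. exp (-(1 * s)) * s powr a) has_integral Gamma (a + 1)) {0<..}"
    by (simp add: exp_minus field_simps)
  define f where "f t = indicator {0<..} t *\<^sub>R (exp (- t) * t powr a)" for t :: real
  have "(LBINT s:{0<..}. exp (-(1 * s)) * s powr a) = Gamma (a + 1)"
    using set_borel_integral_eq_integral(2)[OF exp_powr_set_integrable[of 1 a]] assms hk
    by (simp add: integral_unique)
  then have "(\<integral>t. f t \<partial>lborel) = Gamma (a + 1)"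
    by (simp add: set_lebesgue_integral_def f_def)
  also have "(\<integral>t. f t \<partial>lborel) = x * (\<integral>s. f (x * s) \<partial>lborel)"
    using lborel_integral_real_affine[of x f 0] assms by simp
  also have "(\<lambda>s. f (x * s)) = (\<lambda>s. x powr a * (indicator {0<..} s *\<^sub>R (exp (-(x * s)) * s powr a)))"
    using assms by (auto simp: f_def indicator_def powr_mult zero_less_mult_iff)
  finally have "Gamma (a + 1) = x * (x powr a * (LBINT s:{0<..}. exp (-(x * s)) * s powr a))"
    by (simp add: set_lebesgue_integral_def)
  moreover have "x powr (-(a + 1)) * (x * x powr a) = 1"
  proof -
    have "x * x powr a = x powr (a + 1)" using assms by (simp add: powr_add)
    moreover have "x powr (-(a + 1)) * x powr (a + 1) = 1"
      unfolding powr_add[symmetric] using assms by simp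
    ultimately show ?thesis by (simp only:)
  qed
  ultimately show ?thesis by (simp add: algebra_simps)
qed

definition laplace :: "(real \<Rightarrow> complex) \<Rightarrow> real \<Rightarrow> complex" where
  "laplace \<theta> x = (LBINT s:{0<..}. of_real (exp (-(x * s))) * \<theta> s)"

lemma laplace_integrable:
  fixes \<theta> :: "real \<Rightarrow> complex"
  assumes [measurable]: "\<theta> \<in> borel_measurable borel"
    and b: "\<And>s. s > 0 \<Longrightarrow> norm (\<theta> s) \<le> C * s powr a" and "a > -1" "x > 0"
  shows "set_integrable lborel {0<..} (\<lambda>s. of_real (exp (-(x * s))) * \<theta> s)"
proof (rule set_integrable_bound)
  show "set_integrable lborel {0<..} (\<lambda>s. C * (exp (-(x * s)) * s powr a))"
    by (intro set_integrable_mult_right exp_powr_set_integrable) (use assms in auto)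
  show "AE s in lborel. s \<in> {0<..} \<longrightarrow> norm (of_real (exp (-(x * s))) * \<theta> s) \<le> norm (C * (exp (-(x * s)) * s powr a))"
  proof (intro AE_I2 impI)
    fix s :: real assume s: "s \<in> {0<..}"
    have "norm (of_real (exp (-(x * s))) * \<theta> s) \<le> exp (-(x * s)) * (C * s powr a)"
      unfolding norm_mult using b[of s] s by (intro mult_mono) auto
    also have "\<dots> \<le> norm (C * (exp (-(x * s)) * s powr a))" by (simp add: mult_ac)
    finally show "norm (of_real (exp (-(x * s))) * \<theta> s) \<le> norm (C * (exp (-(x * s)) * s powr a))" .
  qed
  show "set_borel_measurable lborel {0<..} (\<lambda>s. of_real (exp (-(x * s))) * \<theta> s)"
    unfolding set_borel_measurable_def by measurable
qed

lemma laplace_norm_le: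
  assumes m: "\<theta> \<in> borel_measurable borel"
    and b: "\<And>s. s > 0 \<Longrightarrow> norm (\<theta> s) \<le> C * s powr a" and a: "a > -1" "x > 0"
  shows "norm (laplace \<theta> x) \<le> C * (Gamma (a + 1) * x powr (-(a + 1)))"
proof -
  note int = laplace_integrable[OF m b a]
  have "norm (laplace \<theta> x) \<le> (LBINT s:{0<..}. norm (of_real (exp (-(x * s))) * \<theta> s))"
    unfolding laplace_def by (rule set_integral_norm_bound[OF int])
  also have "\<dots> \<le> (LBINT s:{0<..}. C * (exp (-(x * s)) * s powr a))"
  proof (rule set_integral_mono)
    show "set_integrable lborel {0<..} (\<lambda>s. norm (of_real (exp (-(x * s))) * \<theta> s))"
      by (rule set_integrable_norm[OF int])
    show "set_integrable lborel {0<..} (\<lambda>s. C * (exp (-(x * s)) * s powr a))"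
      by (intro set_integrable_mult_right exp_powr_set_integrable) (use assms in auto)
    show "norm (of_real (exp (-(x * s))) * \<theta> s) \<le> C * (exp (-(x * s)) * s powr a)" if "s \<in> {0<..}" for s
    proof -
      have "norm (of_real (exp (-(x * s))) * \<theta> s) \<le> exp (-(x * s)) * (C * s powr a)"
        unfolding norm_mult using b[of s] that by (intro mult_mono) auto
      then show ?thesis by (simp add: mult_ac)
    qed
  qed
  also have "\<dots> = C * (Gamma (a + 1) * x powr (-(a + 1)))"
    using exp_powr_set_integral[of x a] a by simp
  finally show ?thesis .
qed

text \<open>A quadratic remainder is a criterion that can be checked by a direct estimate. It serves
  for differentiation under the Laplace integral and for the flat functions at 0.\<close>

lemma has_vector_derivative_quadratic:
  fixes F :: "real \<Rightarrow> 'b::real_normed_vector"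
  assumes d: "d > 0" and b: "\<And>h. \<bar>h\<bar> < d \<Longrightarrow> norm (F (x + h) - F x - h *\<^sub>R D) \<le> M * h\<^sup>2"
  shows "(F has_vector_derivative D) (at x)"
  unfolding has_vector_derivative_def has_derivative_at'
proof (intro conjI allI impI)
  show "bounded_linear (\<lambda>h. h *\<^sub>R D)" by (rule bounded_linear_scaleR_left)
  fix e :: real assume e: "e > 0"
  have "norm (F y - F x - (y - x) *\<^sub>R D) / norm (y - x) < e"
    if y: "0 < norm (y - x)" "norm (y - x) < min d (e / (\<bar>M\<bar> + 1))" for y
  proof -
    define h where "h = y - x"
    have h: "h \<noteq> 0" "\<bar>h\<bar> < d" "\<bar>h\<bar> * (\<bar>M\<bar> + 1) < e" using y by (auto simp: h_def field_simps)
    have "norm (F y - F x - (y - x) *\<^sub>R D) \<le> M * h\<^sup>2"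
      using b[of h] h by (simp add: h_def)
    also have "\<dots> \<le> (\<bar>M\<bar> + 1) * h\<^sup>2" by (intro mult_right_mono) auto
    also have "h\<^sup>2 = \<bar>h\<bar> * \<bar>h\<bar>" by (simp add: power2_eq_square)
    also have "(\<bar>M\<bar> + 1) * (\<bar>h\<bar> * \<bar>h\<bar>) = \<bar>h\<bar> * (\<bar>M\<bar> + 1) * \<bar>h\<bar>" by (simp only: mult_ac)
    also have "\<dots> < e * \<bar>h\<bar>" using h by (intro mult_strict_right_mono) auto
    finally show ?thesis using h by (simp add: h_def field_simps)
  qed
  moreover have "min d (e / (\<bar>M\<bar> + 1)) > 0" using d e by simp
  ultimately show "\<exists>da>0. \<forall>y. 0 < norm (y - x) \<and> norm (y - x) < da \<longrightarrow>
      norm (F y - F x - (y - x) *\<^sub>R D) / norm (y - x) < e"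
    by blast
qed

lemma exp_second_order: "\<bar>exp u - 1 - u\<bar> \<le> u\<^sup>2 * exp \<bar>u\<bar>" for u :: real
proof -
  have 1: "exp u \<ge> 1 + u" "exp (-u) \<ge> 1 - u" using exp_ge_add_one_self[of u] exp_ge_add_one_self[of "-u"] by auto
  have "exp u * exp (-u) \<ge> exp u * (1 - u)" using 1 by (intro mult_left_mono) auto
  then have 2: "exp u - 1 - u \<le> u * (exp u - 1)" by (simp add: exp_minus algebra_simps)
  have "u * (exp u - 1) \<le> u\<^sup>2 * exp \<bar>u\<bar>"
  proof (cases "u \<ge> 0")
    case True
    have "exp u - 1 \<le> u * exp u" using \<open>exp u * exp (-u) \<ge> _\<close> by (simp add: exp_minus algebra_simps)
    with True show ?thesis by (simp add: power2_eq_square mult.assoc mult_left_mono)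
  next
    case False
    have "u \<le> exp u - 1" using 1 by linarith
    then have "u * (exp u - 1) \<le> u * u" using False by (intro mult_left_mono_neg) auto
    also have "\<dots> \<le> (u * u) * exp \<bar>u\<bar>" using mult_left_mono[of 1 "exp \<bar>u\<bar>" "u * u"] by simp
    finally show ?thesis by (simp add: power2_eq_square)
  qed
  moreover have "0 \<le> exp u - 1 - u" using 1 by linarith
  ultimately show ?thesis using 2 by simp
qed

text \<open>For |h| < x/2 the second-order remainder of exp(-h s) costs at most a factor exp(x s /
  2). Half of the decay exp(-x s) survives, and that is enough to integrate s^(a+2).\<close>

lemma laplace_deriv:
  assumes m[measurable]: "\<theta> \<in> borel_measurable borel"
    and b: "\<And>s. s > 0 \<Longrightarrow> norm (\<theta> s) \<le> C * s powr a" and a: "a > -1" and x: "x > 0"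
  shows "(laplace \<theta> has_vector_derivative - laplace (\<lambda>s. of_real s * \<theta> s) x) (at x)"
proof (rule has_vector_derivative_quadratic[of "x / 2"])
  show "x / 2 > 0" using x by simp
  have b1: "norm (of_real s * \<theta> s) \<le> C * s powr (a + 1)" if "s > 0" for s
    using mult_left_mono[OF b[OF that], of s] that by (simp add: norm_mult powr_add mult_ac)
  have b2: "norm (of_real s ^ 2 * \<theta> s) \<le> C * s powr (a + 2)" if "s > 0" for s
    using mult_left_mono[OF b[OF that], of "s ^ 2"] that by (simp add: norm_mult norm_power powr_add mult_ac)
  fix h :: real assume h: "\<bar>h\<bar> < x / 2"
  have xh: "x + h > 0" using h x by (auto simp: abs_less_iff)
  note i0 = laplace_integrable[OF m b a x] and ih = laplace_integrable[OF m b a xh]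
  have i1: "set_integrable lborel {0<..} (\<lambda>s. of_real (exp (-(x * s))) * (of_real s * \<theta> s))"
    by (rule laplace_integrable[OF _ b1]) (use a x in auto)
  have i2: "set_integrable lborel {0<..} (\<lambda>s. h\<^sup>2 * (C * (exp (-((x/2) * s)) * s powr (a + 2))))"
    by (intro set_integrable_mult_right exp_powr_set_integrable) (use a x in auto)
  define f0 where "f0 s = complex_of_real (exp (-(x * s))) * \<theta> s" for s
  define fh where "fh s = complex_of_real (exp (-((x + h) * s))) * \<theta> s" for s
  define f1 where "f1 s = complex_of_real (exp (-(x * s))) * (of_real s * \<theta> s)" for s
  define D where "D s = (fh s - f0 s) + of_real h * f1 s" for s
  define B where "B s = C * (exp (-((x/2) * s)) * s powr (a + 2))" for s
  have int: "set_integrable lborel {0<..} f0" "set_integrable lborel {0<..} fh" "set_integrable lborel {0<..} f1"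
    using i0 ih i1 unfolding f0_def fh_def f1_def by simp_all
  have intD: "set_integrable lborel {0<..} D"
    unfolding D_def by (intro set_integral_add(1) set_integral_diff(1) set_integrable_mult_right int)
  have "(LBINT s:{0<..}. D s) = laplace \<theta> (x + h) - laplace \<theta> x + of_real h * laplace (\<lambda>s. of_real s * \<theta> s) x"
    unfolding D_def laplace_def f0_def[symmetric] fh_def[symmetric] f1_def[symmetric]
    by (simp add: set_integral_add(2) set_integral_diff set_integrable_mult_right int set_integral_mult_right)
  then have "laplace \<theta> (x + h) - laplace \<theta> x - h *\<^sub>R (- laplace (\<lambda>s. of_real s * \<theta> s) x) =
     (LBINT s:{0<..}. D s)"
    by (simp add: scaleR_conv_of_real)
  also have "norm \<dots> \<le> (LBINT s:{0<..}. norm (D s))"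
    by (rule set_integral_norm_bound[OF intD])
  also have "\<dots> \<le> (LBINT s:{0<..}. h\<^sup>2 * B s)"
  proof (rule set_integral_mono)
    show "set_integrable lborel {0<..} (\<lambda>s. norm (D s))"
      by (rule set_integrable_norm[OF intD])
    show "set_integrable lborel {0<..} (\<lambda>s. h\<^sup>2 * B s)"
      using i2 unfolding B_def .
    fix s :: real assume s: "s \<in> {0<..}"
    have e: "exp (-((x + h) * s)) = exp (-(x * s)) * exp (-(h * s))"
      by (simp add: distrib_right exp_add[symmetric])
    have "D s = of_real (exp (-(x * s)) * (exp (- (h * s)) - 1 - (- (h * s)))) * \<theta> s"
      unfolding D_def f0_def fh_def f1_def e by (simp add: algebra_simps)
    also have "norm \<dots> = exp (-(x * s)) * \<bar>exp (- (h * s)) - 1 - (- (h * s))\<bar> * norm (\<theta> s)"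
      by (simp only: norm_mult norm_of_real abs_mult abs_exp_cancel)
    also have "\<dots> \<le> exp (-(x * s)) * ((h * s)\<^sup>2 * exp \<bar>h * s\<bar>) * (C * s powr a)"
      using exp_second_order[of "- (h * s)"] b[of s] s by (intro mult_mono) auto
    also have "\<dots> = h\<^sup>2 * (C * (exp (-(x * s) + \<bar>h * s\<bar>) * (s\<^sup>2 * s powr a)))"
      unfolding exp_add power_mult_distrib by (simp only: mult_ac)
    also have "s\<^sup>2 * s powr a = s powr (a + 2)"
      using s by (simp add: powr_add)
    also have "h\<^sup>2 * (C * (exp (-(x * s) + \<bar>h * s\<bar>) * s powr (a + 2))) \<le> h\<^sup>2 * B s"
    proof -
      have "\<bar>h * s\<bar> \<le> x / 2 * s" using h s unfolding abs_mult by (intro mult_mono) auto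
      then have "-(x * s) + \<bar>h * s\<bar> \<le> -((x / 2) * s)" by simp
      moreover have "C \<ge> 0" using order_trans[OF norm_ge_zero b[of 1]] by simp
      ultimately show ?thesis unfolding B_def by (intro mult_left_mono mult_right_mono) auto
    qed
    finally show "norm (D s) \<le> h\<^sup>2 * B s" .
  qed
  also have "\<dots> = (LBINT s:{0<..}. B s) * h\<^sup>2"
    by simp
  finally show "norm (laplace \<theta> (x + h) - laplace \<theta> x - h *\<^sub>R (- laplace (\<lambda>s. of_real s * \<theta> s) x)) \<le>
    (LBINT s:{0<..}. (C * (exp (-((x/2) * s)) * s powr (a + 2)))) * h\<^sup>2"
    unfolding B_def .
qed

lemma half_line_FTC:
  fixes F F' :: "real \<Rightarrow> complex"
  assumes "\<And>s. s > 0 \<Longrightarrow> (F has_vector_derivative F' s) (at s)" "\<And>s. s > 0 \<Longrightarrow> isCont F' s"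
    and "set_integrable lborel {0<..} F'" "(F \<longlongrightarrow> A) (at_right 0)" "(F \<longlongrightarrow> B) at_top"
  shows "(LBINT s:{0<..}. F' s) = B - A"
proof -
  have "(LBINT s=ereal 0..\<infinity>. F' s) = B - A"
  proof (rule interval_integral_FTC_integrable[where F = F])
    show "((F \<circ> real_of_ereal) \<longlongrightarrow> A) (at_right (ereal 0))" 
      unfolding ereal_tendsto_simps1(2) using assms(4) by simp
    show "((F \<circ> real_of_ereal) \<longlongrightarrow> B) (at_left \<infinity>)" 
      using assms(5) by (simp add: ereal_tendsto_simps1)
    have "einterval (ereal 0) \<infinity> = {0<..}" by (auto simp: einterval_def)
    then show "set_integrable lborel (einterval (ereal 0) \<infinity>) F'" using assms(3) by simp
  qed (use assms in auto)
  then show ?thesis by (simp add: interval_integral_to_infinity_eq)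
qed


subsection \<open>The outgoing solution of order zero\<close>

text \<open>The argument s - 2 i stays off the cut of the principal root for every real s, so this
  is a smooth branch with nonnegative real part.\<close>

definition hroot :: "real \<Rightarrow> complex" where "hroot s = csqrt (of_real s - 2 * \<i>)"

text \<open>The kernel (s (s - 2 i))^(-1/2) of Laplace's representation: exp(i x) times its Laplace
  transform turns out to be (pi / 2) i H_0(x).\<close>

definition hker :: "real \<Rightarrow> complex" where "hker s = 1 / (of_real (sqrt s) * hroot s)"

lemma hroot_sq: "hroot s * hroot s = of_real s - 2 * \<i>"
  unfolding hroot_def by (metis power2_csqrt power2_eq_square)

lemma hroot_nonpos: "complex_of_real s - 2 * \<i> \<notin> \<real>\<^sub>\<le>\<^sub>0"
  by (auto simp: complex_nonpos_Reals_iff)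

lemma hroot_nonzero: "hroot s \<noteq> 0"
  using hroot_sq[of s] by (auto simp: complex_eq_iff)

lemma Re_hroot: "Re (hroot s) \<ge> 0"
  unfolding hroot_def using csqrt_principal[of "of_real s - 2 * \<i>"] by linarith

lemma norm_hroot: "norm (hroot s) \<ge> 1" "\<bar>s\<bar> \<le> (norm (hroot s))\<^sup>2" "2 \<le> (norm (hroot s))\<^sup>2"
proof -
  have eq: "(norm (hroot s))\<^sup>2 = norm (of_real s - 2 * \<i>)"
    by (metis hroot_sq norm_mult power2_eq_square)
  show "\<bar>s\<bar> \<le> (norm (hroot s))\<^sup>2" "2 \<le> (norm (hroot s))\<^sup>2"
    unfolding eq using abs_Re_le_cmod[of "of_real s - 2 * \<i>"] abs_Im_le_cmod[of "of_real s - 2 * \<i>"] by simp_all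
  then show "norm (hroot s) \<ge> 1"
    using power2_le_imp_le[of 1 "norm (hroot s)"] by simp
qed

lemma hroot_deriv: "(hroot has_vector_derivative 1 / (2 * hroot s)) (at s)"
proof -
  have "((\<lambda>z. csqrt (z - 2 * \<i>)) has_field_derivative 1 / (2 * hroot s)) (at (of_real s))"
    unfolding hroot_def using hroot_nonpos by (auto intro!: derivative_eq_intros)
  from has_vector_derivative_real_field[OF this] show ?thesis
    unfolding hroot_def[abs_def] by simp
qed

lemma hroot_cont: "isCont hroot s"
  using hroot_deriv has_vector_derivative_continuous by blast

lemma hroot_measurable [measurable]: "hroot \<in> borel_measurable borel"
  by (intro borel_measurable_continuous_onI continuous_at_imp_continuous_on ballI hroot_cont)

lemma hker_measurable [measurable]: "hker \<in> borel_measurable borel"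
  unfolding hker_def[abs_def] by measurable

lemma norm_hker: "s > 0 \<Longrightarrow> norm (hker s) \<le> 1 * s powr (-1/2)"
proof -
  assume s: "s > 0"
  have "norm (hker s) = 1 / (sqrt s * norm (hroot s))"
    using s by (simp add: hker_def norm_divide norm_mult)
  also have "\<dots> \<le> 1 / (sqrt s * 1)" using s norm_hroot(1)[of s] by (intro divide_left_mono mult_left_mono mult_pos_pos) auto
  also have "\<dots> = 1 * s powr (-1/2)" using s by (simp add: powr_minus_divide powr_half_sqrt)
  finally show "norm (hker s) \<le> 1 * s powr (-1/2)" .
qed

lemma hker_cont: "s > 0 \<Longrightarrow> isCont hker s"
  unfolding hker_def[abs_def] using hroot_nonzero[of s] by (auto intro!: continuous_intros hroot_cont)

text \<open>Moments of the kernel, that is, up to sign the successive derivatives of its Laplace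
  transform. Each further moment decays by one more power of x.\<close>

definition hmom :: "nat \<Rightarrow> real \<Rightarrow> complex" where
  "hmom j = laplace (\<lambda>s. of_real s ^ j * hker s)"

lemma norm_hker_mom: "s > 0 \<Longrightarrow> norm (of_real s ^ j * hker s) \<le> 1 * s powr (real j - 1/2)"
proof -
  assume s: "s > 0"
  have "norm (of_real s ^ j * hker s) \<le> s powr real j * s powr (-1/2)"
    using mult_left_mono[OF norm_hker[OF s], of "s ^ j"] s by (simp add: norm_mult norm_power powr_realpow)
  then show ?thesis by (simp add: powr_add[symmetric])
qed

lemma hmom_measurable: "(\<lambda>s. of_real s ^ j * hker s) \<in> borel_measurable borel"
  by measurable

lemma hmom_integrable:
  "x > 0 \<Longrightarrow> set_integrable lborel {0<..} (\<lambda>s. of_real (exp (-(x * s))) * (of_real s ^ j * hker s))"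
  by (rule laplace_integrable[OF hmom_measurable norm_hker_mom]) auto

lemma hmom_deriv: "x > 0 \<Longrightarrow> (hmom j has_vector_derivative - hmom (Suc j) x) (at x)"
  using laplace_deriv[OF hmom_measurable norm_hker_mom, of j x] unfolding hmom_def
  by (simp add: mult.assoc)

lemma hmom_norm: "x > 0 \<Longrightarrow> norm (hmom j x) \<le> Gamma (real j + 1/2) * x powr (- (real j + 1/2))"
  using laplace_norm_le[OF hmom_measurable norm_hker_mom, of j x] unfolding hmom_def
  by (simp add: algebra_simps)


text \<open>Integration by parts with the primitive exp(-x s) sqrt(s (s - 2 i)), which vanishes at
  both ends; sqrt(s (s - 2 i)) has derivative (s - i) \<open>hker s\<close>. The result is Bessel's
  equation of order 0 after the factor exp(i x) has been split off.\<close>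

lemma hmom_by_parts:
  assumes x: "x > 0"
  shows "of_real x * (hmom 2 x - 2 * \<i> * hmom 1 x) = hmom 1 x - \<i> * hmom 0 x"
proof -
  define F where "F s = of_real (exp (-(x * s))) * (of_real (sqrt s) * hroot s)" for s
  define e where "e j s = of_real (exp (-(x * s))) * (of_real s ^ j * hker s)" for j s
  have int: "set_integrable lborel {0<..} (e j)" for j
    unfolding e_def by (rule hmom_integrable[OF x])
  have mom: "hmom j x = (LBINT s:{0<..}. e j s)" for j
    unfolding e_def hmom_def laplace_def ..
  define F' where "F' s = (e 1 s - \<i> * e 0 s) - of_real x * (e 2 s - 2 * \<i> * e 1 s)" for s
  have intF: "set_integrable lborel {0<..} F'"
    unfolding F'_def by (intro set_integral_diff(1) set_integrable_mult_right int)
  have "(LBINT s:{0<..}. F' s) = (hmom 1 x - \<i> * hmom 0 x) - of_real x * (hmom 2 x - 2 * \<i> * hmom 1 x)"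
    unfolding F'_def mom
    by (simp add: set_integral_diff set_integrable_mult_right int set_integral_mult_right)
  moreover have "(LBINT s:{0<..}. F' s) = 0 - 0"
  proof (rule half_line_FTC[OF _ _ intF])
    fix s :: real assume s: "s > 0"
    have d1: "((\<lambda>s. complex_of_real (exp (-(x * s)))) has_vector_derivative of_real (- x * exp (-(x * s)))) (at s)"
      by (intro has_vector_derivative_of_real)
        (auto simp: has_real_derivative_iff_has_vector_derivative[symmetric] intro!: derivative_eq_intros)
    have d2: "((\<lambda>s. complex_of_real (sqrt s)) has_vector_derivative of_real (1 / (2 * sqrt s))) (at s)"
      using s by (intro has_vector_derivative_of_real)
        (auto simp: has_real_derivative_iff_has_vector_derivative[symmetric] field_simps intro!: derivative_eq_intros)
    have "(F has_vector_derivative of_real (exp (-(x * s))) * (of_real (sqrt s) * (1 / (2 * hroot s)) + of_real (1 / (2 * sqrt s)) * hroot s)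
        + of_real (- x * exp (-(x * s))) * (of_real (sqrt s) * hroot s)) (at s)"
      unfolding F_def by (intro has_vector_derivative_mult d1 d2 hroot_deriv)
    also have "of_real (exp (-(x * s))) * (of_real (sqrt s) * (1 / (2 * hroot s)) + of_real (1 / (2 * sqrt s)) * hroot s)
        + of_real (- x * exp (-(x * s))) * (of_real (sqrt s) * hroot s) = F' s"
    proof -
      define r g E where "r = complex_of_real (sqrt s)" and "g = hroot s" and "E = complex_of_real (exp (-(x * s)))"
      have rr: "complex_of_real s = r * r" using s by (simp add: r_def flip: of_real_mult)
      have gg: "g * g = r * r - 2 * \<i>" unfolding g_def hroot_sq rr ..
      have nz: "r \<noteq> 0" "g \<noteq> 0" using s by (simp_all add: r_def g_def hroot_nonzero)
      define k where "k = 1 / (r * g)"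
      have ker: "hker s = k" by (simp add: hker_def r_def g_def k_def)
      have "r * (1 / (2 * g)) + 1 / (2 * r) * g = (r * r + g * g) / 2 * k"
        using nz by (simp add: k_def field_simps)
      then have A: "r * (1 / (2 * g)) + 1 / (2 * r) * g = (r * r - \<i>) * k"
        unfolding gg by (simp add: algebra_simps diff_divide_distrib)
      have B: "r * g = (r * r) * (r * r - 2 * \<i>) * k"
        unfolding gg[symmetric] using nz by (simp add: k_def)
      have "F' s = E * ((r * r - \<i>) * k) - of_real x * (E * ((r * r) * (r * r - 2 * \<i>) * k))"
        unfolding F'_def e_def ker rr E_def[symmetric]
        by (simp only: power2_eq_square power_one_right power_0) (simp only: algebra_simps mult_1_left)
      also have "\<dots> = E * (r * (1 / (2 * g)) + 1 / (2 * r) * g) - of_real x * (E * (r * g))"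
        unfolding A[symmetric] B[symmetric] ..
      also have "\<dots> = of_real (exp (-(x * s))) * (of_real (sqrt s) * (1 / (2 * hroot s)) + of_real (1 / (2 * sqrt s)) * hroot s)
        + of_real (- x * exp (-(x * s))) * (of_real (sqrt s) * hroot s)"
        by (simp add: E_def r_def g_def)
      finally show ?thesis by (rule sym)
    qed
    finally show "(F has_vector_derivative F' s) (at s)" .
    show "isCont F' s"
      unfolding F'_def e_def using hker_cont[OF s] by (intro continuous_intros)
  next
    have "(F \<longlongrightarrow> of_real (exp (-(x * 0))) * (of_real (sqrt 0) * hroot 0)) (at_right 0)"
      unfolding F_def by (intro tendsto_intros isCont_tendsto_compose[OF hroot_cont]) 
    then show "(F \<longlongrightarrow> 0) (at_right 0)" by simp
  next
    have lim: "((\<lambda>s. exp (-(x * s)) * (sqrt s * (sqrt s + 2))) \<longlongrightarrow> 0) at_top"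
      using x by real_asymp
    show "(F \<longlongrightarrow> 0) at_top"
    proof (rule Lim_null_comparison[OF _ lim])
      show "\<forall>\<^sub>F s in at_top. norm (F s) \<le> exp (-(x * s)) * (sqrt s * (sqrt s + 2))"
        using eventually_ge_at_top[of 0]
      proof eventually_elim
        case (elim s)
        have "(norm (hroot s))\<^sup>2 = norm (of_real s - 2 * \<i>)"
          by (metis hroot_sq norm_mult power2_eq_square)
        also have "\<dots> \<le> s + 2" using norm_triangle_ineq4[of "of_real s" "2 * \<i>"] elim by (simp add: norm_mult)
        also have "\<dots> \<le> (sqrt s + 2)\<^sup>2" using elim by (simp add: power2_sum)
        finally have "norm (hroot s) \<le> sqrt s + 2"
          using elim by (intro power2_le_imp_le[of "norm (hroot s)"]) auto
        then show ?case unfolding F_def norm_mult using elim by (intro mult_mono) auto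
      qed
    qed
  qed
  ultimately show ?thesis by simp
qed


section \<open>Logarithmic behaviour of the Laplace integral at the origin\<close>

lemma abs_ln_le: "s > 0 \<Longrightarrow> \<bar>ln s\<bar> \<le> 2 * s powr (1/2) + 2 * s powr (-1/2)" for s :: real
proof -
  assume s: "s > 0"
  have 1: "ln s = 2 * ln (sqrt s)" using s by (simp add: ln_sqrt)
  have 2: "ln (sqrt s) \<le> sqrt s - 1" using s by (intro ln_le_minus_one) simp
  have "ln (1 / sqrt s) \<le> 1 / sqrt s - 1" using s by (intro ln_le_minus_one) simp
  then have 3: "- ln (sqrt s) \<le> 1 / sqrt s - 1" using s by (simp add: ln_div)
  have "sqrt s \<ge> 0" "1 / sqrt s \<ge> 0" using s by auto
  with 1 2 3 have "\<bar>ln s\<bar> \<le> 2 * sqrt s + 2 * (1 / sqrt s)" by linarith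
  then show ?thesis using s by (simp add: powr_half_sqrt powr_minus_divide)
qed

lemma ln_laplace_integrable:
  fixes x :: real
  assumes x: "x > 0"
  shows "set_integrable lborel {0<..} (\<lambda>s. exp (-(x * s)) * ln s)"
proof (rule set_integrable_bound)
  show "set_integrable lborel {0<..} (\<lambda>s. 2 * (exp (-(x * s)) * s powr (1/2)) + 2 * (exp (-(x * s)) * s powr (-1/2)))"
    by (intro set_integral_add(1) set_integrable_mult_right exp_powr_set_integrable) (use x in auto)
  show "set_borel_measurable lborel {0<..} (\<lambda>s. exp (-(x * s)) * ln s)"
    unfolding set_borel_measurable_def by measurable
  show "AE s in lborel. s \<in> {0<..} \<longrightarrow> norm (exp (-(x * s)) * ln s) \<le>
      norm (2 * (exp (-(x * s)) * s powr (1/2)) + 2 * (exp (-(x * s)) * s powr (-1/2)))"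
  proof (intro AE_I2 impI)
    fix s :: real assume "s \<in> {0<..}"
    then have "exp (-(x * s)) * \<bar>ln s\<bar> \<le> exp (-(x * s)) * (2 * s powr (1/2) + 2 * s powr (-1/2))"
      by (intro mult_left_mono abs_ln_le) auto
    then show "norm (exp (-(x * s)) * ln s) \<le>
      norm (2 * (exp (-(x * s)) * s powr (1/2)) + 2 * (exp (-(x * s)) * s powr (-1/2)))"
      by (simp add: abs_mult distrib_left mult.left_commute)
  qed
qed

text \<open>The convexity bound \<open>\<delta> ln s \<le> s\<^sup>\<delta> - 1\<close> turns into an inequality between two functions of \<open>\<delta>\<close> that
  touch at \<open>\<delta> = 0\<close>, so their derivatives agree there.\<close>

lemma ln_laplace:
  fixes x :: real
  assumes x: "x > 0"
  shows "x * (LBINT s:{0<..}. exp (-(x * s)) * ln s) = - euler_mascheroni - ln x"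
proof -
  define L where "L = x * (LBINT s:{0<..}. exp (-(x * s)) * ln s)"
  define K where "K \<delta> = Gamma (\<delta> + 1) * x powr (-\<delta>) - 1 - \<delta> * L" for \<delta>
  have K: "K \<delta> \<ge> 0" if \<delta>: "\<bar>\<delta>\<bar> < 1" for \<delta>
  proof -
    have "(LBINT s:{0<..}. \<delta> * (exp (-(x * s)) * ln s)) \<le> (LBINT s:{0<..}. exp (-(x * s)) * s powr \<delta> - exp (-(x * s)) * s powr 0)"
    proof (rule set_integral_mono)
      show "set_integrable lborel {0<..} (\<lambda>s. \<delta> * (exp (-(x * s)) * ln s))"
        by (intro set_integrable_mult_right ln_laplace_integrable x)
      show "set_integrable lborel {0<..} (\<lambda>s. exp (-(x * s)) * s powr \<delta> - exp (-(x * s)) * s powr 0)"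
        by (intro set_integral_diff(1) exp_powr_set_integrable) (use x \<delta> in auto)
      fix s :: real assume s: "s \<in> {0<..}"
      have "\<delta> * ln s \<le> s powr \<delta> - s powr 0"
        using ln_le_minus_one[of "s powr \<delta>"] s by (simp add: ln_powr)
      then have "exp (-(x * s)) * (\<delta> * ln s) \<le> exp (-(x * s)) * (s powr \<delta> - s powr 0)"
        by (intro mult_left_mono) auto
      then show "\<delta> * (exp (-(x * s)) * ln s) \<le> exp (-(x * s)) * s powr \<delta> - exp (-(x * s)) * s powr 0"
        by (simp only: right_diff_distrib mult_ac)
    qed
    also have "\<dots> = Gamma (\<delta> + 1) * x powr (-(\<delta> + 1)) - 1 / x"
    proof -
      have \<delta>': "\<delta> > -1" using \<delta> by simp
      have "(LBINT s:{0<..}. exp (-(x * s)) * s powr 0) = 1 / x"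
        using exp_powr_set_integral[OF x, of 0] x by (simp add: powr_minus_divide)
      then show ?thesis
        using set_integral_diff(2)[OF exp_powr_set_integrable[OF x \<delta>'] exp_powr_set_integrable[OF x, of 0]]
          exp_powr_set_integral[OF x \<delta>'] by simp
    qed
    finally have "\<delta> * (LBINT s:{0<..}. exp (-(x * s)) * ln s) \<le> Gamma (\<delta> + 1) * x powr (-(\<delta> + 1)) - 1 / x"
      by simp
    from mult_left_mono[OF this, of x] x
    have "\<delta> * L \<le> Gamma (\<delta> + 1) * (x * x powr (-(\<delta> + 1))) - 1"
      unfolding L_def by (simp add: algebra_simps)
    also have "x * x powr (-(\<delta> + 1)) = x powr (-\<delta>)"
      using x powr_add[of x 1 "-(\<delta> + 1)"] by simp
    finally show ?thesis unfolding K_def by simp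
  qed
  have "(K has_real_derivative ((- euler_mascheroni) * x powr (-0) + Gamma 1 * (- ln x * x powr (-0)) - L)) (at 0)"
  proof -
    have G1: "(Gamma has_real_derivative Gamma 1 * Digamma 1) (at (0 + 1))"
      using has_field_derivative_Gamma[of "1::real" UNIV] by simp
    have G: "((\<lambda>\<delta>. Gamma (\<delta> + 1)) has_real_derivative - euler_mascheroni) (at 0)"
      using DERIV_shift[THEN iffD1, OF G1] by simp
    have P: "((\<lambda>\<delta>. x powr (-\<delta>)) has_real_derivative - ln x * x powr (-0)) (at 0)"
      using x by (auto intro!: derivative_eq_intros)
    show ?thesis unfolding K_def
      using DERIV_diff[OF DERIV_diff[OF DERIV_mult[OF G P] DERIV_const[of 1]] DERIV_cmult_right[OF DERIV_ident, where c = L]]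
      by (simp add: algebra_simps)
  qed
  moreover have "K 0 \<le> K y" if "\<bar>0 - y\<bar> < 1" for y
    using K[of y] that x by (simp add: K_def)
  ultimately have "(- euler_mascheroni) * x powr (-0) + Gamma 1 * (- ln x * x powr (-0)) - L = 0"
    by (intro DERIV_local_min[of K _ 0 1]) auto
  then show ?thesis unfolding L_def[symmetric] using x by simp
qed

text \<open>A primitive of \<open>hker\<close> / 2. Integrating by parts against it trades the
  kernel for a logarithm, whose Laplace transform is known in closed form.\<close>

definition hprim :: "real \<Rightarrow> complex" where "hprim s = Ln (of_real (sqrt s) + hroot s)"

text \<open>What is left of \<open>hprim\<close> after removing ln (2 sqrt s), its form for large s.
  Being at most 2 s^(-1/2), it has a Laplace transform of order x^(-1/2), which disappears at the
  origin after multiplication by x.\<close>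

definition hrem :: "real \<Rightarrow> complex" where
  "hrem s = indicator {0<..} s *\<^sub>R (hprim s - of_real (ln s / 2 + ln 2))"

lemma hroot_0: "hroot 0 = 1 - \<i>"
  unfolding hroot_def by (rule csqrt_unique) (simp_all add: power2_eq_square complex_eq_iff)

lemma Ln_one_minus_i: "Ln (1 - \<i>) = of_real (ln 2 / 2) - \<i> * of_real (pi / 4)"
proof -
  have "exp (ln 2 / 2) = exp (ln (sqrt (2::real)))" by (subst ln_sqrt) simp_all
  then have "exp (ln 2 / 2) = sqrt (2::real)" by simp
  then have "exp (of_real (ln 2 / 2) - \<i> * of_real (pi / 4)) = 1 - \<i>"
    by (simp add: complex_eq_iff Re_exp Im_exp cos_45 sin_45)
  then have "Ln (1 - \<i>) = Ln (exp (of_real (ln 2 / 2) - \<i> * of_real (pi / 4)))" by simp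
  also have "\<dots> = of_real (ln 2 / 2) - \<i> * of_real (pi / 4)"
    by (rule Ln_exp; simp; use pi_gt_zero in linarith)
  finally show ?thesis .
qed

text \<open>Adding a nonnegative real to a number in the closed right half-plane neither lowers its
  modulus nor moves it onto the cut of the logarithm. At s = 0 nothing is added, and
  \<open>hroot 0\<close> = 1 - i is checked directly.\<close>

lemma sqrt_plus_hroot:
  assumes "s \<ge> 0"
  shows "of_real (sqrt s) + hroot s \<notin> \<real>\<^sub>\<le>\<^sub>0" "norm (of_real (sqrt s) + hroot s) \<ge> 1"
    "norm (of_real (sqrt s) + hroot s) \<ge> sqrt s"
proof -
  have re: "Re (of_real (sqrt s) + hroot s) \<ge> sqrt s" using Re_hroot[of s] by simp
  then show "norm (of_real (sqrt s) + hroot s) \<ge> sqrt s"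
    using complex_Re_le_cmod order_trans by blast
  show "of_real (sqrt s) + hroot s \<notin> \<real>\<^sub>\<le>\<^sub>0"
  proof (cases "s = 0")
    case True then show ?thesis by (simp add: hroot_0 complex_nonpos_Reals_iff)
  next
    case False
    then have "sqrt s > 0" using assms by simp
    with re have "Re (of_real (sqrt s) + hroot s) > 0" by linarith
    then show ?thesis by (auto simp: complex_nonpos_Reals_iff)
  qed
  have "norm (hroot s) \<le> norm (of_real (sqrt s) + hroot s)"
  proof -
    have "(Re (hroot s))\<^sup>2 \<le> (sqrt s + Re (hroot s))\<^sup>2"
      using Re_hroot[of s] assms by (intro power_mono) auto
    then show ?thesis unfolding norm_complex_def by simp
  qed
  with norm_hroot(1)[of s] show "norm (of_real (sqrt s) + hroot s) \<ge> 1" by linarith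
qed

lemma hprim_cont: "s \<ge> 0 \<Longrightarrow> isCont hprim s"
  unfolding hprim_def[abs_def] using sqrt_plus_hroot(1)[of s]
  by (intro continuous_intros hroot_cont isCont_Ln') auto

lemma hprim_deriv:
  assumes s: "s > 0"
  shows "(hprim has_vector_derivative hker s / 2) (at s)"
proof -
  have d2: "((\<lambda>s. complex_of_real (sqrt s)) has_vector_derivative of_real (1 / (2 * sqrt s))) (at s)"
    using s by (intro has_vector_derivative_of_real)
      (auto simp: has_real_derivative_iff_has_vector_derivative[symmetric] field_simps intro!: derivative_eq_intros)
  have d: "((\<lambda>s. of_real (sqrt s) + hroot s) has_vector_derivative of_real (1 / (2 * sqrt s)) + 1 / (2 * hroot s)) (at s)"
    by (intro has_vector_derivative_add d2 hroot_deriv)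
  have n: "of_real (sqrt s) + hroot s \<notin> \<real>\<^sub>\<le>\<^sub>0" using sqrt_plus_hroot s by simp
  have nz: "of_real (sqrt s) + hroot s \<noteq> 0" using n by auto
  have "((\<lambda>s. Ln (of_real (sqrt s) + hroot s)) has_vector_derivative
      (of_real (1 / (2 * sqrt s)) + 1 / (2 * hroot s)) * inverse (of_real (sqrt s) + hroot s)) (at s)"
    using field_vector_diff_chain_at[OF d has_field_derivative_Ln[OF n]] by (simp add: o_def)
  moreover have "(of_real (1 / (2 * sqrt s)) + 1 / (2 * hroot s)) * inverse (of_real (sqrt s) + hroot s) = hker s / 2"
  proof -
    define r g where "r = complex_of_real (sqrt s)" and "g = hroot s"
    have z: "r \<noteq> 0" "g \<noteq> 0" "r + g \<noteq> 0" using s nz by (auto simp: r_def g_def hroot_nonzero)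
    have "(1 / (2 * r) + 1 / (2 * g)) * inverse (r + g) = 1 / (r * g) / 2"
      using z by (simp add: field_simps)
    then show ?thesis unfolding hker_def r_def g_def by (simp only: of_real_divide of_real_mult of_real_1 of_real_numeral)
  qed
  ultimately show ?thesis unfolding hprim_def[abs_def] by (simp only:)
qed

lemma hroot_minus_sqrt:
  assumes s: "s \<ge> 0"
  shows "hroot s - of_real (sqrt s) = - 2 * \<i> / (of_real (sqrt s) + hroot s)"
proof -
  have nz: "of_real (sqrt s) + hroot s \<noteq> 0" using sqrt_plus_hroot(2)[OF s] by auto
  have rr: "complex_of_real s = of_real (sqrt s) * of_real (sqrt s)" using s by (simp flip: of_real_mult)
  have "(hroot s - of_real (sqrt s)) * (of_real (sqrt s) + hroot s) = hroot s * hroot s - of_real (sqrt s) * of_real (sqrt s)"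
    by (simp add: algebra_simps)
  also have "\<dots> = - 2 * \<i>" unfolding hroot_sq rr by simp
  finally show ?thesis using nz by (simp add: field_simps)
qed

text \<open>The factor 2 sqrt s is pulled out of the logarithm. What remains tends to 1, because
  \<open>hroot s\<close> - sqrt s = -2 i / (sqrt s + \<open>hroot s\<close>) is bounded.\<close>

lemma hprim_limit: "((\<lambda>s. hprim s - of_real (ln s / 2 + ln 2)) \<longlongrightarrow> 0) at_top"
proof -
  have "((\<lambda>s. (hroot s - of_real (sqrt s)) / of_real (2 * sqrt s)) \<longlongrightarrow> 0) at_top"
  proof (rule Lim_null_comparison)
    show "\<forall>\<^sub>F s in at_top. norm ((hroot s - of_real (sqrt s)) / of_real (2 * sqrt s)) \<le> 1 / sqrt s"
      using eventually_gt_at_top[of 0]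
    proof eventually_elim
      case (elim s)
      have "norm (hroot s - of_real (sqrt s)) \<le> 2 / 1"
        unfolding hroot_minus_sqrt[OF less_imp_le[OF elim]] norm_divide
        using sqrt_plus_hroot(2)[of s] elim by (intro frac_le) (auto simp: norm_mult)
      then have "norm (hroot s - of_real (sqrt s)) / (2 * sqrt s) \<le> 2 / (2 * sqrt s)"
        using elim by (intro divide_right_mono) auto
      then show ?case using elim by (simp add: norm_divide norm_mult)
    qed
    show "((\<lambda>s::real. 1 / sqrt s) \<longlongrightarrow> 0) at_top" by real_asymp
  qed
  then have "((\<lambda>s. Ln (1 + (hroot s - of_real (sqrt s)) / of_real (2 * sqrt s))) \<longlongrightarrow> Ln (1 + 0)) at_top"
    by (intro tendsto_intros) auto
  moreover have "\<forall>\<^sub>F s in at_top. Ln (1 + (hroot s - of_real (sqrt s)) / of_real (2 * sqrt s)) = hprim s - of_real (ln s / 2 + ln 2)"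
    using eventually_gt_at_top[of 0]
  proof eventually_elim
    case (elim s)
    define w where "w = 1 + (hroot s - of_real (sqrt s)) / of_real (2 * sqrt s)"
    have eq: "of_real (sqrt s) + hroot s = of_real (2 * sqrt s) * w"
      using elim by (simp add: w_def field_simps)
    have "w \<noteq> 0" using eq sqrt_plus_hroot(2)[of s] elim by auto
    then have "hprim s = of_real (ln (2 * sqrt s)) + Ln w"
      unfolding hprim_def eq using elim Ln_of_real[of "2 * sqrt s"] by (subst Ln_times_of_real) auto
    also have "ln (2 * sqrt s) = ln s / 2 + ln 2" using elim by (simp add: ln_mult ln_sqrt)
    finally show ?case by (simp add: w_def)
  qed
  ultimately show ?thesis by (auto elim: Lim_transform_eventually)
qed

lemma hprim_rem_deriv:
  assumes s: "s > 0"
  shows "((\<lambda>s. hprim s - of_real (ln s / 2 + ln 2)) has_vector_derivative (hker s / 2 - of_real (1 / (2 * s)))) (at s)"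
    and "norm (hker s / 2 - of_real (1 / (2 * s))) \<le> s powr (-3/2)"
proof -
  have "((\<lambda>s. complex_of_real (ln s / 2 + ln 2)) has_vector_derivative of_real (1 / (2 * s))) (at s)"
    using s by (intro has_vector_derivative_of_real)
      (auto simp: has_real_derivative_iff_has_vector_derivative[symmetric] intro!: derivative_eq_intros)
  then show "((\<lambda>s. hprim s - of_real (ln s / 2 + ln 2)) has_vector_derivative (hker s / 2 - of_real (1 / (2 * s)))) (at s)"
    by (intro has_vector_derivative_diff hprim_deriv s)
  define r g where "r = complex_of_real (sqrt s)" and "g = hroot s"
  have rr: "complex_of_real s = r * r" using s by (simp add: r_def flip: of_real_mult)
  have nz: "r \<noteq> 0" "g \<noteq> 0" "r + g \<noteq> 0"
    using s hroot_nonzero sqrt_plus_hroot(2)[of s] by (auto simp: r_def g_def)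
  have "hker s / 2 - of_real (1 / (2 * s)) = - (g - r) / (2 * (r * r) * g)"
    unfolding hker_def using nz by (simp add: rr r_def[symmetric] g_def[symmetric] field_simps)
  also have "\<dots> = \<i> / ((r * r) * g * (r + g))"
  proof -
    have gr: "g - r = - 2 * \<i> / (r + g)"
      using hroot_minus_sqrt[of s] s unfolding r_def[symmetric] g_def[symmetric] by simp
    show ?thesis unfolding gr using nz by (simp add: divide_simps)
  qed
  also have "norm \<dots> = 1 / (s * norm g * norm (r + g))"
    unfolding rr[symmetric] using s by (simp add: norm_divide norm_mult)
  also have "\<dots> \<le> 1 / (s * 1 * sqrt s)"
    using norm_hroot(1)[of s] sqrt_plus_hroot(3)[of s] s nz unfolding g_def r_def
    by (intro divide_left_mono mult_mono mult_pos_pos) auto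
  also have "\<dots> = s powr (-3/2)"
  proof -
    have "s * sqrt s = s powr (1 + 1/2)" using s unfolding powr_add by (simp add: powr_half_sqrt)
    then show ?thesis using s by (simp add: powr_minus_divide)
  qed
  finally show "norm (hker s / 2 - of_real (1 / (2 * s))) \<le> s powr (-3/2)" .
qed

text \<open>The derivative is bounded by t^(-3/2), whose integral over (s, T) is below 2 s^(-1/2),
  and the remainder vanishes as T grows.\<close>

lemma hrem_bound:
  assumes s: "s > 0"
  shows "norm (hrem s) \<le> 2 * s powr (-1/2)"
proof -
  define E where "E s = hprim s - of_real (ln s / 2 + ln 2)" for s
  have "norm (E T - E s) \<le> 2 * s powr (-1/2)" if T: "T > s" for T
  proof -
    have "norm (E T - E s) \<le> (- 2 * T powr (-1/2)) - (- 2 * s powr (-1/2))"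
    proof (rule differentiable_bound_general[OF T])
      show "continuous_on {s..T} E"
        unfolding E_def using s
        by (intro continuous_intros continuous_at_imp_continuous_on ballI hprim_cont) auto
      show "continuous_on {s..T} (\<lambda>s. - 2 * s powr (-1/2))"
        using s by (intro continuous_intros) auto
      fix t assume t: "s < t" "t < T"
      then have t0: "t > 0" using s by simp
      show "(E has_vector_derivative (hker t / 2 - of_real (1 / (2 * t)))) (at t)"
        unfolding E_def by (rule hprim_rem_deriv(1)[OF t0])
      show "norm (hker t / 2 - of_real (1 / (2 * t))) \<le> t powr (-3/2)"
        by (rule hprim_rem_deriv(2)[OF t0])
      show "((\<lambda>s. - 2 * s powr (-1/2)) has_vector_derivative t powr (-3/2)) (at t)"
        unfolding has_real_derivative_iff_has_vector_derivative[symmetric]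
        using t0 by (auto intro!: derivative_eq_intros simp: powr_diff field_simps)
    qed
    moreover have "T powr (-1/2) \<ge> 0" by simp
    ultimately show ?thesis by linarith
  qed
  then have "\<forall>\<^sub>F T in at_top. norm (E T - E s) \<le> 2 * s powr (-1/2)"
    using eventually_gt_at_top[of s] by (rule eventually_mono[rotated]) 
  moreover have "((\<lambda>T. norm (E T - E s)) \<longlongrightarrow> norm (0 - E s)) at_top"
    unfolding E_def by (intro tendsto_intros hprim_limit)
  ultimately have "norm (0 - E s) \<le> 2 * s powr (-1/2)"
    by (intro tendsto_upperbound[where F = at_top]) auto
  then show ?thesis using s by (simp add: hrem_def E_def norm_minus_commute)
qed


lemma hrem_measurable [measurable]: "hrem \<in> borel_measurable borel"
  unfolding hrem_def[abs_def]
proof (rule borel_measurable_continuous_on_indicator)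
  show "continuous_on {0<..} (\<lambda>s. hprim s - of_real (ln s / 2 + ln 2))"
    by (intro continuous_intros continuous_at_imp_continuous_on ballI hprim_cont) auto
qed simp

text \<open>Equal to 2 ln 2 - 2 Ln (1 - i), the constant that arises when the primitive is
  normalised to vanish at s = 0. Its imaginary part produces the J_0 component of the Hankel
  function.\<close>

definition hconst :: complex where "hconst = of_real (ln 2) + \<i> * of_real (pi / 2)"

lemma set_integrable_of_real:
  assumes "set_integrable M A f"
  shows "set_integrable M A (\<lambda>x. complex_of_real (f x))"
  using integrable_of_real[OF assms[unfolded set_integrable_def], where 'a = complex]
  unfolding set_integrable_def by (simp add: scaleR_conv_of_real)

text \<open>Integration by parts against the normalised primitive leaves x times a Laplace transform
  that splits into those of ln s, of the constant \<open>hconst\<close> and of the remainder; the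
  first is evaluated by \<open>ln_laplace\<close>.\<close>

lemma hmom_0_eq:
  assumes x: "x > 0"
  shows "hmom 0 x = of_real (- euler_mascheroni - ln x) + hconst + 2 * of_real x * laplace hrem x"
proof -
  \<comment> \<open>\<open>hprim 0\<close> is Ln (1 - i), so this primitive of \<open>hker\<close>
    vanishes at 0 and there is no boundary term.\<close>
  define \<Phi> where "\<Phi> s = 2 * hprim s - 2 * Ln (1 - \<i>)" for s
  define G where "G s = complex_of_real (exp (-(x * s)) * ln s) + hconst * of_real (exp (-(x * s)) * s powr 0)
    + 2 * (of_real (exp (-(x * s))) * hrem s)" for s
  have \<Phi>: "of_real (exp (-(x * s))) * \<Phi> s = G s" if "s > 0" for s
    using that unfolding \<Phi>_def G_def hrem_def Ln_one_minus_i hconst_def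
    by (simp add: algebra_simps)
  have i1: "set_integrable lborel {0<..} (\<lambda>s. complex_of_real (exp (-(x * s)) * ln s))"
    "set_integrable lborel {0<..} (\<lambda>s. complex_of_real (exp (-(x * s)) * s powr 0))"
    by (intro set_integrable_of_real ln_laplace_integrable exp_powr_set_integrable x; simp)+
  have i2: "set_integrable lborel {0<..} (\<lambda>s. of_real (exp (-(x * s))) * hrem s)"
    by (rule laplace_integrable[OF hrem_measurable hrem_bound]) (use x in auto)
  have iG: "set_integrable lborel {0<..} G"
    unfolding G_def by (intro set_integral_add(1) set_integrable_mult_right i1 i2)
  have "(LBINT s:{0<..}. G s) = of_real (LBINT s:{0<..}. exp (-(x * s)) * ln s) + hconst * of_real (LBINT s:{0<..}. exp (-(x * s)) * s powr 0)
    + 2 * laplace hrem x"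
    unfolding G_def laplace_def
    by (simp add: set_integral_add set_integrable_mult_right i1[simplified] i1 i2 set_integral_mult_right
        set_integral_complex_of_real[symmetric])
  also have "(LBINT s:{0<..}. exp (-(x * s)) * s powr 0) = 1 / x"
    using exp_powr_set_integral[OF x, of 0] x by (simp add: powr_minus_divide)
  finally have IG: "of_real x * (LBINT s:{0<..}. G s) =
      of_real (x * (LBINT s:{0<..}. exp (-(x * s)) * ln s)) + hconst + 2 * of_real x * laplace hrem x"
    using x by (simp add: algebra_simps)
  have im: "set_integrable lborel {0<..} (\<lambda>s. of_real (exp (-(x * s))) * hker s)"
    using hmom_integrable[OF x, of 0] by simp
  define F' where "F' s = of_real (exp (-(x * s))) * hker s - of_real x * G s" for s
  have iF: "set_integrable lborel {0<..} F'"
    unfolding F'_def by (intro set_integral_diff(1) set_integrable_mult_right im iG)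
  have "(LBINT s:{0<..}. F' s) = hmom 0 x - of_real x * (LBINT s:{0<..}. G s)"
    unfolding F'_def hmom_def laplace_def
    by (simp add: set_integral_diff set_integrable_mult_right im iG set_integral_mult_right)
  moreover have "(LBINT s:{0<..}. F' s) = 0 - 0"
  proof (rule half_line_FTC[where F = "\<lambda>s. of_real (exp (-(x * s))) * \<Phi> s", OF _ _ iF])
    fix s :: real assume s: "s > 0"
    have d1: "((\<lambda>s. complex_of_real (exp (-(x * s)))) has_vector_derivative of_real (- x * exp (-(x * s)))) (at s)"
      by (intro has_vector_derivative_of_real)
        (auto simp: has_real_derivative_iff_has_vector_derivative[symmetric] intro!: derivative_eq_intros)
    have d2: "(\<Phi> has_vector_derivative hker s) (at s)"
      unfolding \<Phi>_def
      using has_vector_derivative_diff[OF has_vector_derivative_mult_right[OF hprim_deriv[OF s], of 2] has_vector_derivative_const]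
      by simp
    show "((\<lambda>s. of_real (exp (-(x * s))) * \<Phi> s) has_vector_derivative F' s) (at s)"
      using has_vector_derivative_mult[OF d1 d2] unfolding F'_def \<Phi>[OF s, symmetric]
      by (simp add: algebra_simps)
    have cont: "isCont (\<lambda>s. of_real (exp (-(x * s))) * hker s - of_real x * (of_real (exp (-(x * s))) * \<Phi> s)) s"
      unfolding \<Phi>_def using hker_cont[OF s] hprim_cont[of s] s by (intro continuous_intros) auto
    have ev: "\<forall>\<^sub>F t in nhds s. F' t = of_real (exp (-(x * t))) * hker t - of_real x * (of_real (exp (-(x * t))) * \<Phi> t)"
    proof -
      have "\<forall>\<^sub>F t in nhds s. t \<in> {0<..}" using eventually_nhds_in_open[of "{0<..}" s] s by simp
      then show ?thesis
        by eventually_elim (simp only: F'_def \<Phi> greaterThan_iff)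
    qed
    show "isCont F' s"
      by (subst isCont_cong[OF ev]) (fact cont)
  next
    have "isCont (\<lambda>s. of_real (exp (-(x * s))) * \<Phi> s) 0"
      unfolding \<Phi>_def using hprim_cont[of 0] by (intro continuous_intros) auto
    then have "((\<lambda>s. of_real (exp (-(x * s))) * \<Phi> s) \<longlongrightarrow> of_real (exp (-(x * 0))) * \<Phi> 0) (at_right 0)"
      unfolding isCont_def by (rule filterlim_mono) (auto simp: at_le)
    then show "((\<lambda>s. of_real (exp (-(x * s))) * \<Phi> s) \<longlongrightarrow> 0) (at_right 0)"
      by (simp add: \<Phi>_def hprim_def hroot_0)
  next
    have lim: "((\<lambda>s. exp (-(x * s)) * (\<bar>ln s\<bar> + cmod hconst + 4 * s powr (-1/2))) \<longlongrightarrow> 0) at_top"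
    proof -
      have "((\<lambda>s. exp (-(x * s)) * (\<bar>ln s\<bar> + C + 4 * s powr (-1/2))) \<longlongrightarrow> 0) at_top" for C :: real
        using x by real_asymp
      then show ?thesis .
    qed
    show "((\<lambda>s. of_real (exp (-(x * s))) * \<Phi> s) \<longlongrightarrow> 0) at_top"
    proof (rule Lim_null_comparison[OF _ lim])
      show "\<forall>\<^sub>F s in at_top. norm (of_real (exp (-(x * s))) * \<Phi> s) \<le> exp (-(x * s)) * (\<bar>ln s\<bar> + cmod hconst + 4 * s powr (-1/2))"
        using eventually_gt_at_top[of 0]
      proof eventually_elim
        case (elim s)
        have "\<Phi> s = of_real (ln s) + hconst + 2 * hrem s"
          using elim unfolding \<Phi>_def hrem_def Ln_one_minus_i hconst_def by (simp add: algebra_simps)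
        then have "norm (\<Phi> s) \<le> \<bar>ln s\<bar> + cmod hconst + norm (2 * hrem s)"
          by (metis add_mono norm_triangle_ineq norm_triangle_mono order_refl norm_of_real)
        also have "norm (2 * hrem s) \<le> 4 * s powr (-1/2)"
          using hrem_bound[OF elim] by (simp add: norm_mult)
        finally have "norm (\<Phi> s) \<le> \<bar>ln s\<bar> + cmod hconst + 4 * s powr (-1/2)" by simp
        then show ?case by (simp add: norm_mult)
      qed
    qed
  qed
  ultimately have "hmom 0 x = of_real x * (LBINT s:{0<..}. G s)" by simp
  then show ?thesis unfolding IG ln_laplace[OF x] .
qed


section \<open>Identification of the Laplace integral with the Hankel function\<close>

definition hout :: "real \<Rightarrow> complex" where "hout x = exp (\<i> * of_real x) * hmom 0 x"

definition hout_Euler :: "real \<Rightarrow> complex" where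
  "hout_Euler x = of_real x * (exp (\<i> * of_real x) * (\<i> * hmom 0 x - hmom 1 x))"

lemma exp_ii_deriv: "((\<lambda>x. exp (\<i> * of_real x)) has_vector_derivative \<i> * exp (\<i> * of_real x)) (at x)"
proof -
  have "((\<lambda>z. exp (\<i> * z)) has_field_derivative \<i> * exp (\<i> * of_real x)) (at (of_real x))"
    by (auto intro!: derivative_eq_intros)
  from has_vector_derivative_real_field[OF this] show ?thesis by simp
qed

lemma hout_Euler_div:
  "x > 0 \<Longrightarrow> hout_Euler x / of_real x = exp (\<i> * of_real x) * (\<i> * hmom 0 x - hmom 1 x)"
  unfolding hout_Euler_def by simp

lemma hout_deriv:
  assumes "x > 0"
  shows "(hout has_vector_derivative hout_Euler x / of_real x) (at x)"
proof -
  have "hout_Euler x / of_real x = exp (\<i> * of_real x) * (- hmom 1 x) + \<i> * exp (\<i> * of_real x) * hmom 0 x"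
    unfolding hout_Euler_div[OF assms] by (simp add: algebra_simps)
  then show ?thesis
    using has_vector_derivative_mult[OF exp_ii_deriv hmom_deriv[OF assms, of 0]]
    unfolding hout_def[abs_def] by simp
qed

text \<open>Bessel's equation (x u')' = - x u of order 0: the second moment is eliminated by
  \<open>hmom_by_parts\<close>.\<close>

lemma hout_Euler_deriv:
  assumes x: "x > 0"
  shows "(hout_Euler has_vector_derivative - of_real x * hout x) (at x)"
proof -
  have 1: "((\<lambda>x. \<i> * hmom 0 x - hmom 1 x) has_vector_derivative \<i> * (- hmom 1 x) - (- hmom 2 x)) (at x)"
    using hmom_deriv[OF x, of 0] hmom_deriv[OF x, of 1]
    by (intro has_vector_derivative_diff has_vector_derivative_mult_right) (simp_all add: numeral_2_eq_2)
  have 2: "(complex_of_real has_vector_derivative 1) (at x)"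
    using has_vector_derivative_of_real[OF DERIV_ident] by simp
  have "(hout_Euler has_vector_derivative
      of_real x * (exp (\<i> * of_real x) * (\<i> * (- hmom 1 x) - (- hmom 2 x)) + \<i> * exp (\<i> * of_real x) * (\<i> * hmom 0 x - hmom 1 x))
      + 1 * (exp (\<i> * of_real x) * (\<i> * hmom 0 x - hmom 1 x))) (at x)"
    unfolding hout_Euler_def[abs_def]
    by (intro has_vector_derivative_mult 1 2 exp_ii_deriv)
  also have "of_real x * (exp (\<i> * of_real x) * (\<i> * (- hmom 1 x) - (- hmom 2 x)) + \<i> * exp (\<i> * of_real x) * (\<i> * hmom 0 x - hmom 1 x))
      + 1 * (exp (\<i> * of_real x) * (\<i> * hmom 0 x - hmom 1 x)) =
    exp (\<i> * of_real x) * (of_real x * (hmom 2 x - 2 * \<i> * hmom 1 x) - of_real x * hmom 0 x + (\<i> * hmom 0 x - hmom 1 x))"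
    by (simp add: algebra_simps)
  also have "\<dots> = - of_real x * hout x"
    unfolding hmom_by_parts[OF x] hout_def by (simp add: algebra_simps)
  finally show ?thesis .
qed

text \<open>The expansion of \<open>hmom 0\<close> has logarithmic coefficient -1. Replacing exp(i
  x) by 1 in front of the logarithm is harmless because |exp(i x) - 1| \<le> x and x ln x tends to
  0.\<close>

lemma hout_limit: "((\<lambda>x. hout x + of_real (ln x)) \<longlongrightarrow> hconst - of_real euler_mascheroni) (at_right 0)"
proof -
  have e0: "((\<lambda>x. exp (\<i> * of_real x)) \<longlongrightarrow> exp (\<i> * of_real 0)) (at_right 0)"
    by (intro tendsto_intros)
  have rem: "((\<lambda>x. 2 * of_real x * laplace hrem x) \<longlongrightarrow> 0) (at_right 0)"
  proof (rule Lim_null_comparison)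
    show "\<forall>\<^sub>F x in at_right 0. norm (2 * of_real x * laplace hrem x) \<le> 2 * (2 * Gamma (1/2)) * x powr (1/2)"
      using eventually_at_right_less[of 0]
    proof eventually_elim
      case (elim x)
      have "norm (laplace hrem x) \<le> 2 * (Gamma (-1/2 + 1) * x powr (-(-1/2 + 1)))"
        by (rule laplace_norm_le[OF hrem_measurable hrem_bound]) (use elim in auto)
      then have "2 * x * norm (laplace hrem x) \<le> 2 * x * (2 * (Gamma (1/2) * x powr (-1/2)))"
        using elim by (intro mult_left_mono) auto
      also have "\<dots> = 2 * (2 * Gamma (1/2)) * (x powr 1 * x powr (-1/2))" using elim by simp
      also have "x powr 1 * x powr (-1/2) = x powr (1/2)" unfolding powr_add[symmetric] by simp
      finally show ?case using elim by (simp add: norm_mult)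
    qed
    show "((\<lambda>x. 2 * (2 * Gamma (1/2)) * x powr (1/2)) \<longlongrightarrow> 0) (at_right (0::real))"
    proof -
      have "((\<lambda>x. C * x powr (1/2)) \<longlongrightarrow> 0) (at_right (0::real))" for C by real_asymp
      then show ?thesis .
    qed
  qed
  have ex: "((\<lambda>x. (1 - exp (\<i> * of_real x)) * of_real (ln x)) \<longlongrightarrow> 0) (at_right 0)"
  proof (rule Lim_null_comparison)
    show "\<forall>\<^sub>F x in at_right 0. norm ((1 - exp (\<i> * of_real x)) * of_real (ln x)) \<le> x * \<bar>ln x\<bar>"
      using eventually_at_right_less[of 0]
    proof eventually_elim
      case (elim x)
      have "norm (exp (\<i> * of_real x) - 1) \<le> x"
        using dist_exp_i_1[of x] abs_sin_x_le_abs_x[of "x / 2"] elim by (simp add: dist_norm)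
      then show ?case by (simp add: norm_mult norm_minus_commute mult_right_mono)
    qed
    show "((\<lambda>x::real. x * \<bar>ln x\<bar>) \<longlongrightarrow> 0) (at_right 0)" by real_asymp
  qed
  have "((\<lambda>x. exp (\<i> * of_real x) * (hconst - of_real euler_mascheroni + 2 * of_real x * laplace hrem x)
      + (1 - exp (\<i> * of_real x)) * of_real (ln x)) \<longlongrightarrow>
      exp (\<i> * of_real 0) * (hconst - of_real euler_mascheroni + 0) + 0) (at_right 0)"
    by (intro tendsto_add tendsto_mult tendsto_const e0 rem ex)
  moreover have "\<forall>\<^sub>F x in at_right 0. exp (\<i> * of_real x) * (hconst - of_real euler_mascheroni + 2 * of_real x * laplace hrem x)
      + (1 - exp (\<i> * of_real x)) * of_real (ln x) = hout x + of_real (ln x)"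
    using eventually_at_right_less[of 0]
  proof eventually_elim
    case (elim x)
    show ?case unfolding hout_def hmom_0_eq[OF elim] by (simp add: algebra_simps)
  qed
  ultimately show ?thesis by (auto elim: Lim_transform_eventually)
qed

abbreviation H :: "nat \<Rightarrow> real \<Rightarrow> complex" where "H \<equiv> hankel1"

definition EH :: "nat \<Rightarrow> real \<Rightarrow> complex" where "EH n x = Complex (EJ n x) (EY n x)"

lemma H_eq: "H n x = of_real (J n x) + \<i> * of_real (Y n x)"
  by (simp add: hankel1_def J_def complex_eq_iff)

lemma EH_eq: "EH n x = of_real (EJ n x) + \<i> * of_real (EY n x)"
  by (simp add: EH_def complex_eq_iff)

lemma Re_H [simp]: "Re (H n x) = J n x" and Im_H [simp]: "Im (H n x) = Y n x"
  by (simp_all add: hankel1_def J_def)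

lemma Re_EH [simp]: "Re (EH n x) = EJ n x" and Im_EH [simp]: "Im (EH n x) = EY n x"
  by (simp_all add: EH_def)

text \<open>\<open>hout\<close> is some combination \<alpha> J_0 + \<beta> Y_0. The coefficient of
  ln x at the origin determines \<beta>, and then the constant term determines \<alpha>; real
  constants cancel exactly and \<alpha> is purely imaginary.\<close>

theorem hout_eq_hankel:
  obtains "\<And>x. x > 0 \<Longrightarrow> hout x = of_real (pi / 2) * \<i> * H 0 x"
    and "\<And>x. x > 0 \<Longrightarrow> hout_Euler x = of_real (pi / 2) * \<i> * EH 0 x"
proof -
  obtain \<alpha> \<beta> :: complex where sol: "\<And>r. r \<in> {0<..} \<Longrightarrow> hout r = \<alpha> * J 0 (1 * r) + \<beta> * Y 0 (1 * r)"
    and sol': "\<And>r. r \<in> {0<..} \<Longrightarrow> hout_Euler r = \<alpha> * EJ 0 (1 * r) + \<beta> * EY 0 (1 * r)"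
  proof (rule bessel_solution[of "{0<..}" 1 hout hout_Euler 0])
    show "(hout has_vector_derivative hout_Euler r / of_real r) (at r)" if "r \<in> {0<..}" for r
      using hout_deriv[of r] that by simp
    show "(hout_Euler has_vector_derivative of_real ((real 0)\<^sup>2 / r - 1\<^sup>2 * r) * hout r) (at r)" if "r \<in> {0<..}" for r
      using hout_Euler_deriv[of r] that by simp
  qed auto
  define g where "g = hconst - of_real euler_mascheroni"
  define c where "c = \<alpha> + \<beta> * of_real (2 / pi * (euler_mascheroni - ln 2))"
  \<comment> \<open>Chosen so that R has a finite limit at 0 although R x = (1 + 2 \<beta> / pi) ln
    x exactly. Hence the coefficient vanishes, R is zero, and its limit yields \<alpha>.\<close>
  define R where "R x = hout x + of_real (ln x) - \<alpha> * of_real (J 0 x)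
     - \<beta> * of_real (Y 0 x - 2 / pi * (ln (x / 2) + euler_mascheroni))
     - \<beta> * of_real (2 / pi * (euler_mascheroni - ln 2))" for x
  have R: "(R \<longlongrightarrow> g - \<alpha> * of_real 1 - \<beta> * of_real 0 - \<beta> * of_real (2 / pi * (euler_mascheroni - ln 2))) (at_right 0)"
    unfolding R_def g_def using tendsto_J_at_0[of 0]
    by (intro tendsto_intros hout_limit tendsto_Y0_at_0) auto
  have Req: "R x = (1 + \<beta> * of_real (2 / pi)) * of_real (ln x)" if "x > 0" for x
    using sol[of x] that unfolding R_def by (simp add: ln_div algebra_simps add_divide_distrib diff_divide_distrib)
  have "((\<lambda>x. R x * of_real (inverse (ln x))) \<longlongrightarrow> (g - \<alpha> * of_real 1 - \<beta> * of_real 0 - \<beta> * of_real (2 / pi * (euler_mascheroni - ln 2))) * of_real 0) (at_right 0)"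
    by (intro tendsto_mult R tendsto_of_real) real_asymp
  then have lim0: "((\<lambda>x. R x * of_real (inverse (ln x))) \<longlongrightarrow> 0) (at_right 0)" by simp
  have "\<forall>\<^sub>F x in at_right 0. R x * of_real (inverse (ln x)) = 1 + \<beta> * of_real (2 / pi)"
  proof -
    have "\<forall>\<^sub>F x::real in at_right 0. 0 < x \<and> x < 1"
      by (intro eventually_conj eventually_at_right_less eventually_at_right_real[THEN eventually_mono]) auto
    then show ?thesis
    proof eventually_elim
      case (elim x)
      then have "ln x \<noteq> 0" by simp
      then have "complex_of_real (ln x) * of_real (inverse (ln x)) = 1" by (simp flip: of_real_mult)
      then show ?case using Req[of x] elim by (simp only: mult.assoc) simp
    qed
  qed
  then have "((\<lambda>x. R x * of_real (inverse (ln x))) \<longlongrightarrow> 1 + \<beta> * of_real (2 / pi)) (at_right 0)"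
    by (rule tendsto_eventually)
  with lim0 have b: "1 + \<beta> * of_real (2 / pi) = 0"
    using tendsto_unique trivial_limit_at_right_real by blast
  have "((\<lambda>x. R x) \<longlongrightarrow> 0) (at_right 0)"
  proof (rule tendsto_eventually)
    show "\<forall>\<^sub>F x in at_right 0. R x = 0"
      using eventually_at_right_less[of 0] by eventually_elim (simp only: Req b mult_zero_left)
  qed
  with R have a: "g - \<alpha> - \<beta> * of_real (2 / pi * (euler_mascheroni - ln 2)) = 0"
    using tendsto_unique[OF trivial_limit_at_right_real R] by fastforce
  have b': "\<beta> = - of_real (pi / 2)"
  proof -
    have "\<beta> = (1 + \<beta> * of_real (2 / pi)) * of_real (pi / 2) - of_real (pi / 2)" by (simp add: algebra_simps)
    then show ?thesis unfolding b by simp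
  qed
  have "of_real (pi / 2) * of_real (2 / pi * (euler_mascheroni - ln 2)) = (of_real (euler_mascheroni - ln 2) :: complex)"
    unfolding of_real_mult[symmetric] by simp
  then have a': "\<alpha> = of_real (pi / 2) * \<i>"
    using a unfolding b' g_def hconst_def by (simp add: algebra_simps)
  show ?thesis
  proof
    fix x :: real assume x: "x > 0"
    show "hout x = of_real (pi / 2) * \<i> * H 0 x"
      using sol[of x] x unfolding a' b' H_eq by (simp add: algebra_simps)
    show "hout_Euler x = of_real (pi / 2) * \<i> * EH 0 x"
      using sol'[of x] x unfolding a' b' EH_eq by (simp add: algebra_simps)
  qed
qed

subsection \<open>The Hankel functions are outgoing\<close>

lemma EH_down: "EH n x = of_nat n * H n x - of_real x * H (n + 1) x"
  by (simp add: complex_eq_iff EJ_def EY_def)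

lemma EH_up:
  assumes "x > 0"
  shows "EH (n + 1) x = of_real x * H n x - of_nat (n + 1) * H (n + 1) x"
  using besselJ_recurrence[of x n] besselY_recurrence[of x n] assms
  by (simp add: complex_eq_iff EJ_def EY_def field_simps)

text \<open>The defect H_n' - i H_n in the radiation condition for wave number 1.\<close>

definition Hdef :: "nat \<Rightarrow> real \<Rightarrow> complex" where
  "Hdef n x = EH n x / of_real x - \<i> * H n x"

text \<open>For n = 0 the function and its defect are, up to unimodular and constant factors, the
  moments 0 and 1 of the kernel, which differ by a power of x in decay. The recurrences pass both
  estimates from n to n + 1.\<close>

lemma hankel_decay:
  "\<exists>C\<ge>0. \<forall>x\<ge>1. sqrt x * cmod (H n x) \<le> C \<and> sqrt x * cmod (Hdef n x) \<le> C / x"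
proof (induction n)
  case 0
  define C where "C = Gamma (1/2) + Gamma (3/2 :: real)"
  have G: "Gamma (1/2 :: real) > 0" "Gamma (3/2 :: real) > 0" by (simp_all add: Gamma_real_pos)
  have "sqrt x * cmod (H 0 x) \<le> C \<and> sqrt x * cmod (Hdef 0 x) \<le> C / x" if x1: "x \<ge> 1" for x
  proof -
    have x: "x > 0" using x1 by simp
    obtain e: "hout x = of_real (pi / 2) * \<i> * H 0 x" "hout_Euler x = of_real (pi / 2) * \<i> * EH 0 x"
      using hout_eq_hankel x by metis
    have ne: "norm (exp (\<i> * complex_of_real x)) = 1" by simp
    have s: "sqrt x = x powr (1/2)" using x by (simp add: powr_half_sqrt)
    have pi2: "pi / 2 \<ge> 1" using pi_ge_two by simp
    have "cmod (H 0 x) \<le> pi / 2 * cmod (H 0 x)" using mult_right_mono[OF pi2, of "cmod (H 0 x)"] by simp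
    also have "\<dots> = cmod (hout x)" unfolding e by (simp add: norm_mult)
    also have "\<dots> = cmod (hmom 0 x)" unfolding hout_def norm_mult ne by simp
    also have "\<dots> \<le> Gamma (1/2) * x powr (-(1/2))" using hmom_norm[OF x, of 0] by simp
    finally have "sqrt x * cmod (H 0 x) \<le> x powr (1/2) * (Gamma (1/2) * x powr (-(1/2)))"
      unfolding s by (intro mult_left_mono) auto
    also have "\<dots> = Gamma (1/2) * (x powr (1/2) * x powr (-(1/2)))" by simp
    also have "x powr (1/2) * x powr (-(1/2)) = 1" unfolding powr_add[symmetric] using x by simp
    finally have 1: "sqrt x * cmod (H 0 x) \<le> C" using G unfolding C_def by linarith
    have "of_real (pi / 2) * \<i> * Hdef 0 x = hout_Euler x / of_real x - \<i> * hout x"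
      unfolding Hdef_def e by (simp add: algebra_simps)
    also have "\<dots> = - exp (\<i> * of_real x) * hmom 1 x"
      unfolding hout_Euler_div[OF x] hout_def by (simp add: algebra_simps)
    finally have eq: "of_real (pi / 2) * \<i> * Hdef 0 x = - exp (\<i> * of_real x) * hmom 1 x" .
    from arg_cong[OF eq, of cmod] have "pi / 2 * cmod (Hdef 0 x) = cmod (hmom 1 x)"
      unfolding norm_mult norm_minus_cancel ne by simp
    moreover have "cmod (Hdef 0 x) \<le> pi / 2 * cmod (Hdef 0 x)" using mult_right_mono[OF pi2, of "cmod (Hdef 0 x)"] by simp
    moreover have "cmod (hmom 1 x) \<le> Gamma (3/2) * x powr (-(3/2))" using hmom_norm[OF x, of 1] by simp
    ultimately have "cmod (Hdef 0 x) \<le> Gamma (3/2) * x powr (-(3/2))" by linarith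
    then have "sqrt x * cmod (Hdef 0 x) \<le> x powr (1/2) * (Gamma (3/2) * x powr (-(3/2)))"
      unfolding s by (intro mult_left_mono) auto
    also have "\<dots> = Gamma (3/2) * (x powr (1/2) * x powr (-(3/2)))" by simp
    also have "x powr (1/2) * x powr (-(3/2)) = 1 / x" unfolding powr_add[symmetric] using x by (simp add: powr_minus_divide)
    also have "Gamma (3/2) * (1 / x) \<le> C / x" using G x unfolding C_def by (simp add: divide_right_mono)
    finally show ?thesis using 1 by simp
  qed
  moreover have "C \<ge> 0" using G by (simp add: C_def)
  ultimately show ?case by blast
next
  case (Suc n)
  then obtain C where C0: "C \<ge> 0" and C: "\<And>x. x \<ge> 1 \<Longrightarrow> sqrt x * cmod (H n x) \<le> C"
    "\<And>x. x \<ge> 1 \<Longrightarrow> sqrt x * cmod (Hdef n x) \<le> C / x" by blast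
  define C' where "C' = (real n + (real n + 1) * (real n + 2) + 2) * C"
  have le: "(real n + 2) * C \<le> C'"
    unfolding C'_def using C0 by (intro mult_right_mono) auto
  have "sqrt x * cmod (H (n + 1) x) \<le> C' \<and> sqrt x * cmod (Hdef (n + 1) x) \<le> C' / x" if x1: "x \<ge> 1" for x
  proof -
    have x: "x > 0" using x1 by simp
    have h: "H (n + 1) x = of_nat n / of_real x * H n x - \<i> * H n x - Hdef n x"
      using x unfolding Hdef_def EH_down by (simp add: field_simps)
    \<comment> \<open>The copies of \<open>H n x\<close> coming from the derivative and from i
      \<open>H (n + 1) x\<close> cancel. Each remaining term carries the defect of order n or a
      factor 1/x.\<close>
    have d: "Hdef (n + 1) x = \<i> * Hdef n x - \<i> * (of_nat n / of_real x * H n x) - of_nat (n + 1) / of_real x * H (n + 1) x"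
    proof -
      have "Hdef (n + 1) x = H n x - of_nat (n + 1) / of_real x * H (n + 1) x - \<i> * H (n + 1) x"
        using x unfolding Hdef_def EH_up[OF x] by (simp add: field_simps)
      also have "\<i> * H (n + 1) x = \<i> * (of_nat n / of_real x * H n x) + H n x - \<i> * Hdef n x"
        unfolding h by (simp add: algebra_simps)
      finally show ?thesis by (simp add: algebra_simps)
    qed
    define a where "a = sqrt x * cmod (H n x)"
    define b where "b = sqrt x * cmod (Hdef n x)"
    have ab: "a \<le> C" "b \<le> C / x" "0 \<le> a" "0 \<le> b" using C[OF x1] x by (auto simp: a_def b_def)
    have "C / x \<le> C" using mult_left_mono[OF x1 C0] x by (simp add: field_simps)
    have "cmod (H (n + 1) x) \<le> real n / x * cmod (H n x) + cmod (H n x) + cmod (Hdef n x)"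
      unfolding h using norm_triangle_ineq4[of "of_nat n / of_real x * H n x - \<i> * H n x" "Hdef n x"]
        norm_triangle_ineq4[of "of_nat n / of_real x * H n x" "\<i> * H n x"] x
      by (simp add: norm_mult norm_divide)
    then have "sqrt x * cmod (H (n + 1) x) \<le> real n / x * a + a + b"
      using mult_left_mono[of _ _ "sqrt x"] x unfolding a_def b_def by (fastforce simp: algebra_simps)
    also have "\<dots> \<le> real n * C + C + C"
    proof (intro add_mono)
      have "real n / x \<le> real n" using mult_left_mono[OF x1, of "real n"] x by (simp add: field_simps)
      then show "real n / x * a \<le> real n * C" using ab by (intro mult_mono) auto
    qed (use ab \<open>C / x \<le> C\<close> in auto)
    finally have 1: "sqrt x * cmod (H (n + 1) x) \<le> (real n + 2) * C" by (simp add: algebra_simps)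
    have "cmod (Hdef (n + 1) x) \<le> cmod (Hdef n x) + real n / x * cmod (H n x) + real (n + 1) / x * cmod (H (n + 1) x)"
      unfolding d using norm_triangle_ineq4[of "\<i> * Hdef n x - \<i> * (of_nat n / of_real x * H n x)" "of_nat (n + 1) / of_real x * H (n + 1) x"]
        norm_triangle_ineq4[of "\<i> * Hdef n x" "\<i> * (of_nat n / of_real x * H n x)"] x
      by (simp add: norm_mult norm_divide del: of_nat_Suc of_nat_add)
    then have "sqrt x * cmod (Hdef (n + 1) x) \<le> sqrt x * (cmod (Hdef n x) + real n / x * cmod (H n x) + real (n + 1) / x * cmod (H (n + 1) x))"
      using x by (intro mult_left_mono) auto
    also have "\<dots> = b + real n / x * a + real (n + 1) / x * (sqrt x * cmod (H (n + 1) x))"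
      unfolding a_def b_def by (simp add: algebra_simps)
    also have "\<dots> \<le> C / x + real n / x * C + real (n + 1) / x * ((real n + 2) * C)"
      using ab 1 x by (intro add_mono mult_left_mono) auto
    also have "\<dots> = ((real n + (real n + 1) * (real n + 2) + 1) * C) / x"
      using x by (simp add: field_simps)
    also have "\<dots> \<le> C' / x" unfolding C'_def using C0 x by (intro divide_right_mono mult_right_mono) auto
    finally show ?thesis using 1 le by auto
  qed
  moreover have "C' \<ge> 0" unfolding C'_def using C0 by simp
  ultimately show ?case by (auto simp del: of_nat_Suc intro!: exI[of _ C'])
qed


subsection \<open>Monotonicity of the modulus\<close>

text \<open>With \<open>P = x |f|\<^sup>2\<close> and \<open>q = 1 - \<nu> / x\<^sup>2\<close> one has \<open>P''' + 4 q P' + 2 q' P = 0\<close>; the energy below is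
  \<open>P''\<^sup>2 + 4 q P'\<^sup>2 + 4 q' P P'\<close>, whose derivative \<open>8 q' P'\<^sup>2 + 4 q'' P P'\<close> is positive as long as \<open>P' < 0\<close>.\<close>

lemma modulus_descent:
  fixes a b d :: "real \<Rightarrow> real"
  assumes n: "n \<ge> (1::nat)" and T: "T > 0"
    and da: "\<And>x. x > 0 \<Longrightarrow> (a has_real_derivative 2 * b x / x) (at x)"
    and db: "\<And>x. x > 0 \<Longrightarrow> (b has_real_derivative d x / x + ((real n)\<^sup>2 / x - x) * a x) (at x)"
    and dd: "\<And>x. x > 0 \<Longrightarrow> (d has_real_derivative 2 * ((real n)\<^sup>2 / x - x) * b x) (at x)"
    and a0: "\<And>x. x > 0 \<Longrightarrow> a x \<ge> 0" and aT: "a T > 0"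
    and yT: "a T + 2 * b T = 0"
    and zT: "(2 * b T + 2 * d T) / T + 2 * ((real n)\<^sup>2 / T - T) * a T = 0"
    and x0: "0 < x0" "x0 < T"
  shows "a x0 + 2 * b x0 \<le> 0"
proof (rule ccontr)
  define \<nu> where "\<nu> = (real n)\<^sup>2 - 1 / 4"
  have n2: "(real n)\<^sup>2 = \<nu> + 1 / 4" by (simp add: \<nu>_def)
  have "(real n)\<^sup>2 \<ge> 1" using n by simp
  then have \<nu>: "\<nu> > 0" by (simp add: \<nu>_def)
  \<comment> \<open>With a = |f|^2, b = Re (cnj f * x f') and d = |x f'|^2, the functions y and z
    are P' and P'' for P = x a. The number \<nu> = n^2 - 1/4 is the one in the Liouville normal
    form; it is positive because n \<ge> 1.\<close>
  define y where "y x = a x + 2 * b x" for x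
  define z where "z x = (2 * b x + 2 * d x) / x + 2 * ((real n)\<^sup>2 / x - x) * a x" for x
  define e where "e x = (z x)\<^sup>2 + 4 * (1 - \<nu> / x\<^sup>2) * (y x)\<^sup>2 + 8 * \<nu> * a x / x\<^sup>2 * y x" for x
  have dy: "(y has_real_derivative z x) (at x)" if "x > 0" for x
    unfolding y_def z_def using that
    by (auto intro!: derivative_eq_intros da db simp: field_simps)
  have dz: "(z has_real_derivative - 4 * a x - 8 * b x + 8 * \<nu> * b x / x\<^sup>2) (at x)" if x: "x > 0" for x
  proof -
    have "(z has_real_derivative
       ((2 * (d x / x + ((real n)\<^sup>2 / x - x) * a x) + 2 * (2 * ((real n)\<^sup>2 / x - x) * b x)) * x - (2 * b x + 2 * d x) * 1) / (x * x)
       + ((2 * ((0 * x - (real n)\<^sup>2 * 1) / (x * x) - 1)) * a x + (2 * b x / x) * (2 * ((real n)\<^sup>2 / x - x)))) (at x)"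
      unfolding z_def using x
      by (intro DERIV_add DERIV_divide DERIV_mult DERIV_cmult DERIV_diff DERIV_const DERIV_ident da db dd) auto
    moreover have "((2 * (d x / x + ((real n)\<^sup>2 / x - x) * a x) + 2 * (2 * ((real n)\<^sup>2 / x - x) * b x)) * x - (2 * b x + 2 * d x) * 1) / (x * x)
       + ((2 * ((0 * x - (real n)\<^sup>2 * 1) / (x * x) - 1)) * a x + (2 * b x / x) * (2 * ((real n)\<^sup>2 / x - x)))
       = - 4 * a x - 8 * b x + 8 * \<nu> * b x / x\<^sup>2"
      unfolding n2 using x by (simp add: field_simps power2_eq_square)
    ultimately show ?thesis by (simp only:)
  qed
  have de: "(e has_real_derivative 16 * \<nu> / x ^ 3 * (y x)\<^sup>2 - 24 * \<nu> * a x / x ^ 3 * y x) (at x)" if x: "x > 0" for x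
  proof -
    have q: "((\<lambda>x. 1 - \<nu> / x\<^sup>2) has_real_derivative 2 * \<nu> / x ^ 3) (at x)"
      using x by (auto intro!: derivative_eq_intros simp: field_simps power2_eq_square power3_eq_cube)
    have p: "((\<lambda>x. 8 * \<nu> * a x / x\<^sup>2) has_real_derivative 16 * \<nu> * b x / x ^ 3 - 16 * \<nu> * a x / x ^ 3) (at x)"
    proof -
      have "((\<lambda>x. 8 * \<nu> * a x / x\<^sup>2) has_real_derivative
          (8 * \<nu> * (2 * b x / x) * x\<^sup>2 - 8 * \<nu> * a x * (2 * x)) / (x\<^sup>2 * x\<^sup>2)) (at x)"
        using x by (intro DERIV_divide DERIV_cmult da) (auto intro!: derivative_eq_intros)
      moreover have "(8 * \<nu> * (2 * b x / x) * x\<^sup>2 - 8 * \<nu> * a x * (2 * x)) / (x\<^sup>2 * x\<^sup>2) = 16 * \<nu> * b x / x ^ 3 - 16 * \<nu> * a x / x ^ 3"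
        using x by (simp add: field_simps power2_eq_square power3_eq_cube)
      ultimately show ?thesis by (simp only:)
    qed
    define Z where "Z = - 4 * a x - 8 * b x + 8 * \<nu> * b x / x\<^sup>2"
    have "(e has_real_derivative (2 * z x * Z) + (2 * \<nu> / x ^ 3 * 4 * (y x)\<^sup>2 + 2 * y x * z x * (4 * (1 - \<nu> / x\<^sup>2)))
        + ((16 * \<nu> * b x / x ^ 3 - 16 * \<nu> * a x / x ^ 3) * y x + z x * (8 * \<nu> * a x / x\<^sup>2))) (at x)"
      unfolding e_def
    proof (intro DERIV_add DERIV_mult p dy x)
      show "((\<lambda>x. (z x)\<^sup>2) has_real_derivative 2 * z x * Z) (at x)"
        using dz[OF x] by (auto intro!: derivative_eq_intros simp: Z_def)
      show "((\<lambda>x. (y x)\<^sup>2) has_real_derivative 2 * y x * z x) (at x)"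
        using dy[OF x] by (auto intro!: derivative_eq_intros)
      show "((\<lambda>x. 4 * (1 - \<nu> / x\<^sup>2)) has_real_derivative 2 * \<nu> / x ^ 3 * 4) (at x)"
        using DERIV_cmult[OF q, of 4] by (simp add: mult_ac)
    qed
    moreover have "(2 * z x * Z) + (2 * \<nu> / x ^ 3 * 4 * (y x)\<^sup>2 + 2 * y x * z x * (4 * (1 - \<nu> / x\<^sup>2)))
        + ((16 * \<nu> * b x / x ^ 3 - 16 * \<nu> * a x / x ^ 3) * y x + z x * (8 * \<nu> * a x / x\<^sup>2))
        = 16 * \<nu> / x ^ 3 * (y x)\<^sup>2 - 24 * \<nu> * a x / x ^ 3 * y x"
    proof -
      have b: "b x = (y x - a x) / 2" by (simp add: y_def)
      define r where "r = \<nu> / x\<^sup>2"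
      define t where "t = \<nu> / x ^ 3"
      have 1: "Z = - 4 * a x - 8 * b x + 8 * r * b x" "1 - \<nu> / x\<^sup>2 = 1 - r" "8 * \<nu> * a x / x\<^sup>2 = 8 * r * a x"
        "2 * \<nu> / x ^ 3 = 2 * t" "16 * \<nu> * b x / x ^ 3 = 16 * t * b x" "16 * \<nu> * a x / x ^ 3 = 16 * t * a x"
        "16 * \<nu> / x ^ 3 = 16 * t" "24 * \<nu> * a x / x ^ 3 = 24 * t * a x"
        by (simp_all add: Z_def r_def t_def)
      show ?thesis unfolding 1 unfolding b by (simp add: field_simps power2_eq_square)
    qed
    ultimately show ?thesis by (simp only:)
  qed
  have cont: "isCont y x" if "x > 0" for x using dy[OF that] by (rule DERIV_isCont)
  \<comment> \<open>P''' is negative at T while P' = P'' = 0 there. So P'' is positive just left of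
    T, and P' is negative there: the descent has a start.\<close>
  have zT': "(z has_real_derivative - (4 * \<nu> * a T / T\<^sup>2)) (at T)"
  proof -
    have b: "b T = - a T / 2" using yT by simp
    show ?thesis using dz[OF T] unfolding b by (simp add: mult_ac)
  qed
  have "- (4 * \<nu> * a T / T\<^sup>2) < 0" using \<nu> aT T by simp
  from DERIV_neg_dec_left[OF zT' this] obtain \<delta> where \<delta>: "\<delta> > 0" "\<And>h. h > 0 \<Longrightarrow> h < \<delta> \<Longrightarrow> z T < z (T - h)"
    by blast
  assume "\<not> a x0 + 2 * b x0 \<le> 0"
  then have yx0: "y x0 > 0" by (simp add: y_def)
  define c where "c = max x0 (T - \<delta> / 2)"
  have c: "x0 \<le> c" "c < T" "c > 0" "T - c < \<delta>" using \<delta> x0 by (auto simp: c_def)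
  have yneg: "y t < 0" if t: "c \<le> t" "t < T" for t
  proof -
    have "y t < y T"
    proof (rule DERIV_pos_imp_increasing_open[OF t(2)])
      fix s assume s: "t < s" "s < T"
      have "z s > 0" using \<delta>(2)[of "T - s"] s t c zT by (simp add: z_def[of T])
      then show "\<exists>l. (y has_real_derivative l) (at s) \<and> 0 < l" using dy[of s] s t c by auto
    next
      show "continuous_on {t..T} y" using cont t c by (auto intro!: continuous_at_imp_continuous_on)
    qed
    then show ?thesis using yT by (simp add: y_def)
  qed
  \<comment> \<open>The last point x1 before T with P' \<ge> 0 is isolated by compactness. On (x1,
    T) the energy strictly increases to e T = 0, but at x1 it is the square of P'', a
    contradiction.\<close>
  define S where "S = {x0..c} \<inter> {x. 0 \<le> y x}"
  have "closedin (top_of_set {x0..c}) ({x0..c} \<inter> y -` {0..})"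
    using cont x0 by (intro continuous_closedin_preimage continuous_at_imp_continuous_on) auto
  then have "closed ({x0..c} \<inter> y -` {0..})" using closedin_closed_trans closed_atLeastAtMost by blast
  moreover have "S = {x0..c} \<inter> y -` {0..}" by (auto simp: S_def)
  ultimately have "compact S" 
    by (metis compact_Int_closed compact_Icc inf.left_idem)
  moreover have "x0 \<in> S" using c yx0 by (auto simp: S_def)
  ultimately obtain x1 where x1: "x1 \<in> S" "\<And>t. t \<in> S \<Longrightarrow> t \<le> x1"
    using compact_attains_sup[of S] by blast
  have x1p: "x1 > 0" "x1 \<le> c" "y x1 \<ge> 0" "x1 < T" using x1 x0 c by (auto simp: S_def)
  have neg: "y t < 0" if t: "x1 < t" "t < T" for t
  proof (cases "t \<le> c")
    case True
    then have "t \<notin> S" using x1(2)[of t] t by auto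
    then show ?thesis using True t x1 by (auto simp: S_def)
  qed (use yneg t in auto)
  have "y x1 \<le> 0"
  proof (rule tendsto_upperbound[where F = "at_right x1"])
    show "(y \<longlongrightarrow> y x1) (at_right x1)"
      using cont[OF x1p(1)] unfolding isCont_def by (rule filterlim_mono) (auto simp: at_le)
    show "\<forall>\<^sub>F t in at_right x1. y t \<le> 0"
      using eventually_at_right_real[OF x1p(4)] by eventually_elim (use neg in \<open>auto simp: less_imp_le\<close>)
  qed simp
  then have y1: "y x1 = 0" using x1p by simp
  have "e x1 < e T"
  proof (rule DERIV_pos_imp_increasing_open[OF x1p(4)])
    fix s assume s: "x1 < s" "s < T"
    have s0: "s > 0" using s x1p by simp
    have 1: "16 * \<nu> / s ^ 3 * (y s)\<^sup>2 > 0" using neg[OF s] \<nu> s0 by simp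
    have 2: "24 * \<nu> * a s / s ^ 3 * y s \<le> 0"
      using neg[OF s] \<nu> s0 a0[OF s0] by (intro mult_nonneg_nonpos divide_nonneg_nonneg mult_nonneg_nonneg) auto
    show "\<exists>l. (e has_real_derivative l) (at s) \<and> 0 < l"
      by (rule exI, rule conjI, rule de[OF s0]) (use 1 2 in linarith)
  next
    have "isCont e s" if "s \<in> {x1..T}" for s
      using that x1p by (intro DERIV_isCont[OF de]) auto
    then show "continuous_on {x1..T} e" by (intro continuous_at_imp_continuous_on ballI)
  qed
  moreover have "e T = 0" using yT zT by (simp add: e_def y_def z_def)
  moreover have "e x1 \<ge> 0" using y1 by (simp add: e_def)
  ultimately show False by simp
qed


lemma complex_comb_deriv:
  fixes F G :: "real \<Rightarrow> real"
  assumes "(F has_real_derivative F') (at x)" "(G has_real_derivative G') (at x)"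
  shows "((\<lambda>x. Re (\<alpha> * of_real (F x) + \<beta> * of_real (G x))) has_real_derivative Re \<alpha> * F' + Re \<beta> * G') (at x)"
    and "((\<lambda>x. Im (\<alpha> * of_real (F x) + \<beta> * of_real (G x))) has_real_derivative Im \<alpha> * F' + Im \<beta> * G') (at x)"
  using assms by (auto intro!: derivative_eq_intros)

lemma sum_products_deriv:
  fixes p q u v :: "real \<Rightarrow> real"
  assumes "(p has_real_derivative p') (at x)" "(q has_real_derivative q') (at x)"
    "(u has_real_derivative u') (at x)" "(v has_real_derivative v') (at x)"
  shows "((\<lambda>x. p x * u x + q x * v x) has_real_derivative p' * u x + p x * u' + (q' * v x + q x * v')) (at x)"
  using assms by (auto intro!: derivative_eq_intros)

lemma hankel_nonzero: "x > 0 \<Longrightarrow> H n x \<noteq> 0"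
  using wronskian_Euler[of x n] by (auto simp: complex_eq_iff)

text \<open>The left side is the derivative of x |H_n(x)|^2. For large T a solution
  \<open>f T\<close> is built that agrees with H_n at T and whose slope there is adjusted to give P'
  = P'' = 0, so that \<open>modulus_descent\<close> applies to it. As T grows its coefficients tend
  to those of H_n, and the inequality survives the limit at the fixed point x.\<close>

theorem hankel_modulus_decreasing:
  assumes n: "n \<ge> 1" and x: "x > 0"
  shows "(cmod (H n x))\<^sup>2 + 2 * Re (cnj (H n x) * EH n x) \<le> 0"
proof -
  define \<nu> where "\<nu> = (real n)\<^sup>2 - 1 / 4"
  have n2: "(real n)\<^sup>2 = \<nu> + 1 / 4" by (simp add: \<nu>_def)
  have "(real n)\<^sup>2 \<ge> 1" using n by simp
  then have \<nu>: "\<nu> > 0" by (simp add: \<nu>_def)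
  define Q where "Q T = sqrt (1 - \<nu> / T\<^sup>2)" for T
  \<comment> \<open>Prescribed ratio x f' / f at T: the real part -1/2 gives P' = 0, and the
    imaginary part T sqrt(1 - \<nu>/T^2) gives P'' = 0. The coefficients \<alpha> and \<beta> below
    realise this initial value by Cramer's rule.\<close>
  define \<kappa> where "\<kappa> T = \<i> * of_real (T * Q T) - 1 / 2" for T
  define \<alpha> where "\<alpha> T = of_real (pi / 2) * (H n T * of_real (EY n T) - \<kappa> T * H n T * of_real (Y n T))" for T
  define \<beta> where "\<beta> T = - of_real (pi / 2) * (H n T * of_real (EJ n T) - \<kappa> T * H n T * of_real (J n T))" for T
  define f where "f T x = \<alpha> T * of_real (J n x) + \<beta> T * of_real (Y n x)" for T x
  define g where "g T x = \<alpha> T * of_real (EJ n x) + \<beta> T * of_real (EY n x)" for T x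
  have le: "(cmod (f T x))\<^sup>2 + 2 * Re (cnj (f T x) * g T x) \<le> 0" if T: "T > x" "T > 1" "T\<^sup>2 > \<nu>" for T
  proof -
    have T0: "T > 0" using T by simp
    have W: "complex_of_real (J n T) * of_real (EY n T) - of_real (EJ n T) * of_real (Y n T) = of_real (2 / pi)"
      using arg_cong[OF wronskian_Euler[OF T0, of n], of complex_of_real] by simp
    have "f T T = of_real (pi / 2) * H n T * (of_real (J n T) * of_real (EY n T) - of_real (EJ n T) * of_real (Y n T))"
      unfolding f_def \<alpha>_def \<beta>_def by (simp add: algebra_simps)
    then have fT: "f T T = H n T" unfolding W by simp
    have "g T T = of_real (pi / 2) * (\<kappa> T * H n T) * (of_real (J n T) * of_real (EY n T) - of_real (EJ n T) * of_real (Y n T))"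
      unfolding g_def \<alpha>_def \<beta>_def by (simp add: algebra_simps)
    then have gT: "g T T = \<kappa> T * H n T" unfolding W by simp
    have q: "(Q T)\<^sup>2 = 1 - \<nu> / T\<^sup>2" unfolding Q_def using T \<nu> by (simp add: field_simps)
    define a where "a x = (Re (f T x))\<^sup>2 + (Im (f T x))\<^sup>2" for x
    define b where "b x = Re (f T x) * Re (g T x) + Im (f T x) * Im (g T x)" for x
    define d where "d x = (Re (g T x))\<^sup>2 + (Im (g T x))\<^sup>2" for x
    have aT: "a T = (cmod (H n T))\<^sup>2" unfolding a_def fT by (simp add: cmod_power2)
    have bT: "b T = - a T / 2"
      unfolding b_def a_def fT gT \<kappa>_def by (simp add: algebra_simps power2_eq_square)
    have "d T = (cmod (g T T))\<^sup>2" unfolding d_def by (simp only: cmod_power2)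
    then have "d T = (cmod (\<kappa> T))\<^sup>2 * a T"
      unfolding aT gT norm_mult power_mult_distrib .
    also have "(cmod (\<kappa> T))\<^sup>2 = T\<^sup>2 * (Q T)\<^sup>2 + 1 / 4"
      unfolding \<kappa>_def cmod_power2 by (simp add: power_mult_distrib power2_eq_square)
    also have "\<dots> = T\<^sup>2 - \<nu> + 1 / 4" unfolding q using T0 by (simp add: field_simps)
    finally have dT: "d T = (T\<^sup>2 - \<nu> + 1 / 4) * a T" .
    have df: "((\<lambda>x. Re (f T x)) has_real_derivative Re (g T x) / x) (at x)"
      "((\<lambda>x. Im (f T x)) has_real_derivative Im (g T x) / x) (at x)" if "x > 0" for x
      using complex_comb_deriv[OF J_has_deriv[OF that, of n] Y_has_deriv[OF that, of n], of "\<alpha> T" "\<beta> T"]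
      unfolding f_def g_def by (simp_all add: add_divide_distrib)
    have dg: "((\<lambda>x. Re (g T x)) has_real_derivative ((real n)\<^sup>2 / x - x) * Re (f T x)) (at x)"
      "((\<lambda>x. Im (g T x)) has_real_derivative ((real n)\<^sup>2 / x - x) * Im (f T x)) (at x)" if "x > 0" for x
      using complex_comb_deriv[OF EJ_has_deriv[OF that, of n] EY_has_deriv[OF that, of n], of "\<alpha> T" "\<beta> T"]
      unfolding f_def g_def by (simp_all add: algebra_simps)
    have "a x + 2 * b x \<le> 0"
    proof (rule modulus_descent[OF n T0, of a b d])
      fix x :: real assume x: "x > 0"
      show "(a has_real_derivative 2 * b x / x) (at x)"
        unfolding a_def b_def power2_eq_square
        by (rule DERIV_cong[OF sum_products_deriv[OF df[OF x] df[OF x]]]) (simp add: add_divide_distrib)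
      show "(b has_real_derivative d x / x + ((real n)\<^sup>2 / x - x) * a x) (at x)"
        unfolding a_def b_def d_def power2_eq_square
        by (rule DERIV_cong[OF sum_products_deriv[OF df[OF x] dg[OF x]]])
          (simp add: algebra_simps add_divide_distrib power2_eq_square)
      show "(d has_real_derivative 2 * ((real n)\<^sup>2 / x - x) * b x) (at x)"
        unfolding b_def d_def power2_eq_square[of "Re _"] power2_eq_square[of "Im _"]
        by (rule DERIV_cong[OF sum_products_deriv[OF dg[OF x] dg[OF x]]]) (simp add: algebra_simps)
      show "a x \<ge> 0" by (simp add: a_def)
    next
      show "a T > 0" unfolding aT using hankel_nonzero[OF T0, of n] by simp
      show "a T + 2 * b T = 0" by (simp add: bT)
      show "(2 * b T + 2 * d T) / T + 2 * ((real n)\<^sup>2 / T - T) * a T = 0"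
        unfolding bT dT n2 using T0 by (simp add: field_simps power2_eq_square)
    qed (use x T in auto)
    then show ?thesis by (simp add: a_def b_def cmod_power2)
  qed
  obtain C where C: "C \<ge> 0" "\<And>x. x \<ge> 1 \<Longrightarrow> sqrt x * cmod (H n x) \<le> C"
    "\<And>x. x \<ge> 1 \<Longrightarrow> sqrt x * cmod (Hdef n x) \<le> C / x"
    using hankel_decay[of n] by blast
  define M where "M = pi / 2 * (C\<^sup>2 + (\<nu> + 1 / 2) * C\<^sup>2)"
  have est: "cmod (\<alpha> T - 1) \<le> M / T" "cmod (\<beta> T - \<i>) \<le> M / T" if T: "T \<ge> 1" "T\<^sup>2 > \<nu>" for T
  proof -
    have T0: "T > 0" using T by simp
    have W: "complex_of_real (J n T) * of_real (EY n T) - of_real (EJ n T) * of_real (Y n T) = of_real (2 / pi)"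
      using arg_cong[OF wronskian_Euler[OF T0, of n], of complex_of_real] by simp
    have 1: "1 = of_real (pi / 2) * (H n T * of_real (EY n T) - EH n T * of_real (Y n T))"
    proof -
      have "H n T * of_real (EY n T) - EH n T * of_real (Y n T) =
        of_real (J n T) * of_real (EY n T) - of_real (EJ n T) * of_real (Y n T)"
        unfolding H_eq EH_eq by (simp add: algebra_simps)
      then show ?thesis unfolding W by simp
    qed
    have 2: "\<i> = - of_real (pi / 2) * (H n T * of_real (EJ n T) - EH n T * of_real (J n T))"
    proof -
      have "H n T * of_real (EJ n T) - EH n T * of_real (J n T) =
        - \<i> * (of_real (J n T) * of_real (EY n T) - of_real (EJ n T) * of_real (Y n T))"
        unfolding H_eq EH_eq by (simp add: algebra_simps)
      then show ?thesis unfolding W by simp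
    qed
    \<comment> \<open>Mismatch between the true and the prescribed slope. It is of order T^(-1/2),
      as is H_n, and the errors of \<alpha> and \<beta> are products of the two, hence of order
      1/T.\<close>
    define E where "E = EH n T - \<kappa> T * H n T"
    have \<alpha>E: "\<alpha> T - 1 = of_real (pi / 2) * (E * of_real (Y n T))"
      by (subst 1) (simp add: \<alpha>_def E_def algebra_simps)
    have \<beta>E: "\<beta> T - \<i> = - of_real (pi / 2) * (E * of_real (J n T))"
      by (subst 2) (simp add: \<beta>_def E_def algebra_simps)
    have E: "E = of_real T * Hdef n T + (\<i> * of_real (T * (1 - Q T)) + 1 / 2) * H n T"
      unfolding E_def Hdef_def \<kappa>_def using T0 by (simp add: algebra_simps)
    have Qb: "0 \<le> T * (1 - Q T)" "T * (1 - Q T) \<le> \<nu>"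
    proof -
      have "\<nu> / T\<^sup>2 < 1" "\<nu> / T\<^sup>2 > 0" using T \<nu> T0 by simp_all
      then have q01: "0 \<le> 1 - \<nu> / T\<^sup>2" "1 - \<nu> / T\<^sup>2 \<le> 1" by auto
      have "Q T \<le> 1" unfolding Q_def using q01 by simp
      then show "0 \<le> T * (1 - Q T)" using T0 by simp
      have "1 - \<nu> / T\<^sup>2 \<le> Q T" unfolding Q_def
        by (rule real_le_rsqrt) (use q01 in \<open>simp add: power2_eq_square mult_left_le\<close>)
      then have "1 - Q T \<le> \<nu> / T\<^sup>2" by simp
      then have "T * (1 - Q T) \<le> T * (\<nu> / T\<^sup>2)" using T0 by (intro mult_left_mono) auto
      also have "\<dots> = \<nu> / T" using T0 by (simp add: power2_eq_square)
      also have "\<dots> \<le> \<nu> / 1" using T \<nu> by (intro divide_left_mono) auto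
      finally show "T * (1 - Q T) \<le> \<nu>" by simp
    qed
    define h where "h = cmod (H n T)"
    have h2: "h * h \<le> C\<^sup>2 / T"
    proof -
      have "(sqrt T * h) * (sqrt T * h) \<le> C * C"
        using C(1) C(2)[OF T(1)] T0 unfolding h_def by (intro mult_mono) auto
      also have "(sqrt T * h) * (sqrt T * h) = (sqrt T * sqrt T) * (h * h)" by (simp only: mult_ac)
      also have "sqrt T * sqrt T = T" using T0 by simp
      finally have "T * (h * h) \<le> C\<^sup>2" by (simp add: power2_eq_square)
      then show ?thesis using T0 by (simp add: field_simps)
    qed
    have dh: "T * cmod (Hdef n T) * h \<le> C\<^sup>2 / T"
    proof -
      have "(sqrt T * cmod (Hdef n T)) * (sqrt T * h) \<le> C / T * C"
        using C(2,3)[OF T(1)] T0 C(1) unfolding h_def by (intro mult_mono) auto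
      also have "(sqrt T * cmod (Hdef n T)) * (sqrt T * h) = (sqrt T * sqrt T) * (cmod (Hdef n T) * h)"
        by (simp only: mult_ac)
      also have "sqrt T * sqrt T = T" using T0 by simp
      finally show ?thesis by (simp add: power2_eq_square mult_ac)
    qed
    have "cmod (\<i> * of_real r + 1 / 2) \<le> r + 1 / 2" if "r \<ge> 0" for r
      using norm_triangle_ineq[of "\<i> * of_real r" "1 / 2"] that by (simp add: norm_mult)
    from this[OF Qb(1)] have k: "cmod (\<i> * of_real (T * (1 - Q T)) + 1 / 2) \<le> \<nu> + 1 / 2" using Qb by linarith
    have "cmod E \<le> T * cmod (Hdef n T) + cmod (\<i> * of_real (T * (1 - Q T)) + 1 / 2) * h"
      unfolding E h_def using norm_triangle_ineq T0 by (metis abs_of_pos norm_mult norm_of_real)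
    also have "\<dots> \<le> T * cmod (Hdef n T) + (\<nu> + 1 / 2) * h"
      using k by (intro add_left_mono mult_right_mono) (auto simp: h_def)
    finally have "cmod E * h \<le> (T * cmod (Hdef n T) + (\<nu> + 1 / 2) * h) * h"
      by (intro mult_right_mono) (auto simp: h_def)
    also have "\<dots> = T * cmod (Hdef n T) * h + (\<nu> + 1 / 2) * (h * h)" by (simp add: algebra_simps)
    also have "\<dots> \<le> C\<^sup>2 / T + (\<nu> + 1 / 2) * (C\<^sup>2 / T)"
      using \<nu> by (intro add_mono dh mult_left_mono h2) auto
    also have "\<dots> = (C\<^sup>2 + (\<nu> + 1 / 2) * C\<^sup>2) / T" by (simp add: add_divide_distrib)
    finally have "pi / 2 * (cmod E * h) \<le> pi / 2 * ((C\<^sup>2 + (\<nu> + 1 / 2) * C\<^sup>2) / T)"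
      by (intro mult_left_mono) auto
    then have Eh: "pi / 2 * (cmod E * h) \<le> M / T"
      unfolding M_def by (simp only: times_divide_eq_right)
    have "\<bar>Y n T\<bar> \<le> h" "\<bar>J n T\<bar> \<le> h"
      using abs_Re_le_cmod[of "H n T"] abs_Im_le_cmod[of "H n T"] by (simp_all add: h_def)
    then have "pi / 2 * (cmod E * \<bar>Y n T\<bar>) \<le> pi / 2 * (cmod E * h)" "pi / 2 * (cmod E * \<bar>J n T\<bar>) \<le> pi / 2 * (cmod E * h)"
      by (intro mult_left_mono; simp)+
    moreover have "cmod (\<alpha> T - 1) = pi / 2 * (cmod E * \<bar>Y n T\<bar>)" "cmod (\<beta> T - \<i>) = pi / 2 * (cmod E * \<bar>J n T\<bar>)"
      unfolding \<alpha>E \<beta>E norm_mult norm_minus_cancel by simp_all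
    ultimately show "cmod (\<alpha> T - 1) \<le> M / T" "cmod (\<beta> T - \<i>) \<le> M / T"
      using Eh by linarith+
  qed
  have "\<forall>\<^sub>F T in at_top. T > x \<and> T > 1 \<and> T > \<nu> + 1"
    by (intro eventually_conj eventually_gt_at_top)
  then have ev: "\<forall>\<^sub>F T in at_top. T > x \<and> T > 1 \<and> T\<^sup>2 > \<nu>"
  proof eventually_elim
    case (elim T)
    then have "T * 1 < T * T" by (intro mult_strict_left_mono) auto
    with elim show ?case unfolding power2_eq_square by linarith
  qed
  have M0: "((\<lambda>T. M / T) \<longlongrightarrow> 0) at_top" by real_asymp
  have "((\<lambda>T. \<alpha> T - 1) \<longlongrightarrow> 0) at_top"
    by (rule Lim_null_comparison[OF eventually_mono[OF ev] M0]) (use est in auto)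
  then have A: "(\<alpha> \<longlongrightarrow> 1) at_top" by (simp add: LIM_zero_iff)
  have "((\<lambda>T. \<beta> T - \<i>) \<longlongrightarrow> 0) at_top"
    by (rule Lim_null_comparison[OF eventually_mono[OF ev] M0]) (use est in auto)
  then have B: "(\<beta> \<longlongrightarrow> \<i>) at_top" by (simp add: LIM_zero_iff)
  have F: "((\<lambda>T. f T x) \<longlongrightarrow> H n x) at_top"
    unfolding f_def H_eq by (rule tendsto_eq_intros A B refl)+ simp
  have G: "((\<lambda>T. g T x) \<longlongrightarrow> EH n x) at_top"
    unfolding g_def EH_eq by (rule tendsto_eq_intros A B refl)+ simp
  have "((\<lambda>T. (cmod (f T x))\<^sup>2 + 2 * Re (cnj (f T x) * g T x)) \<longlongrightarrow>
      (cmod (H n x))\<^sup>2 + 2 * Re (cnj (H n x) * EH n x)) at_top"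
    by (intro tendsto_intros F G)
  then show ?thesis
  proof (rule tendsto_upperbound)
    show "\<forall>\<^sub>F T in at_top. (cmod (f T x))\<^sup>2 + 2 * Re (cnj (f T x) * g T x) \<le> 0"
      using ev by eventually_elim (blast intro: le)
  qed simp
qed

text \<open>Integrates \<open>hankel_modulus_decreasing\<close> from x to X.\<close>

lemma hankel_sqrt_mono:
  assumes n: "n \<ge> 1" and x: "0 < x" "x \<le> X"
  shows "sqrt X * cmod (H n X) \<le> sqrt x * cmod (H n x)"
proof -
  define P where "P x = x * ((J n x)\<^sup>2 + (Y n x)\<^sup>2)" for x
  have "P X \<le> P x"
  proof (rule DERIV_nonpos_imp_nonincreasing[OF x(2)])
    fix s assume s: "x \<le> s" "s \<le> X"
    have s0: "s > 0" using s x by simp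
    have "(P has_real_derivative (J n s)\<^sup>2 + (Y n s)\<^sup>2 + 2 * (J n s * EJ n s + Y n s * EY n s)) (at s)"
      unfolding P_def using J_has_deriv[OF s0, of n] Y_has_deriv[OF s0, of n] s0
      by (auto intro!: derivative_eq_intros simp: field_simps)
    moreover have "(J n s)\<^sup>2 + (Y n s)\<^sup>2 + 2 * (J n s * EJ n s + Y n s * EY n s) \<le> 0"
      using hankel_modulus_decreasing[OF n s0] by (simp add: cmod_power2)
    ultimately show "\<exists>y. (P has_real_derivative y) (at s) \<and> y \<le> 0" by blast
  qed
  moreover have "P x = (sqrt x * cmod (H n x))\<^sup>2" if "x > 0" for x
    using that by (simp add: P_def power_mult_distrib cmod_power2)
  ultimately have "(sqrt X * cmod (H n X))\<^sup>2 \<le> (sqrt x * cmod (H n x))\<^sup>2" using x by simp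
  then show ?thesis by (rule power2_le_imp_le) (use x in simp)
qed


subsection \<open>Bessel functions below the turning point\<close>

text \<open>Monotonicity from the origin, with a one-sided limit in place of the value at 0:
  derivatives are controlled only for positive arguments.\<close>

lemma ge_limit_at_0:
  fixes f :: "real \<Rightarrow> real"
  assumes t: "t > 0" and d: "\<And>s. 0 < s \<Longrightarrow> s \<le> t \<Longrightarrow> (f has_real_derivative f' s) (at s)"
    and pos: "\<And>s. 0 < s \<Longrightarrow> s < t \<Longrightarrow> f' s \<ge> 0" and lim: "(f \<longlongrightarrow> l) (at_right 0)"
  shows "l \<le> f t"
proof (rule tendsto_upperbound[OF lim])
  have "f s \<le> f t" if "s \<in> {0<..<t}" for s
  proof (rule DERIV_nonneg_imp_increasing_open[of s t f])
    show "continuous_on {s..t} f"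
      using that by (intro continuous_at_imp_continuous_on ballI DERIV_isCont[OF d]) auto
    show "\<exists>y. (f has_real_derivative y) (at u) \<and> 0 \<le> y" if "s < u" "u < t" for u
      using d[of u] pos[of u] that \<open>s \<in> {0<..<t}\<close> by (intro exI[of _ "f' u"]) auto
  qed (use that in auto)
  then show "\<forall>\<^sub>F s in at_right 0. f s \<le> f t"
    using eventually_at_right_real[OF t] by (auto elim!: eventually_mono)
qed simp

lemma le_limit_at_0:
  fixes f :: "real \<Rightarrow> real"
  assumes t: "t > 0" and d: "\<And>s. 0 < s \<Longrightarrow> s \<le> t \<Longrightarrow> (f has_real_derivative f' s) (at s)"
    and neg: "\<And>s. 0 < s \<Longrightarrow> s < t \<Longrightarrow> f' s \<le> 0" and lim: "(f \<longlongrightarrow> l) (at_right 0)"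
  shows "f t \<le> l"
proof -
  have "- l \<le> - f t"
    by (rule ge_limit_at_0[OF t, where f = "\<lambda>s. - f s" and f' = "\<lambda>s. - f' s"])
      (use d neg lim in \<open>auto intro!: DERIV_minus tendsto_minus\<close>)
  then show ?thesis by simp
qed

text \<open>A first point where positivity fails would exist by compactness, and the hypothesis
  \<open>step\<close> rules it out.\<close>

lemma positive_continuation:
  fixes g :: "real \<Rightarrow> real"
  assumes cont: "\<And>s. 0 < s \<Longrightarrow> s \<le> T \<Longrightarrow> isCont g s" and ev: "\<forall>\<^sub>F s in at_right 0. g s > 0"
    and step: "\<And>z. 0 < z \<Longrightarrow> z \<le> T \<Longrightarrow> (\<And>s. 0 < s \<Longrightarrow> s < z \<Longrightarrow> g s > 0) \<Longrightarrow> g z > 0"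
    and t: "0 < t" "t \<le> T"
  shows "g t > 0"
proof (rule ccontr)
  assume neg: "\<not> g t > 0"
  obtain c where c: "c > 0" "\<And>s. 0 < s \<Longrightarrow> s < c \<Longrightarrow> g s > 0"
    using ev unfolding eventually_at_right_field by auto
  define c' where "c' = min c t / 2"
  have c': "c' > 0" "c' < c" "c' < t" using c t by (auto simp: c'_def)
  have "closedin (top_of_set {c'..t}) ({c'..t} \<inter> g -` {..0})"
    using cont c' t by (intro continuous_closedin_preimage continuous_at_imp_continuous_on) auto
  then have "closed ({c'..t} \<inter> g -` {..0})" using closedin_closed_trans closed_atLeastAtMost by blast
  then have "compact ({c'..t} \<inter> g -` {..0})"
    by (metis compact_Int_closed compact_Icc inf.left_idem)
  moreover have "t \<in> {c'..t} \<inter> g -` {..0}" using neg c' by auto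
  ultimately obtain z where z: "z \<in> {c'..t} \<inter> g -` {..0}" "\<And>s. s \<in> {c'..t} \<inter> g -` {..0} \<Longrightarrow> z \<le> s"
    using compact_attains_inf[of "{c'..t} \<inter> g -` {..0}"] by blast
  have "g z > 0"
  proof (rule step)
    fix s assume s: "0 < s" "s < z"
    show "g s > 0"
    proof (cases "s < c")
      case False
      then have "s \<notin> {c'..t} \<inter> g -` {..0}" using z(2)[of s] s by auto
      then show ?thesis using False s z(1) c' by auto
    qed (use c s in auto)
  qed (use z c' t in auto)
  then show False using z by auto
qed

lemma tendsto_EJ_at_0: "(EJ n \<longlongrightarrow> 0) (at_right 0)"
proof -
  have "((\<lambda>x. real n * J n x - x * J (n + 1) x) \<longlongrightarrow> real n * (if n = 0 then 1 else 0) - 0 * (if n + 1 = 0 then 1 else 0)) (at_right 0)"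
    by (intro tendsto_intros tendsto_J_at_0)
  then show ?thesis by (simp add: EJ_def[abs_def] split: if_splits)
qed

lemma isCont_J: "x > 0 \<Longrightarrow> isCont (J n) x"
  using J_has_deriv DERIV_isCont by blast

lemma eventually_J_pos: "\<forall>\<^sub>F x in at_right 0. J n x > 0"
proof -
  have "\<forall>\<^sub>F x in at_right 0. bes n ((x / 2)\<^sup>2) > 0"
    by (rule order_tendstoD(1)[OF tendsto_bes_at_0]) simp
  then show ?thesis
    using eventually_at_right_less[of 0] by eventually_elim (simp add: besselJ_bes)
qed

lemma EJ_nonneg_aux:
  assumes t: "0 < t" "t \<le> real n" and p: "\<And>s. 0 < s \<Longrightarrow> s < t \<Longrightarrow> J n s > 0"
  shows "EJ n t \<ge> 0"
proof (rule ge_limit_at_0[OF t(1) EJ_has_deriv _ tendsto_EJ_at_0])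
  fix s assume s: "0 < s" "s < t"
  have "s * s \<le> real n * real n" using s t by (intro mult_mono) auto
  then have "(real n)\<^sup>2 / s - s \<ge> 0" using s by (simp add: field_simps power2_eq_square)
  then show "((real n)\<^sup>2 / s - s) * J n s \<ge> 0" using p[OF s] by simp
qed auto

text \<open>As long as J_n is positive on (0, z) with z \<le> n, the Euler derivative is nonnegative
  there, so J_n does not decrease and cannot return to zero at z.\<close>

lemma J_pos:
  assumes t: "0 < t" "t \<le> real n"
  shows "J n t > 0"
proof (rule positive_continuation[OF _ eventually_J_pos _ t])
  fix z assume z: "0 < z" "z \<le> real n" and p: "\<And>s. 0 < s \<Longrightarrow> s < z \<Longrightarrow> J n s > 0"
  have "J n (z / 2) \<le> J n z"
  proof (rule DERIV_nonneg_imp_increasing_open[where f = "J n" and a = "z / 2" and b = z])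
    fix s assume s: "z / 2 < s" "s < z"
    then have s0: "s > 0" using z by simp
    have "EJ n s \<ge> 0" by (rule EJ_nonneg_aux[OF s0]) (use s z p in auto)
    then show "\<exists>y. (J n has_real_derivative y) (at s) \<and> 0 \<le> y"
      using J_has_deriv[OF s0, of n] s0 by (auto intro!: exI conjI)
  next
    show "continuous_on {z / 2..z} (J n)"
      using z by (intro continuous_at_imp_continuous_on ballI isCont_J) auto
  qed (use z in auto)
  then show "J n z > 0" using p[of "z / 2"] z by simp
qed (auto intro: isCont_J)

lemma EJ_nonneg: "0 < t \<Longrightarrow> t \<le> real n \<Longrightarrow> EJ n t \<ge> 0"
  by (rule EJ_nonneg_aux) (auto intro: J_pos)

section \<open>The logarithmic derivative and its Riccati equation\<close>

definition psi :: "nat \<Rightarrow> real \<Rightarrow> real" where "psi n t = EJ n t / J n t"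

text \<open>J_n^2 times \<psi>^2 - n^2 + t^2, so the Riccati equation reads t \<psi>' = -
  \<open>QQ\<close> / J_n^2. Its derivative is simply 2 t J_n^2, which makes it nonnegative and easy
  to compare.\<close>

definition QQ :: "nat \<Rightarrow> real \<Rightarrow> real" where "QQ n t = (EJ n t)\<^sup>2 - ((real n)\<^sup>2 - t\<^sup>2) * (J n t)\<^sup>2"

lemma QQ_deriv: "t > 0 \<Longrightarrow> (QQ n has_real_derivative 2 * t * (J n t)\<^sup>2) (at t)"
  unfolding QQ_def[abs_def]
  by (auto intro!: derivative_eq_intros J_has_deriv EJ_has_deriv) (simp add: field_simps power2_eq_square)

lemma psi_deriv:
  assumes t: "0 < t" "t \<le> real n"
  shows "(psi n has_real_derivative - QQ n t / (t * (J n t)\<^sup>2)) (at t)"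
  unfolding psi_def[abs_def] using J_pos[OF t] t
  by (auto intro!: derivative_eq_intros J_has_deriv EJ_has_deriv simp: QQ_def)
    (simp add: field_simps power2_eq_square)

context
  fixes n :: nat
  assumes n: "n \<ge> 1"
begin

lemma tendsto_QQ_at_0: "(QQ n \<longlongrightarrow> 0) (at_right 0)"
proof -
  have "((\<lambda>t. (EJ n t)\<^sup>2 - ((real n)\<^sup>2 - t\<^sup>2) * (J n t)\<^sup>2) \<longlongrightarrow> 0\<^sup>2 - ((real n)\<^sup>2 - 0\<^sup>2) * 0\<^sup>2) (at_right 0)"
    using tendsto_J_at_0[of n] n by (intro tendsto_intros tendsto_EJ_at_0) auto
  then show ?thesis by (simp add: QQ_def[abs_def])
qed

lemma QQ_nonneg: "t > 0 \<Longrightarrow> QQ n t \<ge> 0"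
  by (rule ge_limit_at_0[OF _ QQ_deriv _ tendsto_QQ_at_0]) auto

text \<open>The upper bound is positivity of J_(n+1); the last bound is nonnegativity of
  \<open>QQ\<close>.\<close>

lemma psi_bounds:
  assumes t: "0 < t" "t \<le> real n"
  shows "0 \<le> psi n t" "psi n t \<le> n" "(real n)\<^sup>2 - t\<^sup>2 \<le> (psi n t)\<^sup>2"
proof -
  note p = J_pos[OF t]
  show "0 \<le> psi n t" using p EJ_nonneg[OF t] by (simp add: psi_def)
  have "J (n + 1) t > 0" by (rule J_pos) (use t in auto)
  then have "EJ n t \<le> n * J n t" using t by (simp add: EJ_def)
  then show "psi n t \<le> n" using p by (simp add: psi_def field_simps)
  have "((real n)\<^sup>2 - t\<^sup>2) * (J n t)\<^sup>2 \<le> (psi n t)\<^sup>2 * (J n t)\<^sup>2"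
    using QQ_nonneg[OF t(1)] p by (simp add: QQ_def psi_def power_divide)
  then show "(real n)\<^sup>2 - t\<^sup>2 \<le> (psi n t)\<^sup>2" using p by simp
qed

lemma psi_tendsto: "(psi n \<longlongrightarrow> n) (at_right 0)"
proof -
  have "((\<lambda>t. real n - t\<^sup>2 / 2 * (bes (n + 1) ((t / 2)\<^sup>2) / bes n ((t / 2)\<^sup>2))) \<longlongrightarrow>
      real n - 0\<^sup>2 / 2 * ((1 / fact (n + 1)) / (1 / fact n))) (at_right 0)"
    by (intro tendsto_intros tendsto_bes_at_0) simp_all
  moreover have "\<forall>\<^sub>F t in at_right 0. real n - t\<^sup>2 / 2 * (bes (n + 1) ((t / 2)\<^sup>2) / bes n ((t / 2)\<^sup>2)) = psi n t"
    using eventually_at_right_less[of 0] eventually_J_pos[of n]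
  proof eventually_elim
    case (elim t)
    then have b: "bes n ((t / 2)\<^sup>2) \<noteq> 0" by (auto simp: besselJ_bes)
    have "t * J (n + 1) t = t\<^sup>2 / 2 * ((t / 2) ^ n * bes (n + 1) ((t / 2)\<^sup>2))"
      unfolding besselJ_bes by (simp add: power2_eq_square)
    then have "t * J (n + 1) t / J n t =
        (t\<^sup>2 / 2 * ((t / 2) ^ n * bes (n + 1) ((t / 2)\<^sup>2))) / ((t / 2) ^ n * bes n ((t / 2)\<^sup>2))"
      by (simp only: besselJ_bes[of n])
    also have "\<dots> = t\<^sup>2 / 2 * (bes (n + 1) ((t / 2)\<^sup>2) / bes n ((t / 2)\<^sup>2))"
    proof -
      have "(t / 2) ^ n \<noteq> 0" using elim by simp
      then show ?thesis using b by (simp add: divide_simps)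
    qed
    finally have "t * J (n + 1) t / J n t = t\<^sup>2 / 2 * (bes (n + 1) ((t / 2)\<^sup>2) / bes n ((t / 2)\<^sup>2))" .
    then show ?case using elim by (simp add: psi_def EJ_def diff_divide_distrib)
  qed
  ultimately show ?thesis by (auto elim: Lim_transform_eventually)
qed

text \<open>The left-hand side minus the right-hand side has derivative \<open>- Q\<^sup>2 / (t J\<^sup>2)\<close> and vanishes at \<open>0\<close>.\<close>

lemma QQ_psi_le:
  assumes t: "0 < t" "t \<le> real n"
  shows "QQ n t * (psi n t + 1) \<le> t\<^sup>2 * (J n t)\<^sup>2"
proof -
  define F where "F t = QQ n t * (psi n t + 1) - t\<^sup>2 * (J n t)\<^sup>2" for t
  have dF: "(F has_real_derivative - ((QQ n s)\<^sup>2 / (s * (J n s)\<^sup>2))) (at s)" if s: "0 < s" "s \<le> t" for s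
  proof -
    have s': "s \<le> real n" using s t by simp
    note p = J_pos[OF s(1) s']
    have 1: "((\<lambda>t. t\<^sup>2 * (J n t)\<^sup>2) has_real_derivative 2 * s * (J n s)\<^sup>2 + 2 * s * J n s * EJ n s) (at s)"
      using s by (auto intro!: derivative_eq_intros J_has_deriv) (simp add: field_simps power2_eq_square)
    have "(F has_real_derivative 2 * s * (J n s)\<^sup>2 * (psi n s + 1) + (- QQ n s / (s * (J n s)\<^sup>2) + 0) * QQ n s
        - (2 * s * (J n s)\<^sup>2 + 2 * s * J n s * EJ n s)) (at s)"
      unfolding F_def by (intro DERIV_diff DERIV_mult DERIV_add DERIV_const QQ_deriv psi_deriv s s' 1)
    moreover have "2 * s * (J n s)\<^sup>2 * (psi n s + 1) + (- QQ n s / (s * (J n s)\<^sup>2) + 0) * QQ n s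
        - (2 * s * (J n s)\<^sup>2 + 2 * s * J n s * EJ n s) = - ((QQ n s)\<^sup>2 / (s * (J n s)\<^sup>2))"
    proof -
      have "EJ n s = psi n s * J n s" using p by (simp add: psi_def)
      then show ?thesis by (simp add: algebra_simps power2_eq_square)
    qed
    ultimately show ?thesis by (simp only:)
  qed
  have "(F \<longlongrightarrow> 0 * (real n + 1) - 0\<^sup>2 * 0\<^sup>2) (at_right 0)"
    unfolding F_def using tendsto_J_at_0[of n] n
    by (intro tendsto_intros tendsto_QQ_at_0 psi_tendsto) auto
  then have "F t \<le> 0"
    by (intro le_limit_at_0[OF t(1) dF]) auto
  then show ?thesis by (simp add: F_def)
qed

lemma psi_deriv_bound:
  assumes t: "0 < t" "t \<le> real n"
  shows "QQ n t / (t * (J n t)\<^sup>2) \<le> t / (psi n t + 1)"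
proof -
  have p: "J n t > 0" "psi n t + 1 > 0" using J_pos[OF t] psi_bounds(1)[OF t] by auto
  then show ?thesis using QQ_psi_le[OF t] t
    by (simp add: field_simps power2_eq_square)
qed

lemma psi_decreasing:
  assumes "0 < s" "s \<le> t" "t \<le> real n"
  shows "psi n t \<le> psi n s"
proof (rule DERIV_nonpos_imp_nonincreasing[OF assms(2)])
  fix u assume u: "s \<le> u" "u \<le> t"
  have "QQ n u / (u * (J n u)\<^sup>2) \<ge> 0" using QQ_nonneg[of u] u assms by simp
  then show "\<exists>y. (psi n has_real_derivative y) (at u) \<and> y \<le> 0"
    using psi_deriv[of u n] u assms by (intro exI[of _ "- QQ n u / (u * (J n u)\<^sup>2)"]) auto
qed

text \<open>By \<open>psi_deriv_bound\<close> the right side is nondecreasing in t, and it starts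
  from (n + 1)^2. At t = n it gives only \<psi> of order sqrt n, but that is enough to start the
  sharper argument.\<close>

lemma psi_plus_one_sq:
  assumes t: "0 < t" "t \<le> real n"
  shows "(real n + 1)\<^sup>2 \<le> (psi n t + 1)\<^sup>2 + t\<^sup>2"
proof (rule ge_limit_at_0[OF t(1), where f = "\<lambda>t. (psi n t + 1)\<^sup>2 + t\<^sup>2"])
  fix s assume s: "0 < s" "s \<le> t"
  then show "((\<lambda>t. (psi n t + 1)\<^sup>2 + t\<^sup>2) has_real_derivative
      2 * (psi n s + 1) * (- QQ n s / (s * (J n s)\<^sup>2)) + 2 * s) (at s)"
    using psi_deriv[of s n] t by (auto intro!: derivative_eq_intros)
next
  fix s assume s: "0 < s" "s < t"
  have p: "psi n s + 1 > 0" using psi_bounds(1)[of s] s t by simp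
  have "(psi n s + 1) * (QQ n s / (s * (J n s)\<^sup>2)) \<le> (psi n s + 1) * (s / (psi n s + 1))"
    using psi_deriv_bound[of s] s t p by (intro mult_left_mono) auto
  also have "\<dots> = s" using p by simp
  finally have "(psi n s + 1) * (QQ n s / (s * (J n s)\<^sup>2)) \<le> s" .
  moreover have "2 * (psi n s + 1) * (- QQ n s / (s * (J n s)\<^sup>2)) =
      - 2 * ((psi n s + 1) * (QQ n s / (s * (J n s)\<^sup>2)))"
    by simp
  ultimately show "0 \<le> 2 * (psi n s + 1) * (- QQ n s / (s * (J n s)\<^sup>2)) + 2 * s"
    by linarith
next
  have "((\<lambda>t. (psi n t + 1)\<^sup>2 + t\<^sup>2) \<longlongrightarrow> (real n + 1)\<^sup>2 + 0\<^sup>2) (at_right 0)"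
    by (intro tendsto_intros psi_tendsto)
  then show "((\<lambda>t. (psi n t + 1)\<^sup>2 + t\<^sup>2) \<longlongrightarrow> (real n + 1)\<^sup>2) (at_right 0)" by simp
qed

text \<open>The ratio is - \<psi>' / t. The sign of its derivative is exactly the inequality
  \<open>QQ_psi_le\<close>, so the slope of \<psi> can be estimated by its value at the turning
  point.\<close>

lemma QQ_ratio_increasing:
  assumes "0 < s" "s \<le> t" "t \<le> real n"
  shows "QQ n s / (s\<^sup>2 * (J n s)\<^sup>2) \<le> QQ n t / (t\<^sup>2 * (J n t)\<^sup>2)"
proof (rule DERIV_nonneg_imp_nondecreasing[OF assms(2)])
  fix u assume u: "s \<le> u" "u \<le> t"
  have u0: "u > 0" "u \<le> real n" using u assms by auto
  note p = J_pos[OF u0]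
  have 1: "((\<lambda>t. t\<^sup>2 * (J n t)\<^sup>2) has_real_derivative 2 * u * (J n u)\<^sup>2 + 2 * u * J n u * EJ n u) (at u)"
    using u0 by (auto intro!: derivative_eq_intros J_has_deriv) (simp add: field_simps power2_eq_square)
  have "((\<lambda>t. QQ n t / (t\<^sup>2 * (J n t)\<^sup>2)) has_real_derivative
      (2 * u * (J n u)\<^sup>2 * (u\<^sup>2 * (J n u)\<^sup>2) - QQ n u * (2 * u * (J n u)\<^sup>2 + 2 * u * J n u * EJ n u))
        / ((u\<^sup>2 * (J n u)\<^sup>2) * (u\<^sup>2 * (J n u)\<^sup>2))) (at u)"
    by (intro DERIV_divide QQ_deriv u0 1) (use p u0 in auto)
  moreover have "2 * u * (J n u)\<^sup>2 * (u\<^sup>2 * (J n u)\<^sup>2) - QQ n u * (2 * u * (J n u)\<^sup>2 + 2 * u * J n u * EJ n u)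
      = 2 * u * (J n u)\<^sup>2 * (u\<^sup>2 * (J n u)\<^sup>2 - QQ n u * (psi n u + 1))"
  proof -
    have "EJ n u = psi n u * J n u" using p by (simp add: psi_def)
    then show ?thesis by (simp add: algebra_simps power2_eq_square)
  qed
  moreover have "0 \<le> 2 * u * (J n u)\<^sup>2 * (u\<^sup>2 * (J n u)\<^sup>2 - QQ n u * (psi n u + 1)) / ((u\<^sup>2 * (J n u)\<^sup>2) * (u\<^sup>2 * (J n u)\<^sup>2))"
    using QQ_psi_le[OF u0] u0 by (intro divide_nonneg_nonneg mult_nonneg_nonneg) auto
  ultimately show "\<exists>y. ((\<lambda>t. QQ n t / (t\<^sup>2 * (J n t)\<^sup>2)) has_real_derivative y) (at u) \<and> 0 \<le> y"
    by (simp only:) blast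
qed

lemma psi_lipschitz:
  assumes d: "\<And>u. s \<le> u \<Longrightarrow> u \<le> t \<Longrightarrow> QQ n u / (u * (J n u)\<^sup>2) \<le> c" and st: "0 < s" "s \<le> t" "t \<le> real n"
  shows "psi n s - psi n t \<le> c * (t - s)"
proof -
  have "psi n s + c * s \<le> psi n t + c * t"
  proof (rule DERIV_nonneg_imp_nondecreasing[OF st(2), where f = "\<lambda>t. psi n t + c * t"])
    fix u assume u: "s \<le> u" "u \<le> t"
    have "((\<lambda>t. psi n t + c * t) has_real_derivative - QQ n u / (u * (J n u)\<^sup>2) + c * 1) (at u)"
      by (intro DERIV_add DERIV_cmult DERIV_ident psi_deriv) (use u st in auto)
    then show "\<exists>y. ((\<lambda>t. psi n t + c * t) has_real_derivative y) (at u) \<and> 0 \<le> y"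
      using d[OF u] by (intro exI conjI) (assumption, simp)
  qed
  then show ?thesis by (simp add: algebra_simps)
qed

text \<open>At t = n the slope of \<psi> is P^2 / n in modulus, with P = \<open>psi n n\<close>, and
  it is no larger to the left. So \<psi> is at most 2 P at distance n / P from n, whereas \<psi>^2
  \<ge> n^2 - t^2 makes it large there. Comparing the two forces P to be at least of order
  n^(2/3).\<close>

lemma psi_turning_large:
  assumes n4: "n \<ge> 4"
  shows "psi n n \<ge> 2" "(real n)\<^sup>2 * (2 * psi n n - 1) \<le> 4 * psi n n ^ 4"
proof -
  define P where "P = psi n n"
  have n0: "real n > 0" "real n \<le> real n" using n by auto
  have P0: "P \<ge> 0" using psi_bounds(1)[OF n0] by (simp add: P_def)
  have "2 * real n + 1 \<le> (P + 1)\<^sup>2"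
    using psi_plus_one_sq[OF n0] unfolding P_def by (simp add: power2_eq_square algebra_simps)
  moreover have "2 * real n + 1 \<ge> 3\<^sup>2" using n4 by simp
  ultimately have "3\<^sup>2 \<le> (P + 1)\<^sup>2" by linarith
  then have "3 \<le> P + 1" using P0 by (intro power2_le_imp_le[of 3 "P + 1"]) auto
  then show P2: "psi n n \<ge> 2" by (simp add: P_def)
  have P: "P \<ge> 2" using P2 by (simp add: P_def)
  \<comment> \<open>The distance n / P is such that the slope bound P^2 / n lets \<psi> grow by at
    most P.\<close>
  define t where "t = real n - real n / P"
  have t: "0 < t" "t \<le> real n" using P n0 by (auto simp: t_def field_simps)
  have "QQ n u / (u * (J n u)\<^sup>2) \<le> P\<^sup>2 / real n" if u: "t \<le> u" "u \<le> real n" for u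
  proof -
    have u0: "u > 0" using u t by simp
    have jn: "J n n > 0" using J_pos[of "real n" n] n0 by simp
    have "QQ n u / (u * (J n u)\<^sup>2) = u * (QQ n u / (u\<^sup>2 * (J n u)\<^sup>2))"
      using u0 by (simp add: power2_eq_square)
    also have "\<dots> \<le> real n * (QQ n n / ((real n)\<^sup>2 * (J n n)\<^sup>2))"
      using u u0 QQ_nonneg[of u] by (intro mult_mono QQ_ratio_increasing) auto
    also have "QQ n n = (EJ n n)\<^sup>2" by (simp add: QQ_def)
    also have "real n * ((EJ n n)\<^sup>2 / ((real n)\<^sup>2 * (J n n)\<^sup>2)) = P\<^sup>2 / real n"
      using n0 jn by (simp add: P_def psi_def field_simps power2_eq_square)
    finally show ?thesis .
  qed
  from psi_lipschitz[OF this t order_refl] have "psi n t \<le> P + P\<^sup>2 / real n * (real n - t)"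
    by (simp add: P_def)
  also have "\<dots> = 2 * P" using P n0 by (simp add: t_def power2_eq_square)
  finally have "(psi n t)\<^sup>2 \<le> (2 * P)\<^sup>2" using psi_bounds(1)[OF t] by (intro power_mono) auto
  with psi_bounds(3)[OF t] have "(real n)\<^sup>2 - t\<^sup>2 \<le> 4 * P\<^sup>2" by (simp add: power_mult_distrib)
  then have "((real n)\<^sup>2 - t\<^sup>2) * P\<^sup>2 \<le> 4 * P\<^sup>2 * P\<^sup>2" by (intro mult_right_mono) auto
  moreover have "((real n)\<^sup>2 - t\<^sup>2) * P\<^sup>2 = (real n)\<^sup>2 * (2 * P - 1)"
    using P by (simp add: t_def field_simps power2_eq_square)
  ultimately show "(real n)\<^sup>2 * (2 * psi n n - 1) \<le> 4 * psi n n ^ 4"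
    by (simp add: P_def[symmetric] power4_eq_xxxx power2_eq_square mult_ac)
qed

text \<open>The source of the exponent 1/3 and of the factor 3: a slope n / (P + 1) becomes at most
  3 (P + 1/2) (n + 1)^(-1/3). Both sides are cubed to avoid roots. For n \<ge> 4 one has n^2 \<le>
  (8/3) P^3, with room to spare.\<close>

lemma psi_turning: "real n * (real n + 1) powr (1/3) \<le> 3 * ((psi n n + 1) * (psi n n + 1/2))"
proof -
  define P where "P = psi n n"
  define K where "K = (P + 1) * (P + 1/2)"
  have n0: "real n > 0" "real n \<le> real n" using n by auto
  have P0: "P \<ge> 0" using psi_bounds(1)[OF n0] by (simp add: P_def)
  then have K0: "K > 0" by (simp add: K_def)
  have cube: "(real n) ^ 3 * (real n + 1) \<le> (3 * K) ^ 3"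
  proof (cases "n \<ge> 4")
    case True
    note P = psi_turning_large[OF True, folded P_def]
    have "(real n)\<^sup>2 * (3 / 2 * P) \<le> (real n)\<^sup>2 * (2 * P - 1)" using P(1) by (intro mult_left_mono) auto
    with P(2) have "(real n)\<^sup>2 * (3 / 2 * P) \<le> 4 * P ^ 4" by linarith
    then have "((real n)\<^sup>2 * (3 / 2)) * P \<le> (4 * P ^ 3) * P" by (simp add: power4_eq_xxxx power3_eq_cube mult_ac)
    then have "(real n)\<^sup>2 * (3 / 2) \<le> 4 * P ^ 3" using P(1) by simp
    then have "(real n)\<^sup>2 \<le> 8 / 3 * P ^ 3" by simp
    then have "(real n)\<^sup>2 * (real n)\<^sup>2 \<le> (8 / 3 * P ^ 3) * (8 / 3 * P ^ 3)"
      using P0 by (intro mult_mono) auto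
    then have n4: "(real n) ^ 4 \<le> 64 / 9 * (P * P) ^ 3" by (simp add: power4_eq_xxxx power2_eq_square power3_eq_cube mult_ac)
    have "real n + 1 \<le> 5 / 4 * real n" using True by simp
    then have "(real n) ^ 3 * (real n + 1) \<le> (real n) ^ 3 * (5 / 4 * real n)" by (intro mult_left_mono) auto
    also have "\<dots> = 5 / 4 * (real n) ^ 4" by (simp add: power4_eq_xxxx power3_eq_cube)
    also have "\<dots> \<le> 27 * (P * P) ^ 3" proof -
      have "0 \<le> (P * P) ^ 3" by simp
      with n4 show ?thesis by linarith
    qed
    also have "\<dots> = (3 * (P * P)) ^ 3" by (simp add: power_mult_distrib)
    also have "\<dots> \<le> (3 * K) ^ 3" unfolding K_def using P0 by (intro power_mono mult_left_mono mult_mono) auto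
    finally show ?thesis .
  next
    case False
    then have n3: "real n \<le> 3" by simp
    \<comment> \<open>For n \<le> 3 numbers suffice: P + 1 \<ge> 17/10 gives 3 K \<ge> 6, and 6^3
      exceeds 3^3 * 4.\<close>
    have "2 * real n + 1 \<le> (P + 1)\<^sup>2"
      using psi_plus_one_sq[OF n0] unfolding P_def by (simp add: power2_eq_square algebra_simps)
    then have "(17/10)\<^sup>2 \<le> (P + 1)\<^sup>2" using n by (simp add: power2_eq_square)
    then have P1: "17/10 \<le> P + 1" using P0 by (intro power2_le_imp_le[of "17/10" "P + 1"]) auto
    then have "17/10 * (12/10) \<le> K" unfolding K_def by (intro mult_mono) auto
    then have "(6::real) ^ 3 \<le> (3 * K) ^ 3" by (intro power_mono) auto
    moreover have "(real n) ^ 3 * (real n + 1) \<le> 3 ^ 3 * (3 + 1)"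
      using n3 by (intro mult_mono power_mono) auto
    ultimately show ?thesis by simp
  qed
  have "(real n * (real n + 1) powr (1/3)) ^ 3 = (real n) ^ 3 * ((real n + 1) powr (1/3)) ^ 3"
    by (rule power_mult_distrib)
  also have "((real n + 1) powr (1/3)) ^ 3 = real n + 1"
    by (simp add: powr_power)
  finally have "(real n * (real n + 1) powr (1/3)) ^ 3 \<le> (3 * K) ^ 3" using cube by simp
  then have "real n * (real n + 1) powr (1/3) \<le> 3 * K"
    using K0 power_mono_iff[of "real n * (real n + 1) powr (1/3)" "3 * K" 3] by simp
  then show ?thesis by (simp add: K_def P_def)
qed

text \<open>Slope bound on [x, t] combined with \<open>psi_turning\<close>; as \<psi> decreases, P
  may be replaced by \<psi>(t). The factor \<psi>(t) + 1/2 is kept because the lower bound for the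
  denominator supplies the same factor.\<close>

lemma psi_difference:
  assumes "0 < x" "x \<le> t" "t \<le> real n"
  shows "psi n x - psi n t \<le> (psi n t + 1/2) * (3 * (t - x) * (real n + 1) powr (- 1/3))"
proof -
  define P where "P = psi n n"
  have n0: "real n > 0" "real n \<le> real n" using n by auto
  have P0: "P \<ge> 0" using psi_bounds(1)[OF n0] by (simp add: P_def)
  have Pt: "P \<le> psi n t" unfolding P_def by (rule psi_decreasing) (use assms in auto)
  have "QQ n u / (u * (J n u)\<^sup>2) \<le> real n / (P + 1)" if u: "x \<le> u" "u \<le> t" for u
  proof -
    have "QQ n u / (u * (J n u)\<^sup>2) \<le> u / (psi n u + 1)"
      by (rule psi_deriv_bound) (use u assms in auto)
    also have "\<dots> \<le> real n / (P + 1)"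
      unfolding P_def using u assms psi_decreasing[of u "real n"] P0 P_def by (intro frac_le) auto
    finally show ?thesis .
  qed
  from psi_lipschitz[OF this assms] have 1: "psi n x - psi n t \<le> real n / (P + 1) * (t - x)" .
  have w: "(real n + 1) powr (1/3) * (real n + 1) powr (-1/3) = 1"
    unfolding powr_add[symmetric] by simp
  have "real n * ((real n + 1) powr (1/3) * (real n + 1) powr (-1/3)) \<le> 3 * ((P + 1) * (P + 1/2)) * (real n + 1) powr (-1/3)"
    using mult_right_mono[OF psi_turning, of "(real n + 1) powr (-1/3)"] unfolding P_def[symmetric] by (simp add: mult_ac)
  then have "real n \<le> (P + 1) * ((P + 1/2) * 3 * (real n + 1) powr (-1/3))" unfolding w by (simp add: mult_ac)
  then have "real n / (P + 1) \<le> (P + 1/2) * 3 * (real n + 1) powr (-1/3)"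
    using P0 by (simp add: field_simps)
  also have "\<dots> \<le> (psi n t + 1/2) * 3 * (real n + 1) powr (-1/3)"
    using Pt by (intro mult_right_mono) auto
  finally have "real n / (P + 1) * (t - x) \<le> (psi n t + 1/2) * 3 * (real n + 1) powr (-1/3) * (t - x)"
    using assms by (intro mult_right_mono) auto
  with 1 have "psi n x - psi n t \<le> (psi n t + 1/2) * 3 * (real n + 1) powr (-1/3) * (t - x)" by linarith
  then show ?thesis by (simp only: mult_ac minus_divide_left)
qed

end


subsection \<open>Bounds for the reflection coefficients\<close>

text \<open>The hypothesis \<open>eq\<close> is the matching relation b x D_n = - a x Re D_n with t
  = \<lambda> x. In terms of \<psi> the numerator is J_n(x) J_n(t) (\<psi>(x) - \<psi>(t)), and the
  denominator is at least J_n(t) (\<psi>(t) + 1/2) |H_n(x)|, so the factor \<psi>(t) + 1/2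
  cancels.\<close>

lemma reflection_bound:
  fixes a b :: complex
  assumes n: "n \<ge> 1" and xt: "0 < x" "x \<le> t" "t \<le> real n" and X: "x \<le> X"
    and eq: "b * (EH n x * of_real (J n t) - of_real (EJ n t) * H n x) =
      - a * of_real (EJ n x * J n t - EJ n t * J n x)"
  shows "cmod (b * H n X) \<le> 3 * (t - x) * (real n + 1) powr (-1/3) * sqrt (x / X) * cmod (a * of_real (J n x))"
proof -
  define w where "w = 3 * (t - x) * (real n + 1) powr (-1/3)"
  define D where "D = EH n x * of_real (J n t) - of_real (EJ n t) * H n x"
  have t0: "t > 0" "x \<le> real n" using xt by auto
  have jx: "J n x > 0" and jt: "J n t > 0" using J_pos[of x n] J_pos[of t n] xt t0 by auto
  have pt: "psi n t \<ge> 0" using psi_bounds(1)[OF n] t0 xt by auto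
  have Ex: "EJ n x = psi n x * J n x" and Et: "EJ n t = psi n t * J n t"
    using jx jt by (simp_all add: psi_def)
  define h where "h = cmod (H n x)"
  have h0: "h > 0" using hankel_nonzero[OF xt(1), of n] by (simp add: h_def)
  \<comment> \<open>Multiplying by the conjugate Hankel value exposes Re (cnj H_n * x H_n'), which
    the decreasing modulus bounds by - |H_n|^2 / 2. Both contributions are then negative and cannot
    cancel.\<close>
  have "Re (D * cnj (H n x)) = J n t * Re (cnj (H n x) * EH n x) - EJ n t * h\<^sup>2"
    unfolding D_def h_def cmod_power2 by (simp add: algebra_simps power2_eq_square)
  also have "\<dots> \<le> J n t * (- (h\<^sup>2 / 2)) - EJ n t * h\<^sup>2"
    using hankel_modulus_decreasing[OF n xt(1)] jt unfolding h_def[symmetric]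
    by (intro diff_right_mono mult_left_mono) auto
  also have "\<dots> = - (J n t * (psi n t + 1/2) * h\<^sup>2)" unfolding Et by (simp add: algebra_simps)
  finally have "J n t * (psi n t + 1/2) * h\<^sup>2 \<le> - Re (D * cnj (H n x))" by simp
  also have "\<dots> \<le> cmod (D * cnj (H n x))" using abs_Re_le_cmod[of "D * cnj (H n x)"] by linarith
  also have "\<dots> = cmod D * h" by (simp add: norm_mult h_def)
  finally have "(J n t * (psi n t + 1/2) * h) * h \<le> cmod D * h" by (simp add: power2_eq_square mult_ac)
  then have D: "J n t * (psi n t + 1/2) * h \<le> cmod D" using h0 by simp
  have d0: "0 \<le> psi n x - psi n t" using psi_decreasing[OF n xt] by simp
  have "cmod b * cmod D = cmod a * \<bar>EJ n x * J n t - EJ n t * J n x\<bar>"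
    using arg_cong[OF eq, of cmod] unfolding D_def[symmetric] by (simp only: norm_mult norm_minus_cancel norm_of_real)
  also have "EJ n x * J n t - EJ n t * J n x = J n t * (J n x * (psi n x - psi n t))"
    unfolding Ex Et by (simp add: algebra_simps)
  also have "\<bar>\<dots>\<bar> = J n t * (J n x * (psi n x - psi n t))" using jx jt d0 by simp
  also have "\<dots> \<le> J n t * (J n x * ((psi n t + 1/2) * w))"
    using psi_difference[OF n xt] jx jt unfolding w_def by (intro mult_left_mono) auto
  finally have 1: "cmod b * cmod D \<le> cmod a * (J n t * (J n x * ((psi n t + 1/2) * w)))"
    by (simp add: mult_left_mono)
  have "(J n t * (psi n t + 1/2)) * (cmod b * h) \<le> cmod b * cmod D"
    using mult_left_mono[OF D, of "cmod b"] by (simp add: mult_ac)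
  also note 1
  also have "cmod a * (J n t * (J n x * ((psi n t + 1/2) * w))) = (J n t * (psi n t + 1/2)) * (w * (cmod a * J n x))"
    by (simp only: mult_ac)
  finally have bh: "cmod b * h \<le> w * (cmod a * J n x)"
    by (rule mult_left_le_imp_le) (use jt pt in simp)
  have X0: "X > 0" using xt X by simp
  \<comment> \<open>Transport from the interface to the outer circle; the ratio x / X is \<epsilon>
    / R in the application.\<close>
  have "cmod (H n X) \<le> sqrt (x / X) * h"
    using hankel_sqrt_mono[OF n xt(1) X] X0 unfolding h_def
    by (simp add: real_sqrt_divide field_simps)
  then have "cmod (b * H n X) \<le> cmod b * (sqrt (x / X) * h)"
    unfolding norm_mult by (intro mult_left_mono) auto
  also have "\<dots> = sqrt (x / X) * (cmod b * h)" by simp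
  also have "\<dots> \<le> sqrt (x / X) * (w * (cmod a * J n x))"
    using bh xt X0 by (intro mult_left_mono) auto
  also have "\<dots> = 3 * (t - x) * (real n + 1) powr (-1/3) * sqrt (x / X) * cmod (a * of_real (J n x))"
    using jx unfolding w_def by (simp add: norm_mult)
  finally show ?thesis .
qed

section \<open>The mode of order zero\<close>

lemma J0_bounds:
  assumes t: "0 < t" "t \<le> 1"
  shows "J 0 t \<le> 1" "1 - t\<^sup>2 / 4 \<le> J 0 t" "- (t\<^sup>2 / 2) \<le> EJ 0 t" "EJ 0 t \<le> 0"
proof -
  \<comment> \<open>The bounds bootstrap from here: J_1 > 0 makes J_0 decrease from 1, then J_0
    \<le> 1 bounds the Euler derivative below by - s^2 / 2, and integrating once more bounds J_0
    below.\<close>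
  have EJ0: "EJ 0 s \<le> 0" if "0 < s" "s \<le> 1" for s
    using J_pos[of s 1] that by (simp add: EJ_def)
  have J01: "J 0 s \<le> 1" if s: "0 < s" "s \<le> 1" for s
  proof (rule le_limit_at_0[OF s(1) J_has_deriv])
    show "EJ 0 u / u \<le> 0" if "0 < u" "u < s" for u
      using EJ0[of u] that s by (simp add: divide_nonpos_pos)
    show "(J 0 \<longlongrightarrow> 1) (at_right 0)" using tendsto_J_at_0[of 0] by simp
  qed auto
  have EJ1: "0 \<le> EJ 0 s + s\<^sup>2 / 2" if s: "0 < s" "s \<le> 1" for s
  proof (rule ge_limit_at_0[OF s(1), where f = "\<lambda>s. EJ 0 s + s\<^sup>2 / 2"])
    show "((\<lambda>s. EJ 0 s + s\<^sup>2 / 2) has_real_derivative ((real 0)\<^sup>2 / u - u) * J 0 u + u) (at u)" if "0 < u" "u \<le> s" for u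
      using EJ_has_deriv[OF that(1), of 0] by (auto intro!: derivative_eq_intros)
    show "0 \<le> ((real 0)\<^sup>2 / u - u) * J 0 u + u" if u: "0 < u" "u < s" for u
      using mult_left_mono[OF J01[of u], of u] u s by simp
    have "((\<lambda>s. EJ 0 s + s\<^sup>2 / 2) \<longlongrightarrow> 0 + 0\<^sup>2 / 2) (at_right 0)"
      by (intro tendsto_intros tendsto_EJ_at_0) simp
    then show "((\<lambda>s. EJ 0 s + s\<^sup>2 / 2) \<longlongrightarrow> 0) (at_right 0)" by simp
  qed
  show "J 0 t \<le> 1" "EJ 0 t \<le> 0" by (rule J01 EJ0; fact)+
  show "- (t\<^sup>2 / 2) \<le> EJ 0 t" using EJ1[OF t] by simp
  have "1 \<le> J 0 t + t\<^sup>2 / 4"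
  proof (rule ge_limit_at_0[OF t(1), where f = "\<lambda>s. J 0 s + s\<^sup>2 / 4"])
    show "((\<lambda>s. J 0 s + s\<^sup>2 / 4) has_real_derivative EJ 0 u / u + u / 2) (at u)" if "0 < u" "u \<le> t" for u
      using J_has_deriv[OF that(1), of 0] by (auto intro!: derivative_eq_intros)
    show "0 \<le> EJ 0 u / u + u / 2" if u: "0 < u" "u < t" for u
      using EJ1[of u] u t by (simp add: field_simps power2_eq_square)
    have "((\<lambda>s. J 0 s + s\<^sup>2 / 4) \<longlongrightarrow> 1 + 0\<^sup>2 / 4) (at_right 0)"
      using tendsto_J_at_0[of 0] by (intro tendsto_intros) simp_all
    then show "((\<lambda>s. J 0 s + s\<^sup>2 / 4) \<longlongrightarrow> 1) (at_right 0)" by simp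
  qed
  then show "1 - t\<^sup>2 / 4 \<le> J 0 t" by simp
qed

lemma tendsto_EY0_at_0: "(EY 0 \<longlongrightarrow> 2 / pi) (at_right 0)"
  using tendsto_minus[OF tendsto_x_Y1_at_0] by (simp add: EY_def[abs_def])

lemma x_ln_bound:
  fixes x :: real
  assumes "0 < x"
  shows "- (x * ln x) \<le> 1 / 2"
proof -
  have "ln (1 / sqrt x) \<le> 1 / sqrt x - 1" using assms by (intro ln_le_minus_one) simp
  moreover have "ln (1 / sqrt x) = - (ln x / 2)" using assms by (simp add: ln_div ln_sqrt)
  ultimately have "x * (- ln x) \<le> x * (2 * (1 / sqrt x - 1))" using assms by (intro mult_left_mono) auto
  also have "\<dots> = 2 * sqrt x - 2 * (sqrt x * sqrt x)"
  proof -
    have "x / sqrt x = sqrt x" using assms by (rule real_div_sqrt[OF less_imp_le])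
    moreover have "x * (2 * (1 / sqrt x - 1)) = 2 * (x / sqrt x) - 2 * x" by (simp add: algebra_simps)
    ultimately have "x * (2 * (1 / sqrt x - 1)) = 2 * sqrt x - 2 * x" by (simp only:)
    then show ?thesis using assms by simp
  qed
  also have "\<dots> \<le> 1 / 2" using zero_le_square[of "sqrt x - 1/2"] by (simp add: algebra_simps)
  finally show ?thesis by simp
qed

text \<open>While Y_0 is negative, x Y_0' increases because its derivative is - x Y_0. It therefore
  stays above its limit 2/pi, and Y_0 minus its logarithmic part increases as well.\<close>

lemma Y0_lower_aux:
  assumes z: "0 < z" and neg: "\<And>s. 0 < s \<Longrightarrow> s < z \<Longrightarrow> Y 0 s < 0"
  shows "2 / pi \<le> EY 0 z" "2 / pi * (ln (z / 2) + euler_mascheroni) \<le> Y 0 z"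
proof -
  have 1: "2 / pi \<le> EY 0 s" if s: "0 < s" "s \<le> z" for s
  proof (rule ge_limit_at_0[OF s(1) EY_has_deriv _ tendsto_EY0_at_0])
    show "0 \<le> ((real 0)\<^sup>2 / u - u) * Y 0 u" if "0 < u" "u < s" for u
      using neg[of u] that s by (simp add: mult_nonneg_nonpos)
  qed auto
  then show "2 / pi \<le> EY 0 z" using z by simp
  have "0 \<le> Y 0 z - 2 / pi * (ln (z / 2) + euler_mascheroni)"
  proof (rule ge_limit_at_0[OF z _ _ tendsto_Y0_at_0])
    show "((\<lambda>s. Y 0 s - 2 / pi * (ln (s / 2) + euler_mascheroni)) has_real_derivative EY 0 u / u - 2 / pi * (1 / u)) (at u)"
      if "0 < u" "u \<le> z" for u
      using Y_has_deriv[OF that(1), of 0] that by (auto intro!: derivative_eq_intros)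
    show "0 \<le> EY 0 u / u - 2 / pi * (1 / u)" if "0 < u" "u < z" for u
      using 1[of u] that by (simp add: field_simps)
  qed
  then show "2 / pi * (ln (z / 2) + euler_mascheroni) \<le> Y 0 z" by simp
qed

lemma euler_ln2_bounds:
  "ln 2 - euler_mascheroni \<le> (3/25 :: real)" "(euler_mascheroni :: real) < 3/5" "(2/3::real) \<le> ln 2"
  "ln 2 - euler_mascheroni \<ge> (0::real)"
  using ln2_le_25_over_36 ln2_ge_two_thirds euler_mascheroni_gt_19_over_33 euler_mascheroni_less_13_over_22
  by linarith+

text \<open>Continuation of negativity from the origin. As long as it holds, the lower bound of
  \<open>Y0_lower_aux\<close> controls - s Y_0, hence x Y_0' from above, hence Y_0 from above by
  (2/pi) (ln (z/2) + \<gamma> + 3 z / 5), which is negative for z \<le> 1/2.\<close>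

lemma Y0_neg:
  assumes x: "0 < x" "x \<le> 1/2"
  shows "Y 0 x < 0"
proof -
  have "- Y 0 x > 0"
  proof (rule positive_continuation[where g = "\<lambda>x. - Y 0 x", OF _ _ _ x])
    show "isCont (\<lambda>x. - Y 0 x) s" if "0 < s" for s
      using DERIV_isCont[OF Y_has_deriv[OF that, of 0]] by (intro continuous_intros)
    show "\<forall>\<^sub>F s in at_right 0. 0 < - Y 0 s"
    proof -
      have "\<forall>\<^sub>F s in at_right 0. Y 0 s - 2 / pi * (ln (s / 2) + euler_mascheroni) < 1"
        by (rule order_tendstoD(2)[OF tendsto_Y0_at_0]) simp
      moreover have "\<forall>\<^sub>F s in at_right 0. 2 / pi * (ln (s / 2) + c) < - 1" for c :: real
        by real_asymp
      then have "\<forall>\<^sub>F s in at_right 0. 2 / pi * (ln (s / 2) + euler_mascheroni) < - 1" .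
      ultimately show ?thesis by eventually_elim linarith
    qed
    fix z :: real assume z: "0 < z" "z \<le> 1/2" and "\<And>s. 0 < s \<Longrightarrow> s < z \<Longrightarrow> 0 < - Y 0 s"
    then have neg: "Y 0 s < 0" if "0 < s" "s < z" for s using that by (metis neg_0_less_iff_less)
    have low: "2 / pi * (ln (s / 2) + euler_mascheroni) \<le> Y 0 s" if s: "0 < s" "s < z" for s
      by (rule Y0_lower_aux(2)[OF s(1)]) (use neg s in auto)
    have up: "EY 0 s \<le> 2 / pi * (1 + 3/5 * s)" if s: "0 < s" "s < z" for s
    proof -
      have "EY 0 s - 2 / pi * (3/5) * s \<le> 2 / pi"
      proof (rule le_limit_at_0[OF s(1), where f = "\<lambda>s. EY 0 s - 2 / pi * (3/5) * s"])
        show "((\<lambda>s. EY 0 s - 2 / pi * (3/5) * s) has_real_derivative ((real 0)\<^sup>2 / u - u) * Y 0 u - 2 / pi * (3/5)) (at u)"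
          if "0 < u" "u \<le> s" for u
          using EY_has_deriv[OF that(1), of 0] by (auto intro!: derivative_eq_intros)
        show "((real 0)\<^sup>2 / u - u) * Y 0 u - 2 / pi * (3/5) \<le> 0" if u: "0 < u" "u < s" for u
        proof -
          have "u * (2 / pi * (ln (u / 2) + euler_mascheroni)) \<le> u * Y 0 u"
            using low[of u] u s by (intro mult_left_mono) auto
          moreover have "u * (2 / pi * (ln (u / 2) + euler_mascheroni)) = 2 / pi * (u * ln u - u * (ln 2 - euler_mascheroni))"
          proof -
            have "u * (c * ((l - m) + g)) = c * (u * l - u * (m - g))" for c l m g :: real
              by (simp add: algebra_simps)
            moreover have "ln (u / 2) = ln u - ln 2" using u by (simp add: ln_div)
            ultimately show ?thesis by (simp only:)
          qed
          \<comment> \<open>The constant 3/5 has room: 1/2 bounds - u ln u, and 3/50 bounds this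
            term.\<close>
          moreover have "u * (ln 2 - euler_mascheroni) \<le> 1/2 * (3/25)"
            using euler_ln2_bounds u s z by (intro mult_mono) auto
          then have "- (3/5) \<le> u * ln u - u * (ln 2 - euler_mascheroni)"
            using x_ln_bound[OF u(1)] by simp
          then have "2 / pi * (- (3/5)) \<le> 2 / pi * (u * ln u - u * (ln 2 - euler_mascheroni))"
            by (intro mult_left_mono) auto
          ultimately have "2 / pi * (- (3/5)) \<le> u * Y 0 u" by linarith
          then show ?thesis by simp
        qed
        have "((\<lambda>s. EY 0 s - 2 / pi * (3/5) * s) \<longlongrightarrow> 2 / pi - 2 / pi * (3/5) * 0) (at_right 0)"
          by (intro tendsto_intros tendsto_EY0_at_0)
        then show "((\<lambda>s. EY 0 s - 2 / pi * (3/5) * s) \<longlongrightarrow> 2 / pi) (at_right 0)" by simp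
      qed
      then show ?thesis by (simp add: algebra_simps)
    qed
    have "(Y 0 z - 2 / pi * (ln (z / 2) + euler_mascheroni)) - 2 / pi * (3/5) * z \<le> 0"
    proof (rule le_limit_at_0[OF z(1), where f = "\<lambda>z. (Y 0 z - 2 / pi * (ln (z / 2) + euler_mascheroni)) - 2 / pi * (3/5) * z"])
      show "((\<lambda>z. (Y 0 z - 2 / pi * (ln (z / 2) + euler_mascheroni)) - 2 / pi * (3/5) * z) has_real_derivative
          (EY 0 s / s - 2 / pi * (1 / s)) - 2 / pi * (3/5)) (at s)" if "0 < s" "s \<le> z" for s
        using Y_has_deriv[OF that(1), of 0] that by (auto intro!: derivative_eq_intros simp: mult.commute)
      show "(EY 0 s / s - 2 / pi * (1 / s)) - 2 / pi * (3/5) \<le> 0" if s: "0 < s" "s < z" for s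
      proof -
        have "EY 0 s / s \<le> 2 / pi * (1 + 3/5 * s) / s"
          using up[OF s] s by (intro divide_right_mono) auto
        also have "\<dots> = 2 / pi * (1 / s) + 2 / pi * (3/5)" using s by (simp add: field_simps)
        finally show ?thesis by simp
      qed
      have "((\<lambda>z. (Y 0 z - 2 / pi * (ln (z / 2) + euler_mascheroni)) - 2 / pi * (3/5) * z) \<longlongrightarrow> 0 - 2 / pi * (3/5) * 0) (at_right 0)"
        by (intro tendsto_diff tendsto_Y0_at_0 tendsto_mult tendsto_const tendsto_ident_at)
      then show "((\<lambda>z. (Y 0 z - 2 / pi * (ln (z / 2) + euler_mascheroni)) - 2 / pi * (3/5) * z) \<longlongrightarrow> 0) (at_right 0)" by simp
    qed
    then have "Y 0 z \<le> 2 / pi * (ln (z / 2) + euler_mascheroni + 3/5 * z)" by (simp add: algebra_simps)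
    also have "ln (z / 2) + euler_mascheroni + 3/5 * z < 0"
    proof -
      have "ln (z / 2) \<le> ln (1 / (2 * 2))" using z by (subst ln_le_cancel_iff) auto
      also have "ln (1 / (2 * 2 :: real)) = - ln (2 ^ 2)" by (simp add: ln_div)
      also have "ln (2 ^ 2 :: real) = 2 * ln 2" by (subst ln_realpow) simp_all
      finally show ?thesis using euler_ln2_bounds z by linarith
    qed
    then have "2 / pi * (ln (z / 2) + euler_mascheroni + 3/5 * z) < 0"
      by (intro mult_pos_neg) simp_all
    finally show "0 < - Y 0 z" by simp
  qed
  then show ?thesis by simp
qed

text \<open>Here t / x = \<lambda>. Only the imaginary part of the denominator is used: the term
  with J_0(t) is positive, the one with Y_0(x) may be negative and contains ln x. Writing ln x
  through ln (t/x) and ln t, the hypothesis on t^2 (ln (t/x) + 1) keeps the sum above (2/pi) (2/5).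
  With the numerator bound 17/16 this gives 17/4, rounded up to 5.\<close>

lemma reflection_bound_0:
  fixes a b :: complex
  assumes x: "0 < x" "x < 1/2" and t: "x \<le> t" "t\<^sup>2 * (ln (t / x) + 1) < 1"
    and eq: "b * (EH 0 x * of_real (J 0 t) - of_real (EJ 0 t) * H 0 x) =
      - a * of_real (EJ 0 x * J 0 t - EJ 0 t * J 0 x)"
  shows "cmod b \<le> 5 * (t * (t - x)) * cmod a"
proof -
  have t0: "t > 0" using x t by simp
  have lnr: "ln (t / x) \<ge> 0" using x t by simp
  then have "t\<^sup>2 * 1 \<le> t\<^sup>2 * (ln (t / x) + 1)" by (intro mult_left_mono) auto
  with t have "t\<^sup>2 < 1\<^sup>2" by simp
  then have t1: "t < 1" using power2_less_imp_less[of t 1] by simp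
  note Bt = J0_bounds[OF t0 less_imp_le[OF t1]]
  have x1: "x \<le> 1" using x by simp
  note Bx = J0_bounds[OF x(1) x1]
  define D where "D = EH 0 x * of_real (J 0 t) - of_real (EJ 0 t) * H 0 x"
  \<comment> \<open>The numerator as a function of the interior argument. It vanishes at s = x, so a
    bound on its derivative yields the factor t^2 - x^2; the two terms of the derivative are at most
    s and s / 16.\<close>
  define R where "R s = EJ 0 x * J 0 s - EJ 0 s * J 0 x" for s
  have "R t \<le> 17/32 * (t\<^sup>2 - x\<^sup>2) \<and> 0 \<le> R t"
  proof -
    have dR: "(R has_real_derivative EJ 0 x * (EJ 0 s / s) + s * J 0 s * J 0 x) (at s)" if "s > 0" for s
      unfolding R_def using J_has_deriv[OF that, of 0] EJ_has_deriv[OF that, of 0]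
      by (auto intro!: derivative_eq_intros)
    have rng: "0 \<le> EJ 0 x * (EJ 0 s / s) + s * J 0 s * J 0 x \<and> EJ 0 x * (EJ 0 s / s) + s * J 0 s * J 0 x \<le> 17/16 * s"
      if s: "x \<le> s" "s \<le> t" for s
    proof -
      have s0: "0 < s" "s \<le> 1" using s x t1 by auto
      note Bs = J0_bounds[OF s0]
      have J0p: "0 \<le> J 0 s" "0 \<le> J 0 x"
      proof -
        have "s * s \<le> 1 * 1" "x * x \<le> 1 * 1" using s0 x by (intro mult_mono; simp)+
        then show "0 \<le> J 0 s" "0 \<le> J 0 x" using Bs(2) Bx(2) by (simp_all add: power2_eq_square)
      qed
      have 1: "0 \<le> EJ 0 x * (EJ 0 s / s)"
        by (rule mult_nonpos_nonpos[OF Bx(4) divide_nonpos_pos[OF Bs(4) s0(1)]])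
      have "(- EJ 0 x) * (- EJ 0 s / s) \<le> 1/8 * (s / 2)"
      proof (intro mult_mono)
        have "x * x \<le> 1/2 * (1/2)" using x by (intro mult_mono) auto
        then show "- EJ 0 x \<le> 1/8" using Bx(3) by (simp add: power2_eq_square)
        show "- EJ 0 s / s \<le> s / 2" using Bs(3) s0 by (simp add: field_simps power2_eq_square)
      qed (use divide_nonpos_pos[OF Bs(4) s0(1)] s0 in auto)
      then have 2: "EJ 0 x * (EJ 0 s / s) \<le> s / 16" by simp
      have "s * J 0 s * J 0 x \<le> s * 1 * 1" using Bs(1) Bx(1) J0p s0 by (intro mult_mono) auto
      moreover have "0 \<le> s * J 0 s * J 0 x" using J0p s0 by simp
      ultimately show ?thesis using 1 2 by simp
    qed
    have "R x \<le> R t"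
    proof (rule DERIV_nonneg_imp_nondecreasing[OF t(1)])
      fix s assume "x \<le> s" "s \<le> t"
      with rng[of s] dR[of s] x show "\<exists>y. (R has_real_derivative y) (at s) \<and> 0 \<le> y" by force
    qed
    moreover have "R t - 17/32 * t\<^sup>2 \<le> R x - 17/32 * x\<^sup>2"
    proof (rule DERIV_nonpos_imp_nonincreasing[OF t(1), where f = "\<lambda>s. R s - 17/32 * s\<^sup>2"])
      fix s assume s: "x \<le> s" "s \<le> t"
      have "((\<lambda>s. R s - 17/32 * s\<^sup>2) has_real_derivative EJ 0 x * (EJ 0 s / s) + s * J 0 s * J 0 x - 17/16 * s) (at s)"
        using dR[of s] s x by (auto intro!: derivative_eq_intros)
      with rng[OF s] show "\<exists>y. ((\<lambda>s. R s - 17/32 * s\<^sup>2) has_real_derivative y) (at s) \<and> y \<le> 0"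
        by (intro exI conjI) (assumption, simp)
    qed
    moreover have "R x = 0" by (simp add: R_def)
    ultimately show ?thesis by (simp add: algebra_simps)
  qed
  moreover have "t\<^sup>2 - x\<^sup>2 \<le> 2 * t * (t - x)"
    using zero_le_square[of "t - x"] by (simp add: power2_eq_square algebra_simps)
  ultimately have R: "0 \<le> R t" "R t \<le> 17/16 * (t * (t - x))" by simp_all
  have Yx: "2 / pi \<le> EY 0 x" "2 / pi * (ln (x / 2) + euler_mascheroni) \<le> Y 0 x"
    using Y0_lower_aux[OF x(1)] Y0_neg x by auto
  have "2 / pi * (2/5) \<le> 2 / pi * (J 0 t + (- EJ 0 t) * (ln (x / 2) + euler_mascheroni))"
  proof (intro mult_left_mono)
    define L where "L = - (ln (x / 2) + euler_mascheroni)"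
    \<comment> \<open>The term ln (t / x) is handled by the hypothesis, and t ln t is harmless since
      t < 1.\<close>
    have L: "L = ln 2 - euler_mascheroni + ln (t / x) - ln t" using x t0 by (simp add: L_def ln_div)
    have "ln (t / x) \<ge> 0" "ln t \<le> 0" using lnr t1 t0 by auto
    then have L0: "L \<ge> 0" using L euler_ln2_bounds(4) by linarith
    have "(- EJ 0 t) * L \<le> t\<^sup>2 / 2 * L" using Bt(3) L0 by (intro mult_right_mono) auto
    also have "\<dots> = (t\<^sup>2 * (ln 2 - euler_mascheroni) + t\<^sup>2 * ln (t / x) + t * (- (t * ln t))) / 2"
      unfolding L by (simp add: algebra_simps power2_eq_square)
    also have "\<dots> \<le> (t\<^sup>2 * (3/25) + (1 - t\<^sup>2) + (t - t\<^sup>2)) / 2"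
    proof -
      have 1: "t\<^sup>2 * (ln 2 - euler_mascheroni) \<le> t\<^sup>2 * (3/25)"
        by (rule mult_left_mono[OF euler_ln2_bounds(1)]) simp
      have 2: "t\<^sup>2 * ln (t / x) \<le> 1 - t\<^sup>2" using t(2) by (simp add: algebra_simps)
      have "ln (1 / t) \<le> 1 / t - 1" using t0 by (intro ln_le_minus_one) simp
      then have "t * (t * (- ln t)) \<le> t * (t * (1 / t - 1))"
        using t0 by (intro mult_left_mono) (auto simp: ln_div)
      moreover have "t * (t * (1 / t - 1)) = t - t\<^sup>2"
        using t0 by (simp add: right_diff_distrib power2_eq_square)
      ultimately have 3: "t * (- (t * ln t)) \<le> t - t\<^sup>2" by simp
      from 1 2 3 show ?thesis by (intro divide_right_mono add_mono) auto
    qed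
    finally have "J 0 t - (- EJ 0 t) * L \<ge> (1 - t\<^sup>2 / 4) - (t\<^sup>2 * (3/25) + (1 - t\<^sup>2) + (t - t\<^sup>2)) / 2"
      using Bt(2) by linarith
    also have "(1 - t\<^sup>2 / 4) - (t\<^sup>2 * (3/25) + (1 - t\<^sup>2) + (t - t\<^sup>2)) / 2 \<ge> 2/5"
    proof -
      \<comment> \<open>25/69 is the minimiser of the quadratic 1/2 - t/2 + (69/100) t^2 that is
        left; its minimum exceeds 2/5.\<close>
      have "0 \<le> (t - 25/69)\<^sup>2" by simp
      also have "(t - 25/69)\<^sup>2 = t\<^sup>2 - 50/69 * t + 625/4761" by (simp add: power2_eq_square algebra_simps)
      finally have "50/69 * t \<le> t\<^sup>2 + 625/4761" by simp
      then show ?thesis by (simp add: field_simps)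
    qed
    finally show "2/5 \<le> J 0 t + (- EJ 0 t) * (ln (x / 2) + euler_mascheroni)"
      by (simp add: L_def algebra_simps)
  qed auto
  also have "\<dots> = 2 / pi * J 0 t + (- EJ 0 t) * (2 / pi * (ln (x / 2) + euler_mascheroni))"
    by (simp add: algebra_simps)
  also have "\<dots> \<le> EY 0 x * J 0 t + (- EJ 0 t) * Y 0 x"
  proof (intro add_mono mult_right_mono mult_left_mono Yx)
    have "t * t \<le> 1 * 1" using t0 t1 by (intro mult_mono) auto
    then show "0 \<le> J 0 t" using Bt(2) by (simp add: power2_eq_square)
  qed (use Bt(4) in auto)
  also have "\<dots> = Im D" by (simp add: D_def)
  also have "\<dots> \<le> cmod D" using abs_Im_le_cmod[of D] by linarith
  finally have D: "2 / pi * (2/5) \<le> cmod D" .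
  have "cmod b * cmod D = cmod a * R t"
    using arg_cong[OF eq, of cmod] R(1) unfolding D_def[symmetric] R_def by (simp only: norm_mult norm_minus_cancel norm_of_real abs_of_nonneg)
  also have "\<dots> \<le> cmod a * (17/16 * (t * (t - x)))" using R(2) by (intro mult_left_mono) auto
  finally have "cmod b * cmod D \<le> cmod a * (17/16 * (t * (t - x)))" .
  moreover have "cmod b * (2 / pi * (2/5)) \<le> cmod b * cmod D" using D by (intro mult_left_mono) auto
  ultimately have "cmod b * (2 / pi * (2/5)) \<le> cmod a * (17/16 * (t * (t - x)))" by linarith
  from mult_right_mono[OF this, of "pi * (5/4)"] have "cmod b \<le> cmod a * (17/16 * (t * (t - x))) * (pi * (5/4))"
    by simp
  also have "\<dots> \<le> cmod a * (17/16 * (t * (t - x))) * (16/5 * (5/4))"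
  proof -
    have "pi \<le> 16/5" using pi_approx(2) by simp
    then show ?thesis using t0 t(1) by (intro mult_left_mono mult_right_mono mult_nonneg_nonneg) auto
  qed
  also have "\<dots> \<le> 5 * (t * (t - x)) * cmod a"
  proof -
    have "0 \<le> cmod a * (t * (t - x))" using t0 t by simp
    moreover have "cmod a * (17/16 * (t * (t - x))) * (16/5 * (5/4)) = 17/4 * (cmod a * (t * (t - x)))" by simp
    moreover have "5 * (t * (t - x)) * cmod a = 5 * (cmod a * (t * (t - x)))" by (simp only: mult_ac)
    ultimately show ?thesis by linarith
  qed
  finally show ?thesis .
qed


subsection \<open>Polar coordinates\<close>

lemma antiderivative_exists:
  fixes f :: "real \<Rightarrow> 'a::euclidean_space"
  assumes "continuous_on UNIV f"
  obtains F where "\<And>x. (F has_vector_derivative f x) (at x)"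
proof
  fix x :: real
  define a b where "a = - \<bar>x\<bar> - 1" and "b = \<bar>x\<bar> + 1"
  have ab: "a < x" "x < b" "a \<le> 0" "0 \<le> b" "a \<le> b" by (auto simp: a_def b_def)
  have "((\<lambda>u. LBINT y=ereal 0..ereal u. f y) has_vector_derivative f x) (at x within {a..b})"
    by (rule interval_integral_FTC2) (use ab assms in \<open>auto intro: continuous_on_subset\<close>)
  then show "((\<lambda>u. LBINT y=ereal 0..ereal u. f y) has_vector_derivative f x) (at x)"
    using ab by (simp add: at_within_Icc_at)
qed

lemma integral_periodic_shift:
  fixes g :: "real \<Rightarrow> complex"
  assumes c: "continuous_on UNIV g" and per: "\<And>x. g (x + p) = g x" and p: "p \<ge> 0"
  shows "integral {0..p} (\<lambda>x. g (x + a)) = integral {0..p} g"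
proof -
  obtain G where G: "\<And>x. (G has_vector_derivative g x) (at x)"
    using antiderivative_exists[OF c] by blast
  have shift: "((\<lambda>x. G (x + a)) has_vector_derivative g (x + a)) (at x)" for x a
    using vector_diff_chain_at[of "\<lambda>x. x + a" 1 x G "g (x + a)"] G[of "x + a"]
    by (simp add: o_def has_vector_derivative_add_const has_vector_derivative_id)
  have I: "((\<lambda>x. g (x + a)) has_integral (G (p + a) - G (0 + a))) {0..p}" for a
    by (rule fundamental_theorem_of_calculus[OF p])
      (auto intro: has_vector_derivative_at_within shift)
  have "((\<lambda>x. G (x + p) - G x) has_vector_derivative 0) (at x)" for x
    using has_vector_derivative_diff[OF shift[of p x] G[of x]] by (simp add: per)
  then obtain k where k: "\<And>x. G (x + p) - G x = k"
    using has_vector_derivative_zero_constant[of UNIV "\<lambda>x. G (x + p) - G x"] by auto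
  have "G (p + a) - G (0 + a) = G (p + 0) - G (0 + 0)"
    using k[of a] k[of 0] by (simp add: add.commute)
  then show ?thesis using integral_unique[OF I[of a]] integral_unique[OF I[of 0]] by simp
qed

text \<open>Coordinates in \<open>real ^ 2\<close>, the setting in which invariance of measure under
  orthogonal maps is stated; rotations of the complex plane are transferred through it.\<close>

definition vec2 :: "complex \<Rightarrow> real ^ 2" where "vec2 z = vector [Re z, Im z]"

definition unvec2 :: "real ^ 2 \<Rightarrow> complex" where "unvec2 v = Complex (v $ 1) (v $ 2)"

lemma unvec2_vec2 [simp]: "unvec2 (vec2 z) = z" and vec2_unvec2 [simp]: "vec2 (unvec2 v) = v"
  by (simp_all add: vec2_def unvec2_def vec_eq_iff forall_2)

lemma linear_vec2: "linear vec2" and linear_unvec2: "linear unvec2"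
  by (auto intro!: linearI simp: vec2_def unvec2_def vec_eq_iff forall_2 complex_eq_iff)

lemma vec2_measurable [measurable]: "vec2 \<in> borel_measurable borel"
  and unvec2_measurable [measurable]: "unvec2 \<in> borel_measurable borel"
  using linear_continuous_on[OF linear_conv_bounded_linear[THEN iffD1, OF linear_vec2]]
    linear_continuous_on[OF linear_conv_bounded_linear[THEN iffD1, OF linear_unvec2]]
  by (auto intro: borel_measurable_continuous_onI)

lemma distr_vec2: "distr lborel borel vec2 = lborel"
proof (rule lborel_eqI[symmetric])
  fix l u :: "real ^ 2"
  assume lu: "\<And>b. b \<in> Basis \<Longrightarrow> l \<bullet> b \<le> u \<bullet> b"
  have le: "l $ 1 \<le> u $ 1" "l $ 2 \<le> u $ 2"
    using lu[of "axis 1 1"] lu[of "axis 2 1"] by (auto simp: inner_axis axis_in_Basis_iff)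
  have "emeasure (distr lborel borel vec2) (box l u) = emeasure lborel (vec2 -` box l u)"
    by (subst emeasure_distr) auto
  also have "vec2 -` box l u = box (unvec2 l) (unvec2 u)"
    by (auto simp: vec2_def unvec2_def mem_box_cart in_box_complex_iff forall_2)
  also have "emeasure lborel \<dots> = (\<Prod>b\<in>Basis. (unvec2 u - unvec2 l) \<bullet> b)"
    using le by (intro emeasure_lborel_box) (auto simp: Basis_complex_def unvec2_def)
  also have "(\<Prod>b\<in>Basis. (unvec2 u - unvec2 l) \<bullet> b) = (\<Prod>b\<in>Basis. (u - l) \<bullet> b)"
  proof -
    have B: "(Basis :: (real ^ 2) set) = {axis 1 1, axis 2 1}"
      by (auto simp: Basis_vec_def UNIV_2)
    have ne: "axis 1 1 \<noteq> (axis 2 1 :: real ^ 2)" by (simp add: axis_eq_axis)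
    have "(\<Prod>b\<in>Basis. (u - l) \<bullet> b) = (u $ 1 - l $ 1) * (u $ 2 - l $ 2)"
      unfolding B using ne by (simp add: inner_axis)
    then show ?thesis
      by (simp add: Basis_complex_def unvec2_def)
  qed
  finally show "emeasure (distr lborel borel vec2) (box l u) = (\<Prod>b\<in>Basis. (u - l) \<bullet> b)" .
qed simp

lemma distr_unvec2: "distr lborel borel unvec2 = lborel"
proof -
  have "distr lborel borel unvec2 = distr (distr lborel borel vec2) borel unvec2"
    unfolding distr_vec2 ..
  also have "\<dots> = distr lborel borel (unvec2 \<circ> vec2)" by (rule distr_distr) auto
  also have "unvec2 \<circ> vec2 = (\<lambda>x. x)" by (auto simp: o_def)
  also have "distr lborel borel (\<lambda>x::complex. x) = lborel" by (rule distr_id2) simp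
  finally show ?thesis .
qed

lemma distr_orthogonal_transformation:
  fixes f :: "real ^ 2 \<Rightarrow> real ^ 2"
  assumes f: "orthogonal_transformation f"
  shows "distr lborel borel f = lborel"
proof (rule lborel_eqI[symmetric])
  have cont: "continuous_on UNIV f"
    using orthogonal_transformation_linear[OF f] by (simp add: linear_continuous_on linear_conv_bounded_linear)
  then have fm [measurable]: "f \<in> borel_measurable borel" by (rule borel_measurable_continuous_onI)
  fix l u :: "real ^ 2"
  assume lu: "\<And>b. b \<in> Basis \<Longrightarrow> l \<bullet> b \<le> u \<bullet> b"
  have "f -` box l u = inv f ` box l u"
    using orthogonal_transformation_bij[OF f] by (simp add: bij_vimage_eq_inv_image)
  have inv: "orthogonal_transformation (inv f)" by (rule orthogonal_transformation_inv[OF f])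
  have lm: "inv f ` box l u \<in> lmeasurable" by (intro measurable_orthogonal_image inv lmeasurable_box)
  have meas: "f -` box l u \<in> sets borel" using measurable_sets[OF fm, of "box l u"] by simp
  have "emeasure (distr lborel borel f) (box l u) = emeasure lborel (f -` box l u)"
    by (subst emeasure_distr) auto
  also have "\<dots> = emeasure lebesgue (f -` box l u)"
    using meas by simp
  also have "\<dots> = ennreal (measure lebesgue (inv f ` box l u))"
    unfolding \<open>f -` box l u = _\<close> by (rule emeasure_eq_ennreal_measure[OF fmeasurableD2[OF lm]])
  also have "\<dots> = ennreal (measure lebesgue (box l u))"
    by (subst measure_orthogonal_image[OF inv lmeasurable_box]) simp
  also have "\<dots> = emeasure lebesgue (box l u)"
    by (rule emeasure_eq_ennreal_measure[OF fmeasurableD2[OF lmeasurable_box], symmetric])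
  also have "\<dots> = emeasure lborel (box l u)" by simp
  also have "\<dots> = (\<Prod>b\<in>Basis. (u - l) \<bullet> b)"
    by (rule emeasure_lborel_box[OF lu])
  finally show "emeasure (distr lborel borel f) (box l u) = (\<Prod>b\<in>Basis. (u - l) \<bullet> b)" .
qed simp

lemma distr_rotation: "distr lborel borel (\<lambda>z. cis \<theta> * z) = lborel"
proof -
  define f where "f v = vec2 (cis \<theta> * unvec2 v)" for v
  have rot: "linear (\<lambda>z. cis \<theta> * z)" by (rule linearI) (auto simp: algebra_simps)
  have nv: "norm (vec2 z) = cmod z" for z
    by (simp add: vec2_def norm_vec_def L2_set_def sum_2 cmod_def)
  have "orthogonal_transformation f"
    unfolding orthogonal_transformation
  proof
    show "linear f"
      using linear_compose[OF linear_compose[OF linear_unvec2 rot] linear_vec2]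
      by (simp add: f_def[abs_def] o_def)
    show "\<forall>v. norm (f v) = norm v"
      using nv[of "unvec2 _"] by (simp add: f_def nv norm_mult)
  qed
  then have d: "distr lborel borel f = lborel" by (rule distr_orthogonal_transformation)
  have [measurable]: "(\<lambda>z. cis \<theta> * z) \<in> borel_measurable borel" by (intro borel_measurable_continuous_onI continuous_intros)
  have fm [measurable]: "f \<in> borel_measurable borel" unfolding f_def[abs_def] by measurable
  have "(\<lambda>z. cis \<theta> * z) = unvec2 \<circ> (f \<circ> vec2)" by (auto simp: f_def)
  then have "distr lborel borel (\<lambda>z. cis \<theta> * z) = distr (distr (distr lborel borel vec2) borel f) borel unvec2"
    by (subst distr_distr; simp add: measurable_comp) (subst distr_distr; simp add: measurable_comp o_assoc)
  then show ?thesis unfolding distr_vec2 d distr_unvec2 .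
qed

text \<open>A disc of radius sqrt x has area pi x, and half-lines generate the Borel sets. Squaring
  the modulus makes the density constant.\<close>

lemma distr_norm_squared:
  "distr lborel borel (\<lambda>z::complex. (cmod z)\<^sup>2) = density lborel (\<lambda>s. ennreal pi * indicator {0..} s)"
proof (rule measure_eqI_generator_eq[where E = "range lessThan" and \<Omega> = UNIV and A = "\<lambda>n. {..<real n}"])
  show "Int_stable (range (lessThan :: real \<Rightarrow> _))"
  proof -
    have "{..<a} \<inter> {..<b} = {..<min a b}" for a b :: real by auto
    then show ?thesis unfolding Int_stable_def by auto
  qed
  show "sets (distr lborel borel (\<lambda>z::complex. (cmod z)\<^sup>2)) = sigma_sets UNIV (range lessThan)"
    "sets (density lborel (\<lambda>s::real. ennreal pi * indicator {0..} s)) = sigma_sets UNIV (range lessThan)"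
  proof -
    have "sets (borel :: real measure) = sigma_sets UNIV (range lessThan)" by (subst borel_Iio) simp
    then show "sets (distr lborel borel (\<lambda>z::complex. (cmod z)\<^sup>2)) = sigma_sets UNIV (range lessThan)"
      "sets (density lborel (\<lambda>s::real. ennreal pi * indicator {0..} s)) = sigma_sets UNIV (range lessThan)"
      by simp_all
  qed
  have eq: "emeasure (distr lborel borel (\<lambda>z::complex. (cmod z)\<^sup>2)) {..<x} = (if x \<le> 0 then 0 else ennreal (pi * x))" for x :: real
  proof -
    have "emeasure (distr lborel borel (\<lambda>z::complex. (cmod z)\<^sup>2)) {..<x} = emeasure lborel {z::complex. (cmod z)\<^sup>2 < x}"
      by (subst emeasure_distr) (auto simp: vimage_def)
    also have "{z::complex. (cmod z)\<^sup>2 < x} = (if x \<le> 0 then {} else ball 0 (sqrt x))"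
    proof (cases "x \<le> 0")
      case False
      have iff: "(cmod z)\<^sup>2 < x \<longleftrightarrow> cmod z < sqrt x" for z
        using real_sqrt_less_iff[of "(cmod z)\<^sup>2" x] by simp
      show ?thesis unfolding iff using False by (simp add: ball_def)
    next
      case True
      have "{z::complex. (cmod z)\<^sup>2 < x} = {}"
        using order_trans[OF True zero_le_power2] by (auto simp: not_less)
      then show ?thesis using True by simp
    qed
    also have "emeasure lborel \<dots> = (if x \<le> 0 then 0 else ennreal (pi * x))"
      using emeasure_ball[of "sqrt x" "0::complex"] by (auto simp: unit_ball_vol_2)
    finally show ?thesis .
  qed
  show "emeasure (distr lborel borel (\<lambda>z::complex. (cmod z)\<^sup>2)) X = emeasure (density lborel (\<lambda>s. ennreal pi * indicator {0..} s)) X"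
    if XE: "X \<in> range lessThan" for X
  proof -
    obtain x where X: "X = {..<x}" using XE by auto
    have "emeasure (density lborel (\<lambda>s. ennreal pi * indicator {0..} s)) {..<x} = (\<integral>\<^sup>+s. ennreal pi * indicator {0..<x} s \<partial>lborel)"
      by (subst emeasure_density) (auto intro!: nn_integral_cong simp: indicator_def)
    also have "\<dots> = ennreal pi * emeasure lborel {0..<x}" by (rule nn_integral_cmult_indicator) simp
    also have "\<dots> = (if x \<le> 0 then 0 else ennreal (pi * x))"
      by (auto simp: ennreal_mult'')
    finally show ?thesis unfolding X eq by simp
  qed
  show "emeasure (distr lborel borel (\<lambda>z::complex. (cmod z)\<^sup>2)) {..<real i} \<noteq> \<infinity>" for i
    by (simp add: eq)
  show "(\<Union>i. {..<real i}) = UNIV" using reals_Archimedean2 by auto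
qed auto

text \<open>No change of variables is performed. The integral is averaged over all rotations, each
  of which preserves it; after Fubini the integrand is an angular mean that depends on |z|^2 only,
  and the image measure of |z|^2 finishes. In s = r^2 the weight r dr becomes ds / 2.\<close>

lemma integral_polar:
  fixes F :: "complex \<Rightarrow> complex"
  assumes int: "integrable lborel F" and c: "\<And>r. continuous_on UNIV (\<lambda>\<theta>. F (rcis r \<theta>))"
  shows "(LINT z|lborel. F z) = (LBINT s:{0..}. integral {0..2 * pi} (\<lambda>\<theta>. F (rcis (sqrt s) \<theta>))) / 2"
proof -
  have [measurable]: "F \<in> borel_measurable borel" using int by simp
  define m where "m s = (LBINT \<theta>:{0..2 * pi}. F (rcis (sqrt s) \<theta>))" for s
  have m_int: "m s = integral {0..2 * pi} (\<lambda>\<theta>. F (rcis (sqrt s) \<theta>))" for s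
    unfolding m_def
    by (rule set_borel_integral_eq_integral) (auto intro!: borel_integrable_atLeastAtMost' continuous_on_subset[OF c])
  have [measurable]: "(\<lambda>p. rcis (sqrt (fst p)) (snd p)) \<in> borel_measurable (lborel \<Otimes>\<^sub>M lborel)"
    unfolding rcis_def cis_conv_exp by measurable
  have m_meas [measurable]: "m \<in> borel_measurable lborel"
    unfolding m_def set_lebesgue_integral_def by measurable
  have rotm [measurable]: "(\<lambda>p. cis (fst p) * snd p) \<in> borel_measurable (borel \<Otimes>\<^sub>M borel)"
    unfolding cis_conv_exp by measurable
  define K where "K p = indicator {0..2 * pi} (fst p) *\<^sub>R F (cis (fst p) * snd p)" for p
  have K_meas: "K \<in> borel_measurable (lborel \<Otimes>\<^sub>M lborel)"
    unfolding K_def by measurable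
  have rot_int: "integrable lborel (\<lambda>z. F (cis \<theta> * z))" "(LINT z|lborel. F (cis \<theta> * z)) = (LINT z|lborel. F z)" for \<theta>
  proof -
    have [measurable]: "(\<lambda>z. cis \<theta> * z) \<in> borel_measurable borel" by (intro borel_measurable_continuous_onI continuous_intros)
    have "integrable (distr lborel borel (\<lambda>z. cis \<theta> * z)) F" unfolding distr_rotation by (rule int)
    then show "integrable lborel (\<lambda>z. F (cis \<theta> * z))" by (subst (asm) integrable_distr_eq) auto
    have "(LINT z|distr lborel borel (\<lambda>z. cis \<theta> * z). F z) = (LINT z|lborel. F (cis \<theta> * z))"
      by (rule integral_distr) auto
    then show "(LINT z|lborel. F (cis \<theta> * z)) = (LINT z|lborel. F z)" unfolding distr_rotation by simp
  qed
  have norm_rot: "(LINT z|lborel. norm (F (cis \<theta> * z))) = (LINT z|lborel. norm (F z))" for \<theta>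
  proof -
    have [measurable]: "(\<lambda>z. cis \<theta> * z) \<in> borel_measurable borel" by (intro borel_measurable_continuous_onI continuous_intros)
    have "(LINT z|distr lborel borel (\<lambda>z. cis \<theta> * z). norm (F z)) = (LINT z|lborel. norm (F (cis \<theta> * z)))"
      by (rule integral_distr) auto
    then show ?thesis unfolding distr_rotation by simp
  qed
  have KI: "integrable (lborel \<Otimes>\<^sub>M lborel) K"
  proof (rule lborel_pair.Fubini_integrable[OF K_meas])
    have "(\<lambda>\<theta>. LINT z|lborel. norm (K (\<theta>, z))) = (\<lambda>\<theta>. (LINT z|lborel. norm (F z)) * indicator {0..2 * pi} \<theta>)"
      by (rule ext) (simp add: K_def norm_rot indicator_def)
    then show "integrable lborel (\<lambda>\<theta>. LINT z|lborel. norm (K (\<theta>, z)))"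
      by (simp add: integrable_indicator_iff)
    show "AE \<theta> in lborel. integrable lborel (\<lambda>z. K (\<theta>, z))"
      by (rule AE_I2) (auto simp: K_def rot_int)
  qed
  have "(LINT \<theta>|lborel. LINT z|lborel. K (\<theta>, z)) = (LINT \<theta>|lborel. indicator {0..2 * pi} \<theta> *\<^sub>R (LINT z|lborel. F z))"
    by (intro Bochner_Integration.integral_cong) (auto simp: K_def rot_int)
  also have "\<dots> = of_real (2 * pi) * (LINT z|lborel. F z)"
    by (subst integral_scaleR_left) (auto simp: scaleR_conv_of_real)
  finally have 1: "(LINT \<theta>|lborel. LINT z|lborel. K (\<theta>, z)) = of_real (2 * pi) * (LINT z|lborel. F z)" .
  have inner: "(LINT \<theta>|lborel. K (\<theta>, z)) = m ((cmod z)\<^sup>2)" for z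
  proof -
    have "(LINT \<theta>|lborel. K (\<theta>, z)) = (LBINT \<theta>:{0..2 * pi}. F (cis \<theta> * z))"
      by (simp add: K_def set_lebesgue_integral_def)
    also have "(\<lambda>\<theta>. F (cis \<theta> * z)) = (\<lambda>\<theta>. F (rcis (cmod z) (\<theta> + Arg z)))"
      by (rule ext, rule arg_cong[where f = F], subst (1) rcis_cmod_Arg[of z, symmetric]) (simp add: rcis_def cis_mult[symmetric] mult_ac)
    also have "(LBINT \<theta>:{0..2 * pi}. F (rcis (cmod z) (\<theta> + Arg z))) = integral {0..2 * pi} (\<lambda>\<theta>. F (rcis (cmod z) (\<theta> + Arg z)))"
      by (rule set_borel_integral_eq_integral, rule borel_integrable_atLeastAtMost', rule continuous_on_compose2[OF c[of "cmod z"]])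
        (auto intro!: continuous_intros)
    also have "\<dots> = integral {0..2 * pi} (\<lambda>\<theta>. F (rcis (cmod z) \<theta>))"
      by (rule integral_periodic_shift[OF c]) (auto simp: rcis_def cis_mult[symmetric])
    finally show ?thesis by (simp add: m_int)
  qed
  have "of_real (2 * pi) * (LINT z|lborel. F z) = (LINT z|lborel. LINT \<theta>|lborel. K (\<theta>, z))"
    unfolding 1[symmetric] using lborel_pair.Fubini_integral[of "\<lambda>\<theta> z. K (\<theta>, z)"] KI by simp
  also have "\<dots> = (LINT z|lborel. m ((cmod (z :: complex))\<^sup>2))" by (simp add: inner)
  also have "\<dots> = (LINT s|distr lborel borel (\<lambda>z::complex. (cmod z)\<^sup>2). m s)"
    by (subst integral_distr) auto
  also have "\<dots> = (LINT s|lborel. (pi * indicator {0..} s) *\<^sub>R m s)"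
    unfolding distr_norm_squared
    by (subst integral_density[symmetric]) (auto simp: ennreal_mult'' ennreal_indicator[symmetric] simp del: ennreal_indicator)
  also have "\<dots> = pi *\<^sub>R (LBINT s:{0..}. m s)"
    unfolding set_lebesgue_integral_def scaleR_scaleR[symmetric] by (rule integral_scaleR_right)
  finally have "2 * (LINT z|lborel. F z) = (LBINT s:{0..}. m s)"
    by (simp add: scaleR_conv_of_real)
  then show ?thesis by (simp add: m_int field_simps)
qed


subsection \<open>Smooth profiles on the line\<close>

primrec rsm :: "nat \<Rightarrow> (real \<Rightarrow> real) \<Rightarrow> bool" where
  "rsm 0 f \<longleftrightarrow> continuous_on UNIV f"
| "rsm (Suc k) f \<longleftrightarrow> (\<exists>f'. (\<forall>x. (f has_real_derivative f' x) (at x)) \<and> rsm k f')"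

lemma rsm_Suc_imp: "rsm (Suc k) f \<Longrightarrow> rsm k f"
proof (induction k arbitrary: f)
  case 0
  then show ?case by (auto intro!: continuous_at_imp_continuous_on dest: DERIV_isCont)
next
  case (Suc k)
  from Suc.prems obtain f' where f': "\<forall>x. (f has_real_derivative f' x) (at x)" "rsm (Suc k) f'"
    unfolding rsm.simps(2)[of "Suc k"] by blast
  with Suc.IH[OF f'(2)] show ?case by auto
qed

lemma rsm_add: "rsm k f \<Longrightarrow> rsm k g \<Longrightarrow> rsm k (\<lambda>x. f x + g x)"
proof (induction k arbitrary: f g)
  case (Suc k)
  then obtain f' g' where "\<forall>x. (f has_real_derivative f' x) (at x)" "rsm k f'"
    "\<forall>x. (g has_real_derivative g' x) (at x)" "rsm k g'" by auto
  then show ?case using Suc.IH[of f' g'] by (auto intro!: exI[of _ "\<lambda>x. f' x + g' x"] DERIV_add)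
qed (simp add: continuous_on_add continuous_on_mult)

lemma rsm_mult: "rsm k f \<Longrightarrow> rsm k g \<Longrightarrow> rsm k (\<lambda>x. f x * g x)"
proof (induction k arbitrary: f g)
  case (Suc k)
  then obtain f' g' where f: "\<forall>x. (f has_real_derivative f' x) (at x)" "rsm k f'"
    and g: "\<forall>x. (g has_real_derivative g' x) (at x)" "rsm k g'" by auto
  have "rsm k f" "rsm k g" using Suc.prems rsm_Suc_imp by blast+
  then have "rsm k (\<lambda>x. f' x * g x + g' x * f x)"
    by (intro rsm_add Suc.IH f g)
  then show ?case using f g by (auto intro!: exI[of _ "\<lambda>x. f' x * g x + g' x * f x"] DERIV_mult)
qed (simp add: continuous_on_add continuous_on_mult)

lemma rsm_const: "rsm k (\<lambda>x. c)"
proof (induction k arbitrary: c)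
  case (Suc k)
  then show ?case by (auto intro!: exI[of _ "\<lambda>x. 0"])
qed auto

lemma rsm_affine: "rsm k f \<Longrightarrow> rsm k (\<lambda>x. f (c * x + d))"
proof (induction k arbitrary: f)
  case (Suc k)
  then obtain f' where f: "\<forall>x. (f has_real_derivative f' x) (at x)" "rsm k f'" by auto
  have "((\<lambda>x. f (c * x + d)) has_real_derivative f' (c * x + d) * c) (at x)" for x
    by (rule DERIV_chain2[where f = f and g = "\<lambda>x. c * x + d"]) (use f in \<open>auto intro!: derivative_eq_intros\<close>)
  moreover have "rsm k (\<lambda>x. f' (c * x + d) * c)"
    by (intro rsm_mult rsm_const Suc.IH f)
  ultimately show ?case unfolding rsm.simps(2) by (intro exI[of _ "\<lambda>x. f' (c * x + d) * c"]) simp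
next
  case 0
  then show ?case by (simp add: continuous_on_compose2[of UNIV f UNIV "\<lambda>x. c * x + d"] continuous_on_add continuous_on_mult)
qed

text \<open>The powers in the denominator make the family closed under differentiation, so
  smoothness of all members follows by one induction on the order.\<close>

definition flat :: "nat \<Rightarrow> real \<Rightarrow> real" where
  "flat m x = (if x \<le> 0 then 0 else exp (- (1 / x)) / x ^ m)"

lemma power_le_fact_exp:
  assumes "y \<ge> (0::real)"
  shows "y ^ k \<le> fact k * exp y"
proof -
  have sm: "summable (\<lambda>n. y ^ n /\<^sub>R fact n)" by (rule summable_exp_generic)
  have "sum (\<lambda>n. y ^ n /\<^sub>R fact n) {k} \<le> suminf (\<lambda>n. y ^ n /\<^sub>R fact n)"
    by (rule sum_le_suminf[OF sm]) (use assms in auto)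
  then have "y ^ k / fact k \<le> exp y" by (simp add: exp_def divide_inverse mult.commute)
  then show ?thesis by (simp add: field_simps)
qed

lemma flat_bound: "0 \<le> flat m x" "flat m x \<le> fact (m + 2) * x\<^sup>2"
proof -
  show "0 \<le> flat m x" by (simp add: flat_def)
  show "flat m x \<le> fact (m + 2) * x\<^sup>2"
  proof (cases "x \<le> 0")
    case False
    then have x: "x > 0" by simp
    have "(1 / x) ^ (m + 2) \<le> fact (m + 2) * exp (1 / x)"
      using x by (intro power_le_fact_exp) simp
    then have "(1 / x) ^ (m + 2) * (exp (- (1 / x)) * x\<^sup>2) \<le> fact (m + 2) * exp (1 / x) * (exp (- (1 / x)) * x\<^sup>2)"
      by (intro mult_right_mono) auto
    also have "fact (m + 2) * exp (1 / x) * (exp (- (1 / x)) * x\<^sup>2) = fact (m + 2) * x\<^sup>2 * (exp (1 / x) * exp (- (1 / x)))"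
      by (simp only: mult_ac)
    also have "exp (1 / x) * exp (- (1 / x)) = 1" by (simp add: exp_minus)
    also have "(1 / x) ^ (m + 2) * (exp (- (1 / x)) * x\<^sup>2) = exp (- (1 / x)) / x ^ m"
      using x by (simp add: power_add power_one_over power2_eq_square field_simps)
    finally show ?thesis using x by (simp add: flat_def)
  qed (simp add: flat_def)
qed

text \<open>At the critical point 0 the bound by a multiple of x^2 gives derivative zero; on either
  side the formula is elementary.\<close>

lemma flat_deriv: "(flat m has_real_derivative - real m * flat (m + 1) x + flat (m + 2) x) (at x)"
proof -
  consider "x < 0" | "x = 0" | "x > 0" by linarith
  then show ?thesis
  proof cases
    case 1
    have "(flat m has_real_derivative 0) (at x)"
      by (rule has_field_derivative_transform_within_open[where f = "\<lambda>x. 0" and S = "{..<0}"])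
        (use 1 in \<open>auto simp: flat_def\<close>)
    then show ?thesis using 1 by (simp add: flat_def)
  next
    case 2
    have "(flat m has_vector_derivative 0) (at 0)"
    proof (rule has_vector_derivative_quadratic[of 1])
      show "norm (flat m (0 + h) - flat m 0 - h *\<^sub>R 0) \<le> fact (m + 2) * h\<^sup>2" for h
        using flat_bound[of m h] by (simp add: flat_def[of m 0])
    qed simp
    then show ?thesis using 2 by (simp add: flat_def[of _ 0] has_real_derivative_iff_has_vector_derivative)
  next
    case 3
    have "((\<lambda>x. exp (- (1 / x)) / x ^ m) has_real_derivative
        (exp (- (1 / x)) * (1 / x\<^sup>2) * x ^ m - exp (- (1 / x)) * (real m * x ^ (m - 1))) / (x ^ m * x ^ m)) (at x)"
      by (rule DERIV_divide) (use 3 in \<open>auto intro!: derivative_eq_intros simp: power2_eq_square\<close>)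
    moreover have "(exp (- (1 / x)) * (1 / x\<^sup>2) * x ^ m - exp (- (1 / x)) * (real m * x ^ (m - 1))) / (x ^ m * x ^ m)
        = - real m * flat (m + 1) x + flat (m + 2) x"
      using 3 by (cases m) (simp_all add: flat_def field_simps power2_eq_square)
    ultimately have "((\<lambda>x. exp (- (1 / x)) / x ^ m) has_real_derivative - real m * flat (m + 1) x + flat (m + 2) x) (at x)"
      by (simp only:)
    then show ?thesis
      by (rule has_field_derivative_transform_within_open[where S = "{0<..}"]) (use 3 in \<open>auto simp: flat_def\<close>)
  qed
qed

lemma rsm_flat: "rsm k (flat m)"
proof (induction k arbitrary: m)
  case 0
  show ?case using flat_deriv by (auto intro!: continuous_at_imp_continuous_on DERIV_isCont)
next
  case (Suc k)
  have "rsm k (\<lambda>x. - real m * flat (m + 1) x + flat (m + 2) x)"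
    by (intro rsm_add rsm_mult rsm_const Suc.IH)
  then show ?case unfolding rsm.simps(2) using flat_deriv[of m]
    by (intro exI[of _ "\<lambda>x. - real m * flat (m + 1) x + flat (m + 2) x"]) simp
qed

definition bump :: "real \<Rightarrow> real \<Rightarrow> real \<Rightarrow> real" where
  "bump a b x = flat 0 (x - a) * flat 0 (b - x)"

lemma rsm_bump: "rsm k (bump a b)"
proof -
  have "rsm k (\<lambda>x. flat 0 (1 * x + (- a)) * flat 0 ((-1) * x + b))"
    by (intro rsm_mult rsm_affine rsm_flat)
  then show ?thesis by (simp add: bump_def[abs_def])
qed

lemma bump_nonneg: "bump a b x \<ge> 0"
  by (simp add: bump_def flat_def)

lemma bump_pos: "a < x \<Longrightarrow> x < b \<Longrightarrow> bump a b x > 0"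
  and bump_outside: "x \<le> a \<or> b \<le> x \<Longrightarrow> bump a b x = 0"
  by (auto simp: bump_def flat_def)

lemma primitive_vanishing_right:
  assumes f: "continuous_on UNIV f" and f0: "\<And>x. b \<le> x \<Longrightarrow> f x = 0"
  obtains F :: "real \<Rightarrow> real" where "\<And>x. (F has_real_derivative f x) (at x)" "\<And>x. b \<le> x \<Longrightarrow> F x = 0"
proof -
  obtain G where G: "\<And>x. (G has_vector_derivative f x) (at x)" using antiderivative_exists[OF f] by blast
  have G': "(G has_real_derivative f x) (at x)" for x
    using G by (simp add: has_real_derivative_iff_has_vector_derivative)
  have "(G has_field_derivative 0) (at x within {b..})" if "x \<in> {b..}" for x
    using has_field_derivative_at_within[OF G'[of x], of "{b..}"] f0[of x] that by simp
  then have "\<exists>c. \<forall>x\<in>{b..}. G x = c"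
    by (intro has_field_derivative_zero_constant) auto
  then obtain c where c: "\<And>x. b \<le> x \<Longrightarrow> G x = c" by auto
  show ?thesis
  proof (rule that[of "\<lambda>x. G x - c"])
    show "((\<lambda>x. G x - c) has_real_derivative f x) (at x)" for x
      using DERIV_diff[OF G' DERIV_const[of c]] by simp
  qed (use c in auto)
qed

text \<open>The weak equation sees second derivatives of the profile, so a bump is made one. Both
  primitives are normalised to vanish beyond b; near 0 they need not vanish, since the test function
  is smooth at the origin anyway.\<close>

lemma bump_double_primitive:
  obtains \<rho> \<psi> :: "real \<Rightarrow> real" where "\<And>k. rsm k \<rho>" "\<And>k. rsm k \<psi>"
    "\<And>x. (\<rho> has_real_derivative \<psi> x) (at x)" "\<And>x. (\<psi> has_real_derivative bump a b x) (at x)"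
    "\<And>x. b \<le> x \<Longrightarrow> \<rho> x = 0" "\<And>x. b \<le> x \<Longrightarrow> \<psi> x = 0"
proof -
  have c: "continuous_on UNIV (bump a b)" using rsm_bump[of 0] by simp
  obtain \<psi> where \<psi>: "\<And>x. (\<psi> has_real_derivative bump a b x) (at x)" "\<And>x. b \<le> x \<Longrightarrow> \<psi> x = 0"
    by (rule primitive_vanishing_right[OF c, of b]) (auto simp: bump_outside)
  have r\<psi>: "rsm k \<psi>" for k
  proof (cases k)
    case 0
    have "rsm (Suc 0) \<psi>" using \<psi>(1) rsm_bump[of 0 a b] by (simp only: rsm.simps(2)) blast
    then show ?thesis using rsm_Suc_imp 0 by blast
  next
    case (Suc j)
    then show ?thesis using \<psi>(1) rsm_bump[of j a b] by (simp only: rsm.simps(2)) blast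
  qed
  have c\<psi>: "continuous_on UNIV \<psi>" using r\<psi>[of 0] by simp
  obtain \<rho> where \<rho>: "\<And>x. (\<rho> has_real_derivative \<psi> x) (at x)" "\<And>x. b \<le> x \<Longrightarrow> \<rho> x = 0"
    by (rule primitive_vanishing_right[OF c\<psi>, of b]) (auto simp: \<psi>)
  have r\<rho>: "rsm k \<rho>" for k
  proof (cases k)
    case 0
    have "rsm (Suc 0) \<rho>" using \<rho>(1) r\<psi>[of 0] by (simp only: rsm.simps(2)) blast
    then show ?thesis using rsm_Suc_imp 0 by blast
  next
    case (Suc j)
    then show ?thesis using \<rho>(1) r\<psi>[of j] by (simp only: rsm.simps(2)) blast
  qed
  show ?thesis using that[of \<rho> \<psi>] r\<rho> r\<psi> \<rho> \<psi> by blast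
qed

subsection \<open>Test functions with a given angular dependence\<close>

lemma dir_deriv_eq: "(f has_derivative D) (at x) \<Longrightarrow> dir_deriv h f x = D h"
  unfolding dir_deriv_def using frechet_derivative_at[of f D x] by simp

lemma C_k_Suc_imp: "C_k (Suc k) f \<Longrightarrow> C_k k f"
proof (induction k arbitrary: f)
  case 0
  then show ?case by (auto intro: differentiable_imp_continuous_on)
next
  case (Suc k)
  then have "f differentiable_on UNIV" "C_k (Suc k) (dir_deriv 1 f)" "C_k (Suc k) (dir_deriv \<i> f)"
    unfolding C_k.simps(2)[of "Suc k"] by blast+
  note d = this
  show ?case unfolding C_k.simps(2)[of k] by (intro conjI Suc.IH d)
qed

lemma dir_deriv_add:
  assumes "f differentiable_on UNIV" "g differentiable_on UNIV"
  shows "dir_deriv h (\<lambda>x. f x + g x) = (\<lambda>x. dir_deriv h f x + dir_deriv h g x)"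
proof
  fix x
  have "f differentiable (at x)" "g differentiable (at x)" using assms by (auto simp: differentiable_on_def)
  then have "((\<lambda>x. f x + g x) has_derivative (\<lambda>h. frechet_derivative f (at x) h + frechet_derivative g (at x) h)) (at x)"
    by (intro has_derivative_add) (simp_all add: frechet_derivative_works)
  then show "dir_deriv h (\<lambda>x. f x + g x) x = dir_deriv h f x + dir_deriv h g x"
    by (simp add: dir_deriv_eq) (simp add: dir_deriv_def)
qed

lemma dir_deriv_mult:
  assumes "f differentiable_on UNIV" "g differentiable_on UNIV"
  shows "dir_deriv h (\<lambda>x. f x * g x) = (\<lambda>x. f x * dir_deriv h g x + dir_deriv h f x * g x)"
proof
  fix x
  have "f differentiable (at x)" "g differentiable (at x)" using assms by (auto simp: differentiable_on_def)
  then have "((\<lambda>x. f x * g x) has_derivative (\<lambda>h. f x * frechet_derivative g (at x) h + frechet_derivative f (at x) h * g x)) (at x)"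
    by (intro has_derivative_mult) (simp_all add: frechet_derivative_works)
  then show "dir_deriv h (\<lambda>x. f x * g x) x = f x * dir_deriv h g x + dir_deriv h f x * g x"
    by (simp add: dir_deriv_eq) (simp add: dir_deriv_def)
qed

lemma C_k_add: "C_k k f \<Longrightarrow> C_k k g \<Longrightarrow> C_k k (\<lambda>x. f x + g x)"
proof (induction k arbitrary: f g)
  case (Suc k)
  then have "f differentiable_on UNIV" "g differentiable_on UNIV" by auto
  with Suc show ?case by (auto simp: dir_deriv_add intro: differentiable_on_add)
qed (simp add: continuous_on_add continuous_on_mult)

lemma C_k_mult: "C_k k f \<Longrightarrow> C_k k g \<Longrightarrow> C_k k (\<lambda>x. f x * g x)"
proof (induction k arbitrary: f g)
  case (Suc k)
  then have d: "f differentiable_on UNIV" "g differentiable_on UNIV" by auto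
  have "C_k k f" "C_k k g" using Suc.prems C_k_Suc_imp by blast+
  with Suc d show ?case
    by (auto simp: dir_deriv_mult intro!: C_k_add Suc.IH differentiable_on_mult)
qed (simp add: continuous_on_add continuous_on_mult)

lemma C_k_const: "C_k k (\<lambda>x. c)"
proof (induction k arbitrary: c)
  case (Suc k)
  have "dir_deriv h (\<lambda>x. c) = (\<lambda>x. 0)" for h
    by (rule ext) (simp add: dir_deriv_eq[OF has_derivative_const])
  with Suc show ?case by simp
qed auto

lemma C_k_linear:
  assumes f: "bounded_linear f"
  shows "C_k k f"
proof (cases k)
  case 0
  then show ?thesis using linear_continuous_on[OF f] by simp
next
  case (Suc j)
  have "dir_deriv h f = (\<lambda>x. f h)" for h
    by (rule ext) (rule dir_deriv_eq[OF bounded_linear_imp_has_derivative[OF f]])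
  moreover have "f differentiable_on UNIV"
    using bounded_linear_imp_differentiable_on[OF f] .
  ultimately show ?thesis using Suc C_k_const by simp
qed

lemma C_k_power: "C_k k f \<Longrightarrow> C_k k (\<lambda>x. f x ^ n)"
proof (induction n)
  case 0
  show ?case using C_k_const[of k 1] by simp
next
  case (Suc n)
  show ?case using C_k_mult[OF Suc.prems Suc.IH[OF Suc.prems]] by simp
qed

text \<open>The profile is taken at |x|^2 and not at |x|, which keeps the function smooth at the
  origin.\<close>

definition rad :: "(real \<Rightarrow> real) \<Rightarrow> complex \<Rightarrow> complex" where
  "rad \<rho> x = of_real (\<rho> ((cmod x)\<^sup>2))"

lemma rad_has_derivative:
  assumes "\<And>s. (\<rho> has_real_derivative \<rho>' s) (at s)"
  shows "(rad \<rho> has_derivative (\<lambda>h. 2 * of_real (x \<bullet> h) * rad \<rho>' x)) (at x)"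
proof -
  have 1: "((\<lambda>x. (cmod x)\<^sup>2) has_derivative (\<lambda>h. 2 * (x \<bullet> h))) (at x)"
    unfolding power2_norm_eq_inner
    by (auto intro!: derivative_eq_intros simp: inner_commute)
  have "((\<lambda>x. \<rho> ((cmod x)\<^sup>2)) has_derivative (\<lambda>h. \<rho>' ((cmod x)\<^sup>2) * (2 * (x \<bullet> h)))) (at x)"
    using has_derivative_compose[OF 1, of \<rho> "(*) (\<rho>' ((cmod x)\<^sup>2))"] assms[of "(cmod x)\<^sup>2"]
    by (simp add: has_field_derivative_def)
  from has_derivative_of_real[OF this, where 'a = complex] show ?thesis
    unfolding rad_def by (simp add: mult_ac)
qed

lemma C_k_rad: "(\<And>k. rsm k \<rho>) \<Longrightarrow> C_k k (rad \<rho>)"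
proof (induction k arbitrary: \<rho>)
  case 0
  have "continuous_on UNIV \<rho>" using 0[of 0] by simp
  then have "continuous_on UNIV (\<lambda>x. \<rho> ((cmod x)\<^sup>2))"
    by (rule continuous_on_compose2) (auto intro!: continuous_intros)
  then show ?case unfolding rad_def[abs_def] by (auto intro!: continuous_intros)
next
  case (Suc k)
  obtain \<rho>' where \<rho>': "\<And>x. (\<rho> has_real_derivative \<rho>' x) (at x)" using Suc.prems[of 1] by auto
  have r: "rsm j \<rho>'" for j
  proof -
    obtain g where g: "\<forall>x. (\<rho> has_real_derivative g x) (at x)" "rsm j g" using Suc.prems[of "Suc j"] by auto
    have "g = \<rho>'" using DERIV_unique g(1) \<rho>' by blast
    then show ?thesis using g by simp
  qed
  note D = rad_has_derivative[OF \<rho>']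
  have "rad \<rho> differentiable_on UNIV"
    unfolding differentiable_on_def using D by (auto intro: differentiableI)
  moreover have "C_k k (dir_deriv h (rad \<rho>))" for h
  proof -
    have "dir_deriv h (rad \<rho>) = (\<lambda>x. 2 * of_real (x \<bullet> h) * rad \<rho>' x)"
      by (rule ext) (rule dir_deriv_eq[OF D])
    moreover have "bounded_linear (\<lambda>x. 2 * complex_of_real (x \<bullet> h))"
      by (intro bounded_linear_mult_right[THEN bounded_linear_compose] bounded_linear_compose[OF bounded_linear_of_real bounded_linear_inner_left])
    ultimately show ?thesis by (simp only:) (intro C_k_mult C_k_linear Suc.IH r)
  qed
  ultimately show ?case by simp
qed

text \<open>For \<open>\<tau> = \<plusminus>1\<close> this is \<open>x\<close> or its conjugate, so its powers are \<open>r\<^sup>n e\<^sup>\<plusminus>\<^sup>i\<^sup>n\<^sup>\<theta>\<close>.\<close>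

definition zt :: "real \<Rightarrow> complex \<Rightarrow> complex" where
  "zt \<tau> x = of_real (Re x) + \<i> * of_real (\<tau> * Im x)"

lemma bounded_linear_zt: "bounded_linear (zt \<tau>)"
  unfolding linear_conv_bounded_linear[symmetric]
  by (rule linearI) (simp_all add: zt_def complex_eq_iff algebra_simps)

lemma zt_power_has_derivative:
  "((\<lambda>x. zt \<tau> x ^ n) has_derivative (\<lambda>h. of_nat n * zt \<tau> h * zt \<tau> x ^ (n - 1))) (at x)"
  by (rule has_derivative_power[OF bounded_linear_imp_has_derivative[OF bounded_linear_zt]])

section \<open>Very weak form of the equation\<close>

lemma test_function_dir_deriv:
  assumes "test_function \<phi>" "h = 1 \<or> h = \<i>"
  shows "test_function (dir_deriv h \<phi>)"
proof -
  obtain K where K: "compact K" "\<forall>x. x \<notin> K \<longrightarrow> \<phi> x = 0" using assms by (auto simp: test_function_def)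
  have "dir_deriv h \<phi> x = 0" if "x \<notin> K" for x
  proof -
    have "(\<phi> has_derivative (\<lambda>h. 0)) (at x)"
      by (rule has_derivative_transform_within_open[OF has_derivative_const[of 0], of "- K"])
        (use K that compact_imp_closed in auto)
    then show ?thesis by (simp add: dir_deriv_eq)
  qed
  moreover have "C_k k (dir_deriv h \<phi>)" for k
  proof -
    have "C_k (Suc k) \<phi>" using assms by (simp add: test_function_def)
    then show ?thesis using assms(2) by auto
  qed
  ultimately show ?thesis using K by (auto simp: test_function_def)
qed

lemma L2_loc_test_integrable:
  assumes g: "L2_loc g" and \<psi>: "test_function \<psi>"
  shows "integrable lebesgue (\<lambda>x. g x * \<psi> x)"
proof -
  obtain K where K: "compact K" "\<And>x. x \<notin> K \<Longrightarrow> \<psi> x = 0" using \<psi> by (auto simp: test_function_def)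
  have c: "continuous_on UNIV \<psi>" using \<psi> unfolding test_function_def by (metis C_k.simps(1))
  have "bounded (\<psi> ` K)" by (intro compact_imp_bounded compact_continuous_image continuous_on_subset[OF c] K) simp
  then obtain M where M: "\<And>x. x \<in> K \<Longrightarrow> cmod (\<psi> x) \<le> M" by (auto simp: bounded_iff)
  have gm: "g \<in> borel_measurable lebesgue" and gi: "set_integrable lebesgue K (\<lambda>x. (cmod (g x))\<^sup>2)"
    using g K by (auto simp: L2_loc_def)
  have \<psi>m: "\<psi> \<in> borel_measurable lebesgue"
    using borel_measurable_continuous_onI[OF c] by (simp add: measurable_completion)
  have "K \<in> lmeasurable" using K by (simp add: lmeasurable_compact)
  then have one: "set_integrable lebesgue K (\<lambda>x. 1 :: real)"
    unfolding set_integrable_def by (simp add: lmeasurable_iff_integrable)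
  have "integrable lebesgue (\<lambda>x. M * (indicator K x *\<^sub>R 1 + indicator K x *\<^sub>R (cmod (g x))\<^sup>2))"
    using one gi unfolding set_integrable_def by (intro integrable_mult_right Bochner_Integration.integrable_add)
  then show ?thesis
  proof (rule Bochner_Integration.integrable_bound)
    show "(\<lambda>x. g x * \<psi> x) \<in> borel_measurable lebesgue" using gm \<psi>m by measurable
    show "AE x in lebesgue. norm (g x * \<psi> x) \<le> norm (M * (indicator K x *\<^sub>R 1 + indicator K x *\<^sub>R (cmod (g x))\<^sup>2))"
    proof (rule AE_I2)
      fix x
      show "norm (g x * \<psi> x) \<le> norm (M * (indicator K x *\<^sub>R 1 + indicator K x *\<^sub>R (cmod (g x))\<^sup>2))"
      proof (cases "x \<in> K")
        case True
        have M0: "M \<ge> 0" using M[OF True] norm_ge_zero order_trans by blast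
        have "cmod (g x) \<le> 1 + (cmod (g x))\<^sup>2"
          using zero_le_square[of "cmod (g x) - 1/2"] by (simp add: power2_eq_square algebra_simps)
        then have "cmod (g x) * cmod (\<psi> x) \<le> (1 + (cmod (g x))\<^sup>2) * M"
          using M[OF True] by (intro mult_mono) auto
        then show ?thesis using True M0 by (simp add: norm_mult mult.commute)
      qed (simp add: K)
    qed
  qed
qed

text \<open>Derivatives of test functions are test functions, so the definition of the weak gradient
  moves the second derivative over as well. Afterwards only u itself occurs, whose polar integrals
  are Fourier coefficients.\<close>

lemma very_weak_helmholtz:
  assumes u: "weak_helmholtz V u" and \<phi>: "test_function \<phi>"
  shows "(LINT x|lebesgue. u x * (dir_deriv 1 (dir_deriv 1 \<phi>) x + dir_deriv \<i> (dir_deriv \<i> \<phi>) x)) =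
    - (LINT x|lebesgue. of_real (V x) * u x * \<phi> x)"
proof -
  obtain g1 g2 where L: "L2_loc u" "L2_loc g1" "L2_loc g2" and w: "weak_deriv 1 u g1" "weak_deriv \<i> u g2"
    and eq: "\<And>\<phi>. test_function \<phi> \<Longrightarrow> (LINT x|lebesgue. g1 x * dir_deriv 1 \<phi> x + g2 x * dir_deriv \<i> \<phi> x) =
           (LINT x|lebesgue. of_real (V x) * u x * \<phi> x)"
    using u unfolding weak_helmholtz_def by blast
  note t = test_function_dir_deriv[OF \<phi>, of 1, simplified] test_function_dir_deriv[OF \<phi>, of \<i>, simplified]
  note tt = test_function_dir_deriv[OF t(1), of 1, simplified] test_function_dir_deriv[OF t(2), of \<i>, simplified]
  have "(LINT x|lebesgue. u x * (dir_deriv 1 (dir_deriv 1 \<phi>) x + dir_deriv \<i> (dir_deriv \<i> \<phi>) x)) =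
      (LINT x|lebesgue. u x * dir_deriv 1 (dir_deriv 1 \<phi>) x) + (LINT x|lebesgue. u x * dir_deriv \<i> (dir_deriv \<i> \<phi>) x)"
    unfolding distrib_left by (intro Bochner_Integration.integral_add L2_loc_test_integrable L tt)
  also have "\<dots> = - (LINT x|lebesgue. g1 x * dir_deriv 1 \<phi> x) - (LINT x|lebesgue. g2 x * dir_deriv \<i> \<phi> x)"
    using w t unfolding weak_deriv_def by simp
  also have "\<dots> = - (LINT x|lebesgue. g1 x * dir_deriv 1 \<phi> x + g2 x * dir_deriv \<i> \<phi> x)"
    by (subst Bochner_Integration.integral_add) (auto intro!: L2_loc_test_integrable L t)
  finally show ?thesis unfolding eq[OF \<phi>] .
qed

context
  fixes n :: nat and \<tau> b :: real and \<rho> \<psi> \<eta> :: "real \<Rightarrow> real"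
  assumes rsm\<rho>: "\<And>k. rsm k \<rho>" and d\<rho>: "\<And>s. (\<rho> has_real_derivative \<psi> s) (at s)"
    and d\<psi>: "\<And>s. (\<psi> has_real_derivative \<eta> s) (at s)"
    and \<rho>0: "\<And>s. b \<le> s \<Longrightarrow> \<rho> s = 0" and \<tau>: "\<tau>\<^sup>2 = 1"
begin

lemma angular_test_function: "test_function (\<lambda>x. zt \<tau> x ^ n * rad \<rho> x)"
  unfolding test_function_def
proof (intro conjI allI exI impI)
  show "C_k k (\<lambda>x. zt \<tau> x ^ n * rad \<rho> x)" for k
    by (intro C_k_mult C_k_power C_k_linear bounded_linear_zt C_k_rad rsm\<rho>)
  show "compact (cball (0::complex) (sqrt \<bar>b\<bar>))" by simp
  fix x :: complex assume "x \<notin> cball 0 (sqrt \<bar>b\<bar>)"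
  then have "sqrt \<bar>b\<bar> < cmod x" by simp
  then have "(sqrt \<bar>b\<bar>)\<^sup>2 \<le> (cmod x)\<^sup>2" by (intro power_mono) auto
  then have "b \<le> (cmod x)\<^sup>2" by simp
  then show "zt \<tau> x ^ n * rad \<rho> x = 0" by (simp add: rad_def \<rho>0)
qed

lemma angular_first_derivative:
  "dir_deriv h (\<lambda>x. zt \<tau> x ^ n * rad \<rho> x) =
    (\<lambda>x. (of_nat n * zt \<tau> h) * (zt \<tau> x ^ (n - 1) * rad \<rho> x) + zt \<tau> x ^ n * (2 * of_real (x \<bullet> h) * rad \<psi> x))"
proof
  fix x
  from dir_deriv_eq[OF has_derivative_mult[OF zt_power_has_derivative[of \<tau> n x] rad_has_derivative[OF d\<rho>, of x]], of h]
  show "dir_deriv h (\<lambda>x. zt \<tau> x ^ n * rad \<rho> x) x =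
      (of_nat n * zt \<tau> h) * (zt \<tau> x ^ (n - 1) * rad \<rho> x) + zt \<tau> x ^ n * (2 * of_real (x \<bullet> h) * rad \<psi> x)"
    by (simp add: algebra_simps)
qed

lemma angular_second_derivative:
  "dir_deriv h (dir_deriv h (\<lambda>x. zt \<tau> x ^ n * rad \<rho> x)) x =
    of_nat n * of_nat (n - 1) * (zt \<tau> h)\<^sup>2 * zt \<tau> x ^ (n - 1 - 1) * rad \<rho> x
    + 4 * of_nat n * zt \<tau> h * zt \<tau> x ^ (n - 1) * of_real (x \<bullet> h) * rad \<psi> x
    + zt \<tau> x ^ n * (2 * of_real (h \<bullet> h) * rad \<psi> x + 4 * (of_real (x \<bullet> h))\<^sup>2 * rad \<eta> x)"
proof -
  have lin: "((\<lambda>x. 2 * complex_of_real (x \<bullet> h)) has_derivative (\<lambda>k. 2 * of_real (k \<bullet> h))) (at x)"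
    by (intro bounded_linear_imp_has_derivative bounded_linear_mult_right[THEN bounded_linear_compose] bounded_linear_compose[OF bounded_linear_of_real bounded_linear_inner_left])
  note D1 = has_derivative_mult_right[OF has_derivative_mult[OF zt_power_has_derivative[of \<tau> "n - 1"] rad_has_derivative[OF d\<rho>]], of "of_nat n * zt \<tau> h" x]
  note D2 = has_derivative_mult[OF zt_power_has_derivative[of \<tau> n] has_derivative_mult[OF lin rad_has_derivative[OF d\<psi>]]]
  show ?thesis
    unfolding angular_first_derivative
    using dir_deriv_eq[OF has_derivative_add[OF D1 D2], of h]
    by (simp add: algebra_simps power2_eq_square)
qed

text \<open>The power of \<open>zt\<close> is harmonic: the squares of \<open>zt \<tau> 1\<close>
  and \<open>zt \<tau> \<i>\<close> are 1 and -1 because \<tau>^2 = 1. What survives is a radial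
  operator, in s = |x|^2 equal to 4 (s \<rho>'' + (n + 1) \<rho>').\<close>

lemma angular_laplacian:
  "dir_deriv 1 (dir_deriv 1 (\<lambda>x. zt \<tau> x ^ n * rad \<rho> x)) x + dir_deriv \<i> (dir_deriv \<i> (\<lambda>x. zt \<tau> x ^ n * rad \<rho> x)) x
    = 4 * zt \<tau> x ^ n * rad (\<lambda>s. (real n + 1) * \<psi> s + s * \<eta> s) x"
proof -
  have tt: "complex_of_real \<tau> * of_real \<tau> = 1" using \<tau> by (simp add: power2_eq_square flip: of_real_mult)
  have z1: "zt \<tau> 1 = 1" "zt \<tau> \<i> = \<i> * of_real \<tau>" by (simp_all add: zt_def)
  have sq: "(zt \<tau> 1)\<^sup>2 = 1" "(zt \<tau> \<i>)\<^sup>2 = -1" unfolding z1 by (simp_all add: power2_eq_square tt algebra_simps)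
  have in1: "x \<bullet> 1 = Re x" "x \<bullet> \<i> = Im x" "(1::complex) \<bullet> 1 = 1" "\<i> \<bullet> \<i> = 1"
    by (simp_all add: inner_complex_def)
  have mixed: "zt \<tau> 1 * of_real (Re x) + zt \<tau> \<i> * of_real (Im x) = zt \<tau> x"
    unfolding z1 by (simp add: zt_def)
  have mod: "(of_real (Re x))\<^sup>2 + (of_real (Im x))\<^sup>2 = complex_of_real ((cmod x)\<^sup>2)"
    by (simp add: cmod_power2)
  have pw': "n = 0 \<or> zt \<tau> x * zt \<tau> x ^ (n - Suc 0) = zt \<tau> x ^ n"
    by (cases n) auto
  have pw: "of_nat n * zt \<tau> x ^ (n - 1) * zt \<tau> x = of_nat n * zt \<tau> x ^ n"
    by (cases n) auto
  have "dir_deriv 1 (dir_deriv 1 (\<lambda>x. zt \<tau> x ^ n * rad \<rho> x)) x + dir_deriv \<i> (dir_deriv \<i> (\<lambda>x. zt \<tau> x ^ n * rad \<rho> x)) x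
    = 4 * (of_nat n * zt \<tau> x ^ (n - 1) * (zt \<tau> 1 * of_real (Re x) + zt \<tau> \<i> * of_real (Im x))) * rad \<psi> x
      + zt \<tau> x ^ n * (4 * rad \<psi> x + 4 * ((of_real (Re x))\<^sup>2 + (of_real (Im x))\<^sup>2) * rad \<eta> x)"
    unfolding angular_second_derivative sq in1
    by (simp only: of_real_1 mult_1_right mult_minus1_right mult_minus_left ring_distribs) (simp add: mult_ac)
  also have "\<dots> = 4 * zt \<tau> x ^ n * rad (\<lambda>s. (real n + 1) * \<psi> s + s * \<eta> s) x"
    unfolding mixed mod mult.assoc[symmetric]
    unfolding pw mult.assoc using pw' by (auto simp: rad_def algebra_simps)
  finally show ?thesis .
qed

end


subsection \<open>Radial equation of a Fourier coefficient\<close>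

text \<open>The sign \<tau> is chosen so that, for either sign of \<nu>, the power carries the
  weight of the Fourier coefficient of index \<nu>.\<close>

lemma zt_rcis_power:
  fixes \<nu> :: int
  defines "\<tau> \<equiv> (if \<nu> \<ge> 0 then -1 else 1 :: real)"
  shows "zt \<tau> (rcis r \<theta>) ^ nat \<bar>\<nu>\<bar> = of_real (r ^ nat \<bar>\<nu>\<bar>) * cis (- (of_int \<nu> * \<theta>))"
proof -
  have "zt \<tau> (rcis r \<theta>) = rcis r (\<tau> * \<theta>)"
    by (simp add: zt_def \<tau>_def complex_eq_iff)
  then have "zt \<tau> (rcis r \<theta>) ^ nat \<bar>\<nu>\<bar> = rcis (r ^ nat \<bar>\<nu>\<bar>) (real (nat \<bar>\<nu>\<bar>) * (\<tau> * \<theta>))"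
    by (simp add: DeMoivre2)
  also have "real (nat \<bar>\<nu>\<bar>) * (\<tau> * \<theta>) = - (of_int \<nu> * \<theta>)"
    by (simp add: \<tau>_def)
  finally show ?thesis by (simp add: rcis_def)
qed

lemma continuous_on_fourier_coeff:
  assumes u: "continuous_on UNIV u"
  shows "continuous_on UNIV (\<lambda>r. fourier_coeff r u \<nu>)"
proof -
  have c: "continuous_on UNIV (\<lambda>x. u (rcis (fst x) (snd x)) * cis (- (of_int \<nu> * snd x)))"
    unfolding rcis_def cis_conv_exp
    by (intro continuous_intros continuous_on_compose2[OF u]) auto
  have "continuous_on UNIV (\<lambda>r. integral (cbox 0 (2 * pi)) (\<lambda>\<theta>. u (rcis r \<theta>) * cis (- (of_int \<nu> * \<theta>))))"
    by (rule integral_continuous_on_param) (use continuous_on_subset[OF c] in \<open>simp add: case_prod_beta\<close>)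
  then show ?thesis
    unfolding fourier_coeff_def by (intro continuous_intros) simp
qed

lemma integrable_compact_support:
  fixes g :: "complex \<Rightarrow> complex"
  assumes g: "continuous_on UNIV g" and K: "compact K" "\<And>x. x \<notin> K \<Longrightarrow> g x = 0"
  shows "integrable lborel g"
proof -
  have "integrable lborel (\<lambda>x. indicator K x *\<^sub>R g x)"
    by (rule borel_integrable_compact[OF K(1) continuous_on_subset[OF g]]) simp
  moreover have "(\<lambda>x. indicator K x *\<^sub>R g x) = g"
    using K by (auto simp: fun_eq_iff indicator_def)
  ultimately show ?thesis by simp
qed

definition step :: "real \<Rightarrow> real \<Rightarrow> real \<Rightarrow> real \<Rightarrow> real" where
  "step e v1 v2 s = (if s < e then v1 else v2)"

lemma step_measurable [measurable]: "step e v1 v2 \<in> borel_measurable borel"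
  unfolding step_def by measurable

lemma step_bound: "\<bar>step e v1 v2 s\<bar> \<le> \<bar>v1\<bar> + \<bar>v2\<bar>"
  by (simp add: step_def)

lemma step_mult_integrable:
  fixes g :: "'a::euclidean_space \<Rightarrow> complex"
  assumes g: "integrable lborel g" and p: "p \<in> borel_measurable borel"
  shows "integrable lborel (\<lambda>x. of_real (step e v1 v2 (p x)) * g x)"
proof -
  have [measurable]: "p \<in> borel_measurable borel" "g \<in> borel_measurable borel" using g p by auto
  have "integrable lborel (\<lambda>x. (\<bar>v1\<bar> + \<bar>v2\<bar>) * norm (g x))"
    using g by (intro integrable_mult_right) simp
  then show ?thesis
  proof (rule Bochner_Integration.integrable_bound)
    show "(\<lambda>x. of_real (step e v1 v2 (p x)) * g x) \<in> borel_measurable lborel" by measurable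
    show "AE x in lborel. norm (of_real (step e v1 v2 (p x)) * g x) \<le> norm ((\<bar>v1\<bar> + \<bar>v2\<bar>) * norm (g x))"
      using step_bound by (auto simp: norm_mult intro!: AE_I2 mult_right_mono)
  qed
qed

text \<open>The fundamental lemma of the calculus of variations: near a nonzero value, w times a
  narrow bump has one sign.\<close>

lemma bump_test_zero:
  fixes w :: "real \<Rightarrow> real"
  assumes c: "continuous_on UNIV w"
    and z: "\<And>a b. 0 < a \<Longrightarrow> a < b \<Longrightarrow> integral {0..b} (\<lambda>s. w s * bump a b s) = 0" and s: "s > 0"
  shows "w s = 0"
proof (rule ccontr)
  assume "w s \<noteq> 0"
  define \<sigma> where "\<sigma> = sgn (w s)"
  have "\<sigma> * w s > 0" using \<open>w s \<noteq> 0\<close> unfolding \<sigma>_def by (simp add: sgn_if)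
  have cw: "continuous_on UNIV (\<lambda>s. \<sigma> * w s)" by (intro continuous_intros c)
  have "open ((\<lambda>s. \<sigma> * w s) -` {0<..})" using cw by (simp add: continuous_on_open_vimage)
  moreover have "s \<in> (\<lambda>s. \<sigma> * w s) -` {0<..}" using \<open>\<sigma> * w s > 0\<close> by simp
  ultimately obtain d where d: "d > 0" "ball s d \<subseteq> (\<lambda>s. \<sigma> * w s) -` {0<..}" by (meson open_contains_ball)
  define \<delta> where "\<delta> = min d s / 2"
  have \<delta>: "\<delta> > 0" "\<delta> < d" "\<delta> < s" using d s by (auto simp: \<delta>_def)
  have pos: "\<sigma> * w x > 0" if "s - \<delta> \<le> x" "x \<le> s + \<delta>" for x
    using d(2) that \<delta> by (auto simp: subset_iff dist_real_def)
  let ?f = "\<lambda>x. \<sigma> * (w x * bump (s - \<delta>) (s + \<delta>) x)"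
  have cb: "continuous_on UNIV (bump (s - \<delta>) (s + \<delta>))" using rsm_bump[of 0] by simp
  have nn: "0 \<le> ?f x" for x
  proof (cases "s - \<delta> \<le> x \<and> x \<le> s + \<delta>")
    case True
    then have "0 \<le> (\<sigma> * w x) * bump (s - \<delta>) (s + \<delta>) x" using pos[of x] bump_nonneg mult_nonneg_nonneg less_imp_le by metis
    then show ?thesis by (simp add: mult.assoc)
  qed (auto simp: bump_outside)
  have "integral {0..s + \<delta>} ?f = 0" using z[of "s - \<delta>" "s + \<delta>"] \<delta> by simp
  moreover have "continuous_on {0..s + \<delta>} ?f"
    by (intro continuous_on_mult continuous_on_const continuous_on_subset[OF c] continuous_on_subset[OF cb]) auto
  ultimately have "?f s = 0"
    using integral_eq_0_iff[of 0 "s + \<delta>" ?f] nn \<delta> s by auto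
  moreover have "(\<sigma> * w s) * bump (s - \<delta>) (s + \<delta>) s > 0"
    by (rule mult_pos_pos[OF pos bump_pos]) (use \<delta> in auto)
  ultimately show False by (metis mult.assoc less_irrefl)
qed

lemma set_lborel_Ici_eq_integral:
  fixes F :: "real \<Rightarrow> complex"
  assumes b: "0 \<le> b" and i: "set_integrable lborel {0..b} F" and z: "\<And>s. b < s \<Longrightarrow> F s = 0"
  shows "(LBINT s:{0..}. F s) = integral {0..b} F"
proof -
  have "(LBINT s:{0..}. F s) = (LBINT s:{0..b}. F s)"
    unfolding set_lebesgue_integral_def
    by (rule Bochner_Integration.integral_cong) (use z b in \<open>auto simp: indicator_def\<close>)
  then show ?thesis using set_borel_integral_eq_integral(2)[OF i] by simp
qed

context
  fixes u :: "complex \<Rightarrow> complex" and \<nu> :: int and \<epsilon> v1 v2 :: real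
  assumes u: "continuous_on UNIV u" and \<epsilon>: "\<epsilon> > 0"
    and helm: "weak_helmholtz (\<lambda>x. if cmod x < \<epsilon> then v1 else v2) u"
begin

private definition n where "n = nat \<bar>\<nu>\<bar>"
private definition f where "f r = fourier_coeff r u \<nu>"
text \<open>r^n times the Fourier coefficient in the variable s = r^2: the quantity that integrating
  u against r^n e^(-i \<nu> \<theta>) over circles produces.\<close>

private definition h where "h s = of_real (sqrt s ^ n) * f (sqrt s)"
private abbreviation v where "v \<equiv> step (\<epsilon>\<^sup>2) v1 v2"

lemma continuous_f: "continuous_on UNIV f"
  unfolding f_def by (rule continuous_on_fourier_coeff[OF u])

lemma continuous_h: "continuous_on UNIV h"
  unfolding h_def
  by (intro continuous_intros continuous_on_compose2[OF continuous_f]) auto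

text \<open>The weight w may jump across the interface, so integrability is assumed in place of
  continuity; on each single circle the weight is constant.\<close>

lemma polar_moment:
  assumes c: "integrable lborel (\<lambda>z. of_real (w ((cmod z)\<^sup>2)) * (u z * (zt (if \<nu> \<ge> 0 then -1 else 1) z ^ n)))"
  shows "(LINT z|lborel. of_real (w ((cmod z)\<^sup>2)) * (u z * (zt (if \<nu> \<ge> 0 then -1 else 1) z ^ n)))
    = of_real pi * (LBINT s:{0..}. of_real (w s) * h s)"
proof -
  let ?\<tau> = "if \<nu> \<ge> 0 then -1 else 1 :: real"
  have on_circle: "of_real (w ((cmod (rcis r \<theta>))\<^sup>2)) * (u (rcis r \<theta>) * (zt ?\<tau> (rcis r \<theta>) ^ n))
      = of_real (w (r\<^sup>2) * r ^ n) * (u (rcis r \<theta>) * cis (- (of_int \<nu> * \<theta>)))" for r \<theta>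
    unfolding n_def zt_rcis_power by simp
  have circ: "continuous_on UNIV (\<lambda>\<theta>. u (rcis r \<theta>) * cis (- (of_int \<nu> * \<theta>)))" for r
    unfolding rcis_def cis_conv_exp
    by (intro continuous_intros continuous_on_compose2[OF u]) auto
  have inner: "integral {0..2 * pi} (\<lambda>\<theta>. of_real (w ((cmod (rcis (sqrt s) \<theta>))\<^sup>2)) * (u (rcis (sqrt s) \<theta>) * (zt ?\<tau> (rcis (sqrt s) \<theta>) ^ n)))
      = of_real (2 * pi) * (of_real (w s) * h s)" if "s \<ge> 0" for s
  proof -
    have "integral {0..2 * pi} (\<lambda>\<theta>. u (rcis (sqrt s) \<theta>) * cis (- (of_int \<nu> * \<theta>))) = of_real (2 * pi) * f (sqrt s)"
      by (simp add: f_def fourier_coeff_def)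
    then show ?thesis unfolding on_circle using that by (simp add: h_def)
  qed
  have "(LINT z|lborel. of_real (w ((cmod z)\<^sup>2)) * (u z * (zt ?\<tau> z ^ n))) =
      (LBINT s:{0..}. integral {0..2 * pi} (\<lambda>\<theta>. of_real (w ((cmod (rcis (sqrt s) \<theta>))\<^sup>2)) * (u (rcis (sqrt s) \<theta>) * (zt ?\<tau> (rcis (sqrt s) \<theta>) ^ n)))) / 2"
  proof (rule integral_polar[OF c])
    show "continuous_on UNIV (\<lambda>\<theta>. of_real (w ((cmod (rcis r \<theta>))\<^sup>2)) * (u (rcis r \<theta>) * (zt ?\<tau> (rcis r \<theta>) ^ n)))" for r
      unfolding on_circle by (intro continuous_on_mult continuous_on_const circ)
  qed
  also have "(LBINT s:{0..}. integral {0..2 * pi} (\<lambda>\<theta>. of_real (w ((cmod (rcis (sqrt s) \<theta>))\<^sup>2)) * (u (rcis (sqrt s) \<theta>) * (zt ?\<tau> (rcis (sqrt s) \<theta>) ^ n))))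
      = (LBINT s:{0..}. of_real (2 * pi) * (of_real (w s) * h s))"
    by (rule set_lebesgue_integral_cong) (use inner in auto)
  finally show ?thesis by simp
qed

text \<open>The very weak equation tested with r^n e^(-i \<nu> \<theta>) \<rho>(r^2), with both
  sides reduced to h by polar integration.\<close>

lemma radial_weak_form:
  assumes \<rho>: "\<And>k. rsm k \<rho>" "\<And>s. (\<rho> has_real_derivative \<psi> s) (at s)"
    and \<psi>: "\<And>k. rsm k \<psi>" "\<And>s. (\<psi> has_real_derivative \<eta> s) (at s)" and \<eta>: "continuous_on UNIV \<eta>"
    and b: "b > 0" "\<And>s. b \<le> s \<Longrightarrow> \<rho> s = 0" "\<And>s. b \<le> s \<Longrightarrow> \<psi> s = 0" "\<And>s. b \<le> s \<Longrightarrow> \<eta> s = 0"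
  shows "integral {0..b} (\<lambda>s. of_real (4 * ((real n + 1) * \<psi> s + s * \<eta> s)) * h s) =
    - integral {0..b} (\<lambda>s. of_real (v s * \<rho> s) * h s)"
    and "(\<lambda>s. of_real (v s * \<rho> s) * h s) integrable_on {0..b}"
proof -
  let ?\<tau> = "if \<nu> \<ge> 0 then -1 else 1 :: real"
  define w where "w s = 4 * ((real n + 1) * \<psi> s + s * \<eta> s)" for s
  have c\<rho>: "continuous_on UNIV \<rho>" and c\<psi>: "continuous_on UNIV \<psi>" using \<rho>(1)[of 0] \<psi>(1)[of 0] by auto
  have cw: "continuous_on UNIV w" unfolding w_def by (intro continuous_intros c\<psi> \<eta>)
  have far: "w s = 0" "\<rho> s = 0" if "b \<le> s" for s using that b by (auto simp: w_def)
  have zc: "continuous_on UNIV (zt ?\<tau>)" by (rule linear_continuous_on[OF bounded_linear_zt])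
  have supp: "b \<le> (cmod x)\<^sup>2" if "x \<notin> cball (0::complex) (sqrt b)" for x
  proof -
    have "sqrt b \<le> cmod x" using that by simp
    then have "(sqrt b)\<^sup>2 \<le> (cmod x)\<^sup>2" using b(1) by (intro power_mono) auto
    then show ?thesis using b(1) by simp
  qed
  have int: "integrable lborel (\<lambda>z. of_real (p ((cmod z)\<^sup>2)) * (u z * (zt ?\<tau> z ^ n)))"
    if p: "continuous_on UNIV p" "\<And>s. b \<le> s \<Longrightarrow> p s = 0" for p :: "real \<Rightarrow> real"
  proof (rule integrable_compact_support[of _ "cball 0 (sqrt b)"])
    have "continuous_on UNIV (\<lambda>z::complex. p ((cmod z)\<^sup>2))"
      by (rule continuous_on_compose2[OF p(1)]) (auto intro!: continuous_on_power continuous_on_norm continuous_on_id)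
    then show "continuous_on UNIV (\<lambda>z. of_real (p ((cmod z)\<^sup>2)) * (u z * (zt ?\<tau> z ^ n)))"
      by (intro continuous_on_mult continuous_on_of_real u continuous_on_power zc)
    show "compact (cball (0::complex) (sqrt b))" by simp
    show "of_real (p ((cmod z)\<^sup>2)) * (u z * (zt ?\<tau> z ^ n)) = 0" if "z \<notin> cball 0 (sqrt b)" for z
      using supp[OF that] p(2) by simp
  qed
  have intv: "integrable lborel (\<lambda>z. of_real (v ((cmod z)\<^sup>2) * \<rho> ((cmod z)\<^sup>2)) * (u z * (zt ?\<tau> z ^ n)))"
  proof -
    have "(\<lambda>z::complex. (cmod z)\<^sup>2) \<in> borel_measurable borel" by measurable
    from step_mult_integrable[OF int[OF c\<rho> far(2)] this, of "\<epsilon>\<^sup>2" v1 v2]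
    show ?thesis by (simp add: mult.assoc)
  qed
  have V: "(if cmod x < \<epsilon> then v1 else v2) = v ((cmod x)\<^sup>2)" for x
  proof -
    have "cmod x < \<epsilon> \<longleftrightarrow> (cmod x)\<^sup>2 < \<epsilon>\<^sup>2" using \<epsilon> power_mono_iff[of \<epsilon> "cmod x" 2] by (simp add: not_le[symmetric])
    then show ?thesis by (simp add: step_def)
  qed
  have leb: "(LINT x|lebesgue. g x) = (LINT x|lborel. g x)" if "integrable lborel g" for g :: "complex \<Rightarrow> complex"
    by (rule integral_completion) (use that in simp)
  have tau: "?\<tau>\<^sup>2 = 1" by simp
  have "test_function (\<lambda>x. zt ?\<tau> x ^ n * rad \<rho> x)"
    by (rule angular_test_function[OF \<rho> \<psi>(2) b(2) tau])
  note eq0 = very_weak_helmholtz[OF helm this]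
  have L: "dir_deriv 1 (dir_deriv 1 (\<lambda>x. zt ?\<tau> x ^ n * rad \<rho> x)) x + dir_deriv \<i> (dir_deriv \<i> (\<lambda>x. zt ?\<tau> x ^ n * rad \<rho> x)) x
    = 4 * zt ?\<tau> x ^ n * rad (\<lambda>s. (real n + 1) * \<psi> s + s * \<eta> s) x" for x
    by (rule angular_laplacian[OF \<rho> \<psi>(2) b(2) tau])
  from eq0 have "(LINT x|lebesgue. u x * (4 * zt ?\<tau> x ^ n * rad (\<lambda>s. (real n + 1) * \<psi> s + s * \<eta> s) x)) =
     - (LINT x|lebesgue. of_real (v ((cmod x)\<^sup>2)) * u x * (zt ?\<tau> x ^ n * rad \<rho> x))"
    by (simp only: L V)
  moreover have "(\<lambda>x. u x * (4 * zt ?\<tau> x ^ n * rad (\<lambda>s. (real n + 1) * \<psi> s + s * \<eta> s) x)) =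
      (\<lambda>z. of_real (w ((cmod z)\<^sup>2)) * (u z * (zt ?\<tau> z ^ n)))"
    by (simp add: fun_eq_iff rad_def w_def)
  moreover have "(\<lambda>x. of_real (v ((cmod x)\<^sup>2)) * u x * (zt ?\<tau> x ^ n * rad \<rho> x)) =
      (\<lambda>z. of_real (v ((cmod z)\<^sup>2) * \<rho> ((cmod z)\<^sup>2)) * (u z * (zt ?\<tau> z ^ n)))"
    by (simp add: fun_eq_iff rad_def)
  ultimately have "(LINT z|lborel. of_real (w ((cmod z)\<^sup>2)) * (u z * (zt ?\<tau> z ^ n))) =
      - (LINT z|lborel. of_real (v ((cmod z)\<^sup>2) * \<rho> ((cmod z)\<^sup>2)) * (u z * (zt ?\<tau> z ^ n)))"
    using leb[OF int[OF cw far(1)]] leb[OF intv] by simp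
  then have "of_real pi * (LBINT s:{0..}. of_real (w s) * h s) = of_real pi * (- (LBINT s:{0..}. of_real (v s * \<rho> s) * h s))"
    by (simp only: polar_moment[OF int[OF cw far(1)]] polar_moment[where w = "\<lambda>s. v s * \<rho> s", OF intv] mult_minus_right)
  then have eq: "(LBINT s:{0..}. of_real (w s) * h s) = - (LBINT s:{0..}. of_real (v s * \<rho> s) * h s)"
    by (simp only: mult_cancel_left of_real_eq_0_iff pi_neq_zero simp_thms)
  have si: "set_integrable lborel {0..b} (\<lambda>s. of_real (p s) * h s)" if "continuous_on UNIV p" for p
    by (rule borel_integrable_atLeastAtMost', rule continuous_on_subset[of UNIV])
      (auto intro!: continuous_on_mult continuous_on_of_real that continuous_h)
  have siv: "set_integrable lborel {0..b} (\<lambda>s. of_real (v s * \<rho> s) * h s)"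
  proof -
    have "integrable lborel (\<lambda>s. of_real (v s) * (indicator {0..b} s *\<^sub>R (of_real (\<rho> s) * h s)))"
      by (rule step_mult_integrable) (use si[OF c\<rho>] in \<open>simp_all add: set_integrable_def\<close>)
    then show ?thesis unfolding set_integrable_def by (simp add: mult_ac)
  qed
  have "(LBINT s:{0..}. of_real (w s) * h s) = integral {0..b} (\<lambda>s. of_real (w s) * h s)"
    "(LBINT s:{0..}. of_real (v s * \<rho> s) * h s) = integral {0..b} (\<lambda>s. of_real (v s * \<rho> s) * h s)"
    using set_lborel_Ici_eq_integral[OF less_imp_le[OF b(1)] si[OF cw]] set_lborel_Ici_eq_integral[OF less_imp_le[OF b(1)] siv] far
    by auto
  with eq show "integral {0..b} (\<lambda>s. of_real (4 * ((real n + 1) * \<psi> s + s * \<eta> s)) * h s) =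
    - integral {0..b} (\<lambda>s. of_real (v s * \<rho> s) * h s)"
    by (simp only: w_def)
  show "(\<lambda>s. of_real (v s * \<rho> s) * h s) integrable_on {0..b}"
    by (rule set_borel_integral_eq_integral(1)[OF siv])
qed

text \<open>In the variable \<open>s = r\<^sup>2\<close> with \<open>h = r\<^sup>n f\<close> the equation reads \<open>(4 s h)'' = (4 (n + 1) h)' - v h\<close>. The weak
  form only sees second derivatives of the test profile, hence this is its twice integrated version.\<close>

lemma radial_integrated:
  obtains G K :: "real \<Rightarrow> complex" where
    "continuous_on UNIV G" "\<And>s. s \<noteq> \<epsilon>\<^sup>2 \<Longrightarrow> (G has_vector_derivative of_real (v s) * h s) (at s)"
    "\<And>s. (K has_vector_derivative of_real (4 * (real n + 1)) * h s - G s) (at s)" "G 0 = 0"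
    "\<And>s. s > 0 \<Longrightarrow> of_real (4 * s) * h s = K s"
proof -
  obtain P0 where P0: "\<And>x. (P0 has_vector_derivative h x) (at x)"
    using antiderivative_exists[OF continuous_h] by blast
  define P where "P x = P0 x - P0 0" for x
  have P: "(P has_vector_derivative h x) (at x)" for x
    unfolding P_def using has_vector_derivative_diff[OF P0 has_vector_derivative_const] by simp
  have cP: "continuous_on UNIV P" by (intro continuous_at_imp_continuous_on ballI has_vector_derivative_continuous[OF P])
  define e where "e = \<epsilon>\<^sup>2"
  have e: "e > 0" using \<epsilon> by (simp add: e_def)
  \<comment> \<open>A primitive of v h in one formula: with \<open>min\<close> it is continuous
    across the jump of v at e and differentiable elsewhere.\<close>
  define G where "G s = of_real v1 * P (min s e) + of_real v2 * (P s - P (min s e))" for s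
  have cG: "continuous_on UNIV G"
    unfolding G_def
    by (intro continuous_intros continuous_on_compose2[OF cP]) auto
  have G0: "G 0 = 0" using e by (simp add: G_def P_def)
  have G: "(G has_vector_derivative of_real (v s) * h s) (at s)" if "s \<noteq> e" for s
  proof (cases "s < e")
    case True
    have "((\<lambda>s. of_real v1 * P s) has_vector_derivative of_real v1 * h s) (at s)"
      by (rule has_vector_derivative_mult_right[OF P])
    then have "(G has_vector_derivative of_real v1 * h s) (at s)"
      by (rule has_vector_derivative_transform_within_open[where S = "{..<e}"]) (use True in \<open>auto simp: G_def\<close>)
    then show ?thesis using True by (simp add: step_def e_def)
  next
    case False
    with that have s: "s > e" by simp
    have "((\<lambda>s. of_real v1 * P e + of_real v2 * (P s - P e)) has_vector_derivative 0 + of_real v2 * (h s - 0)) (at s)"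
      by (intro has_vector_derivative_add has_vector_derivative_const has_vector_derivative_mult_right has_vector_derivative_diff P)
    then have "(G has_vector_derivative 0 + of_real v2 * (h s - 0)) (at s)"
      by (rule has_vector_derivative_transform_within_open[where S = "{e<..}"]) (use s in \<open>auto simp: G_def\<close>)
    then show ?thesis using s by (simp add: step_def e_def)
  qed
  have "continuous_on UNIV (\<lambda>s. of_real (4 * (real n + 1)) * h s - G s)"
    by (intro continuous_intros continuous_h cG)
  then obtain K0 where K0: "\<And>x. (K0 has_vector_derivative of_real (4 * (real n + 1)) * h x - G x) (at x)"
    using antiderivative_exists by blast
  define K where "K x = K0 x - K0 0" for x
  have K: "(K has_vector_derivative of_real (4 * (real n + 1)) * h x - G x) (at x)" for x
    unfolding K_def using has_vector_derivative_diff[OF K0 has_vector_derivative_const] by simp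
  have cK: "continuous_on UNIV K" by (intro continuous_at_imp_continuous_on ballI has_vector_derivative_continuous[OF K])
  define w where "w s = of_real (4 * s) * h s - K s" for s
  have cw: "continuous_on UNIV w" unfolding w_def by (intro continuous_intros continuous_h cK)
  have zero: "integral {0..b} (\<lambda>s. w s * of_real (bump a b s)) = 0" if ab: "0 < a" "a < b" for a b
  proof -
    have b: "0 < b" using ab by simp
    obtain \<rho> \<psi> where \<rho>: "\<And>k. rsm k \<rho>" "\<And>x. (\<rho> has_real_derivative \<psi> x) (at x)"
      and \<psi>: "\<And>k. rsm k \<psi>" "\<And>x. (\<psi> has_real_derivative bump a b x) (at x)"
      and far: "\<And>x. b \<le> x \<Longrightarrow> \<rho> x = 0" "\<And>x. b \<le> x \<Longrightarrow> \<psi> x = 0"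
      using bump_double_primitive[of a b] by metis
    have cb: "continuous_on UNIV (bump a b)" using rsm_bump[of 0] by simp
    have c\<rho>: "continuous_on UNIV \<rho>" and c\<psi>: "continuous_on UNIV \<psi>" using \<rho>(1)[of 0] \<psi>(1)[of 0] by auto
    note weak = radial_weak_form[OF \<rho> \<psi> cb b far bump_outside[OF disjI2]]
    have dr: "((\<lambda>x. complex_of_real (\<rho> x)) has_vector_derivative of_real (\<psi> s)) (at s)" for s
      by (rule has_vector_derivative_of_real) (use \<rho>(2) in \<open>simp add: has_real_derivative_iff_has_vector_derivative\<close>)
    have dp: "((\<lambda>x. complex_of_real (\<psi> x)) has_vector_derivative of_real (bump a b s)) (at s)" for s
      by (rule has_vector_derivative_of_real) (use \<psi>(2) in \<open>simp add: has_real_derivative_iff_has_vector_derivative\<close>)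
    \<comment> \<open>This primitive performs both integrations by parts at once. Its values vanish
      at b because of the profile and at 0 because K and G are normalised there, so only the
      residual w against the bump survives.\<close>
    have "((\<lambda>s. K s * of_real (\<psi> s) + G s * of_real (\<rho> s)) has_vector_derivative
        (K s * of_real (bump a b s) + (of_real (4 * (real n + 1)) * h s - G s) * of_real (\<psi> s))
        + (G s * of_real (\<psi> s) + of_real (v s) * h s * of_real (\<rho> s))) (at s)" if "s \<noteq> e" for s
      by (intro has_vector_derivative_add has_vector_derivative_mult K dp dr G that)
    moreover have "(K s * of_real (bump a b s) + (of_real (4 * (real n + 1)) * h s - G s) * of_real (\<psi> s))
        + (G s * of_real (\<psi> s) + of_real (v s) * h s * of_real (\<rho> s))
      = (of_real (4 * ((real n + 1) * \<psi> s + s * bump a b s)) * h s - w s * of_real (bump a b s)) + of_real (v s * \<rho> s) * h s" for s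
      unfolding w_def by (simp add: algebra_simps)
    ultimately have D: "((\<lambda>s. K s * of_real (\<psi> s) + G s * of_real (\<rho> s)) has_vector_derivative
        (of_real (4 * ((real n + 1) * \<psi> s + s * bump a b s)) * h s - w s * of_real (bump a b s)) + of_real (v s * \<rho> s) * h s) (at s)"
      if "s \<noteq> e" for s using that by (simp only:)
    have "((\<lambda>s. (of_real (4 * ((real n + 1) * \<psi> s + s * bump a b s)) * h s - w s * of_real (bump a b s)) + of_real (v s * \<rho> s) * h s)
      has_integral (K b * of_real (\<psi> b) + G b * of_real (\<rho> b)) - (K 0 * of_real (\<psi> 0) + G 0 * of_real (\<rho> 0))) {0..b}"
      by (rule fundamental_theorem_of_calculus_interior_strong[of "{e}"])
        (use b D in \<open>auto intro!: continuous_on_subset[of UNIV _ "{0..b}"] continuous_on_add continuous_on_mult continuous_on_of_real cK cG c\<rho> c\<psi>\<close>)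
    then have "integral {0..b} (\<lambda>s. (of_real (4 * ((real n + 1) * \<psi> s + s * bump a b s)) * h s - w s * of_real (bump a b s)) + of_real (v s * \<rho> s) * h s) = 0"
      using far G0 by (simp add: K_def integral_unique)
    moreover have i1: "(\<lambda>s. of_real (4 * ((real n + 1) * \<psi> s + s * bump a b s)) * h s) integrable_on {0..b}"
      by (intro integrable_continuous_real continuous_on_subset[of UNIV _ "{0..b}"] continuous_intros c\<psi> cb continuous_h) auto
    moreover have i2: "(\<lambda>s. w s * of_real (bump a b s)) integrable_on {0..b}"
      by (intro integrable_continuous_real continuous_on_subset[of UNIV _ "{0..b}"] continuous_intros cw cb) auto
    ultimately have "integral {0..b} (\<lambda>s. of_real (4 * ((real n + 1) * \<psi> s + s * bump a b s)) * h s)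
        - integral {0..b} (\<lambda>s. w s * of_real (bump a b s)) + integral {0..b} (\<lambda>s. of_real (v s * \<rho> s) * h s) = 0"
      using weak(2) by (simp only: Henstock_Kurzweil_Integration.integral_add[OF integrable_diff[OF i1 i2] weak(2)] Henstock_Kurzweil_Integration.integral_diff[OF i1 i2])
    then show ?thesis using weak(1) by simp
  qed
  have "w s = 0" if s: "s > 0" for s
  proof -
    have i: "(\<lambda>s. w s * of_real (bump a b s)) integrable_on {0..b}" for a b
    proof -
      have cb: "continuous_on UNIV (bump a b)" using rsm_bump[of 0] by simp
      show ?thesis by (intro integrable_continuous_real continuous_on_subset[of UNIV _ "{0..b}"] continuous_intros cw cb) auto
    qed
    have "integral {0..b} (\<lambda>s. Re (w s) * bump a b s) = 0" "integral {0..b} (\<lambda>s. Im (w s) * bump a b s) = 0"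
      if "0 < a" "a < b" for a b
      using integral_linear[OF i bounded_linear_Re, of b a] integral_linear[OF i bounded_linear_Im, of b a] zero[OF that]
      by (simp_all add: o_def)
    then have "Re (w s) = 0" "Im (w s) = 0"
      using bump_test_zero[of "\<lambda>s. Re (w s)", OF _ _ s] bump_test_zero[of "\<lambda>s. Im (w s)", OF _ _ s] cw
      by (auto intro: continuous_intros)
    then show ?thesis by (simp add: complex_eq_iff)
  qed
  then show ?thesis using that[OF cG] G K G0 by (auto simp: w_def e_def)
qed

text \<open>The relation 4 s h = K shows that f is continuously differentiable, with r f' equal to n
  f - G(r^2) / (2 r^n). This is continuous across \<epsilon>, which is the transmission condition,
  and differentiable off \<epsilon>, which is Bessel's equation. The bound near 0 is the regularity
  that will exclude Y_n.\<close>

lemma radial_equation_aux: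
  obtains \<phi> where "\<And>r. r > 0 \<Longrightarrow> (f has_vector_derivative \<phi> r / of_real r) (at r)"
    "\<And>r. r > 0 \<Longrightarrow> r \<noteq> \<epsilon> \<Longrightarrow>
      (\<phi> has_vector_derivative of_real ((real n)\<^sup>2 / r - (if r < \<epsilon> then v1 else v2) * r) * f r) (at r)"
    "continuous_on {0<..} \<phi>"
    "\<exists>M. \<forall>r. 0 < r \<longrightarrow> r < \<epsilon> \<longrightarrow> cmod (\<phi> r - of_nat n * f r) \<le> M * r\<^sup>2"
proof -
  obtain G K where cG: "continuous_on UNIV G"
    and G: "\<And>s. s \<noteq> \<epsilon>\<^sup>2 \<Longrightarrow> (G has_vector_derivative of_real (v s) * h s) (at s)"
    and K: "\<And>s. (K has_vector_derivative of_real (4 * (real n + 1)) * h s - G s) (at s)" and G0: "G 0 = 0"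
    and hK: "\<And>s. s > 0 \<Longrightarrow> of_real (4 * s) * h s = K s"
    using radial_integrated by blast
  define \<phi> where "\<phi> r = of_nat n * f r - G (r\<^sup>2) * of_real (inverse (r ^ n)) / 2" for r
  have hf: "h (r\<^sup>2) = of_real (r ^ n) * f r" if "r > 0" for r using that by (simp add: h_def)
  have sq: "((\<lambda>r::real. r\<^sup>2) has_vector_derivative 2 * r) (at r)" for r
    using DERIV_pow[of 2 r] by (simp add: has_real_derivative_iff_has_vector_derivative)
  have comp: "((\<lambda>r. F (r\<^sup>2)) has_vector_derivative of_real (2 * r) * F') (at r)"
    if "(F has_vector_derivative F') (at (r\<^sup>2))" for F F' and r :: real
    using vector_diff_chain_at[OF sq that] by (simp add: o_def scaleR_conv_of_real)
  have ip: "((\<lambda>r. complex_of_real (inverse (r ^ m))) has_vector_derivative of_real (- real m * inverse (r ^ Suc m))) (at r)"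
    if r: "r > 0" for m r
  proof (rule has_vector_derivative_of_real)
    have "((\<lambda>r. inverse (r ^ m)) has_real_derivative - (real m * r ^ (m - Suc 0) * inverse ((r ^ m) ^ Suc (Suc 0)))) (at r)"
      by (rule DERIV_inverse_fun) (use r DERIV_pow[of m r] in auto)
    moreover have "- (real m * r ^ (m - Suc 0) * inverse ((r ^ m) ^ Suc (Suc 0))) = - real m * inverse (r ^ Suc m)"
      using r by (cases m) (simp_all add: field_simps)
    ultimately show "((\<lambda>r. inverse (r ^ m)) has_real_derivative - real m * inverse (r ^ Suc m)) (at r)"
      by (simp only:)
  qed
  have K_eq: "K (r\<^sup>2) = 4 * of_real r * of_real r * (of_real r ^ n * f r)" if r: "r > 0" for r
    using hK[of "r\<^sup>2"] hf[OF r] r by (simp add: power2_eq_square mult_ac)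
  have inv: "of_real (inverse (r ^ (n + 2))) * (of_real r * of_real r * of_real r ^ n) = (1 :: complex)"
    "of_real (inverse (r ^ Suc (n + 2))) * (of_real r * of_real r * of_real r ^ n) = (inverse (of_real r) :: complex)"
    "of_real (inverse (r ^ (n + 2))) * of_real r = of_real (inverse (r ^ n)) * (inverse (of_real r) :: complex)"
    "of_real (inverse (r ^ Suc n)) = of_real (inverse (r ^ n)) * (inverse (of_real r) :: complex)"
    "of_real (inverse (r ^ n)) * of_real r ^ n = (1 :: complex)"
    if r: "r > 0" for r :: real
    using r by (simp_all add: of_real_inverse field_simps)
  have fK: "f r = K (r\<^sup>2) * of_real (inverse (r ^ (n + 2))) / 4" if r: "r > 0" for r
  proof -
    have "K (r\<^sup>2) * of_real (inverse (r ^ (n + 2))) / 4 =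
        (of_real (inverse (r ^ (n + 2))) * (of_real r * of_real r * of_real r ^ n)) * f r"
      unfolding K_eq[OF r] by (simp only: mult_ac times_divide_eq_left) simp
    then show ?thesis by (simp only: inv[OF r] mult_1_left)
  qed
  have df: "(f has_vector_derivative \<phi> r / of_real r) (at r)" if r: "r > 0" for r
  proof -
    have "((\<lambda>r. K (r\<^sup>2) * of_real (inverse (r ^ (n + 2)))) has_vector_derivative
        K (r\<^sup>2) * of_real (- real (n + 2) * inverse (r ^ Suc (n + 2)))
        + of_real (2 * r) * (of_real (4 * (real n + 1)) * h (r\<^sup>2) - G (r\<^sup>2)) * of_real (inverse (r ^ (n + 2)))) (at r)"
      by (rule has_vector_derivative_mult[OF comp[OF K] ip[OF r]])
    from has_vector_derivative_divide[OF this, of 4]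
    have "((\<lambda>r. K (r\<^sup>2) * of_real (inverse (r ^ (n + 2))) / 4) has_vector_derivative
        (K (r\<^sup>2) * of_real (- real (n + 2) * inverse (r ^ Suc (n + 2)))
        + of_real (2 * r) * (of_real (4 * (real n + 1)) * h (r\<^sup>2) - G (r\<^sup>2)) * of_real (inverse (r ^ (n + 2)))) / 4) (at r)" .
    moreover have "(K (r\<^sup>2) * of_real (- real (n + 2) * inverse (r ^ Suc (n + 2)))
        + of_real (2 * r) * (of_real (4 * (real n + 1)) * h (r\<^sup>2) - G (r\<^sup>2)) * of_real (inverse (r ^ (n + 2)))) / 4 = \<phi> r / of_real r"
    proof -
      define A B C :: complex where "A = of_real (inverse (r ^ Suc (n + 2)))" and "B = of_real (inverse (r ^ (n + 2)))"
        and "C = of_real (inverse (r ^ n))"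
      define x :: complex where "x = of_real r"
      define y where "y = x ^ n"
      have i: "A * (x * x * y) = inverse x" "B * (x * x * y) = 1" "B * x = C * inverse x"
        using inv[OF r] by (simp_all add: A_def B_def C_def x_def y_def)
      have c: "of_real (- real (n + 2) * inverse (r ^ Suc (n + 2))) = - (of_nat n + 2) * A"
        "complex_of_real (2 * r) = 2 * x" "complex_of_real (4 * (real n + 1)) = 4 * (of_nat n + 1)"
        "complex_of_real (r ^ n) = y"
        by (simp_all add: A_def x_def y_def)
      have x: "x \<noteq> 0" using r by (simp add: x_def)
      then have i': "B * x * y = inverse x" using i(2) by (simp add: field_simps)
      have "(4 * x * x * (y * f r) * (- (of_nat n + 2) * A) + 2 * x * (4 * (of_nat n + 1) * (y * f r) - G (r\<^sup>2)) * B) / 4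
          = - (of_nat n + 2) * f r * (A * (x * x * y)) + 2 * (of_nat n + 1) * f r * (B * x * y) - (B * x) * G (r\<^sup>2) / 2"
        by (simp add: field_simps)
      also have "\<dots> = (of_nat n * f r - G (r\<^sup>2) * C / 2) * inverse x"
        unfolding i(1) i' unfolding i(3) by (simp add: algebra_simps)
      also have "\<dots> = (of_nat n * f r - G (r\<^sup>2) * C / 2) / x"
        by (rule divide_inverse[symmetric])
      finally show ?thesis
        by (simp only: K_eq[OF r] hf[OF r] \<phi>_def c x_def[symmetric] y_def[symmetric] B_def[symmetric] C_def[symmetric])
    qed
    ultimately have "((\<lambda>r. K (r\<^sup>2) * of_real (inverse (r ^ (n + 2))) / 4) has_vector_derivative \<phi> r / of_real r) (at r)"
      by (simp only:)
    then show ?thesis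
      by (rule has_vector_derivative_transform_within_open[where S = "{0<..}"]) (use r fK in auto)
  qed
  have d\<phi>: "(\<phi> has_vector_derivative of_real ((real n)\<^sup>2 / r - (if r < \<epsilon> then v1 else v2) * r) * f r) (at r)"
    if r: "r > 0" "r \<noteq> \<epsilon>" for r
  proof -
    have r2: "r\<^sup>2 \<noteq> \<epsilon>\<^sup>2" using r \<epsilon> by (simp add: power2_eq_iff)
    have st: "v (r\<^sup>2) = (if r < \<epsilon> then v1 else v2)"
      using r \<epsilon> power_mono_iff[of \<epsilon> r 2] by (simp add: step_def not_le[symmetric])
    have "(\<phi> has_vector_derivative of_nat n * (\<phi> r / of_real r)
        - (G (r\<^sup>2) * of_real (- real n * inverse (r ^ Suc n)) + of_real (2 * r) * (of_real (v (r\<^sup>2)) * h (r\<^sup>2)) * of_real (inverse (r ^ n))) / 2) (at r)"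
      unfolding \<phi>_def[abs_def]
      by (rule has_vector_derivative_diff[OF has_vector_derivative_mult_right[OF df[OF r(1), unfolded \<phi>_def]]
          has_vector_derivative_divide[OF has_vector_derivative_mult[OF comp[OF G[OF r2]] ip[OF r(1)]]]])
    moreover have "of_nat n * (\<phi> r / of_real r)
        - (G (r\<^sup>2) * of_real (- real n * inverse (r ^ Suc n)) + of_real (2 * r) * (of_real (v (r\<^sup>2)) * h (r\<^sup>2)) * of_real (inverse (r ^ n))) / 2
        = of_real ((real n)\<^sup>2 / r - v (r\<^sup>2) * r) * f r"
    proof -
      define C :: complex where "C = of_real (inverse (r ^ n))"
      define x w :: complex where "x = of_real r" and "w = of_real (v (r\<^sup>2))"
      define y where "y = x ^ n"
      have i: "C * y = 1" "of_real (inverse (r ^ Suc n)) = C * inverse x"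
        using inv[OF r(1)] by (simp_all add: C_def x_def y_def)
      have c: "of_real (- real n * inverse (r ^ Suc n)) = - of_nat n * (C * inverse x)"
        "complex_of_real (2 * r) = 2 * x" "complex_of_real (r ^ n) = y"
        "complex_of_real ((real n)\<^sup>2 / r - v (r\<^sup>2) * r) = of_nat n * of_nat n / x - w * x"
        using i(2) by (simp_all add: x_def y_def w_def power2_eq_square)
      define X where "X = inverse x"
      have "of_nat n * ((of_nat n * f r - G (r\<^sup>2) * C / 2) / x)
          - (G (r\<^sup>2) * (- of_nat n * (C * inverse x)) + 2 * x * (w * (y * f r)) * C) / 2
          = of_nat n * of_nat n * inverse x * f r - w * x * f r * (C * y)"
        unfolding divide_inverse[of _ x] X_def[symmetric] by (simp add: field_simps)
      also have "\<dots> = (of_nat n * of_nat n / x - w * x) * f r"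
        unfolding i(1) divide_inverse[of _ x] by (simp add: algebra_simps)
      finally show ?thesis
        by (simp only: hf[OF r(1)] \<phi>_def c x_def[symmetric] y_def[symmetric] w_def[symmetric] C_def[symmetric])
    qed
    ultimately show ?thesis unfolding st by (simp only:)
  qed
  have c: "continuous_on {0<..} \<phi>"
  proof -
    have "continuous_on {0<..} (\<lambda>r. G (r\<^sup>2))"
      by (rule continuous_on_compose2[OF cG]) (auto intro!: continuous_intros)
    then show ?thesis
      unfolding \<phi>_def[abs_def]
      by (intro continuous_on_diff continuous_on_divide continuous_on_mult continuous_on_const
          continuous_on_of_real continuous_on_inverse continuous_on_power continuous_on_id continuous_on_subset[OF continuous_f]) auto
  qed
  have "bounded (f ` {0..\<epsilon>})"
    by (intro compact_imp_bounded compact_continuous_image continuous_on_subset[OF continuous_f]) auto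
  then obtain M where "\<forall>x\<in>{0..\<epsilon>}. cmod (f x) \<le> M" by (auto simp: bounded_iff)
  then have M: "cmod (f r) \<le> M" if "0 \<le> r" "r \<le> \<epsilon>" for r using that by simp
  have M0: "M \<ge> 0" using M[of 0] \<epsilon> norm_ge_zero[of "f 0"] by linarith
  have "cmod (\<phi> r - of_nat n * f r) \<le> (\<bar>v1\<bar> * M / 2) * r\<^sup>2" if r: "0 < r" "r < \<epsilon>" for r
  proof -
    have re: "r\<^sup>2 < \<epsilon>\<^sup>2" using r by (intro power_strict_mono) auto
    have "((\<lambda>s. of_real (v s) * h s) has_integral (G (r\<^sup>2) - G 0)) {0..r\<^sup>2}"
      by (rule fundamental_theorem_of_calculus) (use re in \<open>auto intro!: has_vector_derivative_at_within G\<close>)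
    moreover have "\<forall>s\<in>{0..r\<^sup>2}. cmod (of_real (v s) * h s) \<le> \<bar>v1\<bar> * (r ^ n * M)"
    proof
      fix s assume s: "s \<in> {0..r\<^sup>2}"
      then have s': "0 \<le> sqrt s" "sqrt s \<le> r" using r real_sqrt_le_mono[of s "r\<^sup>2"] by auto
      have "cmod (h s) \<le> r ^ n * M"
        unfolding h_def norm_mult
        by (rule mult_mono) (use s' r M power_mono[of "sqrt s" r n] in \<open>auto simp: norm_power\<close>)
      moreover have "v s = v1" using s re by (simp add: step_def)
      ultimately show "cmod (of_real (v s) * h s) \<le> \<bar>v1\<bar> * (r ^ n * M)"
        by (simp add: norm_mult mult_left_mono)
    qed
    ultimately have "cmod (G (r\<^sup>2) - G 0) \<le> (\<bar>v1\<bar> * (r ^ n * M)) * measure lborel {0..r\<^sup>2}"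
      by (intro has_integral_bound_real[of "\<bar>v1\<bar> * (r ^ n * M)" "{}"]) (use M0 r in auto)
    then have "cmod (G (r\<^sup>2)) \<le> (\<bar>v1\<bar> * (r ^ n * M)) * r\<^sup>2" using G0 by simp
    then have "cmod (G (r\<^sup>2)) * inverse (r ^ n) / 2 \<le> ((\<bar>v1\<bar> * (r ^ n * M)) * r\<^sup>2) * inverse (r ^ n) / 2"
      using r by (intro divide_right_mono mult_right_mono) auto
    also have "\<dots> = (\<bar>v1\<bar> * M / 2) * r\<^sup>2" using r by (simp add: field_simps)
    also have "cmod (G (r\<^sup>2)) * inverse (r ^ n) / 2 = cmod (\<phi> r - of_nat n * f r)"
      unfolding \<phi>_def using r by (simp add: norm_mult norm_divide norm_inverse norm_power)
    finally show ?thesis .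
  qed
  then show ?thesis using that[OF df d\<phi> c] by blast
qed

lemmas radial_equation = radial_equation_aux[unfolded n_def f_def[abs_def]]

end


subsection \<open>Matching of a single mode\<close>

lemma EJ_continuous: "x > 0 \<Longrightarrow> isCont (EJ n) x"
  and J_continuous: "x > 0 \<Longrightarrow> isCont (J n) x"
  using EJ_has_deriv J_has_deriv by (blast intro: DERIV_isCont)+

text \<open>The Wronskian of the solution with J_n is \<beta> times a nonzero constant, and it tends
  to 0 at the origin: for n \<ge> 1 because J_n and its Euler derivative do, for n = 0 because
  \<phi> tends to 0. Continuity then carries the formula to the endpoint e.\<close>

lemma regular_solution:
  fixes f \<phi> :: "real \<Rightarrow> complex"
  assumes e: "e > 0" and k: "k > 0" and cf: "continuous_on UNIV f" and c\<phi>: "continuous_on {0<..} \<phi>"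
    and f: "\<And>r. r > 0 \<Longrightarrow> (f has_vector_derivative \<phi> r / of_real r) (at r)"
    and \<phi>: "\<And>r. 0 < r \<Longrightarrow> r < e \<Longrightarrow> (\<phi> has_vector_derivative of_real ((real n)\<^sup>2 / r - k\<^sup>2 * r) * f r) (at r)"
    and small: "\<And>r. 0 < r \<Longrightarrow> r < e \<Longrightarrow> cmod (\<phi> r - of_nat n * f r) \<le> M * r\<^sup>2"
  obtains c :: complex where "f e = c * of_real (J n (k * e))" "\<phi> e = c * of_real (EJ n (k * e))"
proof -
  obtain \<alpha> \<beta> :: complex where fs: "\<And>r. r \<in> {0<..<e} \<Longrightarrow> f r = \<alpha> * J n (k * r) + \<beta> * Y n (k * r)"
    and ps: "\<And>r. r \<in> {0<..<e} \<Longrightarrow> \<phi> r = \<alpha> * EJ n (k * r) + \<beta> * EY n (k * r)"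
    by (rule bessel_solution[of "{0<..<e}" k f \<phi> n]) (use k f \<phi> in auto)
  have W: "of_real (J n (k * r)) * \<phi> r - of_real (EJ n (k * r)) * f r = \<beta> * of_real (2 / pi)" if r: "r \<in> {0<..<e}" for r
  proof -
    have "k * r > 0" using r k by simp
    from wronskian_Euler[OF this, of n]
    have w: "complex_of_real (J n (k * r) * EY n (k * r) - EJ n (k * r) * Y n (k * r)) = of_real (2 / pi)" by simp
    have "of_real (J n (k * r)) * \<phi> r - of_real (EJ n (k * r)) * f r
        = \<beta> * complex_of_real (J n (k * r) * EY n (k * r) - EJ n (k * r) * Y n (k * r))"
      unfolding fs[OF r] ps[OF r] by (simp add: algebra_simps)
    then show ?thesis unfolding w .
  qed
  have near: "\<forall>\<^sub>F r in at_right 0. r \<in> {0<..<e}"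
    using e by (simp add: eventually_at_right_less eventually_at_right[OF e] exI[of _ e])
  have kr: "filterlim (\<lambda>r. k * r) (at_right 0) (at_right 0)"
    unfolding filterlim_at
  proof
    show "\<forall>\<^sub>F r in at_right 0. k * r \<in> {0<..} \<and> k * r \<noteq> 0"
      using near by eventually_elim (use k in auto)
    have "((\<lambda>r. k * r) \<longlongrightarrow> k * 0) (at_right 0)" by (intro tendsto_intros)
    then show "((\<lambda>r. k * r) \<longlongrightarrow> 0) (at_right 0)" by simp
  qed
  have f0: "(f \<longlongrightarrow> f 0) (at_right 0)"
    using cf by (simp add: continuous_on_eq_continuous_at isCont_def tendsto_within_subset filterlim_at_split)
  have d0: "((\<lambda>r. \<phi> r - of_nat n * f r) \<longlongrightarrow> 0) (at_right 0)"
  proof (rule Lim_null_comparison)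
    show "\<forall>\<^sub>F r in at_right 0. norm (\<phi> r - of_nat n * f r) \<le> M * r\<^sup>2"
      using near by eventually_elim (use small in auto)
    have "((\<lambda>r. M * r\<^sup>2) \<longlongrightarrow> M * 0\<^sup>2) (at_right 0)" by (intro tendsto_intros)
    then show "((\<lambda>r. M * r\<^sup>2) \<longlongrightarrow> 0) (at_right 0)" by simp
  qed
  have p0: "(\<phi> \<longlongrightarrow> of_nat n * f 0) (at_right 0)"
    using tendsto_add[OF d0 tendsto_mult[OF tendsto_const[of "of_nat n"] f0]] by simp
  have "((\<lambda>r. of_real (J n (k * r)) * \<phi> r - of_real (EJ n (k * r)) * f r) \<longlongrightarrow>
      of_real (if n = 0 then 1 else 0) * (of_nat n * f 0) - of_real 0 * f 0) (at_right 0)"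
    by (intro tendsto_diff tendsto_mult tendsto_of_real p0 f0
        filterlim_compose[OF tendsto_J_at_0 kr] filterlim_compose[OF tendsto_EJ_at_0 kr])
  then have "((\<lambda>r. of_real (J n (k * r)) * \<phi> r - of_real (EJ n (k * r)) * f r) \<longlongrightarrow> 0) (at_right 0)"
    by (cases "n = 0") simp_all
  then have "((\<lambda>r. \<beta> * of_real (2 / pi)) \<longlongrightarrow> 0) (at_right (0::real))"
  proof (rule Lim_transform_eventually)
    show "\<forall>\<^sub>F r in at_right 0. of_real (J n (k * r)) * \<phi> r - of_real (EJ n (k * r)) * f r = \<beta> * of_real (2 / pi)"
      using near by eventually_elim (rule W)
  qed
  then have "\<beta> * of_real (2 / pi) = 0"
    using tendsto_unique[OF trivial_limit_at_right_real tendsto_const] by blast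
  then have \<beta>: "\<beta> = 0" by simp
  have lim: "g e = c" if "isCont g e" "isCont h e" "\<And>r. 0 < r \<Longrightarrow> r < e \<Longrightarrow> g r = h r" "h e = c"
    for g h :: "real \<Rightarrow> complex" and c
  proof -
    have ev: "\<forall>\<^sub>F r in at_left e. g r = h r"
      unfolding eventually_at_left[OF e] by (rule exI[of _ 0]) (use e that(3) in simp)
    have g: "(g \<longlongrightarrow> g e) (at_left e)" using that(1) unfolding isCont_def filterlim_at_split by (rule conjunct1)
    have h: "(h \<longlongrightarrow> h e) (at_left e)" using that(2) unfolding isCont_def filterlim_at_split by (rule conjunct1)
    have "g e = h e"
      by (rule tendsto_unique[OF trivial_limit_at_left_real Lim_transform_eventually[OF g ev] h])
    then show ?thesis using that(4) by simp
  qed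
  have ke: "k * e > 0" using k e by simp
  have comp: "isCont (\<lambda>r. \<alpha> * of_real (F (k * r))) e" if "isCont F (k * e)" for F
    by (intro continuous_intros isCont_o2[of e "\<lambda>r. k * r" F, OF _ that])
  show ?thesis
  proof (rule that[of \<alpha>])
    show "f e = \<alpha> * of_real (J n (k * e))"
      by (rule lim[where h = "\<lambda>r. \<alpha> * of_real (J n (k * r))", OF _ comp[OF J_continuous[OF ke]]])
        (use cf fs \<beta> in \<open>auto simp: continuous_on_eq_continuous_at\<close>)
    show "\<phi> e = \<alpha> * of_real (EJ n (k * e))"
      by (rule lim[where h = "\<lambda>r. \<alpha> * of_real (EJ n (k * r))", OF _ comp[OF EJ_continuous[OF ke]]])
        (use c\<phi> ps \<beta> e in \<open>auto simp: continuous_on_eq_continuous_at\<close>)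
  qed
qed

text \<open>The Wronskian of the solution with H_n is the constant (\<beta> - i \<alpha>) (2/pi).
  Written with the radiation defects of both factors, the terms without a defect cancel; the rest
  tends to 0, since solutions are of order r^(-1/2) and the defects are smaller.\<close>

lemma outgoing_bessel:
  fixes \<alpha> \<beta> :: complex
  assumes k: "k > 0"
    and rad: "\<And>e. e > 0 \<Longrightarrow> \<forall>\<^sub>F r in at_top. cmod ((\<alpha> * of_real (EJ n (k * r)) + \<beta> * of_real (EY n (k * r))) / of_real r
        - \<i> * of_real k * (\<alpha> * of_real (J n (k * r)) + \<beta> * of_real (Y n (k * r)))) \<le> e / sqrt r"
  shows "\<beta> = \<i> * \<alpha>"
proof -
  define g where "g r = \<alpha> * of_real (J n (k * r)) + \<beta> * of_real (Y n (k * r))" for r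
  define \<gamma> where "\<gamma> r = \<alpha> * of_real (EJ n (k * r)) + \<beta> * of_real (EY n (k * r))" for r
  define Q where "Q r = \<gamma> r / of_real r - \<i> * of_real k * g r" for r
  define A where "A = cmod \<alpha> + cmod \<beta>"
  obtain C where C: "C \<ge> 0" "\<And>x. x \<ge> 1 \<Longrightarrow> sqrt x * cmod (H n x) \<le> C" "\<And>x. x \<ge> 1 \<Longrightarrow> sqrt x * cmod (Hdef n x) \<le> C / x"
    using hankel_decay[of n] by auto
  have A0: "A \<ge> 0" by (simp add: A_def)
  have lim: "((\<lambda>r. sqrt r * cmod (Q r)) \<longlongrightarrow> 0) at_top"
  proof (rule tendstoI)
    fix e :: real assume e: "e > 0"
    have "\<forall>\<^sub>F r in at_top. cmod (Q r) \<le> (e / 2) / sqrt r"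
      using rad[of "e / 2"] e by (simp add: Q_def \<gamma>_def g_def)
    then show "\<forall>\<^sub>F r in at_top. dist (sqrt r * cmod (Q r)) 0 < e"
      using eventually_gt_at_top[of 0]
    proof eventually_elim
      fix r :: real assume h: "cmod (Q r) \<le> (e / 2) / sqrt r" and r: "0 < r"
      then have "sqrt r * cmod (Q r) \<le> e / 2" by (simp add: field_simps)
      then show "dist (sqrt r * cmod (Q r)) 0 < e" using r e by (simp add: dist_real_def abs_mult)
    qed
  qed
  have bound: "cmod ((\<beta> - \<i> * \<alpha>) * of_real (2 / pi)) \<le> (sqrt r * cmod (Q r)) * (C / sqrt k) + (A * C * C) * (1 / (k * r))"
    if r: "r \<ge> 1 / k" for r
  proof -
    define x where "x = k * r"
    have r0: "r > 0" using r k by (meson less_le_trans zero_less_divide_1_iff)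
    have x: "x \<ge> 1" "x > 0" using r k r0 by (simp_all add: x_def field_simps)
    have w: "complex_of_real (J n x * EY n x - EJ n x * Y n x) = of_real (2 / pi)"
      using wronskian_Euler[OF x(2), of n] by simp
    have sq: "sqrt x * sqrt x = x" using x by simp
    have "\<gamma> r * H n x - g r * EH n x = (\<beta> - \<i> * \<alpha>) * complex_of_real (J n x * EY n x - EJ n x * Y n x)"
      unfolding \<gamma>_def g_def H_eq EH_eq x_def[symmetric] by (simp add: algebra_simps)
    then have "(\<beta> - \<i> * \<alpha>) * of_real (2 / pi) = \<gamma> r * H n x - g r * EH n x" unfolding w ..
    also have "EH n x = of_real x * (Hdef n x + \<i> * H n x)"
      using x by (simp add: Hdef_def)
    also have "\<gamma> r = of_real r * (Q r + \<i> * of_real k * g r)" using r0 by (simp add: Q_def)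
    also have "of_real r * (Q r + \<i> * of_real k * g r) * H n x - g r * (of_real x * (Hdef n x + \<i> * H n x))
        = of_real r * Q r * H n x - of_real x * g r * Hdef n x"
      unfolding x_def by (simp add: algebra_simps)
    finally have "cmod ((\<beta> - \<i> * \<alpha>) * of_real (2 / pi)) \<le> cmod (of_real r * Q r * H n x) + cmod (of_real x * g r * Hdef n x)"
      by (simp only: norm_triangle_ineq4)
    also have "cmod (of_real r * Q r * H n x) = (sqrt r * cmod (Q r)) * (sqrt x * cmod (H n x)) / sqrt k"
    proof -
      have "sqrt x = sqrt k * sqrt r" by (simp add: x_def real_sqrt_mult)
      moreover have "sqrt r * sqrt r = r" using r0 by simp
      ultimately show ?thesis using r0 k by (simp add: norm_mult mult_ac)
    qed
    also have "\<dots> \<le> (sqrt r * cmod (Q r)) * C / sqrt k"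
      using k r0 C(2)[OF x(1)] by (intro divide_right_mono mult_left_mono) auto
    also have "cmod (of_real x * g r * Hdef n x) \<le> A * C * C * (1 / x)"
    proof -
      have "cmod (g r) \<le> cmod \<alpha> * cmod (H n x) + cmod \<beta> * cmod (H n x)"
        unfolding g_def x_def[symmetric]
        using norm_triangle_ineq[of "\<alpha> * of_real (J n x)" "\<beta> * of_real (Y n x)"]
          mult_left_mono[OF abs_Re_le_cmod[of "H n x"], of "cmod \<alpha>"] mult_left_mono[OF abs_Im_le_cmod[of "H n x"], of "cmod \<beta>"]
        by (simp add: norm_mult)
      then have "sqrt x * cmod (g r) \<le> sqrt x * (A * cmod (H n x))"
        by (intro mult_left_mono) (auto simp: A_def algebra_simps x(2) less_imp_le)
      also have "\<dots> = A * (sqrt x * cmod (H n x))" by simp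
      also have "\<dots> \<le> A * C" using A0 C(2)[OF x(1)] by (intro mult_left_mono)
      finally have g: "sqrt x * cmod (g r) \<le> A * C" .
      have "cmod (of_real x * g r * Hdef n x) = (sqrt x * cmod (g r)) * (sqrt x * cmod (Hdef n x))"
        using x sq by (simp add: norm_mult mult_ac)
      also have "\<dots> \<le> (A * C) * (C / x)"
        by (rule mult_mono[OF g C(3)[OF x(1)]]) (use A0 C(1) x in auto)
      finally show ?thesis by simp
    qed
    finally show ?thesis by (simp add: x_def)
  qed
  have "((\<lambda>r. (sqrt r * cmod (Q r)) * (C / sqrt k) + (A * C * C) * (1 / (k * r))) \<longlongrightarrow> 0 * (C / sqrt k) + (A * C * C) * 0) at_top"
  proof (intro tendsto_add tendsto_mult lim tendsto_const)
    show "((\<lambda>r. 1 / (k * r)) \<longlongrightarrow> 0) at_top" using k by real_asymp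
  qed
  then have "cmod ((\<beta> - \<i> * \<alpha>) * of_real (2 / pi)) \<le> 0 * (C / sqrt k) + (A * C * C) * 0"
    by (rule tendsto_lowerbound)
      (use eventually_mono[OF eventually_ge_at_top[of "1 / k"] bound] trivial_limit_at_top_linorder in auto)
  then show ?thesis by simp
qed

section \<open>Fourier coefficients of the expansion and of the radiation condition\<close>

lemma vector_derivative_norm_le:
  fixes W :: "real \<Rightarrow> complex"
  assumes W: "(W has_vector_derivative D) (at r)" and b: "\<And>s. r < s \<Longrightarrow> cmod (W s - W r) \<le> B * (s - r)"
  shows "cmod D \<le> B"
proof (rule field_le_epsilon)
  fix e :: real assume "e > 0"
  with W obtain d where d: "d > 0" "\<And>y. norm (y - r) < d \<Longrightarrow> norm (W y - W r - (y - r) *\<^sub>R D) \<le> e * norm (y - r)"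
    unfolding has_vector_derivative_def has_derivative_at_alt by blast
  define h where "h = d / 2"
  have h: "h > 0" "h < d" using d by (auto simp: h_def)
  have "cmod (W (r + h) - W r - h *\<^sub>R D) \<le> e * h" using d(2)[of "r + h"] h by simp
  moreover have "cmod (W (r + h) - W r) \<le> B * h" using b[of "r + h"] h by simp
  moreover have "cmod (h *\<^sub>R D) \<le> cmod (W (r + h) - W r) + cmod (W (r + h) - W r - h *\<^sub>R D)"
    using norm_triangle_ineq4[of "W (r + h) - W r" "W (r + h) - W r - h *\<^sub>R D"] by simp
  ultimately have "h * cmod D \<le> h * (B + e)" using h by (simp add: algebra_simps)
  then show "cmod D \<le> B + e" using h by simp
qed

lemma integral_cis:
  "((\<lambda>\<theta>. cis (of_int m * \<theta>)) has_integral (if m = 0 then of_real (2 * pi) else 0)) {0..2 * pi}"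
proof (cases "m = 0")
  case True
  then show ?thesis using has_integral_const_real[of "1::complex" 0 "2 * pi"] by (simp add: scaleR_conv_of_real)
next
  case False
  have d: "((\<lambda>\<theta>. cis (of_int m * \<theta>) / (\<i> * of_int m)) has_vector_derivative cis (of_int m * \<theta>)) (at \<theta> within {0..2 * pi})" for \<theta>
  proof -
    have "((\<lambda>z. exp (\<i> * of_int m * z) / (\<i> * of_int m)) has_field_derivative exp (\<i> * of_int m * of_real \<theta>)) (at (of_real \<theta>))"
      using False by (auto intro!: derivative_eq_intros)
    from has_vector_derivative_real_field[OF this]
    show ?thesis by (simp add: cis_conv_exp mult_ac has_vector_derivative_at_within)
  qed
  have "((\<lambda>\<theta>. cis (of_int m * \<theta>)) has_integral cis (of_int m * (2 * pi)) / (\<i> * of_int m) - cis (of_int m * 0) / (\<i> * of_int m)) {0..2 * pi}"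
    by (rule fundamental_theorem_of_calculus) (use d in auto)
  moreover have "cis (of_int m * (2 * pi)) = 1" using cis_multiple_2pi[of "of_int m"] by (simp add: mult_ac)
  ultimately show ?thesis using False by simp
qed

text \<open>Convergence at \<theta> = 0 is unconditional, hence absolute, for complex terms. That
  gives uniform convergence on the circle and allows termwise integration.\<close>

lemma fourier_coeff_series:
  assumes sum: "\<And>\<theta>. ((\<lambda>n. b n * cis (of_int n * \<theta>)) has_sum u (rcis r \<theta>)) UNIV"
  shows "fourier_coeff r u \<nu> = b \<nu>"
    and "(\<lambda>\<theta>. u (rcis r \<theta>) * cis (- (of_int \<nu> * \<theta>))) integrable_on {0..2 * pi}"
proof -
  have "b summable_on UNIV" using sum[of 0] by (auto simp: summable_on_def)
  then have abs: "(\<lambda>n. cmod (b n)) summable_on UNIV" by (simp add: summable_on_iff_abs_summable_on_complex)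
  let ?t = "\<lambda>n \<theta>. b n * cis (of_int n * \<theta>) * cis (- (of_int \<nu> * \<theta>))"
  have "uniform_limit (cbox 0 (2 * pi)) (\<lambda>X \<theta>. \<Sum>n\<in>X. ?t n \<theta>) (\<lambda>\<theta>. u (rcis r \<theta>) * cis (- (of_int \<nu> * \<theta>))) (finite_subsets_at_top UNIV)"
    by (rule Weierstrass_m_test_general'[OF _ _ abs])
      (auto simp: norm_mult intro!: has_sum_cmult_left sum)
  moreover have "continuous_on (cbox 0 (2 * pi)) (\<lambda>\<theta>. \<Sum>n\<in>X. ?t n \<theta>)" for X
    by (intro continuous_intros) 
  ultimately obtain I Jj where I: "\<And>X. ((\<lambda>\<theta>. \<Sum>n\<in>X. ?t n \<theta>) has_integral I X) (cbox 0 (2 * pi))"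
    and Jj: "((\<lambda>\<theta>. u (rcis r \<theta>) * cis (- (of_int \<nu> * \<theta>))) has_integral Jj) (cbox 0 (2 * pi))"
    and lim: "(I \<longlongrightarrow> Jj) (finite_subsets_at_top UNIV)"
    by (rule uniform_limit_integral_cbox) auto
  have tn: "(?t n has_integral (b n * (if n = \<nu> then of_real (2 * pi) else 0))) {0..2 * pi}" for n
  proof -
    have "?t n = (\<lambda>\<theta>. b n * cis (of_int (n - \<nu>) * \<theta>))"
      by (rule ext) (simp add: mult.assoc cis_mult algebra_simps)
    then show ?thesis using has_integral_mult_right[OF integral_cis[of "n - \<nu>"], of "b n"] by simp
  qed
  have IX: "I X = b \<nu> * of_real (2 * pi)" if X: "finite X" "\<nu> \<in> X" for X
  proof -
    have "((\<lambda>\<theta>. \<Sum>n\<in>X. ?t n \<theta>) has_integral (\<Sum>n\<in>X. b n * (if n = \<nu> then of_real (2 * pi) else 0))) {0..2 * pi}"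
      by (rule has_integral_sum[OF X(1)]) (rule tn)
    also have "(\<Sum>n\<in>X. b n * (if n = \<nu> then of_real (2 * pi) else 0)) = (\<Sum>n\<in>X. if n = \<nu> then b \<nu> * of_real (2 * pi) else 0)"
      by (rule sum.cong) auto
    also have "\<dots> = b \<nu> * of_real (2 * pi)" using X by (subst sum.delta) auto
    finally show ?thesis using has_integral_unique[OF I[of X]] by simp
  qed
  have "\<forall>\<^sub>F X in finite_subsets_at_top UNIV. I X = b \<nu> * of_real (2 * pi)"
    unfolding eventually_finite_subsets_at_top by (intro exI[of _ "{\<nu>}"] conjI allI impI IX; auto)
  then have "(I \<longlongrightarrow> b \<nu> * of_real (2 * pi)) (finite_subsets_at_top UNIV)" by (simp add: tendsto_eventually)
  then have "Jj = b \<nu> * of_real (2 * pi)" using tendsto_unique[OF _ lim] by simp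
  then show "fourier_coeff r u \<nu> = b \<nu>"
    using integral_unique[OF Jj] by (simp add: fourier_coeff_def)
  show "(\<lambda>\<theta>. u (rcis r \<theta>) * cis (- (of_int \<nu> * \<theta>))) integrable_on {0..2 * pi}"
    using Jj by auto
qed

text \<open>The radial derivative is not known to be integrable in the angle, so the condition is
  not differentiated under the integral. The increments of exp(-i k s) v along each ray are bounded
  by the mean value inequality, then integrated over the circle, and only then divided by the step
  length.\<close>

lemma radiation_fourier:
  assumes out: "outgoing k v"
    and int: "\<And>r. r \<ge> r0 \<Longrightarrow> (\<lambda>\<theta>. v (rcis r \<theta>) * cis (- (of_int \<nu> * \<theta>))) integrable_on {0..2 * pi}"
    and g: "\<And>r. r > r0 \<Longrightarrow> ((\<lambda>r. fourier_coeff r v \<nu>) has_vector_derivative g' r) (at r)" and e: "e > 0"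
  shows "\<forall>\<^sub>F r in at_top. cmod (g' r - \<i> * of_real k * fourier_coeff r v \<nu>) \<le> e / sqrt r"
proof -
  obtain v' where d: "\<forall>\<^sub>F r in at_top. \<forall>\<theta>. ((\<lambda>s. v (rcis s \<theta>)) has_vector_derivative v' r \<theta>) (at r)"
    and s: "\<forall>\<^sub>F r in at_top. \<forall>\<theta>. cmod (v' r \<theta> - \<i> * of_real k * v (rcis r \<theta>)) \<le> e / sqrt r"
    using out e unfolding outgoing_def by blast
  obtain N where N: "\<And>r \<theta>. r \<ge> N \<Longrightarrow> ((\<lambda>s. v (rcis s \<theta>)) has_vector_derivative v' r \<theta>) (at r)"
    "\<And>r \<theta>. r \<ge> N \<Longrightarrow> cmod (v' r \<theta> - \<i> * of_real k * v (rcis r \<theta>)) \<le> e / sqrt r"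
    using eventually_conj[OF d s] unfolding eventually_at_top_linorder by blast
  \<comment> \<open>With this factor v' - i k v becomes, up to modulus one, a pure
    derivative.\<close>
  define E where "E s = cis (- (k * s))" for s
  have dE: "(E has_vector_derivative - \<i> * of_real k * E s) (at s)" for s
  proof -
    have "((\<lambda>z. exp (- \<i> * of_real k * z)) has_field_derivative - \<i> * of_real k * exp (- \<i> * of_real k * of_real s)) (at (of_real s))"
      by (auto intro!: derivative_eq_intros)
    from has_vector_derivative_real_field[OF this] show ?thesis
      by (simp add: E_def[abs_def] cis_conv_exp mult_ac)
  qed
  have nE: "cmod (E s) = 1" for s by (simp add: E_def)
  define W where "W s = E s * fourier_coeff s v \<nu>" for s
  show ?thesis unfolding eventually_at_top_linorder
  proof (intro exI allI impI)
    fix r assume r: "r \<ge> max (max N 1) (r0 + 1)"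
    have dW: "(W has_vector_derivative E r * g' r + (- \<i> * of_real k * E r) * fourier_coeff r v \<nu>) (at r)"
      unfolding W_def[abs_def] by (rule has_vector_derivative_mult[OF dE g]) (use r in auto)
    have "cmod (W s - W r) \<le> e / sqrt r * (s - r)" if s: "r < s" for s
    proof -
      have pt: "cmod (E s * v (rcis s \<theta>) - E r * v (rcis r \<theta>)) \<le> e / sqrt r * (s - r)" for \<theta>
      proof -
        have dw: "((\<lambda>s. E s * v (rcis s \<theta>)) has_derivative (\<lambda>h. h *\<^sub>R (E p * v' p \<theta> + (- \<i> * of_real k * E p) * v (rcis p \<theta>)))) (at p within {r..s})"
          if "p \<in> {r..s}" for p
          using has_vector_derivative_mult[OF dE N(1)[of p \<theta>]] that r
          by (auto simp: has_vector_derivative_def intro: has_derivative_at_withinI)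
        have "norm ((\<lambda>s. E s * v (rcis s \<theta>)) s - (\<lambda>s. E s * v (rcis s \<theta>)) r) \<le> e / sqrt r * norm (s - r)"
        proof (rule differentiable_bound[OF _ dw])
          show "convex {r..s}" by simp
          fix p assume p: "p \<in> {r..s}"
          have "E p * v' p \<theta> + (- \<i> * of_real k * E p) * v (rcis p \<theta>) = E p * (v' p \<theta> - \<i> * of_real k * v (rcis p \<theta>))"
            by (simp add: algebra_simps)
          then have "cmod (E p * v' p \<theta> + (- \<i> * of_real k * E p) * v (rcis p \<theta>)) \<le> e / sqrt p"
            using N(2)[of p \<theta>] p r by (simp add: norm_mult nE)
          also have "\<dots> \<le> e / sqrt r" using p r e by (intro divide_left_mono) auto
          finally show "onorm (\<lambda>h. h *\<^sub>R (E p * v' p \<theta> + (- \<i> * of_real k * E p) * v (rcis p \<theta>))) \<le> e / sqrt r"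
            by (intro onorm_le) (simp only: norm_scaleR real_norm_def mult.commute[of _ "\<bar>_\<bar>"] mult_left_mono abs_ge_zero)
        qed (use s in auto)
        then show ?thesis using s by simp
      qed
      have i: "(\<lambda>\<theta>. E p * (v (rcis p \<theta>) * cis (- (of_int \<nu> * \<theta>)))) integrable_on {0..2 * pi}" if "p \<ge> r" for p
        by (rule integrable_on_mult_right, rule int) (use r that in auto)
      have W2: "W p = 1 / (2 * pi) * integral {0..2 * pi} (\<lambda>\<theta>. E p * (v (rcis p \<theta>) * cis (- (of_int \<nu> * \<theta>))))" for p
        by (simp add: W_def fourier_coeff_def)
      have "W s - W r = 1 / (2 * pi) * integral {0..2 * pi} (\<lambda>\<theta>. E s * (v (rcis s \<theta>) * cis (- (of_int \<nu> * \<theta>))) - E r * (v (rcis r \<theta>) * cis (- (of_int \<nu> * \<theta>))))"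
        unfolding W2 by (subst Henstock_Kurzweil_Integration.integral_diff[OF i i]) (use s in \<open>auto simp: algebra_simps\<close>)
      moreover have "norm (integral {0..2 * pi} (\<lambda>\<theta>. E s * (v (rcis s \<theta>) * cis (- (of_int \<nu> * \<theta>))) - E r * (v (rcis r \<theta>) * cis (- (of_int \<nu> * \<theta>)))))
          \<le> (e / sqrt r * (s - r)) * measure lborel {0..2 * pi}"
      proof (rule has_integral_bound_real[OF _ _ integrable_integral, of _ "{}"])
        show "(\<lambda>\<theta>. E s * (v (rcis s \<theta>) * cis (- (of_int \<nu> * \<theta>))) - E r * (v (rcis r \<theta>) * cis (- (of_int \<nu> * \<theta>)))) integrable_on {0..2 * pi}"
          by (rule integrable_diff[OF i i]) (use s in auto)
        fix \<theta>
        have "E s * (v (rcis s \<theta>) * cis (- (of_int \<nu> * \<theta>))) - E r * (v (rcis r \<theta>) * cis (- (of_int \<nu> * \<theta>)))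
            = (E s * v (rcis s \<theta>) - E r * v (rcis r \<theta>)) * cis (- (of_int \<nu> * \<theta>))" by (simp add: algebra_simps)
        then show "cmod (E s * (v (rcis s \<theta>) * cis (- (of_int \<nu> * \<theta>))) - E r * (v (rcis r \<theta>) * cis (- (of_int \<nu> * \<theta>)))) \<le> e / sqrt r * (s - r)"
          using pt[of \<theta>] by (simp add: norm_mult)
      qed (use e s r in auto)
      then have "1 / (2 * pi) * norm (integral {0..2 * pi} (\<lambda>\<theta>. E s * (v (rcis s \<theta>) * cis (- (of_int \<nu> * \<theta>))) - E r * (v (rcis r \<theta>) * cis (- (of_int \<nu> * \<theta>)))))
          \<le> 1 / (2 * pi) * ((e / sqrt r * (s - r)) * (2 * pi))" by (intro mult_left_mono) auto
      ultimately show ?thesis by (simp add: norm_mult norm_divide)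
    qed
    from vector_derivative_norm_le[OF dW this]
    have "cmod (E r * g' r + (- \<i> * of_real k * E r) * fourier_coeff r v \<nu>) \<le> e / sqrt r" by blast
    also have "E r * g' r + (- \<i> * of_real k * E r) * fourier_coeff r v \<nu> = E r * (g' r - \<i> * of_real k * fourier_coeff r v \<nu>)"
      by (simp add: algebra_simps)
    finally show "cmod (g' r - \<i> * of_real k * fourier_coeff r v \<nu>) \<le> e / sqrt r" by (simp add: norm_mult nE)
  qed
qed


text \<open>This is x D_n with t = \<lambda> x. If it vanished, its real and imaginary parts would
  be two independent linear equations for J_n(t) and its Euler derivative; both would be zero,
  against the Wronskian at t.\<close>

lemma wronskian_nondegenerate:
  assumes x: "x > 0" and t: "t > 0"
  shows "EH n x * of_real (J n t) - of_real (EJ n t) * H n x \<noteq> 0"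
proof
  assume eq0: "EH n x * of_real (J n t) - of_real (EJ n t) * H n x = 0"
  have re: "EJ n x * J n t = EJ n t * J n x" and im: "EY n x * J n t = EJ n t * Y n x"
    using arg_cong[OF eq0, of Re] arg_cong[OF eq0, of Im] by simp_all
  have "J n t * (J n x * EY n x - EJ n x * Y n x) = J n x * (EY n x * J n t) - Y n x * (EJ n x * J n t)"
    by (simp add: algebra_simps)
  also have "\<dots> = 0" unfolding re im by simp
  finally have Jt: "J n t = 0" using wronskian_Euler[OF x, of n] by simp
  have "EJ n t * (J n x * EY n x - EJ n x * Y n x) = EY n x * (EJ n t * J n x) - EJ n x * (EJ n t * Y n x)"
    by (simp add: algebra_simps)
  also have "\<dots> = 0" unfolding re[symmetric] im[symmetric] by simp
  finally have "EJ n t = 0" using wronskian_Euler[OF x, of n] by simp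
  with Jt show False using wronskian_Euler[OF t, of n] by simp
qed

lemma EY_continuous: "x > 0 \<Longrightarrow> isCont (EY n) x"
  and Y_continuous: "x > 0 \<Longrightarrow> isCont (Y n) x"
  using EY_has_deriv Y_has_deriv by (blast intro: DERIV_isCont)+

lemma right_limit_eq:
  fixes g h :: "real \<Rightarrow> complex"
  assumes "isCont g e" "isCont h e" "\<And>r. e < r \<Longrightarrow> g r = h r"
  shows "g e = h e"
proof -
  have ev: "\<forall>\<^sub>F r in at_right e. g r = h r"
    using eventually_at_right_less[of e] by eventually_elim (rule assms(3))
  have g: "(g \<longlongrightarrow> g e) (at_right e)" using assms(1) unfolding isCont_def filterlim_at_split by (rule conjunct2)
  have h: "(h \<longlongrightarrow> h e) (at_right e)" using assms(2) unfolding isCont_def filterlim_at_split by (rule conjunct2)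
  show ?thesis by (rule tendsto_unique[OF trivial_limit_at_right_real Lim_transform_eventually[OF g ev] h])
qed

context
  fixes \<epsilon> k lam :: real and a :: "int \<Rightarrow> complex" and ui us ut :: "complex \<Rightarrow> complex"
  assumes e: "\<epsilon> > 0" and k: "k > 0" and lam: "lam > 0"
    and helm: "weak_helmholtz (\<lambda>x. if cmod x < \<epsilon> then (k * lam)\<^sup>2 else k\<^sup>2) ut" and cont: "continuous_on UNIV ut"
    and sum: "\<And>r \<theta>. r \<ge> 0 \<Longrightarrow>
      ((\<lambda>n. a n * of_real (besselJ n (k * r)) * cis (of_int n * \<theta>)) has_sum ui (rcis r \<theta>)) UNIV"
    and scat: "\<And>x. cmod x \<ge> \<epsilon> \<Longrightarrow> ut x = ui x + us x"
    and out: "outgoing k us"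
begin

text \<open>Matching at the interface. Inside the mode is a multiple c of J_n, outside it is A J_n +
  b H_n; eliminating c from continuity of value and of Euler derivative leaves the relation for the
  reflection coefficient.\<close>

lemma scattered_mode:
  fixes \<nu> :: int
  defines "n \<equiv> nat \<bar>\<nu>\<bar>"
  obtains b A :: complex where "\<And>r. r \<ge> \<epsilon> \<Longrightarrow> fourier_coeff r us \<nu> = b * H n (k * r)" "cmod A = cmod (a \<nu>)"
    "fourier_coeff \<epsilon> ui \<nu> = A * of_real (J n (k * \<epsilon>))"
    "b * (EH n (k * \<epsilon>) * of_real (J n (k * lam * \<epsilon>)) - of_real (EJ n (k * lam * \<epsilon>)) * H n (k * \<epsilon>)) =
      - A * of_real (EJ n (k * \<epsilon>) * J n (k * lam * \<epsilon>) - EJ n (k * lam * \<epsilon>) * J n (k * \<epsilon>))"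
proof -
  \<comment> \<open>Absorbs the sign in J_(-n) = (-1)^n J_n, so that only natural orders occur from
    here on.\<close>
  define A where "A = of_real (if \<nu> < 0 then (-1) ^ n else 1) * a \<nu>"
  have normA: "cmod A = cmod (a \<nu>)" by (simp add: A_def norm_mult norm_power)
  have ui: "fourier_coeff r ui \<nu> = A * of_real (J n (k * r))"
    and ui_int: "(\<lambda>\<theta>. ui (rcis r \<theta>) * cis (- (of_int \<nu> * \<theta>))) integrable_on {0..2 * pi}" if "r \<ge> 0" for r
    using fourier_coeff_series[where b = "\<lambda>n. a n * of_real (besselJ n (k * r))", OF sum[OF that], of \<nu>]
    by (simp_all add: A_def besselJ_nat_abs[of \<nu>] n_def)
  define f where "f r = fourier_coeff r ut \<nu>" for r
  define g where "g r = fourier_coeff r us \<nu>" for r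
  obtain \<phi> where df: "\<And>r. r > 0 \<Longrightarrow> (f has_vector_derivative \<phi> r / of_real r) (at r)"
    and d\<phi>: "\<And>r. r > 0 \<Longrightarrow> r \<noteq> \<epsilon> \<Longrightarrow>
      (\<phi> has_vector_derivative of_real ((real n)\<^sup>2 / r - (if r < \<epsilon> then (k * lam)\<^sup>2 else k\<^sup>2) * r) * f r) (at r)"
    and c\<phi>: "continuous_on {0<..} \<phi>"
    and small: "\<exists>M. \<forall>r. 0 < r \<longrightarrow> r < \<epsilon> \<longrightarrow> cmod (\<phi> r - of_nat n * f r) \<le> M * r\<^sup>2"
    unfolding f_def[abs_def] n_def using radial_equation[OF cont e helm, of \<nu>] by blast
  have cf: "continuous_on UNIV f" unfolding f_def by (rule continuous_on_fourier_coeff[OF cont])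
  obtain M where M: "\<And>r. 0 < r \<Longrightarrow> r < \<epsilon> \<Longrightarrow> cmod (\<phi> r - of_nat n * f r) \<le> M * r\<^sup>2" using small by blast
  have kl: "k * lam > 0" using k lam by simp
  obtain c where c: "f \<epsilon> = c * of_real (J n (k * lam * \<epsilon>))" "\<phi> \<epsilon> = c * of_real (EJ n (k * lam * \<epsilon>))"
  proof (rule regular_solution[OF e kl cf c\<phi> df _ M])
    show "(\<phi> has_vector_derivative of_real ((real n)\<^sup>2 / r - (k * lam)\<^sup>2 * r) * f r) (at r)" if "0 < r" "r < \<epsilon>" for r
      using d\<phi>[of r] that by simp
  qed
  obtain \<alpha> \<beta> :: complex where fo: "\<And>r. r \<in> {\<epsilon><..} \<Longrightarrow> f r = \<alpha> * J n (k * r) + \<beta> * Y n (k * r)"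
    and po: "\<And>r. r \<in> {\<epsilon><..} \<Longrightarrow> \<phi> r = \<alpha> * EJ n (k * r) + \<beta> * EY n (k * r)"
  proof (rule bessel_solution[of "{\<epsilon><..}" k f \<phi> n])
    show "(f has_vector_derivative \<phi> r / of_real r) (at r)" if "r \<in> {\<epsilon><..}" for r
      using df[of r] that e by simp
    show "(\<phi> has_vector_derivative of_real ((real n)\<^sup>2 / r - k\<^sup>2 * r) * f r) (at r)" if "r \<in> {\<epsilon><..}" for r
      using d\<phi>[of r] that e by simp
  qed (use k e in auto)
  have ke: "k * \<epsilon> > 0" using k e by simp
  have comp: "isCont (\<lambda>r. \<alpha> * of_real (F (k * r)) + \<beta> * of_real (G (k * r))) \<epsilon>"
    if "isCont F (k * \<epsilon>)" "isCont G (k * \<epsilon>)" for F G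
    by (intro continuous_intros isCont_o2[of \<epsilon> "\<lambda>r. k * r" F, OF _ that(1)] isCont_o2[of \<epsilon> "\<lambda>r. k * r" G, OF _ that(2)])
  have fe: "f \<epsilon> = \<alpha> * J n (k * \<epsilon>) + \<beta> * Y n (k * \<epsilon>)"
    by (rule right_limit_eq[where h = "\<lambda>r. \<alpha> * J n (k * r) + \<beta> * Y n (k * r)", OF _ comp[OF J_continuous[OF ke] Y_continuous[OF ke]]])
      (use cf fo in \<open>auto simp: continuous_on_eq_continuous_at\<close>)
  have pe: "\<phi> \<epsilon> = \<alpha> * EJ n (k * \<epsilon>) + \<beta> * EY n (k * \<epsilon>)"
    by (rule right_limit_eq[where h = "\<lambda>r. \<alpha> * EJ n (k * r) + \<beta> * EY n (k * r)", OF _ comp[OF EJ_continuous[OF ke] EY_continuous[OF ke]]])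
      (use c\<phi> po e in \<open>auto simp: continuous_on_eq_continuous_at\<close>)
  have ut_int: "(\<lambda>\<theta>. ut (rcis r \<theta>) * cis (- (of_int \<nu> * \<theta>))) integrable_on {0..2 * pi}" for r
  proof -
    have "continuous_on UNIV (\<lambda>\<theta>. ut (rcis r \<theta>) * cis (- (of_int \<nu> * \<theta>)))"
      unfolding rcis_def cis_conv_exp
      by (intro continuous_intros continuous_on_compose2[OF cont]) auto
    then show ?thesis by (intro integrable_continuous_real) (rule continuous_on_subset, auto)
  qed
  have us_eq: "(\<lambda>\<theta>. us (rcis r \<theta>) * cis (- (of_int \<nu> * \<theta>))) =
      (\<lambda>\<theta>. ut (rcis r \<theta>) * cis (- (of_int \<nu> * \<theta>)) - ui (rcis r \<theta>) * cis (- (of_int \<nu> * \<theta>)))" if "r \<ge> \<epsilon>" for r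
  proof
    fix \<theta>
    have "ut (rcis r \<theta>) = ui (rcis r \<theta>) + us (rcis r \<theta>)" by (rule scat) (use that e in simp)
    then show "us (rcis r \<theta>) * cis (- (of_int \<nu> * \<theta>)) = ut (rcis r \<theta>) * cis (- (of_int \<nu> * \<theta>)) - ui (rcis r \<theta>) * cis (- (of_int \<nu> * \<theta>))"
      by (simp add: algebra_simps)
  qed
  have us_int: "(\<lambda>\<theta>. us (rcis r \<theta>) * cis (- (of_int \<nu> * \<theta>))) integrable_on {0..2 * pi}" if "r \<ge> \<epsilon>" for r
    unfolding us_eq[OF that] by (intro integrable_diff ut_int ui_int) (use that e in simp)
  have g: "g r = f r - A * of_real (J n (k * r))" if r: "r \<ge> \<epsilon>" for r
  proof -
    have "r \<ge> 0" using r e by simp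
    note i = Henstock_Kurzweil_Integration.integral_diff[OF ut_int[of r] ui_int[OF this]]
    have "g r = f r - fourier_coeff r ui \<nu>"
      unfolding g_def f_def fourier_coeff_def us_eq[OF r] i by (simp add: algebra_simps)
    then show ?thesis using ui[of r] r e by simp
  qed
  define g' where "g' r = \<phi> r / of_real r - A * of_real (EJ n (k * r)) / of_real r" for r
  have dg: "(g has_vector_derivative g' r) (at r)" if r: "r > \<epsilon>" for r
  proof -
    have r0: "r > 0" using r e by simp
    have "((\<lambda>r. J n (k * r)) has_real_derivative EJ n (k * r) / (k * r) * k) (at r)"
      by (rule DERIV_chain2[where f = "J n" and g = "\<lambda>r. k * r"]) (use J_has_deriv k r0 in \<open>auto intro!: derivative_eq_intros\<close>)
    moreover have "EJ n (k * r) / (k * r) * k = EJ n (k * r) / r" using k r0 by simp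
    ultimately have "((\<lambda>r. J n (k * r)) has_real_derivative EJ n (k * r) / r) (at r)" by (simp only:)
    from has_vector_derivative_diff[OF df[OF r0] has_vector_derivative_mult_right[OF has_vector_derivative_of_real[OF this], of A]]
    have "((\<lambda>r. f r - A * of_real (J n (k * r))) has_vector_derivative g' r) (at r)" by (simp add: g'_def)
    then show ?thesis
      by (rule has_vector_derivative_transform_within_open[where S = "{\<epsilon><..}"]) (use r g in auto)
  qed
  have "\<beta> = \<i> * (\<alpha> - A)"
  proof (rule outgoing_bessel[OF k])
    fix d :: real assume d: "d > 0"
    have "\<forall>\<^sub>F r in at_top. cmod (g' r - \<i> * of_real k * fourier_coeff r us \<nu>) \<le> d / sqrt r"
      by (rule radiation_fourier[OF out us_int dg[unfolded g_def[abs_def]] d])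
    then show "\<forall>\<^sub>F r in at_top. cmod (((\<alpha> - A) * of_real (EJ n (k * r)) + \<beta> * of_real (EY n (k * r))) / of_real r
        - \<i> * of_real k * ((\<alpha> - A) * of_real (J n (k * r)) + \<beta> * of_real (Y n (k * r)))) \<le> d / sqrt r"
      using eventually_gt_at_top[of \<epsilon>]
    proof eventually_elim
      fix r assume h: "cmod (g' r - \<i> * of_real k * fourier_coeff r us \<nu>) \<le> d / sqrt r" and r: "\<epsilon> < r"
      have 1: "fourier_coeff r us \<nu> = (\<alpha> - A) * of_real (J n (k * r)) + \<beta> * of_real (Y n (k * r))"
        using g[of r] fo[of r] r unfolding g_def by (simp add: algebra_simps)
      have 2: "g' r = ((\<alpha> - A) * of_real (EJ n (k * r)) + \<beta> * of_real (EY n (k * r))) / of_real r"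
        using po[of r] r unfolding g'_def by (simp add: algebra_simps diff_divide_distrib[symmetric] add_divide_distrib[symmetric])
      show "cmod (((\<alpha> - A) * of_real (EJ n (k * r)) + \<beta> * of_real (EY n (k * r))) / of_real r
        - \<i> * of_real k * ((\<alpha> - A) * of_real (J n (k * r)) + \<beta> * of_real (Y n (k * r)))) \<le> d / sqrt r"
        using h unfolding 1 2 .
    qed
  qed
  define b where "b = \<alpha> - A"
  have \<alpha>: "\<alpha> = A + b" and \<beta>: "\<beta> = \<i> * b" using \<open>\<beta> = \<i> * (\<alpha> - A)\<close> by (simp_all add: b_def)
  have gH: "fourier_coeff r us \<nu> = b * H n (k * r)" if r: "r \<ge> \<epsilon>" for r
  proof -
    have "f r = \<alpha> * J n (k * r) + \<beta> * Y n (k * r)" using fo[of r] fe r by (cases "r = \<epsilon>") auto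
    then show ?thesis using g[OF r] unfolding g_def H_eq \<alpha> \<beta> by (simp add: algebra_simps)
  qed
  have m1: "c * of_real (J n (k * lam * \<epsilon>)) = A * of_real (J n (k * \<epsilon>)) + b * H n (k * \<epsilon>)"
    using c(1) fe unfolding H_eq \<alpha> \<beta> by (simp add: algebra_simps)
  have m2: "c * of_real (EJ n (k * lam * \<epsilon>)) = A * of_real (EJ n (k * \<epsilon>)) + b * EH n (k * \<epsilon>)"
    using c(2) pe unfolding EH_eq \<alpha> \<beta> by (simp add: algebra_simps)
  \<comment> \<open>Cross-multiplying the two matching equations by j and j' makes the terms with c
    cancel.\<close>
  define j j' where "j = complex_of_real (J n (k * lam * \<epsilon>))" and "j' = complex_of_real (EJ n (k * lam * \<epsilon>))"
  have "b * (EH n (k * \<epsilon>) * j - j' * H n (k * \<epsilon>)) = (b * EH n (k * \<epsilon>)) * j - (b * H n (k * \<epsilon>)) * j'"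
    by (simp add: algebra_simps)
  also have "b * EH n (k * \<epsilon>) = c * j' - A * of_real (EJ n (k * \<epsilon>))" using m2 by (simp add: j'_def)
  also have "b * H n (k * \<epsilon>) = c * j - A * of_real (J n (k * \<epsilon>))" using m1 by (simp add: j_def)
  finally have "b * (EH n (k * \<epsilon>) * j - j' * H n (k * \<epsilon>)) = - A * (of_real (EJ n (k * \<epsilon>)) * j - j' * of_real (J n (k * \<epsilon>)))"
    by (simp add: algebra_simps)
  then show ?thesis
    using that[OF gH normA ui[of \<epsilon>]] e by (simp add: j_def j'_def)
qed

lemma mode_bound:
  assumes "\<nu> \<noteq> 0" "lam \<ge> 1" "k * lam * \<epsilon> \<le> of_int \<bar>\<nu>\<bar>" "\<epsilon> \<le> R"
  shows "cmod (fourier_coeff R us \<nu>) \<le>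
    (3 * (lam - 1) * (k * \<epsilon>) * sqrt (\<epsilon> / R)) * (1 + of_int \<bar>\<nu>\<bar>) powr (-1/3) * cmod (fourier_coeff \<epsilon> ui \<nu>)"
proof -
  obtain b A where b: "\<And>r. r \<ge> \<epsilon> \<Longrightarrow> fourier_coeff r us \<nu> = b * H (nat \<bar>\<nu>\<bar>) (k * r)"
    and A: "fourier_coeff \<epsilon> ui \<nu> = A * of_real (J (nat \<bar>\<nu>\<bar>) (k * \<epsilon>))"
    and eq: "b * (EH (nat \<bar>\<nu>\<bar>) (k * \<epsilon>) * of_real (J (nat \<bar>\<nu>\<bar>) (k * lam * \<epsilon>)) - of_real (EJ (nat \<bar>\<nu>\<bar>) (k * lam * \<epsilon>)) * H (nat \<bar>\<nu>\<bar>) (k * \<epsilon>)) =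
      - A * of_real (EJ (nat \<bar>\<nu>\<bar>) (k * \<epsilon>) * J (nat \<bar>\<nu>\<bar>) (k * lam * \<epsilon>) - EJ (nat \<bar>\<nu>\<bar>) (k * lam * \<epsilon>) * J (nat \<bar>\<nu>\<bar>) (k * \<epsilon>))"
    using scattered_mode[of \<nu>] by metis
  have n: "nat \<bar>\<nu>\<bar> \<ge> 1" "real (nat \<bar>\<nu>\<bar>) = of_int \<bar>\<nu>\<bar>" using assms(1) by auto
  have x: "0 < k * \<epsilon>" "k * \<epsilon> \<le> k * lam * \<epsilon>" "k * \<epsilon> \<le> k * R" using e k assms(2,4) by auto
  have t: "k * lam * \<epsilon> \<le> real (nat \<bar>\<nu>\<bar>)" using assms(3) n by simp
  have q: "k * \<epsilon> / (k * R) = \<epsilon> / R" using k by simp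
  have d: "k * lam * \<epsilon> - k * \<epsilon> = (lam - 1) * (k * \<epsilon>)" by (simp add: algebra_simps)
  from reflection_bound[OF n(1) x(1,2) t x(3) eq] show ?thesis
    unfolding b[OF assms(4)] A q d n(2) by (simp add: mult_ac add.commute)
qed

lemma mode_bound_0:
  assumes "lam \<ge> 1" "k * \<epsilon> < 1 / 2" "(k * lam * \<epsilon>)\<^sup>2 * (ln lam + 1) < 1" "\<epsilon> \<le> R"
  shows "cmod (fourier_coeff R us 0) \<le> 5 * (lam * (lam - 1) * (k * \<epsilon>)\<^sup>2) * cmod (a 0) * cmod (H 0 (k * R))"
proof -
  obtain b A where b: "\<And>r. r \<ge> \<epsilon> \<Longrightarrow> fourier_coeff r us 0 = b * H 0 (k * r)"
    and A: "cmod A = cmod (a 0)"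
    and eq: "b * (EH 0 (k * \<epsilon>) * of_real (J 0 (k * lam * \<epsilon>)) - of_real (EJ 0 (k * lam * \<epsilon>)) * H 0 (k * \<epsilon>)) =
      - A * of_real (EJ 0 (k * \<epsilon>) * J 0 (k * lam * \<epsilon>) - EJ 0 (k * lam * \<epsilon>) * J 0 (k * \<epsilon>))"
    using scattered_mode[of 0] by (metis abs_zero nat_0)
  have x: "0 < k * \<epsilon>" "k * \<epsilon> \<le> k * lam * \<epsilon>" using e k assms(1) by auto
  have q: "k * lam * \<epsilon> / (k * \<epsilon>) = lam" using k e by simp
  have d: "k * lam * \<epsilon> * (k * lam * \<epsilon> - k * \<epsilon>) = lam * (lam - 1) * (k * \<epsilon>)\<^sup>2" by (simp add: algebra_simps power2_eq_square)
  have "cmod b \<le> 5 * (lam * (lam - 1) * (k * \<epsilon>)\<^sup>2) * cmod (a 0)"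
    using reflection_bound_0[OF x(1) assms(2) x(2) _ eq] assms(3) unfolding q d A by blast
  then show ?thesis unfolding b[OF assms(4)] norm_mult by (rule mult_right_mono) simp
qed

text \<open>A vanishing incident amplitude makes the right side of the matching relation zero, and
  its denominator never vanishes.\<close>

lemma mode_zero:
  assumes "a \<nu> = 0" "\<epsilon> \<le> R"
  shows "fourier_coeff R us \<nu> = 0"
proof -
  obtain b A where b: "\<And>r. r \<ge> \<epsilon> \<Longrightarrow> fourier_coeff r us \<nu> = b * H (nat \<bar>\<nu>\<bar>) (k * r)"
    and A: "cmod A = cmod (a \<nu>)"
    and eq: "b * (EH (nat \<bar>\<nu>\<bar>) (k * \<epsilon>) * of_real (J (nat \<bar>\<nu>\<bar>) (k * lam * \<epsilon>)) - of_real (EJ (nat \<bar>\<nu>\<bar>) (k * lam * \<epsilon>)) * H (nat \<bar>\<nu>\<bar>) (k * \<epsilon>)) =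
      - A * of_real (EJ (nat \<bar>\<nu>\<bar>) (k * \<epsilon>) * J (nat \<bar>\<nu>\<bar>) (k * lam * \<epsilon>) - EJ (nat \<bar>\<nu>\<bar>) (k * lam * \<epsilon>) * J (nat \<bar>\<nu>\<bar>) (k * \<epsilon>))"
    using scattered_mode[of \<nu>] by metis
  have "A = 0" using A assms(1) by simp
  then have "b = 0" using eq wronskian_nondegenerate[of "k * \<epsilon>" "k * lam * \<epsilon>" "nat \<bar>\<nu>\<bar>"] k e lam by simp
  then show ?thesis using b[OF assms(2)] by simp
qed

lemma incident_at_0: "ui 0 = a 0"
proof -
  have "((\<lambda>n. a n * of_real (besselJ n (k * 0)) * cis (of_int n * 0)) has_sum ui (rcis 0 0)) UNIV" by (rule sum) simp
  moreover have "(\<lambda>n. a n * of_real (besselJ n (k * 0)) * cis (of_int n * 0)) = (\<lambda>n. if n = 0 then a 0 else 0)"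
    by (auto simp: fun_eq_iff besselJ_at_0)
  moreover have "((\<lambda>n. if n = 0 then a 0 else 0) has_sum a 0) (UNIV :: int set)"
    by (rule has_sum_finite_neutralI[of "{0}"]) auto
  ultimately have "ui (rcis 0 0) = a 0" using has_sum_unique by (simp only:) blast
  then show ?thesis by simp
qed

end

subsection \<open>Norms on circles\<close>

text \<open>The factor (1 + |n|)^(-1/3) is exactly the change of Sobolev exponent. Mode 0 is split
  off by sqrt(B^2 + S) \<le> B + sqrt S.\<close>

lemma circle_norm_bound:
  assumes C: "C \<ge> 0" and B: "cmod (fourier_coeff R v 0) \<le> B"
    and bd: "\<And>n. n \<noteq> 0 \<Longrightarrow> cmod (fourier_coeff R v n) \<le> C * (1 + of_int \<bar>n\<bar>) powr (-1/3) * cmod (fourier_coeff \<rho> w n)"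
  shows "H_norm \<sigma> R v \<le> ennreal C * H_star_norm (\<sigma> - 1/3) \<rho> w + ennreal (sqrt (2 * pi) * B)"
proof -
  define c where "c n = (cmod (fourier_coeff R v n))\<^sup>2 * (1 + real_of_int \<bar>n\<bar>) powr (2 * \<sigma>)" for n
  define d where "d n = (cmod (fourier_coeff \<rho> w n))\<^sup>2 * (1 + real_of_int \<bar>n\<bar>) powr (2 * (\<sigma> - 1/3))" for n
  have H: "H_norm \<sigma> R v = (if c summable_on UNIV then ennreal (sqrt (2 * pi) * sqrt (\<Sum>\<^sub>\<infinity>n. c n)) else \<infinity>)"
    by (simp add: H_norm_def circle_norm_def c_def[abs_def] Let_def)
  have Hs: "H_star_norm (\<sigma> - 1/3) \<rho> w = (if d summable_on (UNIV - {0}) then ennreal (sqrt (2 * pi) * sqrt (\<Sum>\<^sub>\<infinity>n\<in>UNIV - {0}. d n)) else \<infinity>)"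
    by (simp add: H_star_norm_def circle_norm_def d_def[abs_def] Let_def)
  have B0: "B \<ge> 0" using B norm_ge_zero order_trans by blast
  have nn: "c n \<ge> 0" "d n \<ge> 0" for n by (simp_all add: c_def d_def)
  have cd: "c n \<le> C\<^sup>2 * d n" if n: "n \<noteq> 0" for n
  proof -
    define y where "y = 1 + real_of_int \<bar>n\<bar>"
    have y: "y > 0" by (simp add: y_def)
    have pw: "(y powr (-1/3))\<^sup>2 * y powr (2 * \<sigma>) = y powr (2 * (\<sigma> - 1/3))"
      unfolding power2_eq_square powr_add[symmetric] by (rule arg_cong[where f = "(powr) y"]) simp
    have "(cmod (fourier_coeff R v n))\<^sup>2 \<le> (C * y powr (-1/3) * cmod (fourier_coeff \<rho> w n))\<^sup>2"
      using bd[OF n] unfolding y_def by (rule power_mono) simp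
    then have "c n \<le> (C * y powr (-1/3) * cmod (fourier_coeff \<rho> w n))\<^sup>2 * y powr (2 * \<sigma>)"
      unfolding c_def y_def[symmetric] by (rule mult_right_mono) simp
    also have "\<dots> = C\<^sup>2 * ((cmod (fourier_coeff \<rho> w n))\<^sup>2 * ((y powr (-1/3))\<^sup>2 * y powr (2 * \<sigma>)))"
      by (simp only: power_mult_distrib mult_ac)
    finally show ?thesis unfolding pw d_def y_def[symmetric] .
  qed
  have c0: "c 0 \<le> B\<^sup>2" using power_mono[OF B norm_ge_zero, of 2] by (simp add: c_def)
  show ?thesis
  \<comment> \<open>An infinite norm on the right makes the bound trivial unless C = 0, where 0
    times infinity is 0. In that case all modes n \<noteq> 0 vanish, so it belongs with the summable
    one.\<close>
  proof (cases "C = 0 \<or> d summable_on (UNIV - {0})")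
    case False
    then have "ennreal C * H_star_norm (\<sigma> - 1/3) \<rho> w = \<infinity>"
      using C by (simp add: Hs ennreal_mult_top)
    then show ?thesis by simp
  next
    case True
    define S where "S = (\<Sum>\<^sub>\<infinity>n\<in>UNIV - {0}. C\<^sup>2 * d n)"
    have sd: "(\<lambda>n. C\<^sup>2 * d n) summable_on (UNIV - {0})"
      using True by (auto intro: summable_on_cmult_right)
    have sc: "c summable_on (UNIV - {0})"
      by (rule summable_on_comparison_test[OF sd]) (use cd nn in auto)
    have ins: "(c has_sum (c 0 + (\<Sum>\<^sub>\<infinity>n\<in>UNIV - {0}. c n))) (insert 0 (UNIV - {0}))"
      by (rule has_sum_insert) (use sc in auto)
    then have su: "c summable_on UNIV" and I: "(\<Sum>\<^sub>\<infinity>n. c n) = c 0 + (\<Sum>\<^sub>\<infinity>n\<in>UNIV - {0}. c n)"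
      by (auto simp: insert_absorb infsumI summable_on_def)
    have "(\<Sum>\<^sub>\<infinity>n\<in>UNIV - {0}. c n) \<le> S"
      unfolding S_def by (rule infsum_mono[OF sc sd]) (use cd in auto)
    moreover have S0: "S \<ge> 0" unfolding S_def by (rule infsum_nonneg) (simp add: nn)
    ultimately have "sqrt (\<Sum>\<^sub>\<infinity>n. c n) \<le> sqrt (B\<^sup>2 + S)" using c0 I by simp
    also have "\<dots> \<le> sqrt (B\<^sup>2) + sqrt S" using S0 by (intro sqrt_add_le_add_sqrt) auto
    finally have "sqrt (2 * pi) * sqrt (\<Sum>\<^sub>\<infinity>n. c n) \<le> sqrt (2 * pi) * (B + sqrt S)"
      using B0 by (intro mult_left_mono) auto
    then have "H_norm \<sigma> R v \<le> ennreal (sqrt (2 * pi) * sqrt S + sqrt (2 * pi) * B)"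
      using su by (simp add: H algebra_simps ennreal_leI)
    also have "\<dots> = ennreal (sqrt (2 * pi) * sqrt S) + ennreal (sqrt (2 * pi) * B)"
      using S0 B0 by (intro ennreal_plus) auto
    also have "ennreal (sqrt (2 * pi) * sqrt S) \<le> ennreal C * H_star_norm (\<sigma> - 1/3) \<rho> w"
    proof (cases "d summable_on (UNIV - {0})")
      case True
      have "S = C\<^sup>2 * (\<Sum>\<^sub>\<infinity>n\<in>UNIV - {0}. d n)" unfolding S_def by (rule infsum_cmult_right) (use True in auto)
      then have "sqrt S = C * sqrt (\<Sum>\<^sub>\<infinity>n\<in>UNIV - {0}. d n)" using C by (simp add: real_sqrt_mult)
      then have "sqrt (2 * pi) * sqrt S = C * (sqrt (2 * pi) * sqrt (\<Sum>\<^sub>\<infinity>n\<in>UNIV - {0}. d n))" by simp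
      then show ?thesis using True C by (simp only: Hs if_True ennreal_mult'[symmetric])
    next
      case False
      with True have "S = 0" by (simp add: S_def)
      then show ?thesis by simp
    qed
    finally show ?thesis by (simp add: add_right_mono)
  qed
qed

theorem theorem3p1:
  fixes \<epsilon> \<omega> q q\<^sub>0 \<omega>\<^sub>\<epsilon> lam m_lam R \<sigma> :: real
    and a :: "int \<Rightarrow> complex"
    and u\<^sub>i u\<^sub>s u\<^sub>\<epsilon> :: "complex \<Rightarrow> complex"
  assumes pos: "\<epsilon> > 0" "\<omega> > 0" "q > 0" "q\<^sub>0 > 0"
    and omega_eps: "\<omega>\<^sub>\<epsilon> = sqrt q\<^sub>0 * \<omega> * \<epsilon>"
    and lambda: "lam = sqrt (q / q\<^sub>0)"
    and m_lambda: "m_lam = 1 / (lam * sqrt (ln lam + 1))"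
    and incident_helmholtz: "weak_helmholtz (\<lambda>x. \<omega>\<^sup>2 * q\<^sub>0) u\<^sub>i"
    and incident_expansion: "\<And>r \<theta>. r \<ge> 0 \<Longrightarrow>
          ((\<lambda>n. a n * of_real (besselJ n (sqrt q\<^sub>0 * \<omega> * r)) * cis (of_int n * \<theta>))
             has_sum u\<^sub>i (rcis r \<theta>)) UNIV"
    and total_helmholtz: "weak_helmholtz (\<lambda>x. \<omega>\<^sup>2 * (if cmod x < \<epsilon> then q else q\<^sub>0)) u\<^sub>\<epsilon>"
    \<comment> \<open>fixes the continuous representative of the \<open>H\<^sup>1\<^sub>l\<^sub>o\<^sub>c\<close> solution,
        so that restriction to circles makes sense, including the trace on \<open>|x| = \<epsilon>\<close>\<close>
    and total_continuous: "continuous_on UNIV u\<^sub>\<epsilon>"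
    and scattered: "\<And>x. cmod x \<ge> \<epsilon> \<Longrightarrow> u\<^sub>\<epsilon> x = u\<^sub>i x + u\<^sub>s x"
    and radiation: "outgoing (\<omega> * sqrt q\<^sub>0) u\<^sub>s"
    and R: "\<epsilon> \<le> R"
    and lambda_ge_1: "lam \<ge> 1"
  shows "(\<omega>\<^sub>\<epsilon> < min (1 / 2) m_lam \<longrightarrow>
           H_norm \<sigma> R u\<^sub>s \<le>
             ennreal ((lam - 1) * \<omega>\<^sub>\<epsilon>) *
               (ennreal (3 * sqrt (\<epsilon> / R)) * H_star_norm (\<sigma> - 1 / 3) \<epsilon> u\<^sub>i +
                ennreal (23 * \<omega>\<^sub>\<epsilon> * lam * cmod (u\<^sub>i 0) * cmod (hankel1 0 (sqrt q\<^sub>0 * \<omega> * R))))) \<and>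
         (\<forall>p::int. p > 0 \<longrightarrow> (\<forall>n. \<bar>n\<bar> < p \<longrightarrow> a n = 0) \<longrightarrow> \<omega>\<^sub>\<epsilon> < of_int p / lam \<longrightarrow>
           H_norm \<sigma> R u\<^sub>s \<le>
             ennreal (3 * (lam - 1) * \<omega>\<^sub>\<epsilon> * sqrt (\<epsilon> / R)) * H_star_norm (\<sigma> - 1 / 3) \<epsilon> u\<^sub>i)"
proof -
  define k where "k = sqrt q\<^sub>0 * \<omega>"
  have k: "k > 0" using pos by (simp add: k_def)
  have lam0: "lam > 0" using lambda_ge_1 by simp
  have x: "\<omega>\<^sub>\<epsilon> = k * \<epsilon>" by (simp add: omega_eps k_def)
  have x0: "\<omega>\<^sub>\<epsilon> > 0" using x k pos by simp
  have t: "k * lam * \<epsilon> = lam * \<omega>\<^sub>\<epsilon>" by (simp add: x)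
  have "(k * lam)\<^sup>2 = \<omega>\<^sup>2 * q" "k\<^sup>2 = \<omega>\<^sup>2 * q\<^sub>0" using pos by (simp_all add: k_def lambda power_mult_distrib)
  then have "(\<lambda>x. \<omega>\<^sup>2 * (if cmod x < \<epsilon> then q else q\<^sub>0)) = (\<lambda>x. if cmod x < \<epsilon> then (k * lam)\<^sup>2 else k\<^sup>2)"
    by (simp add: fun_eq_iff)
  with total_helmholtz have helm: "weak_helmholtz (\<lambda>x. if cmod x < \<epsilon> then (k * lam)\<^sup>2 else k\<^sup>2) u\<^sub>\<epsilon>" by simp
  have out: "outgoing k u\<^sub>s" using radiation by (simp add: k_def mult.commute)
  note data = pos(1) k lam0 helm total_continuous incident_expansion[folded k_def] scattered out
  define C where "C = 3 * (lam - 1) * \<omega>\<^sub>\<epsilon> * sqrt (\<epsilon> / R)"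
  have C0: "C \<ge> 0" using lambda_ge_1 x0 pos R by (simp add: C_def)
  have mode: "cmod (fourier_coeff R u\<^sub>s n) \<le> C * (1 + of_int \<bar>n\<bar>) powr (-1/3) * cmod (fourier_coeff \<epsilon> u\<^sub>i n)"
    if "n \<noteq> 0" "lam * \<omega>\<^sub>\<epsilon> \<le> of_int \<bar>n\<bar>" for n
    using mode_bound[OF data that(1) lambda_ge_1 _ R] that(2) unfolding t C_def x[symmetric] by blast
  show ?thesis
  proof (intro conjI impI allI)
    assume small: "\<omega>\<^sub>\<epsilon> < min (1 / 2) m_lam"
    have L: "ln lam + 1 \<ge> 1" using lambda_ge_1 by simp
    then have sL: "sqrt (ln lam + 1) > 0" "(sqrt (ln lam + 1))\<^sup>2 = ln lam + 1" by auto
    \<comment> \<open>After squaring, the bound by \<open>m_lam\<close> is the hypothesis of the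
      mode 0 estimate. As ln \<lambda> \<ge> 0, it also gives t < 1, which puts every n \<noteq> 0
      below its turning point.\<close>
    have "lam * \<omega>\<^sub>\<epsilon> * sqrt (ln lam + 1) < 1"
      using small lam0 sL(1) by (simp add: m_lambda pos_less_divide_eq mult_ac)
    then have "(lam * \<omega>\<^sub>\<epsilon> * sqrt (ln lam + 1))\<^sup>2 < 1\<^sup>2"
      using lam0 x0 sL(1) by (intro power_strict_mono) auto
    then have tL: "(lam * \<omega>\<^sub>\<epsilon>)\<^sup>2 * (ln lam + 1) < 1" unfolding power_mult_distrib[of "lam * \<omega>\<^sub>\<epsilon>"] sL(2) by simp
    have "(lam * \<omega>\<^sub>\<epsilon>)\<^sup>2 * 1 \<le> (lam * \<omega>\<^sub>\<epsilon>)\<^sup>2 * (ln lam + 1)" using L by (intro mult_left_mono) auto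
    with tL have "(lam * \<omega>\<^sub>\<epsilon>)\<^sup>2 < 1\<^sup>2" by simp
    then have t1: "lam * \<omega>\<^sub>\<epsilon> < 1" by (rule power2_less_imp_less) simp
    define B where "B = 5 * (lam * (lam - 1) * \<omega>\<^sub>\<epsilon>\<^sup>2) * cmod (a 0) * cmod (H 0 (k * R))"
    have B: "cmod (fourier_coeff R u\<^sub>s 0) \<le> B"
      using mode_bound_0[OF data lambda_ge_1 _ _ R] small tL unfolding t B_def x[symmetric] by simp
    have 1: "H_norm \<sigma> R u\<^sub>s \<le> ennreal C * H_star_norm (\<sigma> - 1/3) \<epsilon> u\<^sub>i + ennreal (sqrt (2 * pi) * B)"
    proof (rule circle_norm_bound[OF C0 B])
      fix n :: int assume n: "n \<noteq> 0"
      then have "1 \<le> real_of_int \<bar>n\<bar>" by linarith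
      with t1 have "lam * \<omega>\<^sub>\<epsilon> \<le> real_of_int \<bar>n\<bar>" by linarith
      then show "cmod (fourier_coeff R u\<^sub>s n) \<le> C * (1 + of_int \<bar>n\<bar>) powr (-1/3) * cmod (fourier_coeff \<epsilon> u\<^sub>i n)"
        by (rule mode[OF n])
    qed
    define Z where "Z = 23 * \<omega>\<^sub>\<epsilon> * lam * cmod (a 0) * cmod (H 0 (k * R))"
    have 2: "ennreal (sqrt (2 * pi) * B) \<le> ennreal ((lam - 1) * \<omega>\<^sub>\<epsilon> * Z)"
    proof (rule ennreal_leI)
      \<comment> \<open>23/5 turns the constant 5 of mode 0 into 23; even the crude pi < 4
        suffices.\<close>
      have "2 * pi \<le> (23 / 5)\<^sup>2" using pi_less_4 by (simp add: power2_eq_square)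
      then have "sqrt (2 * pi) \<le> 23 / 5" by (rule real_le_lsqrt[rotated]) auto
      then have "sqrt (2 * pi) * B \<le> 23 / 5 * B"
        by (rule mult_right_mono) (use lambda_ge_1 in \<open>simp add: B_def\<close>)
      also have "\<dots> = (lam - 1) * \<omega>\<^sub>\<epsilon> * Z"
        by (simp add: B_def Z_def power2_eq_square)
      finally show "sqrt (2 * pi) * B \<le> (lam - 1) * \<omega>\<^sub>\<epsilon> * Z" .
    qed
    have eqC: "ennreal C = ennreal ((lam - 1) * \<omega>\<^sub>\<epsilon>) * ennreal (3 * sqrt (\<epsilon> / R))"
      using lambda_ge_1 x0 pos R by (subst ennreal_mult[symmetric]) (auto simp: C_def mult_ac)
    have eqZ: "ennreal ((lam - 1) * \<omega>\<^sub>\<epsilon> * Z) =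
        ennreal ((lam - 1) * \<omega>\<^sub>\<epsilon>) * ennreal Z"
      using lambda_ge_1 x0 lam0 by (intro ennreal_mult) (auto simp: Z_def)
    have ui0: "u\<^sub>i 0 = a 0" by (rule incident_at_0[OF data])
    have "H_norm \<sigma> R u\<^sub>s \<le> ennreal C * H_star_norm (\<sigma> - 1/3) \<epsilon> u\<^sub>i + ennreal ((lam - 1) * \<omega>\<^sub>\<epsilon> * Z)"
      by (rule order_trans[OF 1 add_left_mono[OF 2]])
    also have "\<dots> = ennreal ((lam - 1) * \<omega>\<^sub>\<epsilon>) * (ennreal (3 * sqrt (\<epsilon> / R)) * H_star_norm (\<sigma> - 1 / 3) \<epsilon> u\<^sub>i + ennreal Z)"
      unfolding eqC eqZ by (simp only: distrib_left mult.assoc)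
    finally show "H_norm \<sigma> R u\<^sub>s \<le> ennreal ((lam - 1) * \<omega>\<^sub>\<epsilon>) *
               (ennreal (3 * sqrt (\<epsilon> / R)) * H_star_norm (\<sigma> - 1 / 3) \<epsilon> u\<^sub>i +
                ennreal (23 * \<omega>\<^sub>\<epsilon> * lam * cmod (u\<^sub>i 0) * cmod (hankel1 0 (sqrt q\<^sub>0 * \<omega> * R))))"
      unfolding ui0 Z_def k_def .
  next
    fix p :: int assume p: "p > 0" and a0: "\<forall>n. \<bar>n\<bar> < p \<longrightarrow> a n = 0" and small: "\<omega>\<^sub>\<epsilon> < of_int p / lam"
    have tp: "lam * \<omega>\<^sub>\<epsilon> < of_int p" using small lam0 by (simp add: pos_less_divide_eq mult.commute)
    have zero: "fourier_coeff R u\<^sub>s n = 0" if "\<bar>n\<bar> < p" for n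
      using mode_zero[OF data _ R] a0 that by blast
    have "H_norm \<sigma> R u\<^sub>s \<le> ennreal C * H_star_norm (\<sigma> - 1/3) \<epsilon> u\<^sub>i + ennreal (sqrt (2 * pi) * 0)"
    proof (rule circle_norm_bound[OF C0])
      show "cmod (fourier_coeff R u\<^sub>s 0) \<le> 0" using zero[of 0] p by simp
      fix n :: int assume n: "n \<noteq> 0"
      show "cmod (fourier_coeff R u\<^sub>s n) \<le> C * (1 + of_int \<bar>n\<bar>) powr (-1/3) * cmod (fourier_coeff \<epsilon> u\<^sub>i n)"
      proof (cases "\<bar>n\<bar> < p")
        case True
        then show ?thesis using zero[OF True] C0 by simp
      next
        case False
        then have "real_of_int p \<le> real_of_int \<bar>n\<bar>" by linarith
        with tp have "lam * \<omega>\<^sub>\<epsilon> \<le> real_of_int \<bar>n\<bar>" by linarith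
        then show ?thesis by (rule mode[OF n])
      qed
    qed
    then show "H_norm \<sigma> R u\<^sub>s \<le> ennreal (3 * (lam - 1) * \<omega>\<^sub>\<epsilon> * sqrt (\<epsilon> / R)) * H_star_norm (\<sigma> - 1 / 3) \<epsilon> u\<^sub>i"
      by (simp add: C_def)
  qed
qed

end
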